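(* Let $X=(\mathbb{Z}[\mathrm{i}])^3\backslash(\mathbb{C}^3,* )$ be the Iwasawa manifold and let $\{X_{\mathbf t}=(X,J_{\mathbf t})\}_{\mathbf t\in\Delta(\mathbf 0,\varepsilon)\subseteq\mathbb{C}^6}$, with $\varepsilon>0$ sufficiently small, be its small deformations, divided into the classes (i), (ii), (iii) (see context). Then: \begin{itemize} \item $X$ is $\mathcal{C}^\infty$-pure-and-full at every stage as well as pure-and-full at every stage; \item the small deformations $X_{\mathbf t}$ of $X$ of class (i) are $\mathcal{C}^\infty$-pure-and-full at every stage and pure-and-full at every stage; \item the small deformations $X_{\mathbf t}$ of $X$ of classes (ii) and (iii) are neither $\mathcal{C}^\infty$-pure nor $\mathcal{C}^\infty$-full nor pure nor full. \end{itemize}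
   Context: **Iwasawa manifold.** On $\mathbb{C}^3$ consider the group law $(z_1,z_2,z_3)*(w_1,w_2,w_3)=(z_1+w_1,\,z_2+w_2,\,z_3+z_1w_2+w_3)$. Then $(\mathbb{Z}[\mathrm{i}])^3$ is a cocompact discrete subgroup, and the Iwasawa manifold is the compact complex $3$-fold $X=(\mathbb{Z}[\mathrm{i}])^3\backslash(\mathbb{C}^3,* )$ (quotient by left translations), with complex structure induced by the coordinates $z^1,z^2,z^3$ of $\mathbb{C}^3$. **Small deformations (Nakamura).** For $\mathbf t=(t_{11},t_{12},t_{21},t_{22},t_{31},t_{32})\in\mathbb{C}^6$ put $D(\mathbf t)=t_{11}t_{22}-t_{12}t_{21}$ and $A(\bar{\mathbf z})=\frac12\left(t_{11}t_{21}\bar z^1\bar z^1+2t_{11}t_{22}\bar z^1\bar z^2+t_{12}t_{22}\bar z^2\bar z^2\right)$. For $\mathbf t$ in a sufficiently small ball $\Delta(\mathbf 0,\varepsilon)$, $X_{\mathbf t}$ is the differentiable manifold underlying $X$ endowed with the integrable almost-complex structure $J_{\mathbf t}$ whose lift to the universal cover $\mathbb{C}^3$ has holomorphic coordinates $$\zeta^1_{\mathbf t}=z^1+\sum_{j=1}^2 t_{1j}\bar z^j,\qquad \zeta^2_{\mathbf t}=z^2+\sum_{j=1}^2 t_{2j}\bar z^j,\qquad \zeta^3_{\mathbf t}=z^3+\sum_{j=1}^2(t_{3j}+t_{2j}z^1)\bar z^j+A(\bar{\mathbf z})-D(\mathbf t)\bar z^3 .$$ By Nakamura, these are the small deformations of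 $X$ (and $X_{\mathbf 0}=X$). Class (i): $t_{11}=t_{12}=t_{21}=t_{22}=0$. Class (ii): $D(\mathbf t)=0$ but $(t_{11},t_{12},t_{21},t_{22})\neq(0,0,0,0)$. Class (iii): $D(\mathbf t)\neq0$. **Cohomological notions.** Let $(M,J)$ be a compact almost-complex $2n$-manifold, $\wedge^{p,q}M$ the complex forms of type $(p,q)$, and $\wedge^kM$ the real $k$-forms. For $p+q=k$, $H^{(p,q),(q,p)}_J(M)_{\mathbb{R}}\subseteq H^k_{dR}(M;\mathbb{R})$ is the subspace of classes that have a real closed representative in $(\wedge^{p,q}M\oplus\wedge^{q,p}M)\cap\wedge^kM$ (written $H^{(p,p)}_J(M)_{\mathbb{R}}$ if $p=q$). $J$ (or $M$) is $\mathcal{C}^\infty$-pure at the $k$-th stage if the sum of the subspaces $H^{(p,q),(q,p)}_J(M)_{\mathbb{R}}$ over unordered pairs $\{p,q\}$ with $p+q=k$ is direct; $\mathcal{C}^\infty$-full at the $k$-th stage if this sum equals $H^k_{dR}(M;\mathbb{R})$; $\mathcal{C}^\infty$-pure-and-full at the $k$-th stage if both hold. Without mention of a stage, $k=2$ is meant: $\mathcal{C}^\infty$-pure means $H^{(2,0),(0,2)}_J(M)_{\mathbb{R}}\cap H^{(1,1)}_J(M)_{\mathbb{R}}=\{0\}$ and $\mathcal{C}^\infty$-full means $H^{(2,0),(0,2)}_J(M)_{\mathbb{R}}+H^{(1,1)}_J(M)_{\mathbb{R}}=H^2_{dR}(M;\mathbb{R})$. Dually, let $\mathcal{D}_kM$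 be the space of currents of dimension $k$ (the topological dual of $\wedge^kM$) with differential dual to $d$, let $H_k(M;\mathbb{R})$ be the resulting de Rham homology, and let $\mathcal{D}_{p,q}M$ be the complex currents of bidimension $(p,q)$ (those vanishing on all $(r,s)$-forms with $(r,s)\ne(p,q)$). $H^J_{(p,q),(q,p)}(M)_{\mathbb{R}}\subseteq H_{p+q}(M;\mathbb{R})$ is the subspace of classes represented by a real closed current in $\mathcal{D}_{p,q}M\oplus\mathcal{D}_{q,p}M$. $J$ is pure, full, pure-and-full at the $k$-th stage if the sum of these subspaces of $H_k(M;\mathbb{R})$ over unordered pairs $\{p,q\}$ with $p+q=k$ is direct, equals $H_k(M;\mathbb{R})$, or both, respectively; without mention of a stage, $k=2$ is meant. "At every stage" means at the $k$-th stage for every $k$. *)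

theory Defs
  imports
    "HOL-Analysis.Analysis"
    "HOL-Combinatorics.Permutations"
    "HOL-Library.Function_Algebras"
    "HOL-Library.Set_Algebras"
begin

section \<open>Sums of subspaces of a quotient space\<close>

text \<open>
  Elements of a quotient Z/B are cosets \<open>z +o B\<close>; they are added as sets, so the zero
  element is B itself. (The sum over the empty family would be \<open>{0}\<close> instead; all index
  sets below are nonempty.)
\<close>

definition cosets :: "'a::ab_group_add set \<Rightarrow> 'a set \<Rightarrow> 'a set set" where
  "cosets Z B = (\<lambda>z. z +o B) ` Z"

definition subspace_sum :: "'i set \<Rightarrow> ('i \<Rightarrow> 'a::ab_group_add set set) \<Rightarrow> 'a set set" where
  "subspace_sum I V = {(\<Sum>i\<in>I. a i) | a. \<forall>i\<in>I. a i \<in> V i}"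

definition sum_is_direct ::
    "'i set \<Rightarrow> ('i \<Rightarrow> 'a::ab_group_add set set) \<Rightarrow> 'a set \<Rightarrow> bool" where
  "sum_is_direct I V B \<longleftrightarrow>
     (\<forall>a. (\<forall>i\<in>I. a i \<in> V i) \<and> (\<Sum>i\<in>I. a i) = B \<longrightarrow> (\<forall>i\<in>I. a i = B))"

text \<open>Unordered pairs \<open>{p,q}\<close> with \<open>p + q = k\<close>, each listed once with \<open>q \<le> p\<close>.\<close>

definition unordered_pairs :: "nat \<Rightarrow> (nat \<times> nat) set" where
  "unordered_pairs k = {(p, q). p + q = k \<and> q \<le> p}"


section \<open>Smooth forms on a quotient of a Euclidean space\<close>

text \<open>
  A manifold is presented as the quotient of a Euclidean space by a group G of
  diffeomorphisms acting freely and properly discontinuously. Forms on the quotient are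
  identified with G-invariant forms on the Euclidean space. A complex-valued k-form sends a
  point and a list of k tangent vectors to a complex number; on lists of any other length
  it is 0, so that equal forms are equal functions.
\<close>

type_synonym 'e form = "'e \<Rightarrow> 'e list \<Rightarrow> complex"
type_synonym 'e current = "'e form \<Rightarrow> complex"

fun iter_deriv :: "'e::euclidean_space list \<Rightarrow> ('e \<Rightarrow> complex) \<Rightarrow> 'e \<Rightarrow> complex" where
  "iter_deriv [] f = f"
| "iter_deriv (u # us) f = (\<lambda>x. frechet_derivative (iter_deriv us f) (at x) u)"

definition smooth :: "('e::euclidean_space \<Rightarrow> complex) \<Rightarrow> bool" where
  "smooth f \<longleftrightarrow> (\<forall>us x. iter_deriv us f differentiable at x)"

definition alternating :: "nat \<Rightarrow> ('e::euclidean_space list \<Rightarrow> complex) \<Rightarrow> bool" where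
  "alternating k f \<longleftrightarrow>
     (\<forall>vs. length vs \<noteq> k \<longrightarrow> f vs = 0) \<and>
     (\<forall>vs i. length vs = k \<and> i < k \<longrightarrow> linear (\<lambda>v. f (vs[i := v]))) \<and>
     (\<forall>vs i j. length vs = k \<and> i < j \<and> j < k \<and> vs ! i = vs ! j \<longrightarrow> f vs = 0)"

definition pullback :: "('e::euclidean_space \<Rightarrow> 'e) \<Rightarrow> 'e form \<Rightarrow> 'e form" where
  "pullback g \<phi> = (\<lambda>x vs. \<phi> (g x) (map (frechet_derivative g (at x)) vs))"

definition forms :: "('e::euclidean_space \<Rightarrow> 'e) set \<Rightarrow> nat \<Rightarrow> 'e form set" where
  "forms G k = {\<phi>. (\<forall>x. alternating k (\<phi> x)) \<and> (\<forall>vs. smooth (\<lambda>x. \<phi> x vs)) \<and>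
                   (\<forall>g\<in>G. pullback g \<phi> = \<phi>)}"

definition real_forms :: "('e::euclidean_space \<Rightarrow> 'e) set \<Rightarrow> nat \<Rightarrow> 'e form set" where
  "real_forms G k = {\<phi> \<in> forms G k. \<forall>x vs. \<phi> x vs \<in> \<real>}"

text \<open>
  The usual invariant formula for the exterior derivative, evaluated on constant vector
  fields, whose brackets vanish.
\<close>

definition ext_d :: "'e::euclidean_space form \<Rightarrow> 'e form" where
  "ext_d \<phi> = (\<lambda>x vs. \<Sum>i<length vs.
     (-1) ^ i * frechet_derivative (\<lambda>y. \<phi> y (take i vs @ drop (Suc i) vs)) (at x) (vs ! i))"

definition closed_forms :: "('e::euclidean_space \<Rightarrow> 'e) set \<Rightarrow> nat \<Rightarrow> 'e form set" where
  "closed_forms G k = {\<phi> \<in> real_forms G k. ext_d \<phi> = 0}"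

definition exact_forms :: "('e::euclidean_space \<Rightarrow> 'e) set \<Rightarrow> nat \<Rightarrow> 'e form set" where
  "exact_forms G k = insert 0 {ext_d \<eta> | \<eta>. \<exists>j. k = Suc j \<and> \<eta> \<in> real_forms G j}"

definition deRham_cohomology ::
    "('e::euclidean_space \<Rightarrow> 'e) set \<Rightarrow> nat \<Rightarrow> 'e form set set" where
  "deRham_cohomology G k = cosets (closed_forms G k) (exact_forms G k)"


section \<open>Types of forms with respect to an almost-complex structure\<close>

text \<open>
  An almost-complex structure is given by its lift, \<open>J x\<close> being the endomorphism of
  the tangent space at \<open>x\<close>.
\<close>

definition wedge :: "('e \<Rightarrow> complex) list \<Rightarrow> 'e list \<Rightarrow> complex" where
  "wedge as vs = (if length vs = length as
     then \<Sum>\<sigma> | \<sigma> permutes {..<length as}.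
            of_int (sign \<sigma>) * (\<Prod>i<length as. (as ! i) (vs ! \<sigma> i))
     else 0)"

definition covectors10 :: "('e::euclidean_space \<Rightarrow> 'e) \<Rightarrow> ('e \<Rightarrow> complex) set" where
  "covectors10 j = {a. linear a \<and> (\<forall>v. a (j v) = \<i> * a v)}"

definition covectors01 :: "('e::euclidean_space \<Rightarrow> 'e) \<Rightarrow> ('e \<Rightarrow> complex) set" where
  "covectors01 j = {a. linear a \<and> (\<forall>v. a (j v) = - \<i> * a v)}"

definition covectors_pq ::
    "('e::euclidean_space \<Rightarrow> 'e) \<Rightarrow> nat \<Rightarrow> nat \<Rightarrow> ('e list \<Rightarrow> complex) set" where
  "covectors_pq j p q = module.span (\<lambda>c f vs. c * f vs)
     {wedge (as @ bs) | as bs. length as = p \<and> length bs = q \<and>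
        set as \<subseteq> covectors10 j \<and> set bs \<subseteq> covectors01 j}"

definition forms_pq ::
    "('e::euclidean_space \<Rightarrow> 'e) set \<Rightarrow> ('e \<Rightarrow> 'e \<Rightarrow> 'e) \<Rightarrow> nat \<Rightarrow> nat \<Rightarrow> 'e form set" where
  "forms_pq G J p q = {\<phi> \<in> forms G (p + q). \<forall>x. \<phi> x \<in> covectors_pq (J x) p q}"

text \<open>The subspace \<open>H\<^sup>(\<^sup>p\<^sup>,\<^sup>q\<^sup>)\<^sup>,\<^sup>(\<^sup>q\<^sup>,\<^sup>p\<^sup>)\<close> of the real de Rham cohomology. The sum
  of sets of forms on the right is elementwise; it is \<open>forms_pq G J p p\<close> if \<open>p = q\<close>.\<close>

definition cohomology_pq ::
    "('e::euclidean_space \<Rightarrow> 'e) set \<Rightarrow> ('e \<Rightarrow> 'e \<Rightarrow> 'e) \<Rightarrow> nat \<times> nat \<Rightarrow> 'e form set set" where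
  "cohomology_pq G J = (\<lambda>(p, q).
     cosets (closed_forms G (p + q) \<inter> (forms_pq G J p q + forms_pq G J q p))
            (exact_forms G (p + q)))"

definition Cinf_pure_at ::
    "('e::euclidean_space \<Rightarrow> 'e) set \<Rightarrow> ('e \<Rightarrow> 'e \<Rightarrow> 'e) \<Rightarrow> nat \<Rightarrow> bool" where
  "Cinf_pure_at G J k \<longleftrightarrow>
     sum_is_direct (unordered_pairs k) (cohomology_pq G J) (exact_forms G k)"

definition Cinf_full_at ::
    "('e::euclidean_space \<Rightarrow> 'e) set \<Rightarrow> ('e \<Rightarrow> 'e \<Rightarrow> 'e) \<Rightarrow> nat \<Rightarrow> bool" where
  "Cinf_full_at G J k \<longleftrightarrow>
     subspace_sum (unordered_pairs k) (cohomology_pq G J) = deRham_cohomology G k"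

definition Cinf_pure_and_full_at ::
    "('e::euclidean_space \<Rightarrow> 'e) set \<Rightarrow> ('e \<Rightarrow> 'e \<Rightarrow> 'e) \<Rightarrow> nat \<Rightarrow> bool" where
  "Cinf_pure_and_full_at G J k \<longleftrightarrow> Cinf_pure_at G J k \<and> Cinf_full_at G J k"

definition Cinf_pure ::
    "('e::euclidean_space \<Rightarrow> 'e) set \<Rightarrow> ('e \<Rightarrow> 'e \<Rightarrow> 'e) \<Rightarrow> bool" where
  "Cinf_pure G J \<longleftrightarrow> Cinf_pure_at G J 2"

definition Cinf_full ::
    "('e::euclidean_space \<Rightarrow> 'e) set \<Rightarrow> ('e \<Rightarrow> 'e \<Rightarrow> 'e) \<Rightarrow> bool" where
  "Cinf_full G J \<longleftrightarrow> Cinf_full_at G J 2"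


section \<open>Currents\<close>

text \<open>
  The Frechet topology on the space of k-forms: uniform convergence of all derivatives of
  all coefficients on compact sets. For invariant forms and a compact quotient, compact
  subsets of the Euclidean space give the same topology as the compact quotient itself.
\<close>

definition Cinf_topology :: "('e::euclidean_space \<Rightarrow> 'e) set \<Rightarrow> nat \<Rightarrow> 'e form topology" where
  "Cinf_topology G k = topology_generated_by
     {{\<psi> \<in> forms G k. \<forall>x\<in>K. cmod (iter_deriv us (\<lambda>y. \<psi> y vs) x
                                  - iter_deriv us (\<lambda>y. \<phi> y vs) x) < r}
      | \<phi> K us vs r. \<phi> \<in> forms G k \<and> compact K \<and> r > 0}"

text \<open>
  Complex currents of dimension k, set to 0 outside the k-forms so that equal currents are
  equal functions. A real current is identified with its complex-linear extension.
\<close>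

definition currents :: "('e::euclidean_space \<Rightarrow> 'e) set \<Rightarrow> nat \<Rightarrow> 'e current set" where
  "currents G k = {T.
     (\<forall>\<phi>. \<phi> \<notin> forms G k \<longrightarrow> T \<phi> = 0) \<and>
     (\<forall>\<phi>\<in>forms G k. \<forall>\<psi>\<in>forms G k. T (\<phi> + \<psi>) = T \<phi> + T \<psi>) \<and>
     (\<forall>c. \<forall>\<phi>\<in>forms G k. T (\<lambda>x vs. c * \<phi> x vs) = c * T \<phi>) \<and>
     continuous_map (Cinf_topology G k) euclidean T}"

definition real_currents :: "('e::euclidean_space \<Rightarrow> 'e) set \<Rightarrow> nat \<Rightarrow> 'e current set" where
  "real_currents G k = {T \<in> currents G k. \<forall>\<phi>\<in>real_forms G k. T \<phi> \<in> \<real>}"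

text \<open>The differential of a current of dimension k, a current of dimension \<open>k - 1\<close>;
  it is zero for \<open>k = 0\<close>.\<close>

definition current_d ::
    "('e::euclidean_space \<Rightarrow> 'e) set \<Rightarrow> nat \<Rightarrow> 'e current \<Rightarrow> 'e current" where
  "current_d G k T = (\<lambda>\<phi>. if \<exists>j. k = Suc j \<and> \<phi> \<in> forms G j then T (ext_d \<phi>) else 0)"

definition closed_currents :: "('e::euclidean_space \<Rightarrow> 'e) set \<Rightarrow> nat \<Rightarrow> 'e current set" where
  "closed_currents G k = {T \<in> real_currents G k. current_d G k T = 0}"

definition exact_currents :: "('e::euclidean_space \<Rightarrow> 'e) set \<Rightarrow> nat \<Rightarrow> 'e current set" where
  "exact_currents G k = current_d G (Suc k) ` real_currents G (Suc k)"

definition deRham_homology ::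
    "('e::euclidean_space \<Rightarrow> 'e) set \<Rightarrow> nat \<Rightarrow> 'e current set set" where
  "deRham_homology G k = cosets (closed_currents G k) (exact_currents G k)"

definition currents_pq ::
    "('e::euclidean_space \<Rightarrow> 'e) set \<Rightarrow> ('e \<Rightarrow> 'e \<Rightarrow> 'e) \<Rightarrow> nat \<Rightarrow> nat \<Rightarrow> 'e current set" where
  "currents_pq G J p q = {T \<in> currents G (p + q).
     \<forall>r s. (r, s) \<noteq> (p, q) \<longrightarrow> (\<forall>\<phi>\<in>forms_pq G J r s. T \<phi> = 0)}"

definition homology_pq ::
    "('e::euclidean_space \<Rightarrow> 'e) set \<Rightarrow> ('e \<Rightarrow> 'e \<Rightarrow> 'e) \<Rightarrow> nat \<times> nat \<Rightarrow> 'e current set set" where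
  "homology_pq G J = (\<lambda>(p, q).
     cosets (closed_currents G (p + q) \<inter> (currents_pq G J p q + currents_pq G J q p))
            (exact_currents G (p + q)))"

definition pure_at ::
    "('e::euclidean_space \<Rightarrow> 'e) set \<Rightarrow> ('e \<Rightarrow> 'e \<Rightarrow> 'e) \<Rightarrow> nat \<Rightarrow> bool" where
  "pure_at G J k \<longleftrightarrow>
     sum_is_direct (unordered_pairs k) (homology_pq G J) (exact_currents G k)"

definition full_at ::
    "('e::euclidean_space \<Rightarrow> 'e) set \<Rightarrow> ('e \<Rightarrow> 'e \<Rightarrow> 'e) \<Rightarrow> nat \<Rightarrow> bool" where
  "full_at G J k \<longleftrightarrow>
     subspace_sum (unordered_pairs k) (homology_pq G J) = deRham_homology G k"

definition pure_and_full_at ::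
    "('e::euclidean_space \<Rightarrow> 'e) set \<Rightarrow> ('e \<Rightarrow> 'e \<Rightarrow> 'e) \<Rightarrow> nat \<Rightarrow> bool" where
  "pure_and_full_at G J k \<longleftrightarrow> pure_at G J k \<and> full_at G J k"

definition pure ::
    "('e::euclidean_space \<Rightarrow> 'e) set \<Rightarrow> ('e \<Rightarrow> 'e \<Rightarrow> 'e) \<Rightarrow> bool" where
  "pure G J \<longleftrightarrow> pure_at G J 2"

definition full ::
    "('e::euclidean_space \<Rightarrow> 'e) set \<Rightarrow> ('e \<Rightarrow> 'e \<Rightarrow> 'e) \<Rightarrow> bool" where
  "full G J \<longleftrightarrow> full_at G J 2"


section \<open>The Iwasawa manifold and its small deformations\<close>

definition heis_mult :: "complex ^ 3 \<Rightarrow> complex ^ 3 \<Rightarrow> complex ^ 3" where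
  "heis_mult z w = vector [z$1 + w$1, z$2 + w$2, z$3 + z$1 * w$2 + w$3]"

definition gauss_ints :: "complex set" where
  "gauss_ints = {z. Re z \<in> \<int> \<and> Im z \<in> \<int>}"

text \<open>The left translations of \<open>complex ^ 3\<close> whose quotient is the Iwasawa manifold.\<close>

definition iwasawa_deck :: "(complex ^ 3 \<Rightarrow> complex ^ 3) set" where
  "iwasawa_deck = heis_mult ` {\<gamma>. \<forall>i. \<gamma>$i \<in> gauss_ints}"

text \<open>The almost-complex structure for which the components of \<open>\<zeta>\<close> are holomorphic
  coordinates; meaningful only where the derivative of \<open>\<zeta>\<close> is invertible.\<close>

definition coord_structure ::
    "(complex ^ 3 \<Rightarrow> complex ^ 3) \<Rightarrow> complex ^ 3 \<Rightarrow> complex ^ 3 \<Rightarrow> complex ^ 3" where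
  "coord_structure \<zeta> x v =
     inv (frechet_derivative \<zeta> (at x)) (\<i> *s frechet_derivative \<zeta> (at x) v)"

definition iwasawa_J :: "complex ^ 3 \<Rightarrow> complex ^ 3 \<Rightarrow> complex ^ 3" where
  "iwasawa_J = coord_structure (\<lambda>z. z)"

text \<open>The parameter \<open>t \<in> \<complex>\<^sup>6\<close> is a 3-by-2 array with \<open>t$i$j\<close> the parameter
  with indices i, j. The norm of this type is the Euclidean norm of \<open>\<complex>\<^sup>6\<close>.\<close>

definition def_D :: "complex ^ 2 ^ 3 \<Rightarrow> complex" where
  "def_D t = t$1$1 * t$2$2 - t$1$2 * t$2$1"

text \<open>\<open>def_A t\<close> is applied to the conjugates of the first two coordinates.\<close>

definition def_A :: "complex ^ 2 ^ 3 \<Rightarrow> complex \<Rightarrow> complex \<Rightarrow> complex" where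
  "def_A t w1 w2 = (t$1$1 * t$2$1 * w1 * w1 + 2 * t$1$1 * t$2$2 * w1 * w2
                    + t$1$2 * t$2$2 * w2 * w2) / 2"

definition def_coords :: "complex ^ 2 ^ 3 \<Rightarrow> complex ^ 3 \<Rightarrow> complex ^ 3" where
  "def_coords t z = vector
     [z$1 + t$1$1 * cnj (z$1) + t$1$2 * cnj (z$2),
      z$2 + t$2$1 * cnj (z$1) + t$2$2 * cnj (z$2),
      z$3 + (t$3$1 + t$2$1 * z$1) * cnj (z$1) + (t$3$2 + t$2$2 * z$1) * cnj (z$2)
        + def_A t (cnj (z$1)) (cnj (z$2)) - def_D t * cnj (z$3)]"

definition deformed_J :: "complex ^ 2 ^ 3 \<Rightarrow> complex ^ 3 \<Rightarrow> complex ^ 3 \<Rightarrow> complex ^ 3" where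
  "deformed_J t = coord_structure (def_coords t)"

definition class_i :: "complex ^ 2 ^ 3 \<Rightarrow> bool" where
  "class_i t \<longleftrightarrow> t$1$1 = 0 \<and> t$1$2 = 0 \<and> t$2$1 = 0 \<and> t$2$2 = 0"

definition class_ii :: "complex ^ 2 ^ 3 \<Rightarrow> bool" where
  "class_ii t \<longleftrightarrow> def_D t = 0 \<and> (t$1$1, t$1$2, t$2$1, t$2$2) \<noteq> (0, 0, 0, 0)"

definition class_iii :: "complex ^ 2 ^ 3 \<Rightarrow> bool" where
  "class_iii t \<longleftrightarrow> def_D t \<noteq> 0"

end

theory Submission
  imports Defs
begin

text \<open>
  The structures \<open>J\<^sub>t\<close> are left-invariant, so in a left-invariant frame forms become functions
  with values in the alternating functions on the Lie algebra, and types can be read off pointwise.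
  Averaging over the coordinate directions, the central ones first, is homotopic to the identity
  through operators that are continuous and real. Hence the finite-dimensional complex of
  left-invariant forms computes the cohomology and, dually, the homology, compatibly with types.

  For class (i) the weights 1, 1, 2 on a (1,0)-frame define a circle of automorphisms of the Lie
  algebra. In every degree these weights determine, among the types that occur there, whether
  \<open>\<bar>p - q\<bar>\<close> is as small as possible. The projections onto types therefore commute with the
  differential, and they split the cohomology and the homology.

  For the classes (ii) and (iii) there is a vector v with \<open>[v, \<i>v] = 0\<close> and
  \<open>[Jv, J(\<i>v)] \<noteq> 0\<close>. The evaluation at \<open>(v, \<i>v)\<close> is a closed current. It vanishes on
  exact left-invariant forms, but not on the (2,0)+(0,2)-part of a suitable exact form, although
  both parts of that form are closed. Choose w with \<open>[v, w] \<noteq> 0\<close>. The differential of the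
  (2,0)+(0,2)-part, evaluated at \<open>(v, \<i>v, w)\<close>, is likewise a closed current. Its sum with the
  analogous (1,1)-current is a boundary, but it does not vanish on a suitable closed form.
\<close>

section \<open>Smooth functions\<close>

text \<open>For a central direction V, Cartan's formula integrated over a period against the
  sawtooth s - 1/2 already gives the homotopy to the average. The obstacle is a noncentral V: its
  adjoint action on the frame leaves an error term \<open>nilop V\<close>. The bracket takes values
  in the centre and kills it, so this error is nilpotent; it also annihilates the average and is
  annihilated by it, so that a power of the sum of \<open>avg V\<close> and \<open>nilop V\<close>
  is \<open>avg V\<close> itself. Dualising to currents requires all operators to be continuous,
  hence the comparison of \<open>Cinf_topology\<close> with explicit seminorms. Types are
  eigenspaces of a circle acting on the arguments, and the projections onto them are finite Fourier
  sums, which makes linearity, reality and estimates elementary. The weights 1, 1, 2 reflect that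
  the bracket multiplies the first two coordinates into the third. In the classes (ii) and (iii) the
  bracket of the J-images is, after multiplication by a determinant, a sesquilinear expression in v
  whose coefficients cannot all vanish; the radius 1/10 keeps the determinants in question away from
  zero.\<close>

abbreviation ddir :: "'e::euclidean_space \<Rightarrow> ('e \<Rightarrow> complex) \<Rightarrow> 'e \<Rightarrow> complex" where
  "ddir u f \<equiv> (\<lambda>x. frechet_derivative f (at x) u)"

lemma smooth_differentiable: "smooth f \<Longrightarrow> f differentiable at x"
  unfolding smooth_def by (metis iter_deriv.simps(1))

lemma smooth_has_derivative: "smooth f \<Longrightarrow> (f has_derivative frechet_derivative f (at x)) (at x)"
  using frechet_derivative_works smooth_differentiable by blast

lemma smooth_linear_deriv: "smooth f \<Longrightarrow> linear (frechet_derivative f (at x))"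
  by (simp add: linear_frechet_derivative smooth_differentiable)

lemma smooth_continuous_on: "smooth f \<Longrightarrow> continuous_on A f"
  by (simp add: differentiable_imp_continuous_on differentiable_on_def differentiable_at_withinI
      smooth_differentiable)

lemma iter_deriv_append: "iter_deriv (us @ vs) f = iter_deriv us (iter_deriv vs f)"
  by (induction us) auto

lemma smooth_iter_deriv: "smooth f \<Longrightarrow> smooth (iter_deriv vs f)"
  unfolding smooth_def by (metis iter_deriv_append)

lemma smooth_ddir: "smooth f \<Longrightarrow> smooth (ddir u f)"
  using smooth_iter_deriv[of f "[u]"] by simp

text \<open>Smoothness as a coinductive property: differentiability and closure under directional
  derivatives are all that \<open>iter_deriv\<close> asks for. Each closure property below then
  needs only a suitable set S and one derivative rule.\<close>

lemma smooth_coinduct: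
  assumes "f \<in> S" and "\<And>f x. f \<in> S \<Longrightarrow> f differentiable at x" and "\<And>f u. f \<in> S \<Longrightarrow> ddir u f \<in> S"
  shows "smooth f"
proof -
  have "iter_deriv us f \<in> S" for us
    by (induction us) (auto simp: assms)
  thus ?thesis by (auto simp: smooth_def assms(2))
qed

lemma ddir_add: "smooth f \<Longrightarrow> smooth g \<Longrightarrow> ddir u (\<lambda>x. f x + g x) = (\<lambda>x. ddir u f x + ddir u g x)"
  by (rule ext) (simp add: frechet_derivative_at[OF has_derivative_add[OF smooth_has_derivative smooth_has_derivative], symmetric])

lemma ddir_cmult: "smooth f \<Longrightarrow> ddir u (\<lambda>x. c * f x) = (\<lambda>x. c * ddir u f x)"
proof (rule ext)
  fix x assume "smooth f"
  have "((\<lambda>x. c * f x) has_derivative (\<lambda>u. c * frechet_derivative f (at x) u)) (at x)"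
    by (rule has_derivative_mult_right[OF smooth_has_derivative[OF \<open>smooth f\<close>]])
  thus "ddir u (\<lambda>x. c * f x) x = c * ddir u f x" by (metis frechet_derivative_at)
qed

lemma smooth_const [simp]: "smooth (\<lambda>x. c)"
  by (rule smooth_coinduct[where S = "range (\<lambda>c x. c)"]) (auto simp: frechet_derivative_const)

lemma smooth_add:
  assumes "smooth f" "smooth g" shows "smooth (\<lambda>x. f x + g x)"
proof -
  define S where "S = {h. \<exists>f g. h = (\<lambda>x::'a. f x + g x) \<and> smooth f \<and> smooth g}"
  show ?thesis
  proof (rule smooth_coinduct[where S = S])
    show "(\<lambda>x. f x + g x) \<in> S" using assms by (auto simp: S_def)
  next
    fix h x assume "h \<in> S"
    then obtain f g where "h = (\<lambda>x. f x + g x)" "smooth f" "smooth g" by (auto simp: S_def)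
    thus "h differentiable at x" by (simp add: smooth_differentiable)
  next
    fix h u assume "h \<in> S"
    then obtain f g where h: "h = (\<lambda>x. f x + g x)" "smooth f" "smooth g" by (auto simp: S_def)
    show "ddir u h \<in> S" unfolding S_def mem_Collect_eq h(1)
      by (rule exI[of _ "ddir u f"], rule exI[of _ "ddir u g"]) (simp add: ddir_add h smooth_ddir)
  qed
qed

lemma smooth_cmult:
  assumes "smooth f" shows "smooth (\<lambda>x. c * f x)"
proof -
  define S where "S = (\<lambda>f x. c * f x) ` {f :: 'a \<Rightarrow> complex. smooth f}"
  show ?thesis
  proof (rule smooth_coinduct[where S = S])
    show "(\<lambda>x. c * f x) \<in> S" using assms by (auto simp: S_def)
  next
    fix h x assume "h \<in> S"
    then obtain f where "h = (\<lambda>x. c * f x)" "smooth f" by (auto simp: S_def)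
    thus "h differentiable at x" by (simp add: smooth_differentiable)
  next
    fix h u assume "h \<in> S"
    then obtain f where h: "h = (\<lambda>x. c * f x)" "smooth f" by (auto simp: S_def)
    show "ddir u h \<in> S" unfolding S_def h(1) ddir_cmult[OF h(2)]
      by (rule image_eqI[of _ _ "ddir u f"]) (simp_all add: smooth_ddir h(2))
  qed
qed

lemma iter_deriv_add:
  "smooth f \<Longrightarrow> smooth g \<Longrightarrow> iter_deriv us (\<lambda>x. f x + g x) = (\<lambda>x. iter_deriv us f x + iter_deriv us g x)"
  by (induction us) (auto simp: ddir_add smooth_iter_deriv)

lemma iter_deriv_cmult: "smooth f \<Longrightarrow> iter_deriv us (\<lambda>x. c * f x) = (\<lambda>x. c * iter_deriv us f x)"
  by (induction us) (auto simp: ddir_cmult smooth_iter_deriv)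

lemma iter_deriv_zero [simp]: "iter_deriv us (\<lambda>x. 0) = (\<lambda>x. 0)"
  by (induction us) (auto simp: frechet_derivative_const)

lemma smooth_sum: "(\<And>i. i \<in> A \<Longrightarrow> smooth (f i)) \<Longrightarrow> smooth (\<lambda>x. \<Sum>i\<in>A. f i x)"
  by (induction A rule: infinite_finite_induct) (auto intro: smooth_add)

lemma iter_deriv_sum:
  "(\<And>i. i \<in> A \<Longrightarrow> smooth (f i)) \<Longrightarrow> iter_deriv us (\<lambda>x. \<Sum>i\<in>A. f i x) = (\<lambda>x. \<Sum>i\<in>A. iter_deriv us (f i) x)"
  by (induction A rule: infinite_finite_induct) (auto simp: iter_deriv_add smooth_sum)

lemma smooth_diff: "smooth f \<Longrightarrow> smooth g \<Longrightarrow> smooth (\<lambda>x. f x - g x)"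
  using smooth_add[of f "\<lambda>x. (-1) * g x"] smooth_cmult[of g "-1"] by simp

lemma iter_deriv_diff:
  "smooth f \<Longrightarrow> smooth g \<Longrightarrow> iter_deriv us (\<lambda>x. f x - g x) = (\<lambda>x. iter_deriv us f x - iter_deriv us g x)"
  using iter_deriv_add[of f "\<lambda>x. (-1) * g x" us] smooth_cmult[of g "-1"] iter_deriv_cmult[of g us "-1"] by simp

lemma ddir_sum:
  "(\<And>i. i \<in> A \<Longrightarrow> smooth (f i)) \<Longrightarrow> ddir u (\<lambda>x. \<Sum>i\<in>A. f i x) = (\<lambda>x. \<Sum>i\<in>A. ddir u (f i) x)"
  using iter_deriv_sum[of A f "[u]"] by simp

lemma ddir_diff:
  "smooth f \<Longrightarrow> smooth g \<Longrightarrow> ddir u (\<lambda>x. f x - g x) = (\<lambda>x. ddir u f x - ddir u g x)"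
  using iter_deriv_diff[of f g "[u]"] by simp

lemma linear_mult_has_derivative:
  fixes l :: "'e::euclidean_space \<Rightarrow> real"
  assumes "linear l" "smooth f"
  shows "((\<lambda>x. of_real (l x) * f x) has_derivative
     (\<lambda>u. of_real (l u) * f x + of_real (l x) * frechet_derivative f (at x) u)) (at x)"
proof -
  have "(l has_derivative l) (at x)"
    using assms(1) by (simp add: bounded_linear_imp_has_derivative linear_conv_bounded_linear)
  hence "((\<lambda>x. complex_of_real (l x)) has_derivative (\<lambda>u. of_real (l u))) (at x)"
    by (rule has_derivative_of_real)
  from has_derivative_mult[OF this smooth_has_derivative[OF assms(2)]]
  show ?thesis by (simp add: add.commute)
qed

lemma ddir_linear_mult:
  fixes l :: "'e::euclidean_space \<Rightarrow> real"
  assumes "linear l" "smooth f"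
  shows "ddir u (\<lambda>x. of_real (l x) * f x) = (\<lambda>x. of_real (l u) * f x + of_real (l x) * ddir u f x)"
  by (simp add: frechet_derivative_at[OF linear_mult_has_derivative[OF assms], symmetric])

lemma smooth_linear_mult:
  fixes l :: "'e::euclidean_space \<Rightarrow> real"
  assumes "linear l" "smooth f"
  shows "smooth (\<lambda>x. of_real (l x) * f x)"
proof -
  \<comment> \<open>Products with l alone are not closed under derivatives, since differentiating l
    leaves a term without l; the extra summand g absorbs it.\<close>
  define S where "S = {h. \<exists>f g. h = (\<lambda>x. of_real (l x) * f x + g x) \<and> smooth f \<and> smooth g}"
  have der: "((\<lambda>x. of_real (l x) * f x + g x) has_derivative
     (\<lambda>u. of_real (l u) * f x + of_real (l x) * ddir u f x + ddir u g x)) (at x)"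
    if "smooth f" "smooth g" for f g x
    by (rule has_derivative_add[OF linear_mult_has_derivative[OF assms(1) that(1)] smooth_has_derivative[OF that(2)]])
  show ?thesis
  proof (rule smooth_coinduct[where S = S])
    show "(\<lambda>x. of_real (l x) * f x) \<in> S"
      unfolding S_def mem_Collect_eq
      by (rule exI[of _ f], rule exI[of _ "\<lambda>x. 0"]) (simp add: assms(2))
  next
    fix h x assume "h \<in> S"
    then obtain f g where h: "h = (\<lambda>x. of_real (l x) * f x + g x)" "smooth f" "smooth g" by (auto simp: S_def)
    show "h differentiable at x" unfolding h(1) by (rule differentiableI[OF der[OF h(2,3)]])
  next
    fix h u assume "h \<in> S"
    then obtain f g where h: "h = (\<lambda>x. of_real (l x) * f x + g x)" "smooth f" "smooth g" by (auto simp: S_def)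
    have "ddir u h = (\<lambda>x. of_real (l u) * f x + of_real (l x) * ddir u f x + ddir u g x)"
      unfolding h(1) by (rule ext) (simp add: frechet_derivative_at[OF der[OF h(2,3)], symmetric])
    hence "ddir u h = (\<lambda>x. of_real (l x) * ddir u f x + (of_real (l u) * f x + ddir u g x))"
      by (simp add: add_ac)
    thus "ddir u h \<in> S" unfolding S_def mem_Collect_eq
      by - (rule exI[of _ "ddir u f"], rule exI[of _ "\<lambda>x. of_real (l u) * f x + ddir u g x"],
         simp add: h smooth_ddir smooth_add smooth_cmult)
  qed
qed

lemma affine_has_derivative:
  fixes L :: "'e::euclidean_space \<Rightarrow> 'e"
  assumes "linear L" "smooth f"
  shows "((\<lambda>x. f (L x + c)) has_derivative (\<lambda>u. ddir (L u) f (L x + c))) (at x)"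
proof -
  have "((\<lambda>x. L x + c) has_derivative L) (at x)"
    using assms(1) by (auto intro!: derivative_eq_intros bounded_linear_imp_has_derivative simp flip: linear_conv_bounded_linear)
  from has_derivative_compose[OF this smooth_has_derivative[OF assms(2)]]
  show ?thesis .
qed

lemma ddir_affine:
  fixes L :: "'e::euclidean_space \<Rightarrow> 'e"
  assumes "linear L" "smooth f"
  shows "ddir u (\<lambda>x. f (L x + c)) = (\<lambda>x. ddir (L u) f (L x + c))"
  by (simp add: frechet_derivative_at[OF affine_has_derivative[OF assms], symmetric])

lemma smooth_affine:
  fixes L :: "'e::euclidean_space \<Rightarrow> 'e"
  assumes "linear L" "smooth f" shows "smooth (\<lambda>x. f (L x + c))"
proof -
  define S where "S = (\<lambda>f x. f (L x + c)) ` {f. smooth f}"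
  show ?thesis
  proof (rule smooth_coinduct[where S = S])
    show "(\<lambda>x. f (L x + c)) \<in> S" using assms by (auto simp: S_def)
  next
    fix h x assume "h \<in> S"
    then obtain f where "h = (\<lambda>x. f (L x + c))" "smooth f" by (auto simp: S_def)
    thus "h differentiable at x" using affine_has_derivative[OF assms(1)] differentiableI by blast
  next
    fix h u assume "h \<in> S"
    then obtain f where h: "h = (\<lambda>x. f (L x + c))" "smooth f" by (auto simp: S_def)
    show "ddir u h \<in> S" unfolding S_def h(1) ddir_affine[OF assms(1) h(2)]
      by (rule image_eqI[of _ _ "ddir (L u) f"]) (simp_all add: smooth_ddir h(2))
  qed
qed

lemma smooth_translate: "smooth f \<Longrightarrow> smooth (\<lambda>x. f (x + c))"
  using smooth_affine[of "\<lambda>x. x" f c] by (simp add: linear_id[unfolded id_def])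

lemma ddir_translate: "smooth f \<Longrightarrow> ddir u (\<lambda>x. f (x + c)) = (\<lambda>x. ddir u f (x + c))"
  using ddir_affine[of "\<lambda>x. x" f c u] by (simp add: linear_id[unfolded id_def])

text \<open>Linearity in each direction lets bounds on iterated derivatives be checked on basis
  directions only.\<close>

lemma iter_deriv_linear_slot:
  assumes "smooth f" shows "linear (\<lambda>u. iter_deriv (us @ u # vs) f x)"
proof (rule linearI)
  let ?g = "iter_deriv vs f"
  have sg: "smooth ?g" by (rule smooth_iter_deriv[OF assms])
  fix u v
  have "ddir (u + v) ?g = (\<lambda>x. ddir u ?g x + ddir v ?g x)"
    using linear_add[OF smooth_linear_deriv[OF sg]] by auto
  thus "iter_deriv (us @ (u + v) # vs) f x = iter_deriv (us @ u # vs) f x + iter_deriv (us @ v # vs) f x"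
    by (simp add: iter_deriv_append iter_deriv_add smooth_ddir sg)
next
  let ?g = "iter_deriv vs f"
  have sg: "smooth ?g" by (rule smooth_iter_deriv[OF assms])
  fix r u
  have "ddir (r *\<^sub>R u) ?g = (\<lambda>x. of_real r * ddir u ?g x)"
    using linear_scale[OF smooth_linear_deriv[OF sg]] by (auto simp: scaleR_conv_of_real)
  thus "iter_deriv (us @ (r *\<^sub>R u) # vs) f x = r *\<^sub>R iter_deriv (us @ u # vs) f x"
    by (simp add: iter_deriv_append iter_deriv_cmult smooth_ddir sg scaleR_conv_of_real)
qed

section \<open>Integrals along translations\<close>

text \<open>The weight w will be 1 for averages over a period and s - 1/2 for the homotopy
  operators.\<close>

definition tint :: "(real \<Rightarrow> real) \<Rightarrow> 'e::euclidean_space \<Rightarrow> ('e \<Rightarrow> complex) \<Rightarrow> 'e \<Rightarrow> complex" where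
  "tint w V f = (\<lambda>x. integral {0..1} (\<lambda>s. of_real (w s) * f (x + s *\<^sub>R V)))"

lemma tint_integrable:
  assumes "smooth f" "continuous_on {0..1} w"
  shows "(\<lambda>s. of_real (w s) * f (x + s *\<^sub>R V)) integrable_on {0..1}"
proof -
  have "continuous_on {0..1} (\<lambda>s. f (x + s *\<^sub>R V))"
    by (rule continuous_on_compose2[OF smooth_continuous_on[OF assms(1), of UNIV]]) (auto intro!: continuous_intros)
  thus ?thesis by (auto intro!: integrable_continuous_interval continuous_intros assms(2))
qed

text \<open>Differentiation under the integral sign. The Leibniz rule wants the derivative as a
  continuous family of bounded linear maps, so the Frechet derivative is packaged as
  \<open>Df\<close>, whose continuity is read off from the directional derivatives.\<close>

lemma tint_has_derivative:
  assumes "smooth f" and w: "continuous_on {0..1} w"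
  shows "(tint w V f has_derivative (\<lambda>u. tint w V (ddir u f) x)) (at x)"
proof -
  define Df where "Df y = Blinfun (frechet_derivative f (at y))" for y
  have Df: "blinfun_apply (Df y) = frechet_derivative f (at y)" for y
    unfolding Df_def
    by (simp add: bounded_linear_Blinfun_apply linear_conv_bounded_linear[symmetric] smooth_linear_deriv assms(1))
  have cont: "continuous_on UNIV Df"
    by (rule continuous_on_blinfun_componentwise) (simp add: Df smooth_continuous_on smooth_ddir assms(1))
  define fx where "fx x t = w t *\<^sub>R Df (x + t *\<^sub>R V)" for x t
  have c2: "continuous_on (UNIV \<times> cbox 0 1) (\<lambda>(x, t). fx x t)"
  proof -
    have "continuous_on (UNIV \<times> cbox 0 1) (\<lambda>p. w (snd p))"
      by (rule continuous_on_compose2[OF w]) (auto intro!: continuous_intros)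
    moreover have "continuous_on (UNIV \<times> cbox 0 1) (\<lambda>p. Df (fst p + snd p *\<^sub>R V))"
      by (rule continuous_on_compose2[OF cont]) (auto intro!: continuous_intros)
    ultimately show ?thesis by (auto simp: fx_def split_beta intro!: continuous_intros)
  qed
  have "((\<lambda>x. integral (cbox 0 1) (\<lambda>s. of_real (w s) * f (x + s *\<^sub>R V)))
      has_derivative blinfun_apply (integral (cbox 0 1) (fx x))) (at x within UNIV)"
  proof (rule leibniz_rule[OF _ _ c2])
    fix y t
    have "((\<lambda>x. f (x + t *\<^sub>R V)) has_derivative frechet_derivative f (at (y + t *\<^sub>R V))) (at y)"
      by (rule has_derivative_compose[OF _ smooth_has_derivative[OF assms(1)], of "\<lambda>x. x + t *\<^sub>R V" "\<lambda>x. x", simplified])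
        (auto intro!: derivative_eq_intros)
    from has_derivative_mult_right[OF this, of "of_real (w t)"]
    have "((\<lambda>x. of_real (w t) * f (x + t *\<^sub>R V)) has_derivative
       (\<lambda>u. of_real (w t) * frechet_derivative f (at (y + t *\<^sub>R V)) u)) (at y)" .
    moreover have "blinfun_apply (fx y t) = (\<lambda>u. of_real (w t) * frechet_derivative f (at (y + t *\<^sub>R V)) u)"
      by (rule ext) (simp add: fx_def blinfun.scaleR_left Df scaleR_conv_of_real)
    ultimately show "((\<lambda>x. of_real (w t) * f (x + t *\<^sub>R V)) has_derivative blinfun_apply (fx y t)) (at y within UNIV)"
      by simp
  next
    fix y show "(\<lambda>s. of_real (w s) * f (y + s *\<^sub>R V)) integrable_on cbox 0 1"
      using tint_integrable[OF assms] by simp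
  qed auto
  moreover have "blinfun_apply (integral (cbox 0 1) (fx x)) = (\<lambda>u. tint w V (ddir u f) x)"
  proof
    fix u
    have "fx x integrable_on cbox 0 1"
      by (intro integrable_continuous continuous_on_compose2[OF c2, of "cbox 0 1" "\<lambda>t. (x, t)", unfolded split_conv])
         (auto intro!: continuous_intros)
    from blinfun_apply_integral[OF this]
    show "blinfun_apply (integral (cbox 0 1) (fx x)) u = tint w V (ddir u f) x"
      by (simp add: tint_def fx_def blinfun.scaleR_left Df scaleR_conv_of_real)
  qed
  ultimately show ?thesis by (simp add: tint_def)
qed

lemma ddir_tint:
  assumes "smooth f" "continuous_on {0..1} w"
  shows "ddir u (tint w V f) = tint w V (ddir u f)"
  by (rule ext) (simp add: frechet_derivative_at[OF tint_has_derivative[OF assms], symmetric])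

lemma smooth_tint:
  assumes "smooth f" "continuous_on {0..1} w"
  shows "smooth (tint w V f)"
proof (rule smooth_coinduct[where S = "tint w V ` {f. smooth f}"])
  show "\<And>h x. h \<in> tint w V ` {f. smooth f} \<Longrightarrow> h differentiable at x"
    using tint_has_derivative[OF _ assms(2)] differentiableI by blast
next
  fix h u assume "h \<in> tint w V ` {f. smooth f}"
  then obtain f where h: "h = tint w V f" "smooth f" by auto
  show "ddir u h \<in> tint w V ` {f. smooth f}" unfolding h(1) ddir_tint[OF h(2) assms(2)]
    using smooth_ddir[OF h(2)] by blast
qed (use assms in auto)

lemma iter_deriv_tint:
  assumes "smooth f" "continuous_on {0..1} w"
  shows "iter_deriv us (tint w V f) = tint w V (iter_deriv us f)"
  by (induction us) (auto simp: ddir_tint assms smooth_iter_deriv)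

lemma tint_add:
  assumes "smooth f" "smooth g" "continuous_on {0..1} w"
  shows "tint w V (\<lambda>x. f x + g x) x = tint w V f x + tint w V g x"
  unfolding tint_def
  by (simp add: distrib_left integral_add tint_integrable assms)

lemma tint_cmult: "tint w V (\<lambda>x. c * f x) x = c * tint w V f x"
  unfolding tint_def by (simp add: mult.left_commute[of _ c])

lemma tint_real:
  assumes "\<And>x. f x \<in> \<real>" shows "tint w V f x \<in> \<real>"
proof -
  let ?g = "\<lambda>s. complex_of_real (w s) * f (x + s *\<^sub>R V)"
  have im: "Im (?g s) = 0" for s
    using assms[of "x + s *\<^sub>R V"] by (simp add: complex_is_Real_iff)
  have "Im (integral {0..1} ?g) = 0"
  \<comment> \<open>A non-integrable function has integral 0 by convention, and 0 is real.\<close>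
  proof (cases "?g integrable_on {0..1}")
    case True
    from integral_linear[OF this bounded_linear_Im]
    have "Im (integral {0..1} ?g) = integral {0..1} (\<lambda>s. Im (?g s))" by (simp add: o_def)
    thus ?thesis by (simp only: im integral_0)
  qed (simp add: not_integrable_integral)
  thus ?thesis by (simp add: tint_def complex_is_Real_iff)
qed

lemma tint_bound:
  assumes "smooth f" "continuous_on {0..1} w" "\<And>s. s \<in> {0..1} \<Longrightarrow> \<bar>w s\<bar> \<le> 1"
    and "\<And>s. s \<in> {0..1} \<Longrightarrow> cmod (f (x + s *\<^sub>R V)) \<le> M"
  shows "cmod (tint w V f x) \<le> M"
proof -
  have "cmod (integral {0..1} (\<lambda>s. of_real (w s) * f (x + s *\<^sub>R V))) \<le> M * (1 - 0)"
  proof (rule integral_bound)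
    show "continuous_on {0..1} (\<lambda>s. of_real (w s) * f (x + s *\<^sub>R V))"
      by (intro continuous_intros assms(2) continuous_on_compose2[OF smooth_continuous_on[OF assms(1), of UNIV]]) auto
    show "\<And>s. s \<in> {0..1} \<Longrightarrow> cmod (of_real (w s) * f (x + s *\<^sub>R V)) \<le> M"
    proof -
      fix s :: real assume "s \<in> {0..1}"
      thus "cmod (of_real (w s) * f (x + s *\<^sub>R V)) \<le> M"
        using mult_mono[OF assms(3,4), of s s] by (simp add: norm_mult)
    qed
  qed simp
  thus ?thesis by (simp add: tint_def)
qed

text \<open>Integration by parts. The weight s - 1/2 has derivative 1 and values -1/2 and 1/2 at the
  ends, so by periodicity the boundary terms add up to f x.\<close>

lemma tint_sawtooth_ddir:
  assumes "smooth f" "f (x + V) = f x"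
  shows "tint (\<lambda>s. s - 1/2) V (ddir V f) x = f x - tint (\<lambda>s. 1) V f x"
proof -
  let ?g = "\<lambda>s::real. of_real (s - 1/2) * f (x + s *\<^sub>R V)"
  have der: "((\<lambda>s. f (x + s *\<^sub>R V)) has_vector_derivative ddir V f (x + s *\<^sub>R V)) (at s within {0..1})" for s
  proof -
    have "((\<lambda>s. x + s *\<^sub>R V) has_derivative (\<lambda>r. r *\<^sub>R V)) (at s within {0..1})"
      by (auto intro!: derivative_eq_intros)
    from has_derivative_compose[OF this smooth_has_derivative[OF assms(1)]]
    show ?thesis
      using linear_scale[OF smooth_linear_deriv[OF assms(1)]] by (simp add: has_vector_derivative_def)
  qed
  have "(?g has_vector_derivative (of_real (s - 1/2) * ddir V f (x + s *\<^sub>R V) + of_real 1 * f (x + s *\<^sub>R V))) (at s within {0..1})" for s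
    by (rule has_vector_derivative_mult[OF has_vector_derivative_of_real der])
       (auto intro!: derivative_eq_intros)
  hence "((\<lambda>s. of_real (s - 1/2) * ddir V f (x + s *\<^sub>R V) + of_real 1 * f (x + s *\<^sub>R V)) has_integral (?g 1 - ?g 0)) {0..1}"
    by (intro fundamental_theorem_of_calculus) auto
  hence "integral {0..1} (\<lambda>s. of_real (s - 1/2) * ddir V f (x + s *\<^sub>R V) + of_real 1 * f (x + s *\<^sub>R V)) = ?g 1 - ?g 0"
    by (rule integral_unique)
  also have "integral {0..1} (\<lambda>s. of_real (s - 1/2) * ddir V f (x + s *\<^sub>R V) + of_real 1 * f (x + s *\<^sub>R V))
     = tint (\<lambda>s. s - 1/2) V (ddir V f) x + tint (\<lambda>s. 1) V f x"
    unfolding tint_def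
    by (rule integral_add; (rule tint_integrable, simp add: smooth_ddir assms(1), intro continuous_intros))
  finally show ?thesis using assms(2) by (simp add: algebra_simps)
qed

section \<open>Alternating functions of lists\<close>

abbreviation del :: "nat \<Rightarrow> 'a list \<Rightarrow> 'a list" where
  "del i vs \<equiv> take i vs @ drop (Suc i) vs"

lemma alternating_length: "alternating k f \<Longrightarrow> length vs \<noteq> k \<Longrightarrow> f vs = 0"
  by (simp add: alternating_def)

lemma alternating_linear:
  assumes "alternating k f" "length us + length vs + 1 = k"
  shows "linear (\<lambda>v. f (us @ v # vs))"
proof -
  have "length (us @ 0 # vs) = k \<and> length us < k" using assms(2) by auto
  hence "linear (\<lambda>v. f ((us @ 0 # vs)[length us := v]))"
    using assms(1) unfolding alternating_def by blast
  thus ?thesis by (simp add: list_update_append)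
qed

lemma alternating_repeat:
  assumes "alternating k f" shows "f (us @ v # vs @ v # ws) = 0"
proof (cases "length (us @ v # vs @ v # ws) = k")
  case True
  let ?l = "us @ v # vs @ v # ws"
  have "?l ! length us = v" "?l ! (length us + length vs + 1) = v"
    by (simp_all add: nth_append)
  moreover have "length us < length us + length vs + 1" "length us + length vs + 1 < k" using True by auto
  moreover have "\<forall>vs i j. length vs = k \<and> i < j \<and> j < k \<and> vs ! i = vs ! j \<longrightarrow> f vs = 0"
    using assms unfolding alternating_def by blast
  ultimately show ?thesis using True by metis
qed (simp add: alternating_length[OF assms])

text \<open>Replaces positions i < j by splittings of the argument list, in which updates and
  deletions simplify.\<close>

lemma alternatingI:
  assumes "\<And>vs. length vs \<noteq> k \<Longrightarrow> f vs = 0"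
    and lin: "\<And>us vs. length us + length vs + 1 = k \<Longrightarrow> linear (\<lambda>v. f (us @ v # vs))"
    and rep: "\<And>us vs ws v. length us + length vs + length ws + 2 = k \<Longrightarrow> f (us @ v # vs @ v # ws) = 0"
  shows "alternating k f"
  unfolding alternating_def
proof (intro conjI allI impI)
  fix vs :: "'a list" and i assume "length vs = k \<and> i < k"
  thus "linear (\<lambda>v. f (vs[i := v]))"
    using lin[of "take i vs" "drop (Suc i) vs"] by (simp add: upd_conv_take_nth_drop)
next
  fix vs :: "'a list" and i j assume *: "length vs = k \<and> i < j \<and> j < k \<and> vs ! i = vs ! j"
  define us where "us = take i vs"
  define ms where "ms = take (j - Suc i) (drop (Suc i) vs)"
  define ws where "ws = drop (Suc j) vs"
  have "vs = us @ vs ! i # drop (Suc i) vs" unfolding us_def using * by (intro id_take_nth_drop) auto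
  also have "drop (Suc i) vs = ms @ drop (Suc i) vs ! (j - Suc i) # drop (Suc (j - Suc i)) (drop (Suc i) vs)"
    unfolding ms_def using * by (intro id_take_nth_drop) auto
  also have "drop (Suc i) vs ! (j - Suc i) = vs ! i" using * by simp
  also have "drop (Suc (j - Suc i)) (drop (Suc i) vs) = ws" using * by (simp add: ws_def)
  finally have vs: "vs = us @ vs ! i # ms @ vs ! i # ws" .
  have "length us + length ms + length ws + 2 = k" using * arg_cong[OF vs, of length] by simp
  from rep[OF this, of "vs ! i"] show "f vs = 0" using vs by simp
qed (use assms in auto)

text \<open>Polarisation: the function vanishes when both slots hold a + b, and so do the two
  diagonal terms of the expansion.\<close>

lemma alternating_swap:
  assumes "alternating k f" shows "f (us @ a # vs @ b # ws) = - f (us @ b # vs @ a # ws)"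
proof (cases "length (us @ a # vs @ b # ws) = k")
  case True
  have l1: "f (us @ (x + y) # vs @ z # ws) = f (us @ x # vs @ z # ws) + f (us @ y # vs @ z # ws)" for x y z
    using linear_add[OF alternating_linear[OF assms, of us "vs @ z # ws"]] True by simp
  have l2: "f (us @ z # vs @ (x + y) # ws) = f (us @ z # vs @ x # ws) + f (us @ z # vs @ y # ws)" for x y z
    using linear_add[OF alternating_linear[OF assms, of "us @ z # vs" ws]] True by simp
  have "f (us @ (a + b) # vs @ (a + b) # ws) = 0" by (rule alternating_repeat[OF assms])
  hence "f (us @ a # vs @ b # ws) + f (us @ b # vs @ a # ws) = 0"
    by (simp only: l1 l2) (simp add: alternating_repeat[OF assms] add.commute)
  thus ?thesis by (simp add: add_eq_0_iff2)
qed (simp add: alternating_length[OF assms])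

lemma alternating_move:
  assumes "alternating k f" shows "f (us @ a # vs @ ws) = (-1) ^ length vs * f (us @ vs @ a # ws)"
proof (induction vs arbitrary: us)
  case (Cons b vs)
  have "f (us @ a # (b # vs) @ ws) = - f (us @ b # a # vs @ ws)"
    using alternating_swap[OF assms, of us a "[]" b "vs @ ws"] by simp
  also have "f (us @ b # a # vs @ ws) = (-1) ^ length vs * f (us @ (b # vs) @ a # ws)"
    using Cons.IH[of "us @ [b]"] by simp
  finally show ?case by simp
qed simp

lemma alternating_zero [simp]: "alternating k (\<lambda>vs. 0)"
  by (rule alternatingI) (auto simp: linear_iff)

lemma alternating_add: "alternating k f \<Longrightarrow> alternating k g \<Longrightarrow> alternating k (\<lambda>vs. f vs + g vs)"
  by (rule alternatingI) (simp_all add: alternating_length alternating_repeat linear_compose_add alternating_linear)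

lemma alternating_cmult:
  assumes "alternating k f" shows "alternating k (\<lambda>vs. c * f vs)"
proof (rule alternatingI)
  fix us vs :: "'a list" assume "length us + length vs + 1 = k"
  from alternating_linear[OF assms this] show "linear (\<lambda>v. c * f (us @ v # vs))"
    by (simp add: linear_iff algebra_simps)
qed (auto simp: alternating_length[OF assms] alternating_repeat[OF assms])

lemma alternating_sum: "(\<And>i. i \<in> A \<Longrightarrow> alternating k (f i)) \<Longrightarrow> alternating k (\<lambda>vs. \<Sum>i\<in>A. f i vs)"
  by (induction A rule: infinite_finite_induct) (auto intro: alternating_add)

lemma alternating_diff: "alternating k f \<Longrightarrow> alternating k g \<Longrightarrow> alternating k (\<lambda>vs. f vs - g vs)"
  using alternating_add[of k f "\<lambda>vs. (-1) * g vs"] alternating_cmult[of k g "-1"] by simp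

lemma alternating_map:
  assumes "alternating k f" "linear L" shows "alternating k (\<lambda>vs. f (map L vs))"
proof (rule alternatingI)
  fix us vs :: "'b list" assume "length us + length vs + 1 = k"
  hence "linear (\<lambda>v. f (map L us @ v # map L vs))" by (intro alternating_linear[OF assms(1)]) auto
  from linear_compose[OF assms(2) this] show "linear (\<lambda>v. f (map L (us @ v # vs)))" by (simp add: o_def)
qed (auto simp: alternating_length[OF assms(1)] alternating_repeat[OF assms(1)])

lemma alternating_Cons:
  assumes "alternating (Suc k) f" shows "alternating k (\<lambda>vs. f (V # vs))"
proof (rule alternatingI)
  fix us vs :: "'a list" assume "length us + length vs + 1 = k"
  thus "linear (\<lambda>v. f (V # us @ v # vs))" using alternating_linear[OF assms, of "V # us" vs] by simp
next
  fix us vs ws v show "f (V # us @ v # vs @ v # ws) = 0"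
    using alternating_repeat[OF assms, of "V # us"] by simp
qed (auto simp: alternating_length[OF assms])

lemma slot_cases:
  assumes "i < length us + length vs + 1"
  obtains "i < length us" | "i = length us" | j where "i = length us + 1 + j" "j < length vs"
proof -
  have "i = length us + 1 + (i - length us - 1) \<and> i - length us - 1 < length vs"
    if "\<not> i < length us" "i \<noteq> length us" using that assms by auto
  thus thesis using that by blast
qed

text \<open>Singles out the two positions of a repeated argument in a list of the form
  \<open>us @ v # vs @ v # ws\<close>; the three sums belong to the positions before, between and
  after them.\<close>

lemma sum_lessThan_split3:
  fixes g :: "nat \<Rightarrow> 'a::comm_monoid_add"
  shows "(\<Sum>i<a + b + c + 2. g i) = (\<Sum>i<a. g i) + g a + (\<Sum>i<b. g (Suc a + i)) + g (Suc (a + b)) + (\<Sum>i<c. g (Suc (Suc (a + b + i))))"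
proof -
  have s: "(\<Sum>i<m + n. g i) = (\<Sum>i<m. g i) + (\<Sum>i<n. g (m + i))" for m n
    by (induction n) (auto simp: add.assoc)
  have "a + b + c + 2 = Suc (Suc a + b) + c" by simp
  thus ?thesis by (simp only: s sum.lessThan_Suc lessThan_0 sum.empty) (simp add: s add.assoc sum.lessThan_Suc_shift)
qed

text \<open>The pattern common to the exterior derivative of forms and to its value on constant
  coefficients.\<close>

definition antisymmetrize :: "('e \<Rightarrow> 'e list \<Rightarrow> complex) \<Rightarrow> 'e list \<Rightarrow> complex" where
  "antisymmetrize B vs = (\<Sum>i<length vs. (-1) ^ i * B (vs ! i) (del i vs))"

text \<open>The recursion behind both Cartan's formula and the vanishing of the square of the
  differential: fixing the first argument splits off its own term and reverses the sign of the
  rest.\<close>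

lemma antisymmetrize_Cons:
  "antisymmetrize B (V # vs) = B V vs - antisymmetrize (\<lambda>v ws. B v (V # ws)) vs"
  unfolding antisymmetrize_def length_Cons sum.lessThan_Suc_shift
  by (simp add: sum_negf)

text \<open>If an argument v is repeated, every term that removes some other argument vanishes. The
  two remaining terms differ by moving v across the arguments in between, and the sign of that move
  makes them cancel.\<close>

lemma alternating_antisymmetrize:
  assumes lin: "\<And>ws. linear (\<lambda>u. B u ws)" and alt: "\<And>u. alternating k (B u)"
  shows "alternating (Suc k) (antisymmetrize B)"
proof (rule alternatingI)
  fix vs :: "'a list" assume "length vs \<noteq> Suc k"
  thus "antisymmetrize B vs = 0"
    unfolding antisymmetrize_def by (intro sum.neutral) (auto simp: alternating_length[OF alt])
next
  fix us vs :: "'a list" assume l: "length us + length vs + 1 = Suc k"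
  have "linear (\<lambda>v. (-1) ^ i * B ((us @ v # vs) ! i) (del i (us @ v # vs)))" if "i < Suc k" for i
  proof -
    have m: "linear (\<lambda>v. c * h v)" if "linear h" for c :: complex and h :: "'a \<Rightarrow> complex"
      using that by (simp add: linear_iff algebra_simps)
    have "i < length us + length vs + 1" using \<open>i < Suc k\<close> l by simp
    then consider "i < length us" | "i = length us" | j where "i = length us + 1 + j" "j < length vs"
      by (rule slot_cases)
    thus ?thesis
    proof cases
      case 1
      have "linear (\<lambda>v. B (us ! i) (del i us @ v # vs))"
        by (rule alternating_linear[OF alt]) (use 1 l in auto)
      thus ?thesis using 1 by (intro m) (simp add: nth_append)
    next
      case 2 thus ?thesis using lin by (intro m) (simp add: nth_append)
    next
      case 3
      have "linear (\<lambda>v. B (vs ! j) (us @ v # del j vs))"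
        by (rule alternating_linear[OF alt]) (use 3 l in auto)
      thus ?thesis using 3 by (intro m) (simp add: nth_append)
    qed
  qed
  hence "linear (\<lambda>v. \<Sum>i<Suc k. (-1) ^ i * B ((us @ v # vs) ! i) (del i (us @ v # vs)))"
    by (intro linear_compose_sum) auto
  moreover have "length (us @ v # vs) = Suc k" for v using l by simp
  ultimately show "linear (\<lambda>v. antisymmetrize B (us @ v # vs))" unfolding antisymmetrize_def by simp
next
  fix us vs ws :: "'a list" and v assume l: "length us + length vs + length ws + 2 = Suc k"
  let ?l = "us @ v # vs @ v # ws" and ?a = "length us" and ?b = "length vs" and ?c = "length ws"
  let ?g = "\<lambda>i. (-1) ^ i * B (?l ! i) (del i ?l)"
  have z1: "?g i = 0" if "i < ?a" for i
    using that alternating_repeat[OF alt, of _ "del i us" v vs ws] by simp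
  have z2: "?g (Suc ?a + i) = 0" if "i < ?b" for i
    using that alternating_repeat[OF alt, of _ us v "del i vs" ws] by simp
  have z3: "?g (Suc (Suc (?a + ?b + i))) = 0" if "i < ?c" for i
  proof -
    have "del (Suc (Suc (?a + ?b + i))) ?l = us @ v # vs @ v # del i ws"
      by (simp add: take_Cons' drop_Cons')
    thus ?thesis using alternating_repeat[OF alt, of _ us v vs "del i ws"] by simp
  qed
  have "antisymmetrize B ?l = (\<Sum>i<?a + ?b + ?c + 2. ?g i)"
    unfolding antisymmetrize_def by (simp add: ac_simps)
  also have "\<dots> = ?g ?a + ?g (Suc (?a + ?b))"
    unfolding sum_lessThan_split3 using z1 z2 z3 by simp
  also have "?g ?a = (-1) ^ ?a * B v (us @ vs @ v # ws)" by (simp add: nth_append)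
  also have "?g (Suc (?a + ?b)) = - ((-1) ^ (?a + ?b) * B v (us @ v # vs @ ws))" by (simp add: nth_append)
  also have "B v (us @ v # vs @ ws) = (-1) ^ ?b * B v (us @ vs @ v # ws)" by (rule alternating_move[OF alt])
  finally show "antisymmetrize B ?l = 0" by (simp add: power_add flip: power_mult_distrib)
qed

text \<open>The extension of C as a derivation to functions of several arguments. With C the bracket
  by a fixed vector this is, up to sign, the coadjoint action.\<close>

definition slot_sum :: "('e \<Rightarrow> 'e) \<Rightarrow> ('e list \<Rightarrow> complex) \<Rightarrow> 'e list \<Rightarrow> complex" where
  "slot_sum C f vs = (\<Sum>i<length vs. f (vs[i := C (vs ! i)]))"

text \<open>On a repeated argument only the two terms that change one of the copies survive, and a
  transposition identifies them up to sign.\<close>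

lemma alternating_slot_sum:
  assumes "linear C" and alt: "alternating k f"
  shows "alternating k (slot_sum C f)"
proof (rule alternatingI)
  fix vs :: "'a list" assume "length vs \<noteq> k"
  thus "slot_sum C f vs = 0"
    unfolding slot_sum_def by (intro sum.neutral) (auto simp: alternating_length[OF alt])
next
  fix us vs :: "'a list" assume l: "length us + length vs + 1 = k"
  have "linear (\<lambda>v. f ((us @ v # vs)[i := C ((us @ v # vs) ! i)]))" if "i < k" for i
  proof -
    have "i < length us + length vs + 1" using \<open>i < k\<close> l by simp
    then consider "i < length us" | "i = length us" | j where "i = length us + 1 + j" "j < length vs"
      by (rule slot_cases)
    thus ?thesis
    proof cases
      case 1
      have "linear (\<lambda>v. f (us[i := C (us ! i)] @ v # vs))"
        by (rule alternating_linear[OF alt]) (use 1 l in auto)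
      thus ?thesis using 1 by (simp add: nth_append list_update_append)
    next
      case 2
      have "linear (\<lambda>v. f (us @ v # vs))" by (rule alternating_linear[OF alt l])
      from linear_compose[OF assms(1) this] show ?thesis using 2 by (simp add: o_def list_update_append)
    next
      case 3
      have "linear (\<lambda>v. f (us @ v # vs[j := C (vs ! j)]))"
        by (rule alternating_linear[OF alt]) (use 3 l in auto)
      thus ?thesis using 3 by (simp add: nth_append list_update_append)
    qed
  qed
  hence "linear (\<lambda>v. \<Sum>i<k. f ((us @ v # vs)[i := C ((us @ v # vs) ! i)]))"
    by (intro linear_compose_sum) auto
  moreover have "length (us @ v # vs) = k" for v using l by simp
  ultimately show "linear (\<lambda>v. slot_sum C f (us @ v # vs))" unfolding slot_sum_def by simp
next
  fix us vs ws :: "'a list" and v assume l: "length us + length vs + length ws + 2 = k"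
  let ?l = "us @ v # vs @ v # ws" and ?a = "length us" and ?b = "length vs" and ?c = "length ws"
  let ?g = "\<lambda>i. f (?l[i := C (?l ! i)])"
  have z1: "?g i = 0" if "i < ?a" for i
    using that alternating_repeat[OF alt, of "us[i := C (us ! i)]" v vs ws] by (simp add: nth_append list_update_append)
  have z2: "?g (Suc ?a + i) = 0" if "i < ?b" for i
    using that alternating_repeat[OF alt, of us v "vs[i := C (vs ! i)]" ws] by (simp add: nth_append list_update_append)
  have z3: "?g (Suc (Suc (?a + ?b + i))) = 0" if "i < ?c" for i
    using that alternating_repeat[OF alt, of us v vs "ws[i := C (ws ! i)]"] by (simp add: nth_append list_update_append)
  have "slot_sum C f ?l = (\<Sum>i<?a + ?b + ?c + 2. ?g i)"
    unfolding slot_sum_def by (simp add: ac_simps)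
  also have "\<dots> = ?g ?a + ?g (Suc (?a + ?b))"
    unfolding sum_lessThan_split3 using z1 z2 z3 by simp
  also have "?g ?a = f (us @ C v # vs @ v # ws)" by (simp add: nth_append list_update_append)
  also have "?g (Suc (?a + ?b)) = f (us @ v # vs @ C v # ws)" by (simp add: nth_append list_update_append)
  also have "f (us @ v # vs @ C v # ws) = - f (us @ C v # vs @ v # ws)" by (rule alternating_swap[OF alt])
  finally show "slot_sum C f ?l = 0" by simp
qed

section \<open>Smooth families and their seminorms\<close>

text \<open>The conditions of \<open>forms\<close> without invariance, so that a form and its frame
  coefficients can be treated alike.\<close>

definition smooth_family :: "nat \<Rightarrow> 'e::euclidean_space form \<Rightarrow> bool" where
  "smooth_family k \<phi> \<longleftrightarrow> (\<forall>x. alternating k (\<phi> x)) \<and> (\<forall>vs. smooth (\<lambda>x. \<phi> x vs))"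

lemma forms_iff: "\<phi> \<in> forms G k \<longleftrightarrow> smooth_family k \<phi> \<and> (\<forall>g\<in>G. pullback g \<phi> = \<phi>)"
  by (auto simp: forms_def smooth_family_def)

lemma alternating_iter_deriv:
  assumes "smooth_family k \<phi>" shows "alternating k (\<lambda>ws. iter_deriv us (\<lambda>y. \<phi> y ws) x)"
proof (rule alternatingI)
  have alt: "alternating k (\<phi> y)" for y using assms by (simp add: smooth_family_def)
  have sm: "smooth (\<lambda>y. \<phi> y ws)" for ws using assms by (simp add: smooth_family_def)
  fix vs ws :: "'a list" assume "length vs + length ws + 1 = k"
  note lin = alternating_linear[OF alt this]
  have 1: "(\<lambda>y. \<phi> y (vs @ (a + b) # ws)) = (\<lambda>y. \<phi> y (vs @ a # ws) + \<phi> y (vs @ b # ws))" for a b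
    using linear_add[OF lin] by auto
  have 2: "(\<lambda>y. \<phi> y (vs @ (r *\<^sub>R a) # ws)) = (\<lambda>y. of_real r * \<phi> y (vs @ a # ws))" for a r
    using linear_scale[OF lin] by (auto simp: scaleR_conv_of_real)
  show "linear (\<lambda>v. iter_deriv us (\<lambda>y. \<phi> y (vs @ v # ws)) x)"
    by (rule linearI) (simp_all add: 1 2 iter_deriv_add sm iter_deriv_cmult scaleR_conv_of_real)
next
  fix vs :: "'a list" assume "length vs \<noteq> k"
  hence "(\<lambda>y. \<phi> y vs) = (\<lambda>y. 0)"
    using assms unfolding smooth_family_def by (intro ext alternating_length[of k]) auto
  thus "iter_deriv us (\<lambda>y. \<phi> y vs) x = 0" by simp
next
  fix us' vs ws :: "'a list" and v
  have "(\<lambda>y. \<phi> y (us' @ v # vs @ v # ws)) = (\<lambda>y. 0)"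
    using assms unfolding smooth_family_def by (intro ext alternating_repeat) auto
  thus "iter_deriv us (\<lambda>y. \<phi> y (us' @ v # vs @ v # ws)) x = 0" by simp
qed

abbreviation pn :: "'e::real_normed_vector list \<Rightarrow> real" where
  "pn us \<equiv> prod_list (map norm us)"

lemma pn_nonneg [simp]: "pn us \<ge> 0"
  by (induction us) auto

text \<open>One inequality for all directions and arguments, scaled by their norms. In this shape it
  passes easily through changes of frame and replacements of arguments.\<close>

definition seminorm_le :: "nat \<Rightarrow> real \<Rightarrow> real \<Rightarrow> 'e::euclidean_space form \<Rightarrow> bool" where
  "seminorm_le n R M \<phi> \<longleftrightarrow> (\<forall>x\<in>cball 0 R. \<forall>us vs. length us \<le> n \<longrightarrow>
     cmod (iter_deriv us (\<lambda>y. \<phi> y vs) x) \<le> M * pn us * pn vs)"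

lemma seminorm_le_mono:
  fixes \<phi> :: "'a::euclidean_space form"
  assumes "seminorm_le n R M \<phi>" "n' \<le> n" "R' \<le> R" "M \<le> M'"
  shows "seminorm_le n' R' M' \<phi>"
  unfolding seminorm_le_def
proof (intro ballI allI impI)
  fix x and us vs :: "'a list" assume "x \<in> cball (0::'a) R'" "length us \<le> n'"
  hence "cmod (iter_deriv us (\<lambda>y. \<phi> y vs) x) \<le> M * pn us * pn vs"
    using assms unfolding seminorm_le_def by auto
  also have "\<dots> \<le> M' * pn us * pn vs" by (intro mult_right_mono assms) auto
  finally show "cmod (iter_deriv us (\<lambda>y. \<phi> y vs) x) \<le> M' * pn us * pn vs" .
qed

lemma multilinear_bound:
  fixes f :: "'e::euclidean_space list \<Rightarrow> complex"
  assumes lin: "\<And>us vs. length us + length vs + 1 = k \<Longrightarrow> linear (\<lambda>v. f (us @ v # vs))"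
    and bound: "\<And>us. length us = k \<Longrightarrow> set us \<subseteq> Basis \<Longrightarrow> cmod (f us) \<le> M" and M: "M \<ge> 0"
  shows "length vs = k \<Longrightarrow> cmod (f vs) \<le> M * real DIM('e) ^ k * pn vs"
proof -
  \<comment> \<open>\<open>us\<close> holds the arguments already replaced by basis vectors, and
    each replacement costs a factor of the dimension.\<close>
  have *: "cmod (f (us @ vs)) \<le> M * real DIM('e) ^ length vs * pn vs"
    if "length us + length vs = k" "set us \<subseteq> Basis" for us vs
    using that
  proof (induction vs arbitrary: us)
    case Nil thus ?case using bound[of us] by simp
  next
    case (Cons v vs)
    let ?K = "M * real DIM('e) ^ length vs * pn vs"
    have l: "linear (\<lambda>v. f (us @ v # vs))" using Cons.prems by (intro lin) auto
    have "f (us @ v # vs) = f (us @ (\<Sum>b\<in>Basis. (v \<bullet> b) *\<^sub>R b) # vs)" by (simp add: euclidean_representation)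
    also have "\<dots> = (\<Sum>b\<in>Basis. (v \<bullet> b) *\<^sub>R f (us @ b # vs))"
      using linear_sum[OF l, of "\<lambda>b. (v \<bullet> b) *\<^sub>R b" Basis] linear_scale[OF l] by simp
    finally have "cmod (f (us @ v # vs)) \<le> (\<Sum>b\<in>Basis. cmod ((v \<bullet> b) *\<^sub>R f (us @ b # vs)))"
      by (simp only: norm_sum)
    also have "\<dots> \<le> (\<Sum>b\<in>(Basis::'e set). norm v * ?K)"
    proof (rule sum_mono)
      fix b :: 'e assume b: "b \<in> Basis"
      have "cmod (f ((us @ [b]) @ vs)) \<le> ?K" using Cons.prems b by (intro Cons.IH) auto
      thus "cmod ((v \<bullet> b) *\<^sub>R f (us @ b # vs)) \<le> norm v * ?K"
        using b by (auto intro!: mult_mono simp: Basis_le_norm)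
    qed
    finally show ?case by (simp add: algebra_simps)
  qed
  show "length vs = k \<Longrightarrow> cmod (f vs) \<le> M * real DIM('e) ^ k * pn vs"
    using *[of "[]" vs] by simp
qed

text \<open>Finitely many inequalities, on basis directions and basis arguments, control the whole
  seminorm. This allows a finite intersection of subbasic sets of \<open>Cinf_topology\<close> to
  lie in a seminorm ball.\<close>

lemma seminorm_le_from_Basis:
  fixes \<phi> :: "'e::euclidean_space form"
  assumes \<phi>: "smooth_family k \<phi>" and M: "M \<ge> 0"
    and bound: "\<And>x us vs. x \<in> cball 0 R \<Longrightarrow> length us \<le> n \<Longrightarrow> length vs = k \<Longrightarrow> set us \<subseteq> Basis \<Longrightarrow>
       set vs \<subseteq> Basis \<Longrightarrow> cmod (iter_deriv us (\<lambda>y. \<phi> y vs) x) \<le> M"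
  shows "seminorm_le n R (M * real DIM('e) ^ k * real DIM('e) ^ n) \<phi>"
  unfolding seminorm_le_def
proof (intro ballI allI impI)
  fix x and us vs :: "'e list" assume x: "x \<in> cball (0::'e) R" and us: "length us \<le> n"
  have sm: "smooth (\<lambda>y. \<phi> y ws)" for ws using \<phi> by (simp add: smooth_family_def)
  show "cmod (iter_deriv us (\<lambda>y. \<phi> y vs) x) \<le> M * real DIM('e) ^ k * real DIM('e) ^ n * pn us * pn vs"
  proof (cases "length vs = k")
    case True
    have 1: "cmod (iter_deriv ds (\<lambda>y. \<phi> y vs) x) \<le> M * real DIM('e) ^ k * pn vs"
      if "set ds \<subseteq> Basis" "length ds = length us" for ds
      by (rule multilinear_bound[OF alternating_linear[OF alternating_iter_deriv[OF \<phi>]]])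
         (use that us bound[OF x] M True in auto)
    have "cmod (iter_deriv us (\<lambda>y. \<phi> y vs) x) \<le> (M * real DIM('e) ^ k * pn vs) * real DIM('e) ^ length us * pn us"
      by (rule multilinear_bound[OF iter_deriv_linear_slot[OF sm]]) (use 1 M in auto)
    also have "\<dots> \<le> (M * real DIM('e) ^ k * pn vs) * real DIM('e) ^ n * pn us"
      using M us by (intro mult_right_mono mult_left_mono power_increasing) (auto simp: Suc_le_eq)
    finally show ?thesis by (simp add: algebra_simps)
  next
    case False
    hence "(\<lambda>y. \<phi> y vs) = (\<lambda>y. 0)"
      using \<phi> unfolding smooth_family_def by (intro ext alternating_length[of k]) auto
    thus ?thesis using M by simp
  qed
qed

text \<open>Leibniz rule for a linear factor: either no derivative falls on l, which costs
  \<open>norm x\<close>, or exactly one does, which gives as many terms as there are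
  derivatives.\<close>

lemma linear_mult_bound:
  fixes l :: "'e::euclidean_space \<Rightarrow> real"
  assumes "linear l" and K: "\<And>x. \<bar>l x\<bar> \<le> K * norm x"
  shows "smooth g \<Longrightarrow> M \<ge> 0 \<Longrightarrow> (\<And>ds'. length ds' \<le> length ds \<Longrightarrow> cmod (iter_deriv ds' g x) \<le> M * pn ds') \<Longrightarrow>
     cmod (iter_deriv ds (\<lambda>x. of_real (l x) * g x) x) \<le> K * (norm x + length ds) * M * pn ds"
\<comment> \<open>Induction from the right, because the last direction of the list is the first to
  be applied.\<close>
proof (induction ds arbitrary: g M rule: rev_induct)
  case Nil
  have "0 \<le> K * norm x" using order_trans[OF abs_ge_zero K[of x]] .
  thus ?case using mult_mono[OF K[of x] Nil(3)[of "[]"]] Nil(2) by (simp add: norm_mult mult.assoc)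
next
  case (snoc u ds)
  have K0: "0 \<le> K * norm u" using order_trans[OF abs_ge_zero K[of u]] .
  have sg: "smooth (ddir u g)" by (rule smooth_ddir[OF snoc(2)])
  have "iter_deriv (ds @ [u]) (\<lambda>x. of_real (l x) * g x) x
     = of_real (l u) * iter_deriv ds g x + iter_deriv ds (\<lambda>x. of_real (l x) * ddir u g x) x"
    by (simp add: iter_deriv_append ddir_linear_mult[OF assms(1) snoc(2)] iter_deriv_add iter_deriv_cmult
       smooth_cmult smooth_linear_mult[OF assms(1)] sg snoc(2))
  moreover have "cmod (of_real (l u) * iter_deriv ds g x) \<le> K * norm u * (M * pn ds)"
    unfolding norm_mult by (intro mult_mono) (use K[of u] snoc(4)[of ds] K0 in auto)
  moreover have "cmod (iter_deriv ds (\<lambda>x. of_real (l x) * ddir u g x) x) \<le> K * (norm x + length ds) * (M * norm u) * pn ds"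
  proof (rule snoc.IH[OF sg])
    fix ds' :: "'e list" assume "length ds' \<le> length ds"
    thus "cmod (iter_deriv ds' (ddir u g) x) \<le> M * norm u * pn ds'"
      using snoc(4)[of "ds' @ [u]"] by (simp add: iter_deriv_append algebra_simps)
  qed (use snoc(3) in auto)
  ultimately have "cmod (iter_deriv (ds @ [u]) (\<lambda>x. of_real (l x) * g x) x)
     \<le> K * norm u * (M * pn ds) + K * (norm x + length ds) * (M * norm u) * pn ds"
    using norm_triangle_ineq[of "of_real (l u) * iter_deriv ds g x"] by (smt (verit))
  thus ?case by (simp add: algebra_simps)
qed

text \<open>Replacing every argument \<open>v\<close> by \<open>v + B x v\<close> with B bilinear changes the
  coefficients by polynomials in x, hence preserves smoothness and seminorm estimates.\<close>

lemma twist_expand: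
  fixes \<phi> :: "'e::euclidean_space form"
  assumes \<phi>: "smooth_family k \<phi>" and l: "length us + length vs + 1 = k"
  shows "\<phi> y (us @ (v + B y v) # map (\<lambda>v. v + B y v) vs) =
     \<phi> y ((us @ [v]) @ map (\<lambda>v. v + B y v) vs) +
     (\<Sum>b\<in>Basis. of_real (B y v \<bullet> b) * \<phi> y ((us @ [b]) @ map (\<lambda>v. v + B y v) vs))"
proof -
  let ?f = "\<lambda>w. \<phi> y (us @ w # map (\<lambda>v. v + B y v) vs)"
  have lin: "linear ?f" using \<phi> l unfolding smooth_family_def by (intro alternating_linear) auto
  have "?f (v + B y v) = ?f v + ?f (\<Sum>b\<in>Basis. (B y v \<bullet> b) *\<^sub>R b)"
    using linear_add[OF lin] by (simp add: euclidean_representation)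
  also have "?f (\<Sum>b\<in>Basis. (B y v \<bullet> b) *\<^sub>R b) = (\<Sum>b\<in>Basis. of_real (B y v \<bullet> b) * ?f b)"
    using linear_sum[OF lin, of "\<lambda>b. (B y v \<bullet> b) *\<^sub>R b" Basis] linear_scale[OF lin] by (simp add: scaleR_conv_of_real)
  finally show ?thesis by simp
qed

lemma twist_smooth:
  fixes \<phi> :: "'e::euclidean_space form"
  assumes \<phi>: "smooth_family k \<phi>" and B: "\<And>v. linear (\<lambda>x. B x v)"
  shows "smooth (\<lambda>x. \<phi> x (us @ map (\<lambda>v. v + B x v) vs))"
proof (cases "length us + length vs = k")
  case True thus ?thesis
  proof (induction vs arbitrary: us)
    case Nil thus ?case using \<phi> by (simp add: smooth_family_def)
  next
    case (Cons v vs)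
    have lb: "linear (\<lambda>x. B x v \<bullet> b)" for b using B[of v] by (simp add: linear_iff inner_add_left)
    have e: "length us + length vs + 1 = k" using Cons.prems by simp
    have sm: "smooth (\<lambda>y. \<phi> y ((us @ [b]) @ map (\<lambda>v. v + B y v) vs))" for b
      using Cons.prems by (intro Cons.IH) auto
    show ?case unfolding list.map twist_expand[OF \<phi> e, where B=B]
      by (intro smooth_add smooth_sum smooth_linear_mult lb sm)
  qed
next
  case False
  have "(\<lambda>x. \<phi> x (us @ map (\<lambda>v. v + B x v) vs)) = (\<lambda>x. 0)"
    using \<phi> False unfolding smooth_family_def by (intro ext alternating_length[of k]) auto
  thus ?thesis by simp
qed

lemma twist_seminorm_le:
  fixes \<phi> :: "'e::euclidean_space form" and M K R :: real
  assumes \<phi>: "smooth_family k \<phi>" and B: "\<And>v. linear (\<lambda>x. B x v)"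
    and K: "\<And>x v. norm (B x v) \<le> K * norm x * norm v" "K \<ge> 0"
    and "M \<ge> 0" "R \<ge> 0" "seminorm_le n R M \<phi>"
  shows "seminorm_le n R ((1 + DIM('e) * K * (R + n)) ^ k * M) (\<lambda>x vs. \<phi> x (map (\<lambda>v. v + B x v) vs))"
proof -
  define c :: real where "c = 1 + DIM('e) * K * (R + n)"
  have c: "c \<ge> 1" unfolding c_def using K(2) assms(6) by simp
  \<comment> \<open>\<open>us\<close> collects the arguments already expanded. Each remaining
    twisted argument contributes a factor c: 1 for the vector itself and the rest for the basis
    expansion of its twist.\<close>
  have main: "length ds \<le> n \<Longrightarrow> x \<in> cball 0 R \<Longrightarrow> length us + length vs = k \<Longrightarrow>
     cmod (iter_deriv ds (\<lambda>y. \<phi> y (us @ map (\<lambda>v. v + B y v) vs)) x) \<le> M * c ^ length vs * pn ds * pn us * pn vs" for ds x and us vs :: "'e list"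
  proof (induction vs arbitrary: us ds)
    case Nil
    thus ?case using assms(7) unfolding seminorm_le_def by simp
  next
    case (Cons v vs)
    have lb: "linear (\<lambda>x. B x v \<bullet> b)" for b using B[of v] by (simp add: linear_iff inner_add_left)
    have e: "length us + length vs + 1 = k" using Cons.prems by simp
    have sm: "smooth (\<lambda>y. \<phi> y ((us @ [b]) @ map (\<lambda>v. v + B y v) vs))" for b
      by (rule twist_smooth[OF \<phi> B])
    let ?M = "\<lambda>b. M * c ^ length vs * pn us * norm b * pn vs"
    have M0: "0 \<le> ?M b" for b :: 'e using assms(5) c by simp
    have bd: "cmod (iter_deriv ds' (\<lambda>y. \<phi> y ((us @ [b]) @ map (\<lambda>v. v + B y v) vs)) x) \<le> ?M b * pn ds'"
      if "length ds' \<le> n" for ds' b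
      using Cons.IH[OF that Cons.prems(2), of "us @ [b]"] e by (simp add: algebra_simps)
    have bd2: "cmod (iter_deriv ds (\<lambda>y. of_real (B y v \<bullet> b) * \<phi> y ((us @ [b]) @ map (\<lambda>v. v + B y v) vs)) x)
       \<le> K * (R + n) * norm v * ?M (1::real) * pn ds" if b: "b \<in> Basis" for b
    proof -
      have "cmod (iter_deriv ds (\<lambda>y. of_real (B y v \<bullet> b) * \<phi> y ((us @ [b]) @ map (\<lambda>v. v + B y v) vs)) x)
       \<le> (K * norm v) * (norm x + length ds) * ?M b * pn ds"
      proof (rule linear_mult_bound[OF lb _ sm M0])
        fix x show "\<bar>B x v \<bullet> b\<bar> \<le> K * norm v * norm x"
          using Basis_le_norm[OF b, of "B x v"] K(1)[of x v] by (simp add: algebra_simps)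
      qed (use bd Cons.prems in auto)
      also have "\<dots> = (K * norm v * ?M b * pn ds) * (norm x + length ds)" by (simp add: algebra_simps)
      also have "\<dots> \<le> (K * norm v * ?M b * pn ds) * (R + n)"
        using Cons.prems K(2) M0[of b] by (intro mult_left_mono add_mono) auto
      finally show ?thesis using b by (simp add: algebra_simps)
    qed
    have "cmod (iter_deriv ds (\<lambda>y. \<phi> y (us @ map (\<lambda>v. v + B y v) (v # vs))) x)
       = cmod (iter_deriv ds (\<lambda>y. \<phi> y ((us @ [v]) @ map (\<lambda>v. v + B y v) vs)) x +
          (\<Sum>b\<in>Basis. iter_deriv ds (\<lambda>y. of_real (B y v \<bullet> b) * \<phi> y ((us @ [b]) @ map (\<lambda>v. v + B y v) vs)) x))"
      unfolding list.map twist_expand[OF \<phi> e, where B=B]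
      by (subst iter_deriv_add) (simp_all only: iter_deriv_sum smooth_sum smooth_linear_mult[OF lb sm] sm)
    also have "\<dots> \<le> ?M v * pn ds + (\<Sum>b\<in>(Basis::'e set). K * (R + n) * norm v * ?M (1::real) * pn ds)"
      by (intro order_trans[OF norm_triangle_ineq] add_mono bd order_trans[OF norm_sum] sum_mono bd2 Cons.prems)
    also have "\<dots> = M * c ^ length (v # vs) * pn ds * pn us * pn (v # vs)"
      by (simp add: c_def algebra_simps)
    finally show ?case .
  qed
  show ?thesis unfolding seminorm_le_def c_def[symmetric]
  proof (intro ballI allI impI)
    fix x and us vs :: "'e list" assume x: "x \<in> cball (0::'e) R" and us: "length us \<le> n"
    show "cmod (iter_deriv us (\<lambda>y. \<phi> y (map (\<lambda>v. v + B y v) vs)) x) \<le> c ^ k * M * pn us * pn vs"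
    proof (cases "length vs = k")
      case True
      with main[OF us x, of "[]" vs] show ?thesis by (simp add: algebra_simps)
    next
      case False
      hence "(\<lambda>y. \<phi> y (map (\<lambda>v. v + B y v) vs)) = (\<lambda>y. 0)"
        using \<phi> unfolding smooth_family_def by (intro ext alternating_length[of k]) auto
      thus ?thesis using assms(5) c by simp
    qed
  qed
qed

section \<open>Forms and currents on a quotient\<close>

lemma smooth_family_add:
  "smooth_family k \<phi> \<Longrightarrow> smooth_family k \<psi> \<Longrightarrow> smooth_family k (\<lambda>x vs. \<phi> x vs + \<psi> x vs)"
  by (simp add: smooth_family_def alternating_add smooth_add)

lemma smooth_family_cmult: "smooth_family k \<phi> \<Longrightarrow> smooth_family k (\<lambda>x vs. c * \<phi> x vs)"
  by (simp add: smooth_family_def alternating_cmult smooth_cmult)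

lemma smooth_family_diff:
  "smooth_family k \<phi> \<Longrightarrow> smooth_family k \<psi> \<Longrightarrow> smooth_family k (\<lambda>x vs. \<phi> x vs - \<psi> x vs)"
  by (simp add: smooth_family_def alternating_diff smooth_diff)

lemma smooth_family_const: "alternating k f \<Longrightarrow> smooth_family k (\<lambda>x. f)"
  by (simp add: smooth_family_def)

lemma forms_add: "\<phi> \<in> forms G k \<Longrightarrow> \<psi> \<in> forms G k \<Longrightarrow> \<phi> + \<psi> \<in> forms G k"
  using smooth_family_add[of k \<phi> \<psi>]
  by (auto simp: forms_iff pullback_def plus_fun_def fun_eq_iff)

lemma forms_cmult: "\<phi> \<in> forms G k \<Longrightarrow> (\<lambda>x vs. c * \<phi> x vs) \<in> forms G k"
  using smooth_family_cmult[of k \<phi> c]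
  by (auto simp: forms_iff pullback_def fun_eq_iff)

lemma forms_zero: "0 \<in> forms G k"
  by (auto simp: forms_iff smooth_family_def pullback_def fun_eq_iff zero_fun_def)

lemma forms_uminus: "\<phi> \<in> forms G k \<Longrightarrow> - \<phi> \<in> forms G k"
  using forms_cmult[of \<phi> G k "-1"] by (simp add: fun_Compl_def)

lemma forms_diff: "\<phi> \<in> forms G k \<Longrightarrow> \<psi> \<in> forms G k \<Longrightarrow> \<phi> - \<psi> \<in> forms G k"
  using forms_add[OF _ forms_uminus, of \<phi> G k \<psi>] by simp

section \<open>Continuity of currents as a seminorm estimate\<close>

definition bounded_functional :: "('e::euclidean_space \<Rightarrow> 'e) set \<Rightarrow> nat \<Rightarrow> 'e current \<Rightarrow> bool" where
  "bounded_functional G k T \<longleftrightarrow> (\<exists>n R C. R \<ge> 0 \<and> C \<ge> 0 \<and>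
     (\<forall>\<phi>\<in>forms G k. \<forall>M\<ge>0. seminorm_le n R M \<phi> \<longrightarrow> cmod (T \<phi>) \<le> C * M))"

lemma seminorm_le_cmult:
  assumes "\<phi> \<in> forms G k" "seminorm_le n R M \<phi>"
  shows "seminorm_le n R (cmod c * M) (\<lambda>x vs. c * \<phi> x vs)"
  unfolding seminorm_le_def
proof (intro ballI allI impI)
  fix x and us vs :: "'a list" assume "x \<in> cball (0::'a) R" "length us \<le> n"
  hence "cmod (iter_deriv us (\<lambda>y. \<phi> y vs) x) \<le> M * pn us * pn vs"
    using assms(2) unfolding seminorm_le_def by auto
  hence "cmod c * cmod (iter_deriv us (\<lambda>y. \<phi> y vs) x) \<le> cmod c * (M * pn us * pn vs)"
    by (intro mult_left_mono) auto
  moreover have "smooth (\<lambda>y. \<phi> y vs)" using assms(1) by (simp add: forms_iff smooth_family_def)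
  ultimately show "cmod (iter_deriv us (\<lambda>y. c * \<phi> y vs) x) \<le> cmod c * M * pn us * pn vs"
    by (simp add: iter_deriv_cmult norm_mult mult.assoc)
qed

text \<open>Every open set contains a seminorm ball around each of its points. For a subbasic set
  this holds because its strict inequality has a margin on the compact set K; the rest is induction
  over the generation of the topology.\<close>

lemma Cinf_topology_neighbourhood:
  fixes G :: "('e::euclidean_space \<Rightarrow> 'e) set"
  assumes "generate_topology_on
     {{\<psi> \<in> forms G k. \<forall>x\<in>K. cmod (iter_deriv us (\<lambda>y. \<psi> y vs) x - iter_deriv us (\<lambda>y. \<phi> y vs) x) < r}
      | \<phi> K us vs r. \<phi> \<in> forms G k \<and> compact K \<and> r > 0} U" "\<xi> \<in> U"
  shows "\<exists>n R. \<exists>\<delta>>0. R \<ge> 0 \<and> (\<forall>\<psi>\<in>forms G k. seminorm_le n R \<delta> (\<psi> - \<xi>) \<longrightarrow> \<psi> \<in> U)"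
  using assms
proof (induction rule: generate_topology_on.induct)
  case (Int a b)
  obtain n R \<delta> where 1: "\<delta> > 0" "R \<ge> 0"
    "\<And>\<psi>. \<psi>\<in>forms G k \<Longrightarrow> seminorm_le n R \<delta> (\<psi> - \<xi>) \<Longrightarrow> \<psi> \<in> a"
    using Int.IH(1) Int.prems by blast
  obtain n' R' \<delta>' where 2: "\<delta>' > 0" "R' \<ge> 0"
    "\<And>\<psi>. \<psi>\<in>forms G k \<Longrightarrow> seminorm_le n' R' \<delta>' (\<psi> - \<xi>) \<Longrightarrow> \<psi> \<in> b"
    using Int.IH(2) Int.prems by blast
  note * = 1(1,2) 2(1,2) 1(3) 2(3)
  show ?case
  proof (rule exI[of _ "max n n'"], rule exI[of _ "max R R'"], rule exI[of _ "min \<delta> \<delta>'"], intro conjI ballI impI)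
    fix \<psi> assume "\<psi> \<in> forms G k" and s: "seminorm_le (max n n') (max R R') (min \<delta> \<delta>') (\<psi> - \<xi>)"
    thus "\<psi> \<in> a \<inter> b" using *(5,6) seminorm_le_mono[OF s] by auto
  qed (use * in auto)
next
  case (UN K)
  then obtain a where a: "a \<in> K" "\<xi> \<in> a" by blast
  from UN.IH[OF this] obtain n R \<delta> where "\<delta> > 0" "R \<ge> 0"
    "\<And>\<psi>. \<psi>\<in>forms G k \<Longrightarrow> seminorm_le n R \<delta> (\<psi> - \<xi>) \<Longrightarrow> \<psi> \<in> a" by blast
  with a(1) show ?case by blast
next
  case (Basis s)
  then obtain \<phi> K us vs r where s: "s = {\<psi> \<in> forms G k. \<forall>x\<in>K. cmod (iter_deriv us (\<lambda>y. \<psi> y vs) x - iter_deriv us (\<lambda>y. \<phi> y vs) x) < r}"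
    and \<phi>: "\<phi> \<in> forms G k" "compact K" "r > 0" by blast
  have \<xi>: "\<xi> \<in> forms G k" and lt: "\<And>x. x \<in> K \<Longrightarrow> cmod (iter_deriv us (\<lambda>y. \<xi> y vs) x - iter_deriv us (\<lambda>y. \<phi> y vs) x) < r"
    using Basis s by auto
  have sm: "smooth (\<lambda>y. \<theta> y vs)" if "\<theta> \<in> forms G k" for \<theta> using that by (simp add: forms_iff smooth_family_def)
  let ?g = "\<lambda>x. cmod (iter_deriv us (\<lambda>y. \<xi> y vs) x - iter_deriv us (\<lambda>y. \<phi> y vs) x)"
  \<comment> \<open>The continuous function \<open>?g\<close> attains its maximum on K, and that
    maximum is below r. For empty K any r' < r will do.\<close>
  obtain r' where r': "r' < r" "\<And>x. x \<in> K \<Longrightarrow> ?g x \<le> r'"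
  proof (cases "K = {}")
    case True thus thesis using that[of "r - 1"] by simp
  next
    case False
    have "continuous_on K ?g"
      by (intro continuous_intros smooth_continuous_on smooth_iter_deriv sm \<xi> \<phi>)
    from continuous_attains_sup[OF \<phi>(2) False this] show thesis using that lt by blast
  qed
  obtain R where R: "R \<ge> 0" "K \<subseteq> cball 0 R"
    using compact_imp_bounded[OF \<phi>(2)] unfolding bounded_pos by (auto simp: subset_iff intro: less_imp_le)
  \<comment> \<open>The margin divided by the scaling of the seminorm; the summand 1 keeps the
    denominator positive.\<close>
  define \<delta> where "\<delta> = (r - r') / (1 + pn us * pn vs)"
  have p: "0 \<le> pn us * pn vs" by simp
  have \<delta>: "\<delta> > 0" "\<delta> * (pn us * pn vs) < r - r'"
  proof -
    show "\<delta> > 0" unfolding \<delta>_def using r'(1) p by (intro divide_pos_pos) linarith+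
    have "(r - r') * (pn us * pn vs) < (r - r') * (1 + pn us * pn vs)" using r'(1) by (intro mult_strict_left_mono) auto
    moreover have "0 < 1 + pn us * pn vs" using p by linarith
    ultimately show "\<delta> * (pn us * pn vs) < r - r'" unfolding \<delta>_def by (simp add: divide_less_eq)
  qed
  show ?case
  proof (rule exI[of _ "length us"], rule exI[of _ R], rule exI[of _ \<delta>], intro conjI ballI impI R \<delta>)
    fix \<psi> assume \<psi>: "\<psi> \<in> forms G k" "seminorm_le (length us) R \<delta> (\<psi> - \<xi>)"
    have "cmod (iter_deriv us (\<lambda>y. \<psi> y vs) x - iter_deriv us (\<lambda>y. \<phi> y vs) x) < r" if "x \<in> K" for x
    proof -
      have "cmod (iter_deriv us (\<lambda>y. \<psi> y vs - \<xi> y vs) x) \<le> \<delta> * pn us * pn vs"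
        using \<psi>(2) that R(2) unfolding seminorm_le_def by auto
      hence "cmod (iter_deriv us (\<lambda>y. \<psi> y vs) x - iter_deriv us (\<lambda>y. \<xi> y vs) x) \<le> \<delta> * (pn us * pn vs)"
        by (simp add: iter_deriv_diff sm \<psi> \<xi> mult.assoc)
      moreover have "cmod (iter_deriv us (\<lambda>y. \<psi> y vs) x - iter_deriv us (\<lambda>y. \<phi> y vs) x) \<le>
         cmod (iter_deriv us (\<lambda>y. \<psi> y vs) x - iter_deriv us (\<lambda>y. \<xi> y vs) x) + ?g x"
        using dist_triangle[of "iter_deriv us (\<lambda>y. \<psi> y vs) x" "iter_deriv us (\<lambda>y. \<phi> y vs) x" "iter_deriv us (\<lambda>y. \<xi> y vs) x"]
        by (simp add: dist_norm)
      ultimately show ?thesis using \<delta>(2) r'(2)[OF that] by linarith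
    qed
    thus "\<psi> \<in> s" using s \<psi> by blast
  qed
qed auto

lemma topspace_Cinf: "topspace (Cinf_topology G k) = forms G k"
proof -
  let ?S = "{{\<psi> \<in> forms G k. \<forall>x\<in>K. cmod (iter_deriv us (\<lambda>y. \<psi> y vs) x - iter_deriv us (\<lambda>y. \<phi> y vs) x) < r}
      | \<phi> K us vs r. \<phi> \<in> forms G k \<and> compact K \<and> r > 0}"
  have "forms G k \<in> ?S"
    by (rule CollectI, rule exI[of _ 0], rule exI[of _ "{}"], rule exI[of _ "[]"], rule exI[of _ "[]"], rule exI[of _ 1])
       (simp add: forms_zero)
  hence "\<Union> ?S = forms G k" by blast
  thus ?thesis unfolding Cinf_topology_def topology_generated_by_topspace .
qed

text \<open>The preimage of the unit disc contains a seminorm ball around 0; homogeneity turns this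
  into an estimate for all forms.\<close>

lemma currents_bounded:
  fixes G :: "('e::euclidean_space \<Rightarrow> 'e) set"
  assumes T: "T \<in> currents G k" shows "bounded_functional G k T"
proof -
  have cont: "continuous_map (Cinf_topology G k) euclidean T"
    and hom: "\<And>c \<phi>. \<phi>\<in>forms G k \<Longrightarrow> T (\<lambda>x vs. c * \<phi> x vs) = c * T \<phi>"
    using T unfolding currents_def by auto
  have T0: "T 0 = 0" using hom[OF forms_zero, of 0] by (simp add: zero_fun_def)
  have "openin (Cinf_topology G k) {\<phi> \<in> topspace (Cinf_topology G k). T \<phi> \<in> ball 0 1}"
    by (rule openin_continuous_map_preimage[OF cont]) auto
  hence "generate_topology_on
     {{\<psi> \<in> forms G k. \<forall>x\<in>K. cmod (iter_deriv us (\<lambda>y. \<psi> y vs) x - iter_deriv us (\<lambda>y. \<phi> y vs) x) < r}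
      | \<phi> K us vs r. \<phi> \<in> forms G k \<and> compact K \<and> r > 0} {\<phi> \<in> forms G k. T \<phi> \<in> ball 0 1}"
    unfolding topspace_Cinf unfolding Cinf_topology_def openin_topology_generated_by_iff .
  moreover have "0 \<in> {\<phi> \<in> forms G k. T \<phi> \<in> ball 0 1}" by (simp add: T0 forms_zero)
  ultimately have "\<exists>n R. \<exists>\<delta>>0. R \<ge> 0 \<and> (\<forall>\<psi>\<in>forms G k. seminorm_le n R \<delta> (\<psi> - 0) \<longrightarrow> \<psi> \<in> {\<phi> \<in> forms G k. T \<phi> \<in> ball 0 1})"
    by (rule Cinf_topology_neighbourhood)
  then obtain n R \<delta> where
    *: "\<delta> > 0" "R \<ge> 0" "\<And>\<psi>. \<psi>\<in>forms G k \<Longrightarrow> seminorm_le n R \<delta> \<psi> \<Longrightarrow> cmod (T \<psi>) < 1"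
    by auto
  have pos: "cmod (T \<phi>) \<le> M / \<delta>" if "\<phi> \<in> forms G k" "M > 0" "seminorm_le n R M \<phi>" for \<phi> M
  proof -
    have "cmod (of_real (\<delta> / M)) * M = \<delta>" using that *(1) by (simp only: norm_of_real) simp
    hence "seminorm_le n R \<delta> (\<lambda>x vs. of_real (\<delta> / M) * \<phi> x vs)"
      using seminorm_le_cmult[OF that(1,3), of "of_real (\<delta> / M)"] by simp
    hence "cmod (T (\<lambda>x vs. of_real (\<delta> / M) * \<phi> x vs)) < 1" using *(3) forms_cmult[OF that(1)] by blast
    hence "cmod (of_real (\<delta> / M) * T \<phi>) < 1" by (simp only: hom[OF that(1)])
    hence "\<delta> / M * cmod (T \<phi>) < 1" using that *(1) by (simp only: norm_mult norm_of_real) simp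
    thus ?thesis using that *(1) by (simp add: field_simps)
  qed
  show ?thesis unfolding bounded_functional_def
  proof (rule exI[of _ n], rule exI[of _ R], rule exI[of _ "1 / \<delta>"], intro conjI ballI allI impI)
    fix \<phi> M assume \<phi>: "\<phi> \<in> forms G k" "(0::real) \<le> M" "seminorm_le n R M \<phi>"
    show "cmod (T \<phi>) \<le> 1 / \<delta> * M"
    \<comment> \<open>Rescaling needs a positive bound, so M = 0 is reached by enlarging M
      slightly.\<close>
    proof (rule field_le_epsilon)
      fix e :: real assume "e > 0"
      have "seminorm_le n R (M + e * \<delta>) \<phi>" by (rule seminorm_le_mono[OF \<phi>(3)]) (use \<open>e > 0\<close> * in auto)
      hence "cmod (T \<phi>) \<le> (M + e * \<delta>) / \<delta>"
        using \<phi>(2) mult_pos_pos[OF \<open>e > 0\<close> *(1)] by (intro pos[OF \<phi>(1)]) linarith+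
      thus "cmod (T \<phi>) \<le> 1 / \<delta> * M + e" using *(1) by (simp add: field_simps)
    qed
  qed (use * in auto)
qed

text \<open>The converse of \<open>currents_bounded\<close>: the seminorm ball on which T varies by
  less than e contains a finite intersection of subbasic sets, indexed by lists of basis
  vectors.\<close>

lemma currentsI:
  fixes G :: "('e::euclidean_space \<Rightarrow> 'e) set"
  assumes zero: "\<And>\<phi>. \<phi> \<notin> forms G k \<Longrightarrow> T \<phi> = 0"
    and add: "\<And>\<phi> \<psi>. \<phi> \<in> forms G k \<Longrightarrow> \<psi> \<in> forms G k \<Longrightarrow> T (\<phi> + \<psi>) = T \<phi> + T \<psi>"
    and hom: "\<And>c \<phi>. \<phi> \<in> forms G k \<Longrightarrow> T (\<lambda>x vs. c * \<phi> x vs) = c * T \<phi>"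
    and bdd: "bounded_functional G k T"
  shows "T \<in> currents G k"
proof -
  obtain n R C where *: "R \<ge> 0" "C \<ge> 0"
     "\<And>\<phi> M. \<phi>\<in>forms G k \<Longrightarrow> M\<ge>0 \<Longrightarrow> seminorm_le n R M \<phi> \<Longrightarrow> cmod (T \<phi>) \<le> C * M"
    using bdd unfolding bounded_functional_def by blast
  have "openin (Cinf_topology G k) {\<phi> \<in> forms G k. T \<phi> \<in> U}" if "open U" for U
  proof (subst openin_subopen, intro ballI)
    fix \<phi> assume "\<phi> \<in> {\<phi> \<in> forms G k. T \<phi> \<in> U}"
    hence \<phi>: "\<phi> \<in> forms G k" and "T \<phi> \<in> U" by auto
    obtain e where e: "e > 0" "ball (T \<phi>) e \<subseteq> U" using openE[OF \<open>open U\<close> \<open>T \<phi> \<in> U\<close>] by blast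
    define D where "D = real DIM('e) ^ k * real DIM('e) ^ n"
    have D: "D > 0" unfolding D_def by simp
    \<comment> \<open>D is the loss in passing from basis vectors to all vectors. With C + 1 in
      place of C the final estimate is strict also for C = 0.\<close>
    define \<delta> where "\<delta> = e / ((C + 1) * D)"
    have \<delta>: "\<delta> > 0" unfolding \<delta>_def using e * D by simp
    \<comment> \<open>The length n + k suffices both for the directions, at most n of them, and for
      the k arguments.\<close>
    define L where "L = {us :: 'e list. set us \<subseteq> Basis \<and> length us \<le> n + k}"
    have fin: "finite L" unfolding L_def by (rule finite_lists_length_le) simp
    define N where "N = (\<Inter>p\<in>L \<times> L. {\<psi> \<in> forms G k. \<forall>x\<in>cball 0 R. cmod (iter_deriv (fst p) (\<lambda>y. \<psi> y (snd p)) x - iter_deriv (fst p) (\<lambda>y. \<phi> y (snd p)) x) < \<delta>})"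
    have "openin (Cinf_topology G k) N" unfolding N_def
    proof (rule openin_Inter)
      have "[] \<in> L" by (simp add: L_def)
      thus "(\<lambda>p. {\<psi> \<in> forms G k. \<forall>x\<in>cball 0 R. cmod (iter_deriv (fst p) (\<lambda>y. \<psi> y (snd p)) x - iter_deriv (fst p) (\<lambda>y. \<phi> y (snd p)) x) < \<delta>}) ` (L \<times> L) \<noteq> {}"
        by blast
    next
      fix X assume "X \<in> (\<lambda>p. {\<psi> \<in> forms G k. \<forall>x\<in>cball 0 R. cmod (iter_deriv (fst p) (\<lambda>y. \<psi> y (snd p)) x - iter_deriv (fst p) (\<lambda>y. \<phi> y (snd p)) x) < \<delta>}) ` (L \<times> L)"
      then obtain us vs where X: "X = {\<psi> \<in> forms G k. \<forall>x\<in>cball 0 R. cmod (iter_deriv us (\<lambda>y. \<psi> y vs) x - iter_deriv us (\<lambda>y. \<phi> y vs) x) < \<delta>}" by auto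
      show "openin (Cinf_topology G k) X" unfolding Cinf_topology_def X
        by (rule topology_generated_by_Basis, rule CollectI, rule exI[of _ \<phi>], rule exI[of _ "cball 0 R"],
            rule exI[of _ us], rule exI[of _ vs], rule exI[of _ \<delta>]) (simp add: \<phi> \<delta>)
    qed (use fin in auto)
    moreover have "\<phi> \<in> N" unfolding N_def using \<phi> \<delta> by auto
    moreover have "N \<subseteq> {\<phi> \<in> forms G k. T \<phi> \<in> U}"
    proof
      fix \<psi> assume \<psi>N: "\<psi> \<in> N"
      have "([], []) \<in> L \<times> L" by (simp add: L_def)
      hence \<psi>: "\<psi> \<in> forms G k" using \<psi>N unfolding N_def by blast
      have d: "\<psi> - \<phi> \<in> forms G k" by (rule forms_diff[OF \<psi> \<phi>])
      have sm: "smooth (\<lambda>y. \<theta> y vs)" if "\<theta> \<in> forms G k" for \<theta> :: "'e form" and vs using that by (simp add: forms_iff smooth_family_def)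
      have "seminorm_le n R (\<delta> * real DIM('e) ^ k * real DIM('e) ^ n) (\<psi> - \<phi>)"
      proof (rule seminorm_le_from_Basis)
        fix x :: 'e and us vs :: "'e list" assume x: "x \<in> cball 0 R" and l: "length us \<le> n" "length vs = k" "set us \<subseteq> Basis" "set vs \<subseteq> Basis"
        hence "(us, vs) \<in> L \<times> L" by (auto simp: L_def)
        hence "cmod (iter_deriv us (\<lambda>y. \<psi> y vs) x - iter_deriv us (\<lambda>y. \<phi> y vs) x) < \<delta>"
          using \<psi>N x unfolding N_def by (auto dest!: bspec[of _ _ "(us, vs)"])
        thus "cmod (iter_deriv us (\<lambda>y. (\<psi> - \<phi>) y vs) x) \<le> \<delta>"
          by (simp add: iter_deriv_diff sm \<psi> \<phi>)
      qed (use d \<delta> in \<open>auto simp: forms_iff\<close>)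
      from *(3)[OF d _ this] have "cmod (T (\<psi> - \<phi>)) \<le> C * (\<delta> * D)"
        using \<delta> by (simp add: D_def mult.assoc)
      also have "C * (\<delta> * D) < (C + 1) * D * \<delta>" using \<delta> D by (simp add: algebra_simps)
      also have "\<dots> = e" unfolding \<delta>_def using * D by simp
      finally have "cmod (T (\<psi> - \<phi>)) < e" .
      moreover have "T \<psi> = T (\<psi> - \<phi>) + T \<phi>" using add[OF d \<phi>] by simp
      ultimately have "T \<psi> \<in> ball (T \<phi>) e" by (simp add: dist_norm norm_minus_commute)
      thus "\<psi> \<in> {\<phi> \<in> forms G k. T \<phi> \<in> U}" using e \<psi> by blast
    qed
    ultimately show "\<exists>N. openin (Cinf_topology G k) N \<and> \<phi> \<in> N \<and> N \<subseteq> {\<phi> \<in> forms G k. T \<phi> \<in> U}" by blast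
  qed
  hence "continuous_map (Cinf_topology G k) euclidean T"
    by (auto simp: continuous_map_def topspace_Cinf)
  thus ?thesis unfolding currents_def using zero add hom by blast
qed

section \<open>Elementary properties of the exterior derivative\<close>

lemma ext_d_antisymmetrize: "ext_d \<phi> x = antisymmetrize (\<lambda>v ws. ddir v (\<lambda>y. \<phi> y ws) x)"
  by (simp add: ext_d_def antisymmetrize_def fun_eq_iff)

lemma smooth_family_ext_d:
  assumes "smooth_family k \<phi>" shows "smooth_family (Suc k) (ext_d \<phi>)"
proof -
  have sm: "smooth (\<lambda>y. \<phi> y ws)" for ws using assms by (simp add: smooth_family_def)
  have "alternating (Suc k) (ext_d \<phi> x)" for x
    unfolding ext_d_antisymmetrize
    by (rule alternating_antisymmetrize[OF smooth_linear_deriv[OF sm]])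
       (use alternating_iter_deriv[OF assms, of "[_]"] in simp)
  moreover have "smooth (\<lambda>x. ext_d \<phi> x vs)" for vs
    unfolding ext_d_def by (intro smooth_sum smooth_cmult smooth_ddir sm)
  ultimately show ?thesis by (simp add: smooth_family_def)
qed

lemma ext_d_add:
  assumes "smooth_family k \<phi>" "smooth_family k \<psi>"
  shows "ext_d (\<phi> + \<psi>) = ext_d \<phi> + ext_d \<psi>"
proof -
  have "ddir u (\<lambda>y. \<phi> y vs + \<psi> y vs) x = ddir u (\<lambda>y. \<phi> y vs) x + ddir u (\<lambda>y. \<psi> y vs) x" for u vs x
    by (rule ddir_add[THEN fun_cong]) (use assms in \<open>simp_all add: smooth_family_def\<close>)
  thus ?thesis by (simp add: ext_d_def fun_eq_iff sum.distrib distrib_left)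
qed

section \<open>Symmetry of second derivatives\<close>

lemmas ddir_pointwise = ddir_add[THEN fun_cong] ddir_cmult[THEN fun_cong] ddir_diff[THEN fun_cong]
  ddir_sum[THEN fun_cong] ddir_translate[THEN fun_cong] ddir_tint[THEN fun_cong]

lemma tint_ddir:
  assumes "smooth f" shows "tint (\<lambda>s. 1) V (ddir V f) x = f (x + V) - f x"
proof -
  have "((\<lambda>s. f (x + s *\<^sub>R V)) has_vector_derivative ddir V f (x + s *\<^sub>R V)) (at s within {0..1})" for s
  proof -
    have "((\<lambda>s. x + s *\<^sub>R V) has_derivative (\<lambda>r. r *\<^sub>R V)) (at s within {0..1})"
      by (auto intro!: derivative_eq_intros)
    from has_derivative_compose[OF this smooth_has_derivative[OF assms(1)]]
    show ?thesis
      using linear_scale[OF smooth_linear_deriv[OF assms(1)]] by (simp add: has_vector_derivative_def)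
  qed
  hence "((\<lambda>s. ddir V f (x + s *\<^sub>R V)) has_integral (f (x + 1 *\<^sub>R V) - f (x + 0 *\<^sub>R V))) {0..1}"
    by (intro fundamental_theorem_of_calculus) auto
  thus ?thesis unfolding tint_def by (simp add: integral_unique)
qed

lemma tint_diff:
  assumes "smooth f" "smooth g" "continuous_on {0..1} w"
  shows "tint w V (\<lambda>x. f x - g x) x = tint w V f x - tint w V g x"
  using tint_add[OF assms(1) smooth_cmult[OF assms(2), of "-1"] assms(3), of V x] tint_cmult[of w V "-1" g x] by simp

lemma tint_const:
  assumes "continuous_on {0..1} w" shows "tint w V (\<lambda>x. c) x = of_real (integral {0..1} w) * c"
proof -
  have "(w has_integral integral {0..1} w) {0..1}"
    by (intro integrable_integral integrable_continuous_interval assms)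
  from has_integral_linear[OF this, of "\<lambda>r. of_real r * c"]
  have "((\<lambda>s. of_real (w s) * c) has_integral of_real (integral {0..1} w) * c) {0..1}"
    by (simp add: o_def bounded_linear_mult_const bounded_linear_of_real)
  thus ?thesis unfolding tint_def by (rule integral_unique)
qed

lemma ddir_scale: "smooth f \<Longrightarrow> ddir (r *\<^sub>R u) f x = of_real r * ddir u f x"
  using linear_scale[OF smooth_linear_deriv] by (auto simp: scaleR_conv_of_real)

text \<open>Integrating either mixed derivative from x to x + r u gives the same increment of the
  derivative along v. So their difference has integral 0 along all short segments in direction u,
  and continuity forces it to vanish at x.\<close>

lemma ddir_commute:
  fixes f :: "'e::euclidean_space \<Rightarrow> complex"
  assumes f: "smooth f" shows "ddir u (ddir v f) = ddir v (ddir u f)"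
proof
  fix x
  define H where "H = (\<lambda>x. ddir v (ddir u f) x - ddir u (ddir v f) x)"
  have sH: "smooth H" unfolding H_def by (intro smooth_diff smooth_ddir f)
  have c1: "continuous_on {0..1} (\<lambda>s::real. 1::real)" by simp
  have z: "tint (\<lambda>s. 1) (r *\<^sub>R u) H x = 0" if "r \<noteq> 0" for r
  proof -
    have "tint (\<lambda>s. 1) (r *\<^sub>R u) (ddir v (ddir (r *\<^sub>R u) f)) x = ddir v (tint (\<lambda>s. 1) (r *\<^sub>R u) (ddir (r *\<^sub>R u) f)) x"
      by (rule ddir_tint[THEN fun_cong, symmetric]) (simp_all add: smooth_ddir f)
    also have "tint (\<lambda>s. 1) (r *\<^sub>R u) (ddir (r *\<^sub>R u) f) = (\<lambda>x. f (x + r *\<^sub>R u) - f x)"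
      by (rule ext) (rule tint_ddir[OF f])
    also have "ddir v (\<lambda>x. f (x + r *\<^sub>R u) - f x) x = ddir v f (x + r *\<^sub>R u) - ddir v f x"
      by (simp add: ddir_pointwise smooth_translate f)
    also have "\<dots> = tint (\<lambda>s. 1) (r *\<^sub>R u) (ddir (r *\<^sub>R u) (ddir v f)) x"
      by (simp add: tint_ddir smooth_ddir f)
    finally have "of_real r * tint (\<lambda>s. 1) (r *\<^sub>R u) (ddir v (ddir u f)) x = of_real r * tint (\<lambda>s. 1) (r *\<^sub>R u) (ddir u (ddir v f)) x"
      by (simp add: ddir_scale f smooth_ddir ddir_pointwise tint_cmult)
    thus ?thesis using that unfolding H_def by (simp add: tint_diff smooth_ddir f)
  qed
  have "H x = 0"
  proof (rule ccontr)
    assume nz: "H x \<noteq> 0"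
    have "continuous_on UNIV H" by (rule smooth_continuous_on[OF sH])
    hence "isCont H x" by (simp add: continuous_on_eq_continuous_at)
    then obtain d where d: "d > 0" "\<And>y. dist y x < d \<Longrightarrow> dist (H y) (H x) < cmod (H x) / 2"
      using nz unfolding continuous_at_eps_delta by (metis half_gt_zero zero_less_norm_iff)
    \<comment> \<open>Keeps the segment from x within distance d/2; the summand 1 allows u =
      0.\<close>
    define r where "r = d / (2 * (norm u + 1))"
    have n1: "norm u + 1 > 0" by (simp add: add_nonneg_pos)
    have r: "r > 0" using d n1 by (simp add: r_def)
    have b: "cmod (H (x + s *\<^sub>R (r *\<^sub>R u)) - H x) \<le> cmod (H x) / 2" if "s \<in> {0..1}" for s
    proof -
      have "norm (s *\<^sub>R (r *\<^sub>R u)) = s * (r * norm u)" using that r by simp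
      also have "\<dots> \<le> 1 * (r * (norm u + 1))" using that r by (intro mult_mono) auto
      also have "\<dots> = d / 2" using n1 by (simp add: r_def field_simps)
      also have "\<dots> < d" using d by simp
      finally show ?thesis using d(2)[of "x + s *\<^sub>R (r *\<^sub>R u)"] by (simp add: dist_norm less_imp_le)
    qed
    have "cmod (tint (\<lambda>s. 1) (r *\<^sub>R u) (\<lambda>y. H y - H x) x) \<le> cmod (H x) / 2"
      by (rule tint_bound[OF smooth_diff[OF sH smooth_const] _ _ b]) simp_all
    moreover have "tint (\<lambda>s. 1) (r *\<^sub>R u) (\<lambda>y. H y - H x) x = - H x"
      using z[of r] r by (simp add: tint_diff sH tint_const)
    ultimately show False using nz by simp
  qed
  thus "ddir u (ddir v f) x = ddir v (ddir u f) x" by (simp add: H_def)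
qed

lemma antisymmetrize_add: "antisymmetrize (\<lambda>v ws. A v ws + B v ws) vs = antisymmetrize A vs + antisymmetrize B vs"
  by (simp add: antisymmetrize_def distrib_left sum.distrib)

lemma antisymmetrize_diff: "antisymmetrize (\<lambda>v ws. A v ws - B v ws) vs = antisymmetrize A vs - antisymmetrize B vs"
  by (simp add: antisymmetrize_def right_diff_distrib sum_subtractf)

text \<open>In the induction, the terms that remove the first argument at the outer stage cancel by
  symmetry against those that remove it at the inner stage.\<close>

lemma antisymmetrize_twice:
  assumes "\<And>u v zs. C u v zs = C v u zs"
  shows "antisymmetrize (\<lambda>u ws. antisymmetrize (C u) ws) vs = 0"
  using assms
proof (induction vs arbitrary: C)
  case Nil show ?case by (simp add: antisymmetrize_def)
next
  case (Cons V vs)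
  have "C V = (\<lambda>v. C v V)" by (intro ext Cons.prems)
  hence "antisymmetrize (C V) vs = antisymmetrize (\<lambda>v. C v V) vs" by (rule arg_cong)
  moreover have "antisymmetrize (\<lambda>u. antisymmetrize (\<lambda>z zs. C u z (V # zs))) vs = 0"
    by (rule Cons.IH) (rule Cons.prems)
  ultimately show ?case by (simp add: antisymmetrize_Cons antisymmetrize_diff)
qed

lemma ddir_antisymmetrize:
  assumes "\<And>v ws. smooth (\<lambda>x. B x v ws)"
  shows "ddir u (\<lambda>x. antisymmetrize (B x) vs) x = antisymmetrize (\<lambda>v ws. ddir u (\<lambda>x. B x v ws) x) vs"
  unfolding antisymmetrize_def by (simp add: ddir_pointwise smooth_cmult assms)

lemma ext_d_ext_d:
  assumes "smooth_family k \<phi>" shows "ext_d (ext_d \<phi>) = 0"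
proof (intro ext)
  fix x vs
  have sm: "smooth (\<lambda>y. \<phi> y ws)" for ws using assms by (simp add: smooth_family_def)
  have "ext_d (ext_d \<phi>) x vs = antisymmetrize (\<lambda>u ws. antisymmetrize (\<lambda>v zs. ddir u (ddir v (\<lambda>y. \<phi> y zs)) x) ws) vs"
    unfolding ext_d_antisymmetrize by (simp add: ddir_antisymmetrize smooth_ddir sm)
  also have "\<dots> = 0" by (rule antisymmetrize_twice) (rule ddir_commute[OF sm, THEN fun_cong])
  finally show "ext_d (ext_d \<phi>) x vs = 0 x vs" by simp
qed

section \<open>Forms in the left-invariant frame\<close>

text \<open>The bilinear part of the group law. Left translation by x has differential
  \<open>\<lambda>v. v + bet x v\<close>, so v in the frame stands for the left-invariant vector
  field with value v at the origin.\<close>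

definition bet :: "complex ^ 3 \<Rightarrow> complex ^ 3 \<Rightarrow> complex ^ 3" where
  "bet u v = vector [0, 0, u $ 1 * v $ 2]"

lemma bet_nth [simp]: "bet u v $ 1 = 0" "bet u v $ 2 = 0" "bet u v $ 3 = u $ 1 * v $ 2"
  by (simp_all add: bet_def)

lemma heis_mult_bet: "heis_mult z w = z + w + bet z w"
  by (simp add: heis_mult_def vec_eq_iff forall_3)

lemma bet_simps [simp]:
  "bet u (bet v w) = 0" "bet (bet u v) w = 0" "bet 0 v = 0" "bet u 0 = 0"
  by (simp_all add: vec_eq_iff forall_3)

lemma bet_linear_left: "linear (\<lambda>u. bet u v)" and bet_linear_right: "linear (\<lambda>v. bet u v)"
  by (rule linearI; simp add: vec_eq_iff forall_3 algebra_simps)+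

lemmas bet_add_left = linear_add[OF bet_linear_left] and bet_add_right = linear_add[OF bet_linear_right]
  and bet_diff_right = linear_diff[OF bet_linear_right]
  and bet_scale_left = linear_scale[OF bet_linear_left] and bet_scale_right = linear_scale[OF bet_linear_right]

lemma norm_bet: "norm (bet u v) \<le> norm u * norm v"
proof -
  have "norm (bet u v) = cmod (u $ 1) * cmod (v $ 2)"
    by (simp add: norm_vec_def L2_set_def sum_3 norm_mult)
  thus ?thesis by (simp add: mult_mono Finite_Cartesian_Product.norm_nth_le)
qed

text \<open>Passes to the coefficients of a form in the left-invariant frame; \<open>unhat\<close>
  is the way back.\<close>

definition hat :: "(complex ^ 3) form \<Rightarrow> (complex ^ 3) form" where
  "hat \<phi> = (\<lambda>x vs. \<phi> x (map (\<lambda>v. v + bet x v) vs))"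

definition unhat :: "(complex ^ 3) form \<Rightarrow> (complex ^ 3) form" where
  "unhat \<psi> = (\<lambda>x vs. \<psi> x (map (\<lambda>v. v + - bet x v) vs))"

text \<open>The two changes of arguments are inverse to each other because applying
  \<open>bet x\<close> twice gives 0.\<close>

lemma hat_unhat [simp]: "hat (unhat \<psi>) = \<psi>" and unhat_hat [simp]: "unhat (hat \<phi>) = \<phi>"
proof -
  have "(\<lambda>v. v + - bet x v) \<circ> (\<lambda>v. v + bet x v) = id" "(\<lambda>v. v + bet x v) \<circ> (\<lambda>v. v + - bet x v) = id" for x
    by (simp_all add: fun_eq_iff bet_add_right bet_diff_right)
  thus "hat (unhat \<psi>) = \<psi>" "unhat (hat \<phi>) = \<phi>" by (simp_all add: hat_def unhat_def)
qed

lemma smooth_family_twist: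
  fixes \<phi> :: "'e::euclidean_space form"
  assumes \<phi>: "smooth_family k \<phi>" and B: "\<And>v. linear (\<lambda>x. B x v)" "\<And>x. linear (B x)"
  shows "smooth_family k (\<lambda>x vs. \<phi> x (map (\<lambda>v. v + B x v) vs))"
proof -
  have "alternating k (\<lambda>vs. \<phi> x (map (\<lambda>v. v + B x v) vs))" for x
    by (rule alternating_map) (use \<phi> B(2) in \<open>auto simp: smooth_family_def intro: linear_compose_add linear_ident[unfolded id_def]\<close>)
  thus ?thesis using twist_smooth[OF \<phi> B(1), where us="[]"] by (simp add: smooth_family_def)
qed

lemma linear_neg_bet: "linear (\<lambda>u. - bet u v)" "linear (\<lambda>v. - bet u v)"
  by (simp_all add: linear_compose_neg bet_linear_left bet_linear_right)

lemma smooth_family_hat: "smooth_family k \<phi> \<Longrightarrow> smooth_family k (hat \<phi>)"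
  unfolding hat_def by (rule smooth_family_twist) (simp_all add: bet_linear_left bet_linear_right)

lemma smooth_family_unhat: "smooth_family k \<phi> \<Longrightarrow> smooth_family k (unhat \<phi>)"
  unfolding unhat_def by (rule smooth_family_twist) (simp_all add: linear_neg_bet)

lemma alternating_expand:
  assumes "alternating k f" "length us + length vs + 1 = k"
  shows "f (us @ (v + w) # vs) = f (us @ v # vs) + (\<Sum>b\<in>Basis. of_real (w \<bullet> b) * f (us @ b # vs))"
proof -
  note lin = alternating_linear[OF assms]
  have "f (us @ (v + w) # vs) = f (us @ v # vs) + f (us @ (\<Sum>b\<in>Basis. (w \<bullet> b) *\<^sub>R b) # vs)"
    using linear_add[OF lin] by (simp add: euclidean_representation)
  thus ?thesis
    using linear_sum[OF lin, of "\<lambda>b. (w \<bullet> b) *\<^sub>R b" Basis] linear_scale[OF lin] by (simp add: scaleR_conv_of_real)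
qed

lemma smooth_family_ddir:
  assumes "smooth_family k \<phi>" shows "smooth_family k (\<lambda>x ws. ddir u (\<lambda>y. \<phi> y ws) x)"
  using alternating_iter_deriv[OF assms, of "[u]"] assms by (simp add: smooth_family_def smooth_ddir)

text \<open>Product rule: the derivative falls either on the form, with the twist frozen at x, or on
  one of the twisted arguments, whose derivative is \<open>B u v\<close> because B is linear in the
  point.\<close>

lemma ddir_twist:
  fixes \<phi> :: "'e::euclidean_space form"
  assumes \<phi>: "smooth_family k \<phi>" and B: "\<And>v. linear (\<lambda>x. B x v)"
  shows "length us + length vs = k \<Longrightarrow> ddir u (\<lambda>y. \<phi> y (us @ map (\<lambda>v. v + B y v) vs)) x =
     ddir u (\<lambda>y. \<phi> y (us @ map (\<lambda>v. v + B x v) vs)) x +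
     (\<Sum>j<length vs. \<phi> x (us @ (map (\<lambda>v. v + B x v) vs)[j := B u (vs ! j)]))"
proof (induction vs arbitrary: us)
  case Nil thus ?case by simp
next
  case (Cons v vs)
  let ?M = "\<lambda>y. map (\<lambda>v. v + B y v) vs"
  have e: "length us + length vs + 1 = k" using Cons.prems by simp
  have lb: "linear (\<lambda>x. B x v \<bullet> b)" for b using B[of v] by (simp add: linear_iff inner_add_left)
  have sm: "smooth (\<lambda>y. \<phi> y ((us @ [b]) @ ?M y))" for b by (rule twist_smooth[OF \<phi> B])
  have lm: "smooth (\<lambda>y. of_real (B y v \<bullet> b) * \<phi> y ((us @ [b]) @ ?M y))" for b by (rule smooth_linear_mult[OF lb sm])
  have alt: "alternating k (\<phi> x)" using \<phi> by (simp add: smooth_family_def)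
  have alt': "alternating k (\<lambda>ws. ddir u (\<lambda>y. \<phi> y ws) x)"
    using smooth_family_ddir[OF \<phi>, of u] by (simp add: smooth_family_def)
  have IH: "ddir u (\<lambda>y. \<phi> y ((us @ [b]) @ ?M y)) x = ddir u (\<lambda>y. \<phi> y (us @ b # ?M x)) x +
     (\<Sum>j<length vs. \<phi> x (us @ b # (?M x)[j := B u (vs ! j)]))" for b
    using Cons.IH[of "us @ [b]"] e by simp
  have "ddir u (\<lambda>y. \<phi> y (us @ map (\<lambda>v. v + B y v) (v # vs))) x =
     ddir u (\<lambda>y. \<phi> y ((us @ [v]) @ ?M y)) x +
     (\<Sum>b\<in>Basis. of_real (B u v \<bullet> b) * \<phi> x (us @ b # ?M x) + of_real (B x v \<bullet> b) * ddir u (\<lambda>y. \<phi> y ((us @ [b]) @ ?M y)) x)"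
    unfolding list.map twist_expand[OF \<phi> e, where B=B]
    using sm lm
    by (simp only: ddir_pointwise smooth_sum ddir_linear_mult[OF lb, THEN fun_cong] append_assoc append.simps)
  also have "\<dots> = (ddir u (\<lambda>y. \<phi> y (us @ v # ?M x)) x + (\<Sum>b\<in>Basis. of_real (B x v \<bullet> b) * ddir u (\<lambda>y. \<phi> y (us @ b # ?M x)) x))
     + (\<Sum>b\<in>Basis. of_real (B u v \<bullet> b) * \<phi> x (us @ b # ?M x))
     + (\<Sum>j<length vs. \<phi> x (us @ v # (?M x)[j := B u (vs ! j)]) + (\<Sum>b\<in>Basis. of_real (B x v \<bullet> b) * \<phi> x (us @ b # (?M x)[j := B u (vs ! j)])))"
    unfolding IH
    by (simp add: sum.distrib distrib_left sum_distrib_left sum.swap[of _ _ Basis] algebra_simps)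
  also have "ddir u (\<lambda>y. \<phi> y (us @ v # ?M x)) x + (\<Sum>b\<in>Basis. of_real (B x v \<bullet> b) * ddir u (\<lambda>y. \<phi> y (us @ b # ?M x)) x)
     = ddir u (\<lambda>y. \<phi> y (us @ (v + B x v) # ?M x)) x"
    using alternating_expand[OF alt', of us "?M x" v "B x v"] e by simp
  also have "(\<Sum>j<length vs. \<phi> x (us @ v # (?M x)[j := B u (vs ! j)]) + (\<Sum>b\<in>Basis. of_real (B x v \<bullet> b) * \<phi> x (us @ b # (?M x)[j := B u (vs ! j)])))
     = (\<Sum>j<length vs. \<phi> x (us @ (v + B x v) # (?M x)[j := B u (vs ! j)]))"
    by (intro sum.cong refl alternating_expand[OF alt, symmetric]) (use e in simp)
  also have "(\<Sum>b\<in>Basis. of_real (B u v \<bullet> b) * \<phi> x (us @ b # ?M x)) = \<phi> x (us @ B u v # ?M x)"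
  proof -
    have "\<phi> x (us @ 0 # ?M x) = 0" using linear_0[OF alternating_linear[OF alt, of us "?M x"]] e by simp
    thus ?thesis using alternating_expand[OF alt, of us "?M x" 0 "B u v"] e by simp
  qed
  finally show ?case by (simp add: sum.lessThan_Suc_shift algebra_simps del: sum.lessThan_Suc)
qed

text \<open>The exterior derivative in the frame: the first term differentiates the coefficients
  along the frame field of v, and after antisymmetrisation the second yields the bracket terms of
  the invariant formula.\<close>

definition dh :: "(complex ^ 3) form \<Rightarrow> (complex ^ 3) form" where
  "dh \<psi> = (\<lambda>x. antisymmetrize (\<lambda>v ws. ddir (v + bet x v) (\<lambda>y. \<psi> y ws) x - slot_sum (bet v) (\<psi> x) ws))"

lemma alternating_zero_slot: "alternating k f \<Longrightarrow> f (us @ 0 # vs) = 0"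
proof (cases "length us + length vs + 1 = k")
  case True
  moreover assume "alternating k f"
  ultimately show ?thesis using linear_0[OF alternating_linear] by blast
qed (simp add: alternating_length)

lemma alternating_neg_slot:
  assumes "alternating k f" shows "f (us @ (- v) # vs) = - f (us @ v # vs)"
proof (cases "length us + length vs + 1 = k")
  case True show ?thesis using linear_neg[OF alternating_linear[OF assms True]] .
qed (simp add: alternating_length[OF assms])

lemma hat_ext_d_unhat:
  assumes \<psi>: "smooth_family k \<psi>" shows "hat (ext_d (unhat \<psi>)) = dh \<psi>"
proof (intro ext)
  fix x vs
  have alt: "alternating k (\<psi> x)" using \<psi> by (simp add: smooth_family_def)
  let ?E = "\<lambda>v. v + bet x v"
  have *: "ddir (?E v) (\<lambda>y. unhat \<psi> y (map ?E ws)) x = ddir (?E v) (\<lambda>y. \<psi> y ws) x - slot_sum (bet v) (\<psi> x) ws" for v ws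
  proof (cases "length ws = k")
    case True
    have FE: "map (\<lambda>v. v + - bet x v) (map ?E ws) = ws"
      by (simp add: o_def bet_add_right map_idI)
    have "ddir (?E v) (\<lambda>y. unhat \<psi> y (map ?E ws)) x =
       ddir (?E v) (\<lambda>y. \<psi> y ([] @ map (\<lambda>v. v + - bet y v) (map ?E ws))) x" by (simp add: unhat_def)
    also have "\<dots> = ddir (?E v) (\<lambda>y. \<psi> y ws) x + (\<Sum>j<length ws. \<psi> x (ws[j := - bet (?E v) (map ?E ws ! j)]))"
      by (subst ddir_twist[OF \<psi> linear_neg_bet(1)]) (simp_all only: True FE append.simps length_map list.size)
    also have "(\<Sum>j<length ws. \<psi> x (ws[j := - bet (?E v) (map ?E ws ! j)])) = - slot_sum (bet v) (\<psi> x) ws"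
      unfolding slot_sum_def sum_negf[symmetric]
      by (intro sum.cong refl) (simp add: upd_conv_take_nth_drop alternating_neg_slot[OF alt] bet_add_left bet_add_right)
    finally show ?thesis by simp
  next
    case False
    have "(\<lambda>y. unhat \<psi> y (map ?E ws)) = (\<lambda>y. 0)" "(\<lambda>y. \<psi> y ws) = (\<lambda>y. 0)"
      using \<psi> False unfolding smooth_family_def unhat_def by (auto intro!: ext alternating_length[of k])
    moreover have "slot_sum (bet v) (\<psi> x) ws = 0"
      by (rule alternating_length[OF alternating_slot_sum[OF bet_linear_right alt] False])
    ultimately show ?thesis by (simp add: frechet_derivative_const)
  qed
  show "hat (ext_d (unhat \<psi>)) x vs = dh \<psi> x vs"
    unfolding hat_def dh_def ext_d_antisymmetrize antisymmetrize_def
    by (intro sum.cong) (simp_all add: *[symmetric] take_map drop_map)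
qed

lemma smooth_family_dh: "smooth_family k \<psi> \<Longrightarrow> smooth_family (Suc k) (dh \<psi>)"
  unfolding hat_ext_d_unhat[symmetric]
  by (intro smooth_family_hat smooth_family_ext_d smooth_family_unhat)

lemma dh_dh: "smooth_family k \<psi> \<Longrightarrow> dh (dh \<psi>) = 0"
proof -
  assume \<psi>: "smooth_family k \<psi>"
  have "dh (dh \<psi>) = dh (hat (ext_d (unhat \<psi>)))" by (simp only: hat_ext_d_unhat[OF \<psi>])
  also have "\<dots> = hat (ext_d (unhat (hat (ext_d (unhat \<psi>)))))"
    by (rule hat_ext_d_unhat[OF smooth_family_hat[OF smooth_family_ext_d[OF smooth_family_unhat[OF \<psi>]]], symmetric])
  finally have "dh (dh \<psi>) = hat (ext_d (ext_d (unhat \<psi>)))" by simp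
  thus ?thesis by (simp add: ext_d_ext_d[OF smooth_family_unhat[OF \<psi>]] hat_def fun_eq_iff)
qed

section \<open>Cartan's formula in the left-invariant frame\<close>

lemma slot_sum_Cons: "slot_sum C f (V # ws) = f (C V # ws) + slot_sum C (\<lambda>ws. f (V # ws)) ws"
  by (simp add: slot_sum_def sum.lessThan_Suc_shift del: sum.lessThan_Suc)

text \<open>Moving the changed argument from the front back to its slot absorbs the sign of the
  antisymmetrisation.\<close>

lemma antisymmetrize_slot:
  assumes "alternating k f" shows "antisymmetrize (\<lambda>v ws. f (C v # ws)) vs = slot_sum C f vs"
  unfolding antisymmetrize_def slot_sum_def
proof (intro sum.cong refl)
  fix i assume "i \<in> {..<length vs}"
  thus "(- 1) ^ i * f (C (vs ! i) # del i vs) = f (vs[i := C (vs ! i)])"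
    using alternating_move[OF assms, of "[]" "C (vs ! i)" "take i vs" "drop (Suc i) vs"]
    by (simp add: upd_conv_take_nth_drop flip: power_mult_distrib mult.assoc)
qed

text \<open>The Lie bracket of the group; it takes values in the centre.\<close>

definition brk :: "complex ^ 3 \<Rightarrow> complex ^ 3 \<Rightarrow> complex ^ 3" where
  "brk V v = bet V v - bet v V"

lemma linear_brk: "linear (brk V)"
  unfolding brk_def by (intro linear_compose_sub bet_linear_left bet_linear_right)

definition contr :: "complex ^ 3 \<Rightarrow> (complex ^ 3) form \<Rightarrow> (complex ^ 3) form" where
  "contr V \<psi> = (\<lambda>x vs. \<psi> x (V # vs))"

lemma slot_sum_diff:
  assumes "alternating k f" shows "slot_sum (\<lambda>v. C v - D v) f vs = slot_sum C f vs - slot_sum D f vs"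
proof (cases "length vs = k")
  case True
  have "f (vs[i := C (vs ! i) - D (vs ! i)]) = f (vs[i := C (vs ! i)]) - f (vs[i := D (vs ! i)])" if "i < length vs" for i
  proof -
    have "linear (\<lambda>v. f (take i vs @ v # drop (Suc i) vs))"
      by (rule alternating_linear[OF assms]) (use that True in auto)
    from linear_diff[OF this] that show ?thesis by (simp add: upd_conv_take_nth_drop)
  qed
  thus ?thesis by (simp add: slot_sum_def sum_subtractf)
qed (simp add: slot_sum_def alternating_length[OF assms])

text \<open>The right-hand side is the Lie derivative along the left-invariant field of V: the
  derivative of the coefficients minus the adjoint action of V on the arguments.\<close>

lemma cartan:
  assumes \<psi>: "smooth_family k \<psi>"
  shows "dh (contr V \<psi>) x vs + contr V (dh \<psi>) x vs = ddir (V + bet x V) (\<lambda>y. \<psi> y vs) x - slot_sum (brk V) (\<psi> x) vs"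
proof -
  have alt: "alternating k (\<psi> x)" using \<psi> by (simp add: smooth_family_def)
  show ?thesis
    unfolding dh_def contr_def antisymmetrize_Cons slot_sum_Cons antisymmetrize_diff antisymmetrize_add
      antisymmetrize_slot[OF alt] brk_def slot_sum_diff[OF alt]
    by simp
qed

section \<open>Averaging over a direction\<close>

definition lattice :: "(complex ^ 3) set" where "lattice = {\<gamma>. \<forall>i. \<gamma> $ i \<in> gauss_ints}"

lemma iwasawa_deck_lattice: "iwasawa_deck = heis_mult ` lattice"
  by (simp add: iwasawa_deck_def lattice_def)

text \<open>Frame coefficients of invariant forms. Since the frame is left-invariant, invariance of
  the form means invariance of the coefficients as functions. W collects the directions along which
  they have already been made constant.\<close>

definition hatforms :: "(complex ^ 3) set \<Rightarrow> nat \<Rightarrow> (complex ^ 3) form set" where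
  "hatforms W k = {\<psi>. smooth_family k \<psi> \<and> (\<forall>\<gamma>\<in>lattice. \<forall>x. \<psi> (heis_mult \<gamma> x) = \<psi> x) \<and>
     (\<forall>w\<in>W. \<forall>r x. \<psi> (x + r *\<^sub>R w) = \<psi> x)}"

lemma hatforms_smooth_family: "\<psi> \<in> hatforms W k \<Longrightarrow> smooth_family k \<psi>"
  and hatforms_alternating: "\<psi> \<in> hatforms W k \<Longrightarrow> alternating k (\<psi> x)"
  and hatforms_smooth: "\<psi> \<in> hatforms W k \<Longrightarrow> smooth (\<lambda>y. \<psi> y vs)"
  and hatforms_lattice: "\<psi> \<in> hatforms W k \<Longrightarrow> \<gamma> \<in> lattice \<Longrightarrow> \<psi> (heis_mult \<gamma> x) = \<psi> x"
  by (auto simp: hatforms_def smooth_family_def)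

lemma hatforms_span:
  assumes "\<psi> \<in> hatforms W k" "w \<in> span W" shows "\<psi> (x + w) = \<psi> x"
proof -
  from assms(2) have "\<forall>x. \<psi> (x + w) = \<psi> x"
  proof (induction rule: span_induct_alt)
    case (step c w y)
    have "\<psi> (x + (c *\<^sub>R w + y)) = \<psi> x" for x
    proof -
      have "\<psi> (x + (c *\<^sub>R w + y)) = \<psi> ((x + c *\<^sub>R w) + y)" by (simp add: add.assoc)
      also have "\<dots> = \<psi> (x + c *\<^sub>R w)" using step by blast
      also have "\<dots> = \<psi> x" using step assms(1) by (auto simp: hatforms_def)
      finally show ?thesis .
    qed
    thus ?case by blast
  qed simp
  thus ?thesis by blast
qed

lemma hatforms_zero: "0 \<in> hatforms W k"
  by (simp add: hatforms_def smooth_family_def zero_fun_def)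

lemma hatforms_add: "\<psi> \<in> hatforms W k \<Longrightarrow> \<phi> \<in> hatforms W k \<Longrightarrow> \<psi> + \<phi> \<in> hatforms W k"
  using smooth_family_add[of k \<psi> \<phi>] by (simp add: hatforms_def plus_fun_def)

lemma hatforms_sum: "(\<And>i. i \<in> A \<Longrightarrow> \<psi> i \<in> hatforms W k) \<Longrightarrow> (\<Sum>i\<in>A. \<psi> i) \<in> hatforms W k"
  by (induction A rule: infinite_finite_induct) (auto simp: hatforms_zero hatforms_add)

lemma hatforms_mono: "W \<subseteq> W' \<Longrightarrow> hatforms W' k \<subseteq> hatforms W k"
  by (auto simp: hatforms_def)

lemma ddir_invariant:
  assumes "smooth f" "\<And>r. f (x + r *\<^sub>R w) = f x" shows "ddir w f x = 0"
proof -
  have "((\<lambda>r. x + r *\<^sub>R w) has_derivative (\<lambda>r. r *\<^sub>R w)) (at 0)"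
    by (auto intro!: derivative_eq_intros)
  from has_derivative_compose[OF this smooth_has_derivative[OF assms(1)]]
  have "((\<lambda>r. f (x + r *\<^sub>R w)) has_derivative (\<lambda>r. ddir (r *\<^sub>R w) f x)) (at 0)" by simp
  hence "((\<lambda>r::real. f x) has_derivative (\<lambda>r. ddir (r *\<^sub>R w) f x)) (at 0)" by (simp add: assms(2))
  hence "(\<lambda>r::real. ddir (r *\<^sub>R w) f x) = (\<lambda>r. 0)" using has_derivative_const has_derivative_unique by blast
  from fun_cong[OF this, of 1] show ?thesis by simp
qed

lemma invariant_if_ddir_zero:
  assumes "smooth f" "\<And>x. ddir w f x = 0" shows "f (x + r *\<^sub>R w) = f x"
proof -
  have "((\<lambda>r. f (x + r *\<^sub>R w)) has_derivative (\<lambda>h. 0)) (at r within UNIV)" for r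
  proof -
    have "((\<lambda>r. x + r *\<^sub>R w) has_derivative (\<lambda>r. r *\<^sub>R w)) (at r)"
      by (auto intro!: derivative_eq_intros)
    from has_derivative_compose[OF this smooth_has_derivative[OF assms(1)]]
    show ?thesis using assms by (simp add: ddir_scale)
  qed
  from has_derivative_zero_unique[OF convex_UNIV this, of r 0] show ?thesis by simp
qed

text \<open>Formulated with \<open>bet\<close> instead of the bracket, because the translations in
  question are those of the coordinates.\<close>

definition ideal :: "(complex ^ 3) set \<Rightarrow> bool" where
  "ideal W \<longleftrightarrow> (\<forall>w\<in>W. \<forall>u. bet w u \<in> span W \<and> bet u w \<in> span W)"

text \<open>V is a lattice element and central modulo W. So coefficients constant along W are
  periodic in the direction V, and translation along V commutes with the differential. The norm
  bounds serve the seminorm estimates.\<close>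

definition admissible :: "(complex ^ 3) set \<Rightarrow> complex ^ 3 \<Rightarrow> bool" where
  "admissible W V \<longleftrightarrow> ideal W \<and> V \<in> lattice \<and> norm V \<le> 1 \<and>
     (\<forall>u. norm (brk V u) \<le> norm u \<and> bet u V \<in> span W \<and> bet V u \<in> span W)"

lemma ddir_span:
  assumes "\<psi> \<in> hatforms W k" "w \<in> span W" shows "ddir w (\<lambda>y. \<psi> y vs) x = 0"
  by (rule ddir_invariant[OF hatforms_smooth[OF assms(1)]])
     (simp add: hatforms_span[OF assms(1)] span_scale assms(2))

lemma ddir_add_span:
  assumes "\<psi> \<in> hatforms W k" "w \<in> span W"
  shows "ddir (v + w) (\<lambda>y. \<psi> y vs) x = ddir v (\<lambda>y. \<psi> y vs) x"
  using linear_add[OF smooth_linear_deriv[OF hatforms_smooth[OF assms(1)]]] ddir_span[OF assms] by simp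

text \<open>Left translation by \<gamma> is affine and carries the frame at x to the frame at its
  image. Translation along w changes a frame vector by an element of \<open>span W\<close>, along
  which the coefficients are constant.\<close>

lemma dh_hatforms:
  assumes W: "ideal W" and \<psi>: "\<psi> \<in> hatforms W k" shows "dh \<psi> \<in> hatforms W (Suc k)"
proof -
  have "dh \<psi> (heis_mult \<gamma> x) = dh \<psi> x" if "\<gamma> \<in> lattice" for \<gamma> x
  proof -
    have "ddir (v + bet (heis_mult \<gamma> x) v) (\<lambda>y. \<psi> y ws) (heis_mult \<gamma> x) = ddir (v + bet x v) (\<lambda>y. \<psi> y ws) x" for v ws
    proof -
      have lin: "linear (\<lambda>y. y + bet \<gamma> y)" by (intro linear_compose_add linear_ident[unfolded id_def] bet_linear_right)
      have h: "heis_mult \<gamma> y = (y + bet \<gamma> y) + \<gamma>" for y by (simp add: heis_mult_bet)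
      have "(\<lambda>y. \<psi> y ws) = (\<lambda>y. \<psi> ((y + bet \<gamma> y) + \<gamma>) ws)"
        using hatforms_lattice[OF \<psi> that] by (simp add: h)
      hence "ddir (v + bet x v) (\<lambda>y. \<psi> y ws) x = ddir (v + bet x v) (\<lambda>y. \<psi> ((y + bet \<gamma> y) + \<gamma>) ws) x" by simp
      also have "\<dots> = ddir ((v + bet x v) + bet \<gamma> (v + bet x v)) (\<lambda>y. \<psi> y ws) ((x + bet \<gamma> x) + \<gamma>)"
        by (rule ddir_affine[OF lin hatforms_smooth[OF \<psi>], THEN fun_cong])
      also have "(v + bet x v) + bet \<gamma> (v + bet x v) = v + bet (heis_mult \<gamma> x) v"
        by (simp add: heis_mult_bet bet_add_left bet_add_right)
      finally show ?thesis by (simp add: h)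
    qed
    thus ?thesis unfolding dh_def using hatforms_lattice[OF \<psi> that] by simp
  qed
  moreover have "dh \<psi> (x + r *\<^sub>R w) = dh \<psi> x" if "w \<in> W" for r x w
  proof -
    have inv: "\<psi> (y + r *\<^sub>R w) = \<psi> y" for y using \<psi> that by (simp add: hatforms_def)
    have "ddir (v + bet (x + r *\<^sub>R w) v) (\<lambda>y. \<psi> y ws) (x + r *\<^sub>R w) = ddir (v + bet x v) (\<lambda>y. \<psi> y ws) x" for v ws
    proof -
      have "r *\<^sub>R bet w v \<in> span W" using W that by (simp add: ideal_def span_scale)
      from ddir_add_span[OF \<psi> this, where v = "v + bet x v"]
      have "ddir (v + bet (x + r *\<^sub>R w) v) (\<lambda>y. \<psi> y ws) (x + r *\<^sub>R w) = ddir (v + bet x v) (\<lambda>y. \<psi> y ws) (x + r *\<^sub>R w)"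
        by (simp add: bet_add_left bet_scale_left add.assoc)
      also have "\<dots> = ddir (v + bet x v) (\<lambda>y. \<psi> (y + r *\<^sub>R w) ws) x"
        by (rule ddir_translate[OF hatforms_smooth[OF \<psi>], THEN fun_cong, symmetric])
      finally show ?thesis by (simp add: inv)
    qed
    thus ?thesis unfolding dh_def by (simp add: inv)
  qed
  ultimately show ?thesis using smooth_family_dh[OF hatforms_smooth_family[OF \<psi>]] by (simp add: hatforms_def)
qed

definition form_int :: "(real \<Rightarrow> real) \<Rightarrow> complex ^ 3 \<Rightarrow> (complex ^ 3) form \<Rightarrow> (complex ^ 3) form" where
  "form_int w V \<psi> = (\<lambda>x vs. tint w V (\<lambda>y. \<psi> y vs) x)"

lemma tint_zero [simp]: "tint w V (\<lambda>y. 0) x = 0"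
  by (simp add: tint_def)

lemma tint_scaleR: "tint w V (\<lambda>x. r *\<^sub>R f x) x = r *\<^sub>R tint w V f x"
  using tint_cmult[of w V "of_real r" f x] by (simp only: scaleR_conv_of_real)

lemma smooth_family_form_int:
  assumes \<psi>: "smooth_family k \<psi>" and w: "continuous_on {0..1} w"
  shows "smooth_family k (form_int w V \<psi>)"
proof -
  have sm: "smooth (\<lambda>y. \<psi> y vs)" and alt: "alternating k (\<psi> y)" for y vs using \<psi> by (auto simp: smooth_family_def)
  have "alternating k (form_int w V \<psi> x)" for x
  proof (rule alternatingI)
    fix vs :: "(complex ^ 3) list" assume "length vs \<noteq> k"
    thus "form_int w V \<psi> x vs = 0" by (simp add: form_int_def alternating_length[OF alt])
  next
    fix us vs :: "(complex ^ 3) list" assume "length us + length vs + 1 = k"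
    note lin = alternating_linear[OF alt this]
    show "linear (\<lambda>v. form_int w V \<psi> x (us @ v # vs))"
      unfolding form_int_def
      by (rule linearI) (simp_all add: linear_add[OF lin] linear_scale[OF lin] tint_add sm w tint_scaleR)
  next
    fix us vs ws :: "(complex ^ 3) list" and v
    show "form_int w V \<psi> x (us @ v # vs @ v # ws) = 0"
      by (simp add: form_int_def alternating_repeat[OF alt])
  qed
  moreover have "smooth (\<lambda>x. form_int w V \<psi> x vs)" for vs
    unfolding form_int_def by (rule smooth_tint[OF sm w])
  ultimately show ?thesis by (simp add: smooth_family_def)
qed

lemma tint_cong: "(\<And>s. f (x + s *\<^sub>R V) = g (y + s *\<^sub>R V)) \<Longrightarrow> tint w V f x = tint w V g y"
  by (simp add: tint_def)

lemma form_int_hatforms: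
  assumes V: "admissible W V" and \<psi>: "\<psi> \<in> hatforms W k" and w: "continuous_on {0..1} w"
  shows "form_int w V \<psi> \<in> hatforms W k"
proof -
  have "form_int w V \<psi> (heis_mult \<gamma> x) = form_int w V \<psi> x" if "\<gamma> \<in> lattice" for \<gamma> x
  proof -
    \<comment> \<open>Left multiplication by \<gamma> does not commute with the coordinate
      translation along V, but the defect lies in \<open>span W\<close>.\<close>
    have "\<psi> (heis_mult \<gamma> x + s *\<^sub>R V) = \<psi> (x + s *\<^sub>R V)" for s
    proof -
      have "s *\<^sub>R bet \<gamma> V \<in> span W" using V by (simp add: admissible_def span_scale)
      from hatforms_span[OF \<psi> this] have "\<psi> (heis_mult \<gamma> x + s *\<^sub>R V) = \<psi> (heis_mult \<gamma> x + s *\<^sub>R V + s *\<^sub>R bet \<gamma> V)" by simp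
      also have "heis_mult \<gamma> x + s *\<^sub>R V + s *\<^sub>R bet \<gamma> V = heis_mult \<gamma> (x + s *\<^sub>R V)"
        by (simp add: heis_mult_bet bet_add_right bet_scale_right)
      finally show ?thesis using hatforms_lattice[OF \<psi> that] by simp
    qed
    thus ?thesis unfolding form_int_def by (intro ext tint_cong) simp
  qed
  moreover have "form_int w V \<psi> (x + r *\<^sub>R u) = form_int w V \<psi> x" if "u \<in> W" for r x u
  proof -
    have "\<psi> (x + r *\<^sub>R u + s *\<^sub>R V) = \<psi> (x + s *\<^sub>R V)" for s
    proof -
      have "x + r *\<^sub>R u + s *\<^sub>R V = (x + s *\<^sub>R V) + r *\<^sub>R u" by simp
      thus ?thesis using \<psi> that by (simp only: hatforms_def mem_Collect_eq)
    qed
    thus ?thesis unfolding form_int_def by (intro ext tint_cong) simp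
  qed
  ultimately show ?thesis
    using smooth_family_form_int[OF hatforms_smooth_family[OF \<psi>] w] by (simp add: hatforms_def)
qed

lemma tint_sum:
  assumes "\<And>i. i \<in> A \<Longrightarrow> smooth (f i)" "continuous_on {0..1} w"
  shows "tint w V (\<lambda>x. \<Sum>i\<in>A. f i x) x = (\<Sum>i\<in>A. tint w V (f i) x)"
  using assms(1) by (induction A rule: infinite_finite_induct) (auto simp: tint_add smooth_sum assms(2))

lemma smooth_slot_sum: "(\<And>vs. smooth (\<lambda>y. \<psi> y vs)) \<Longrightarrow> smooth (\<lambda>y. slot_sum C (\<psi> y) vs)"
  unfolding slot_sum_def by (rule smooth_sum)

lemma dh_form_int:
  assumes V: "admissible W V" and \<psi>: "\<psi> \<in> hatforms W k" and w: "continuous_on {0..1} w"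
  shows "dh (form_int w V \<psi>) = form_int w V (dh \<psi>)"
proof (intro ext)
  fix x vs
  note sm = hatforms_smooth[OF \<psi>]
  \<comment> \<open>The frame vectors are frozen at x here; moving them along V changes them only by
    elements of \<open>span W\<close>.\<close>
  define g where "g i y = ddir (vs ! i + bet x (vs ! i)) (\<lambda>y. \<psi> y (del i vs)) y - slot_sum (bet (vs ! i)) (\<psi> y) (del i vs)" for i y
  have sg: "smooth (g i)" for i
    unfolding g_def by (intro smooth_diff smooth_ddir smooth_slot_sum sm)
  have gi: "ddir (v + bet x v) (\<lambda>y. form_int w V \<psi> y ws) x - slot_sum (bet v) (form_int w V \<psi> x) ws
     = tint w V (\<lambda>y. ddir (v + bet x v) (\<lambda>y. \<psi> y ws) y - slot_sum (bet v) (\<psi> y) ws) x" for v ws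
  proof -
    have "ddir (v + bet x v) (\<lambda>y. form_int w V \<psi> y ws) x = tint w V (ddir (v + bet x v) (\<lambda>y. \<psi> y ws)) x"
      unfolding form_int_def by (rule ddir_tint[OF sm w, THEN fun_cong])
    moreover have "slot_sum (bet v) (form_int w V \<psi> x) ws = tint w V (\<lambda>y. slot_sum (bet v) (\<psi> y) ws) x"
      unfolding slot_sum_def form_int_def by (rule tint_sum[OF sm w, symmetric])
    ultimately show ?thesis
      by (simp add: tint_diff[OF smooth_ddir[OF sm] smooth_slot_sum[OF sm] w])
  qed
  have "dh (form_int w V \<psi>) x vs = (\<Sum>i<length vs. (- 1) ^ i * tint w V (g i) x)"
    unfolding dh_def antisymmetrize_def gi g_def ..
  also have "\<dots> = tint w V (\<lambda>y. \<Sum>i<length vs. (- 1) ^ i * g i y) x"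
    by (simp add: tint_sum smooth_cmult sg w tint_cmult)
  also have "\<dots> = tint w V (\<lambda>y. dh \<psi> y vs) x"
  proof (rule tint_cong)
    fix s
    have "ddir (v + bet (x + s *\<^sub>R V) v) (\<lambda>y. \<psi> y ws) (x + s *\<^sub>R V) = ddir (v + bet x v) (\<lambda>y. \<psi> y ws) (x + s *\<^sub>R V)" for v ws
    proof -
      have "s *\<^sub>R bet V v \<in> span W" using V by (simp add: admissible_def span_scale)
      from ddir_add_span[OF \<psi> this, where v = "v + bet x v"] show ?thesis by (simp add: bet_add_left bet_scale_left add.assoc)
    qed
    thus "(\<Sum>i<length vs. (- 1) ^ i * g i (x + s *\<^sub>R V)) = dh \<psi> (x + s *\<^sub>R V) vs"
      unfolding dh_def antisymmetrize_def g_def by simp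
  qed
  finally show "dh (form_int w V \<psi>) x vs = form_int w V (dh \<psi>) x vs" by (simp add: form_int_def)
qed

lemma contr_hatforms:
  assumes \<psi>: "\<psi> \<in> hatforms W k" shows "contr V \<psi> \<in> hatforms W (k - 1)"
proof (cases k)
  \<comment> \<open>In degree 0 the contraction is zero, so the truncated degree k - 1 = 0 is
    harmless.\<close>
  case 0
  have "contr V \<psi> = 0"
    unfolding contr_def using alternating_length[OF hatforms_alternating[OF \<psi>]] 0 by (auto simp: fun_eq_iff)
  thus ?thesis by (simp add: hatforms_zero)
next
  case (Suc j)
  thus ?thesis using \<psi> alternating_Cons[of j "\<psi> x" V for x]
    by (simp add: hatforms_def smooth_family_def contr_def)
qed

section \<open>The sawtooth homotopy and its error term\<close>

definition lie_op :: "complex ^ 3 \<Rightarrow> (complex ^ 3) form \<Rightarrow> (complex ^ 3) form" where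
  "lie_op V \<psi> = (\<lambda>x. slot_sum (brk V) (\<psi> x))"

lemma lie_op_hatforms: "\<psi> \<in> hatforms W k \<Longrightarrow> lie_op V \<psi> \<in> hatforms W k"
  by (simp add: hatforms_def smooth_family_def lie_op_def alternating_slot_sum[OF linear_brk] smooth_slot_sum)

abbreviation saw :: "real \<Rightarrow> real" where "saw \<equiv> \<lambda>s. s - 1 / 2"

lemma continuous_on_saw [simp]: "continuous_on {0..1} saw"
  by (intro continuous_intros)

text \<open>Integrating Cartan's formula along V brings in these three operators: the average, the
  chain homotopy \<open>homot\<close>, and the contribution \<open>nilop\<close> of the adjoint
  action, which measures the failure of V to be central.\<close>

definition avg :: "complex ^ 3 \<Rightarrow> (complex ^ 3) form \<Rightarrow> (complex ^ 3) form" where "avg V = form_int (\<lambda>s. 1) V"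
definition homot :: "complex ^ 3 \<Rightarrow> (complex ^ 3) form \<Rightarrow> (complex ^ 3) form" where "homot V \<psi> = form_int saw V (contr V \<psi>)"
definition nilop :: "complex ^ 3 \<Rightarrow> (complex ^ 3) form \<Rightarrow> (complex ^ 3) form" where "nilop V \<psi> = form_int saw V (lie_op V \<psi>)"

text \<open>The sum of V and x differs from their product by \<open>bet V x\<close>, an element of
  \<open>span W\<close>, so lattice invariance becomes periodicity.\<close>

lemma admissible_period:
  assumes V: "admissible W V" and \<psi>: "\<psi> \<in> hatforms W k" shows "\<psi> (x + V) = \<psi> x"
proof -
  have "bet V x \<in> span W" "V \<in> lattice" using V by (simp_all add: admissible_def)
  thus ?thesis using hatforms_span[OF \<psi>, of "bet V x" "x + V"] hatforms_lattice[OF \<psi>, of V x]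
    by (simp add: heis_mult_bet add.commute)
qed

text \<open>Cartan's formula integrated against s - 1/2: the derivative part gives the form minus
  its average, the adjoint part gives \<open>nilop\<close>. The term \<open>bet x V\<close> in the
  frame vector of V drops out because it lies in \<open>span W\<close>.\<close>

lemma homotopy_formula:
  assumes V: "admissible W V" and \<psi>: "\<psi> \<in> hatforms W k"
  shows "\<psi> - (avg V \<psi> + nilop V \<psi>) = dh (homot V \<psi>) + homot V (dh \<psi>)"
proof (intro ext)
  fix x vs
  note sm = hatforms_smooth[OF \<psi>]
  have W: "ideal W" using V by (simp add: admissible_def)
  have c: "contr V \<psi> \<in> hatforms W (k - 1)" by (rule contr_hatforms[OF \<psi>])
  have c2: "contr V (dh \<psi>) \<in> hatforms W k" using contr_hatforms[OF dh_hatforms[OF W \<psi>], of V] by simp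
  have "(dh (homot V \<psi>) + homot V (dh \<psi>)) x vs = tint saw V (\<lambda>y. dh (contr V \<psi>) y vs) x + tint saw V (\<lambda>y. contr V (dh \<psi>) y vs) x"
    unfolding homot_def dh_form_int[OF V c continuous_on_saw] by (simp add: form_int_def)
  also have "\<dots> = tint saw V (\<lambda>y. dh (contr V \<psi>) y vs + contr V (dh \<psi>) y vs) x"
    by (rule tint_add[OF hatforms_smooth[OF dh_hatforms[OF W c]] hatforms_smooth[OF c2] continuous_on_saw, symmetric])
  also have "\<dots> = tint saw V (\<lambda>y. ddir V (\<lambda>y. \<psi> y vs) y - slot_sum (brk V) (\<psi> y) vs) x"
  proof (rule tint_cong)
    fix s
    have "bet (x + s *\<^sub>R V) V \<in> span W" using V by (simp add: admissible_def)
    thus "dh (contr V \<psi>) (x + s *\<^sub>R V) vs + contr V (dh \<psi>) (x + s *\<^sub>R V) vs =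
      ddir V (\<lambda>y. \<psi> y vs) (x + s *\<^sub>R V) - slot_sum (brk V) (\<psi> (x + s *\<^sub>R V)) vs"
      by (simp add: cartan[OF hatforms_smooth_family[OF \<psi>]] ddir_add_span[OF \<psi>])
  qed
  also have "\<dots> = tint saw V (ddir V (\<lambda>y. \<psi> y vs)) x - tint saw V (\<lambda>y. slot_sum (brk V) (\<psi> y) vs) x"
    by (rule tint_diff[OF smooth_ddir[OF sm] smooth_slot_sum[OF sm] continuous_on_saw])
  also have "tint saw V (ddir V (\<lambda>y. \<psi> y vs)) x = \<psi> x vs - tint (\<lambda>s. 1) V (\<lambda>y. \<psi> y vs) x"
    by (rule tint_sawtooth_ddir[OF sm]) (simp add: admissible_period[OF V \<psi>])
  finally show "(\<psi> - (avg V \<psi> + nilop V \<psi>)) x vs = (dh (homot V \<psi>) + homot V (dh \<psi>)) x vs"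
    by (simp add: avg_def nilop_def form_int_def lie_op_def)
qed

lemma tint_swap:
  assumes "smooth f" "continuous_on {0..1} w"
  shows "tint (\<lambda>s. 1) V (tint w V f) x = tint w V (tint (\<lambda>s. 1) V f) x"
proof -
  let ?h = "\<lambda>r s. complex_of_real (w s) * f (x + r *\<^sub>R V + s *\<^sub>R V)"
  have c: "continuous_on (cbox (0, 0) (1, 1)) (\<lambda>(r, s). ?h r s)"
  proof -
    have "continuous_on (cbox (0::real, 0::real) (1, 1)) (\<lambda>p. w (snd p))"
      by (rule continuous_on_compose2[OF assms(2)]) (auto intro!: continuous_intros)
    thus ?thesis unfolding split_beta
      by (intro continuous_intros continuous_on_compose2[OF smooth_continuous_on[OF assms(1), of UNIV]]) auto
  qed
  have "tint (\<lambda>s. 1) V (tint w V f) x = integral (cbox 0 1) (\<lambda>r. integral (cbox 0 1) (?h r))"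
    by (simp add: tint_def)
  also have "\<dots> = integral (cbox 0 1) (\<lambda>s. integral (cbox 0 1) (\<lambda>r. ?h r s))"
    by (rule integral_swap_continuous[OF c])
  also have "\<dots> = tint w V (tint (\<lambda>s. 1) V f) x"
    by (simp add: tint_def add_ac)
  finally show ?thesis .
qed

text \<open>The derivative of the average along V is the increment over one period, hence 0.\<close>

lemma avg_invariant:
  assumes V: "admissible W V" and \<psi>: "\<psi> \<in> hatforms W k" shows "avg V \<psi> (x + r *\<^sub>R V) = avg V \<psi> x"
proof
  fix vs
  note sm = hatforms_smooth[OF \<psi>]
  have "ddir V (tint (\<lambda>s. 1) V (\<lambda>y. \<psi> y vs)) y = 0" for y
    by (simp add: ddir_tint[OF sm, THEN fun_cong] tint_ddir[OF sm] admissible_period[OF V \<psi>])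
  from invariant_if_ddir_zero[OF smooth_tint[OF sm] this]
  show "avg V \<psi> (x + r *\<^sub>R V) vs = avg V \<psi> x vs" by (simp add: avg_def form_int_def)
qed

lemma tint_invariant:
  assumes "\<And>x r. f (x + r *\<^sub>R V) = f x" "continuous_on {0..1} w"
  shows "tint w V f x = of_real (integral {0..1} w) * f x"
proof -
  have "tint w V f x = tint w V (\<lambda>y. f x) x" by (rule tint_cong) (simp add: assms(1))
  thus ?thesis by (simp add: tint_const[OF assms(2)])
qed

lemma integral_saw [simp]: "integral {0..1} saw = 0"
proof -
  have "(saw has_integral ((1\<^sup>2 / 2 - 1 / 2) - (0\<^sup>2 / 2 - 0 / 2))) {0..1}"
    by (rule fundamental_theorem_of_calculus[where f = "\<lambda>s. s\<^sup>2 / 2 - s / 2"])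
       (auto intro!: derivative_eq_intros simp: has_real_derivative_iff_has_vector_derivative[symmetric])
  from integral_unique[OF this] show ?thesis by simp
qed

text \<open>The average is constant along V and the sawtooth has mean 0.\<close>

lemma nilop_avg:
  assumes V: "admissible W V" and \<psi>: "\<psi> \<in> hatforms W k" shows "nilop V (avg V \<psi>) = 0"
proof (intro ext)
  fix x vs
  have "nilop V (avg V \<psi>) x vs = tint saw V (\<lambda>y. slot_sum (brk V) (avg V \<psi> y) vs) x"
    by (simp add: nilop_def form_int_def lie_op_def)
  also have "\<dots> = 0" by (subst tint_invariant) (simp_all add: avg_invariant[OF V \<psi>])
  finally show "nilop V (avg V \<psi>) x vs = 0 x vs" by simp
qed

lemma avg_avg:
  assumes V: "admissible W V" and \<psi>: "\<psi> \<in> hatforms W k" shows "avg V (avg V \<psi>) = avg V \<psi>"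
proof (intro ext)
  fix x vs
  have "avg V (avg V \<psi>) x vs = tint (\<lambda>s. 1) V (\<lambda>y. avg V \<psi> y vs) x"
    by (subst avg_def) (simp add: form_int_def)
  also have "\<dots> = avg V \<psi> x vs" by (subst tint_invariant) (simp_all add: avg_invariant[OF V \<psi>])
  finally show "avg V (avg V \<psi>) x vs = avg V \<psi> x vs" .
qed

text \<open>After exchanging the two integrals the sawtooth again meets a function constant along
  V.\<close>

lemma avg_nilop:
  assumes V: "admissible W V" and \<psi>: "\<psi> \<in> hatforms W k" shows "avg V (nilop V \<psi>) = 0"
proof (intro ext)
  fix x vs
  let ?f = "\<lambda>y. lie_op V \<psi> y vs"
  have l: "lie_op V \<psi> \<in> hatforms W k" by (rule lie_op_hatforms[OF \<psi>])
  have "avg V (nilop V \<psi>) x vs = tint (\<lambda>s. 1) V (tint saw V ?f) x"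
    by (simp add: avg_def nilop_def form_int_def)
  also have "\<dots> = tint saw V (tint (\<lambda>s. 1) V ?f) x" by (rule tint_swap[OF hatforms_smooth[OF l] continuous_on_saw])
  also have "\<dots> = 0"
    using avg_invariant[OF V l] by (subst tint_invariant) (simp_all add: avg_def form_int_def fun_eq_iff)
  finally show "avg V (nilop V \<psi>) x vs = 0 x vs" by simp
qed

abbreviation central :: "complex ^ 3 \<Rightarrow> bool" where "central v \<equiv> v $ 1 = 0 \<and> v $ 2 = 0"

text \<open>A filtration by the number of central arguments a form tolerates; it measures the
  nilpotency of \<open>nilop\<close>.\<close>

definition vanishes_on_central :: "nat \<Rightarrow> (complex ^ 3) form \<Rightarrow> bool" where
  "vanishes_on_central m \<psi> \<longleftrightarrow> (\<forall>x vs. m \<le> length (filter central vs) \<longrightarrow> \<psi> x vs = 0)"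

lemma length_filter_update:
  assumes "i < length vs" "P a" "\<not> P (vs ! i)"
  shows "length (filter P (vs[i := a])) = Suc (length (filter P vs))"
proof -
  have "filter P vs = filter P (take i vs @ vs ! i # drop (Suc i) vs)" using assms(1) by (simp add: id_take_nth_drop[symmetric])
  thus ?thesis using assms by (simp add: upd_conv_take_nth_drop)
qed

text \<open>The bracket with V kills central arguments and makes the others central, so each
  surviving term has one more central argument than before.\<close>

lemma nilop_vanishes:
  assumes \<psi>: "\<psi> \<in> hatforms W k" and v: "vanishes_on_central (Suc m) \<psi>"
  shows "vanishes_on_central m (nilop V \<psi>)"
  unfolding vanishes_on_central_def
proof (intro allI impI)
  fix x vs assume m: "m \<le> length (filter central vs)"
  have "\<psi> y (vs[i := brk V (vs ! i)]) = 0" if "i < length vs" for y i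
  proof (cases "central (vs ! i)")
    case True
    hence "brk V (vs ! i) = 0" by (simp add: brk_def vec_eq_iff forall_3)
    thus ?thesis using alternating_zero_slot[OF hatforms_alternating[OF \<psi>]] that by (simp add: upd_conv_take_nth_drop)
  next
    case False
    have "central (brk V (vs ! i))" by (simp add: brk_def)
    from length_filter_update[of i vs central, OF that this False] m
    show ?thesis using v by (simp add: vanishes_on_central_def)
  qed
  hence "slot_sum (brk V) (\<psi> y) vs = 0" for y by (simp add: slot_sum_def)
  thus "nilop V \<psi> x vs = 0" by (simp add: nilop_def form_int_def lie_op_def)
qed

lemma nilop_hatforms:
  assumes V: "admissible W V" and \<psi>: "\<psi> \<in> hatforms W k" shows "nilop V \<psi> \<in> hatforms W k"
  unfolding nilop_def by (rule form_int_hatforms[OF V lie_op_hatforms[OF \<psi>] continuous_on_saw])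

lemma avg_hatforms:
  assumes V: "admissible W V" and \<psi>: "\<psi> \<in> hatforms W k" shows "avg V \<psi> \<in> hatforms (insert V W) k"
proof -
  have "avg V \<psi> \<in> hatforms W k" unfolding avg_def by (rule form_int_hatforms[OF V \<psi>]) simp
  thus ?thesis using avg_invariant[OF V \<psi>] by (simp add: hatforms_def)
qed

lemma nilop_funpow_hatforms:
  assumes V: "admissible W V" and \<psi>: "\<psi> \<in> hatforms W k" shows "(nilop V ^^ m) \<psi> \<in> hatforms W k"
  by (induction m) (simp_all add: \<psi> nilop_hatforms[OF V])

text \<open>A k-form trivially vanishes on k + 1 central arguments, and each application lowers that
  number by one.\<close>

lemma nilop_nilpotent:
  assumes V: "admissible W V" and \<psi>: "\<psi> \<in> hatforms W k" shows "(nilop V ^^ Suc k) \<psi> = 0"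
proof -
  have "vanishes_on_central (Suc k - m) ((nilop V ^^ m) \<psi>)" if "m \<le> Suc k" for m
    using that
  proof (induction m)
    case 0
    have "\<psi> x vs = 0" if "Suc k \<le> length (filter central vs)" for x vs
    proof -
      have "length vs \<noteq> k" using that length_filter_le[of central vs] by linarith
      thus ?thesis by (rule alternating_length[OF hatforms_alternating[OF \<psi>]])
    qed
    thus ?case by (simp add: vanishes_on_central_def)
  next
    case (Suc m)
    hence "vanishes_on_central (Suc (Suc k - Suc m)) ((nilop V ^^ m) \<psi>)" by (simp add: Suc_diff_le)
    from nilop_vanishes[OF nilop_funpow_hatforms[OF V \<psi>] this] show ?case by simp
  qed
  from this[of "Suc k"] have "vanishes_on_central 0 ((nilop V ^^ Suc k) \<psi>)" by simp
  thus ?thesis unfolding vanishes_on_central_def by (intro ext) (simp del: funpow.simps)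
qed

section \<open>Continuous operators on invariant forms\<close>

definition real_form :: "'e form \<Rightarrow> bool" where
  "real_form \<psi> \<longleftrightarrow> (\<forall>x vs. \<psi> x vs \<in> \<real>)"

definition bounded_op :: "(complex ^ 3) set \<Rightarrow> nat \<Rightarrow> ((complex ^ 3) form \<Rightarrow> (complex ^ 3) form) \<Rightarrow> bool" where
  "bounded_op W k F \<longleftrightarrow> (\<forall>n R. R \<ge> 0 \<longrightarrow> (\<exists>n' R' C. R' \<ge> 0 \<and> C \<ge> 0 \<and>
     (\<forall>\<psi>\<in>hatforms W k. \<forall>M\<ge>0. seminorm_le n' R' M \<psi> \<longrightarrow> seminorm_le n R (C * M) (F \<psi>))))"

text \<open>Everything that composing a real current with the operator requires: complex linearity,
  preservation of reality, and continuity.\<close>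

definition good_op :: "(complex ^ 3) set \<Rightarrow> nat \<Rightarrow> (complex ^ 3) set \<Rightarrow> nat \<Rightarrow> ((complex ^ 3) form \<Rightarrow> (complex ^ 3) form) \<Rightarrow> bool" where
  "good_op W k W' l F \<longleftrightarrow> (\<forall>\<psi>\<in>hatforms W k. F \<psi> \<in> hatforms W' l) \<and>
     (\<forall>\<psi>\<in>hatforms W k. \<forall>\<phi>\<in>hatforms W k. F (\<psi> + \<phi>) = F \<psi> + F \<phi>) \<and>
     (\<forall>c. \<forall>\<psi>\<in>hatforms W k. F (\<lambda>x vs. c * \<psi> x vs) = (\<lambda>x vs. c * F \<psi> x vs)) \<and>
     (\<forall>\<psi>\<in>hatforms W k. real_form \<psi> \<longrightarrow> real_form (F \<psi>)) \<and> bounded_op W k F"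

lemma bounded_opD:
  assumes "bounded_op W k F" "R \<ge> 0"
  shows "\<exists>n' R' C. R' \<ge> 0 \<and> C \<ge> 0 \<and>
     (\<forall>\<psi>\<in>hatforms W k. \<forall>M\<ge>0. seminorm_le n' R' M \<psi> \<longrightarrow> seminorm_le n R (C * M) (F \<psi>))"
  using assms unfolding bounded_op_def by simp

lemma good_op_zero_arg: "good_op W k W' l F \<Longrightarrow> F 0 = 0"
proof -
  assume "good_op W k W' l F"
  hence "F (\<lambda>x vs. 0 * (0 :: (complex ^ 3) form) x vs) = (\<lambda>x vs. 0 * F 0 x vs)"
    unfolding good_op_def using hatforms_zero by blast
  thus "F 0 = 0" by (simp add: zero_fun_def)
qed

lemma good_op_compose:
  assumes F: "good_op W k W' l F" and G: "good_op W' l W'' m G"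
  shows "good_op W k W'' m (\<lambda>\<psi>. G (F \<psi>))"
proof -
  have "bounded_op W k (\<lambda>\<psi>. G (F \<psi>))"
    unfolding bounded_op_def
  proof (intro allI impI)
    fix n and R :: real assume "R \<ge> 0"
    have b: "bounded_op W' l G" "bounded_op W k F" using F G by (auto simp: good_op_def)
    from bounded_opD[where n = n, OF b(1) \<open>R \<ge> 0\<close>] obtain n1 R1 C1 where a1'': "R1 \<ge> 0" "C1 \<ge> 0"
      "\<forall>\<psi>\<in>hatforms W' l. \<forall>M\<ge>0. seminorm_le n1 R1 M \<psi> \<longrightarrow> seminorm_le n R (C1 * M) (G \<psi>)"
      by (elim exE conjE)
    note 1 = a1''(1,2) a1''(3)[rule_format]
    from bounded_opD[where n = n1, OF b(2) 1(1)] obtain n2 R2 C2 where a2'': "R2 \<ge> 0" "C2 \<ge> 0"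
      "\<forall>\<psi>\<in>hatforms W k. \<forall>M\<ge>0. seminorm_le n2 R2 M \<psi> \<longrightarrow> seminorm_le n1 R1 (C2 * M) (F \<psi>)"
      by (elim exE conjE)
    note 2 = a2''(1,2) a2''(3)[rule_format]
    have st: "seminorm_le n R (C1 * C2 * M) (G (F \<psi>))" if "\<psi> \<in> hatforms W k" "M \<ge> 0" "seminorm_le n2 R2 M \<psi>" for \<psi> M
      using 1(3)[OF _ _ 2(3)[OF that]] F that 2(2) by (auto simp: good_op_def mult.assoc)
    show "\<exists>n' R' C. R' \<ge> 0 \<and> C \<ge> 0 \<and>
       (\<forall>\<psi>\<in>hatforms W k. \<forall>M\<ge>0. seminorm_le n' R' M \<psi> \<longrightarrow> seminorm_le n R (C * M) (G (F \<psi>)))"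
      by (rule exI[of _ n2], rule exI[of _ R2], rule exI[of _ "C1 * C2"]) (use 1(1,2) 2(1,2) st in simp)
  qed
  thus ?thesis using F G by (simp add: good_op_def)
qed

lemma seminorm_le_add:
  assumes "smooth_family k \<phi>" "smooth_family k \<psi>" "seminorm_le n R M \<phi>" "seminorm_le n R M' \<psi>"
  shows "seminorm_le n R (M + M') (\<phi> + \<psi>)"
  unfolding seminorm_le_def
proof (intro ballI allI impI)
  fix x and us vs :: "'a list" assume "x \<in> cball (0::'a) R" "length us \<le> n"
  hence "cmod (iter_deriv us (\<lambda>y. \<phi> y vs) x) \<le> M * pn us * pn vs" "cmod (iter_deriv us (\<lambda>y. \<psi> y vs) x) \<le> M' * pn us * pn vs"
    using assms unfolding seminorm_le_def by auto
  moreover have "iter_deriv us (\<lambda>y. (\<phi> + \<psi>) y vs) x = iter_deriv us (\<lambda>y. \<phi> y vs) x + iter_deriv us (\<lambda>y. \<psi> y vs) x"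
    using assms by (simp add: smooth_family_def iter_deriv_add)
  ultimately show "cmod (iter_deriv us (\<lambda>y. (\<phi> + \<psi>) y vs) x) \<le> (M + M') * pn us * pn vs"
    using norm_triangle_ineq[of "iter_deriv us (\<lambda>y. \<phi> y vs) x" "iter_deriv us (\<lambda>y. \<psi> y vs) x"]
    by (simp add: distrib_right)
qed

lemma good_op_add:
  assumes F: "good_op W k W' l F" and G: "good_op W k W' l G"
  shows "good_op W k W' l (\<lambda>\<psi>. F \<psi> + G \<psi>)"
proof -
  have "bounded_op W k (\<lambda>\<psi>. F \<psi> + G \<psi>)"
    unfolding bounded_op_def
  proof (intro allI impI)
    fix n and R :: real assume "R \<ge> 0"
    have b: "bounded_op W k G" "bounded_op W k F" using F G by (auto simp: good_op_def)
    from bounded_opD[where n = n, OF b(1) \<open>R \<ge> 0\<close>] obtain n1 R1 C1 where a1'': "R1 \<ge> 0" "C1 \<ge> 0"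
      "\<forall>\<psi>\<in>hatforms W k. \<forall>M\<ge>0. seminorm_le n1 R1 M \<psi> \<longrightarrow> seminorm_le n R (C1 * M) (G \<psi>)"
      by (elim exE conjE)
    note 1 = a1''(1,2) a1''(3)[rule_format]
    from bounded_opD[where n = n, OF b(2) \<open>R \<ge> 0\<close>] obtain n2 R2 C2 where a2'': "R2 \<ge> 0" "C2 \<ge> 0"
      "\<forall>\<psi>\<in>hatforms W k. \<forall>M\<ge>0. seminorm_le n2 R2 M \<psi> \<longrightarrow> seminorm_le n R (C2 * M) (F \<psi>)"
      by (elim exE conjE)
    note 2 = a2''(1,2) a2''(3)[rule_format]
    have st: "seminorm_le n R ((C2 + C1) * M) (F \<psi> + G \<psi>)"
      if "\<psi> \<in> hatforms W k" "M \<ge> 0" "seminorm_le (max n1 n2) (max R1 R2) M \<psi>" for \<psi> M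
    proof -
      have "F \<psi> \<in> hatforms W' l" "G \<psi> \<in> hatforms W' l" using F G that by (auto simp: good_op_def)
      moreover have "seminorm_le n R (C2 * M) (F \<psi>)" by (rule 2(3)[OF that(1,2) seminorm_le_mono[OF that(3)]]) auto
      moreover have "seminorm_le n R (C1 * M) (G \<psi>)" by (rule 1(3)[OF that(1,2) seminorm_le_mono[OF that(3)]]) auto
      ultimately show ?thesis unfolding distrib_right by (intro seminorm_le_add hatforms_smooth_family)
    qed
    show "\<exists>n' R' C. R' \<ge> 0 \<and> C \<ge> 0 \<and>
       (\<forall>\<psi>\<in>hatforms W k. \<forall>M\<ge>0. seminorm_le n' R' M \<psi> \<longrightarrow> seminorm_le n R (C * M) (F \<psi> + G \<psi>))"
      by (rule exI[of _ "max n1 n2"], rule exI[of _ "max R1 R2"], rule exI[of _ "C2 + C1"]) (use 1(1,2) 2(1,2) st in simp)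
  qed
  moreover have "F (\<psi> + \<phi>) + G (\<psi> + \<phi>) = F \<psi> + G \<psi> + (F \<phi> + G \<phi>)" if "\<psi> \<in> hatforms W k" "\<phi> \<in> hatforms W k" for \<psi> \<phi>
    using F G that by (simp add: good_op_def add_ac)
  moreover have "F (\<lambda>x vs. c * \<psi> x vs) + G (\<lambda>x vs. c * \<psi> x vs) = (\<lambda>x vs. c * (F \<psi> + G \<psi>) x vs)" if "\<psi> \<in> hatforms W k" for \<psi> c
    using F G that by (simp add: good_op_def fun_eq_iff distrib_left)
  ultimately show ?thesis using F G unfolding good_op_def by (simp add: hatforms_add real_form_def)
qed

lemma good_op_zero: "good_op W k W' l (\<lambda>\<psi>. 0)"
proof -
  have "bounded_op W k (\<lambda>\<psi>. 0)"
    unfolding bounded_op_def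
    by (intro allI impI, rule exI[of _ 0], rule exI[of _ 0], rule exI[of _ 0]) (simp add: seminorm_le_def zero_fun_def)
  thus ?thesis by (simp add: good_op_def hatforms_zero real_form_def) (simp add: zero_fun_def)
qed

lemma good_op_sum: "(\<And>i. i < (m::nat) \<Longrightarrow> good_op W k W' l (F i)) \<Longrightarrow> good_op W k W' l (\<lambda>\<psi>. \<Sum>i<m. F i \<psi>)"
  by (induction m) (auto simp: good_op_zero good_op_add)

lemma good_op_weaken:
  assumes F: "good_op W k W' l F" and "W \<subseteq> W1" "W1' \<subseteq> W'"
  shows "good_op W1 k W1' l F"
proof -
  have d: "hatforms W1 k \<subseteq> hatforms W k" "hatforms W' l \<subseteq> hatforms W1' l" using hatforms_mono assms(2,3) by auto
  have "bounded_op W1 k F"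
    unfolding bounded_op_def
  proof (intro allI impI)
    fix n and R :: real assume "R \<ge> 0"
    have b: "bounded_op W k F" using F by (simp add: good_op_def)
    from bounded_opD[where n = n, OF b \<open>R \<ge> 0\<close>] obtain n' R' C where a1'': "R' \<ge> 0" "C \<ge> 0"
      "\<forall>\<psi>\<in>hatforms W k. \<forall>M\<ge>0. seminorm_le n' R' M \<psi> \<longrightarrow> seminorm_le n R (C * M) (F \<psi>)"
      by (elim exE conjE)
    note 1 = a1''(1,2) a1''(3)[rule_format]
    show "\<exists>n' R' C. R' \<ge> 0 \<and> C \<ge> 0 \<and>
       (\<forall>\<psi>\<in>hatforms W1 k. \<forall>M\<ge>0. seminorm_le n' R' M \<psi> \<longrightarrow> seminorm_le n R (C * M) (F \<psi>))"
      by (rule exI[of _ n'], rule exI[of _ R'], rule exI[of _ C]) (use 1 d(1) in auto)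
  qed
  thus ?thesis using F d by (simp add: good_op_def subset_iff)
qed

lemma good_op_id: "good_op W k W k (\<lambda>\<psi>. \<psi>)"
proof -
  have "bounded_op W k (\<lambda>\<psi>. \<psi>)"
    unfolding bounded_op_def
    by (intro allI impI, rule_tac x = n in exI, rule_tac x = R in exI, rule exI[of _ 1]) simp
  thus ?thesis by (simp add: good_op_def)
qed

lemma good_op_funpow: "good_op W k W k F \<Longrightarrow> good_op W k W k (F ^^ m)"
proof (induction m)
  case 0 thus ?case using good_op_id by (simp add: id_def)
next
  case (Suc m) thus ?case using good_op_compose[of W k W k "F ^^ m" W k F] by (simp add: o_def)
qed

lemma good_op_form_int:
  assumes V: "admissible W V" and w: "continuous_on {0..1} w" "\<And>s. s \<in> {0..1} \<Longrightarrow> \<bar>w s\<bar> \<le> 1"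
  shows "good_op W k W k (form_int w V)"
proof -
  have "bounded_op W k (form_int w V)"
    unfolding bounded_op_def
  proof (intro allI impI)
    fix n and R :: real assume "R \<ge> 0"
    \<comment> \<open>The radius grows by 1 because the segments starting in the ball of radius R
      have length at most 1.\<close>
    have st: "seminorm_le n R (1 * M) (form_int w V \<psi>)" if \<psi>: "\<psi> \<in> hatforms W k" and M: "M \<ge> 0" "seminorm_le n (R + 1) M \<psi>" for \<psi> M
      unfolding seminorm_le_def
    proof (intro ballI allI impI)
      fix x :: "complex ^ 3" and us vs :: "(complex ^ 3) list" assume x: "x \<in> cball 0 R" and us: "length us \<le> n"
      have nV: "norm V \<le> 1" using V by (simp add: admissible_def)
      have "cmod (tint w V (iter_deriv us (\<lambda>y. \<psi> y vs)) x) \<le> M * pn us * pn vs"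
      proof (rule tint_bound[OF smooth_iter_deriv[OF hatforms_smooth[OF \<psi>]] w])
        fix s :: real assume s: "s \<in> {0..1}"
        have "norm (x + s *\<^sub>R V) \<le> norm x + \<bar>s\<bar> * norm V" using norm_triangle_ineq[of x "s *\<^sub>R V"] by simp
        also have "\<dots> \<le> R + 1 * 1" using x s nV by (intro add_mono mult_mono) auto
        finally show "cmod (iter_deriv us (\<lambda>y. \<psi> y vs) (x + s *\<^sub>R V)) \<le> M * pn us * pn vs"
          using M(2) us unfolding seminorm_le_def by simp
      qed
      thus "cmod (iter_deriv us (\<lambda>y. form_int w V \<psi> y vs) x) \<le> 1 * M * pn us * pn vs"
        unfolding form_int_def by (simp add: iter_deriv_tint[OF hatforms_smooth[OF \<psi>] w(1)])
    qed
    show "\<exists>n' R' C. R' \<ge> 0 \<and> C \<ge> 0 \<and>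
       (\<forall>\<psi>\<in>hatforms W k. \<forall>M\<ge>0. seminorm_le n' R' M \<psi> \<longrightarrow> seminorm_le n R (C * M) (form_int w V \<psi>))"
      by (rule exI[of _ n], rule exI[of _ "R + 1"], rule exI[of _ 1]) (use \<open>R \<ge> 0\<close> st in simp)
  qed
  moreover have "form_int w V (\<psi> + \<phi>) = form_int w V \<psi> + form_int w V \<phi>" if "\<psi> \<in> hatforms W k" "\<phi> \<in> hatforms W k" for \<psi> \<phi>
    using that by (simp add: form_int_def fun_eq_iff tint_add hatforms_smooth w(1))
  ultimately show ?thesis
    unfolding good_op_def using form_int_hatforms[OF V _ w(1)]
    by (simp add: real_form_def form_int_def tint_cmult tint_real)
qed

lemma good_op_contr:
  assumes "norm V \<le> 1" shows "good_op W k W (k - 1) (contr V)"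
proof -
  have "bounded_op W k (contr V)"
    unfolding bounded_op_def
  proof (intro allI impI)
    fix n and R :: real assume "R \<ge> 0"
    have st: "seminorm_le n R (1 * M) (contr V \<psi>)" if M: "M \<ge> 0" "seminorm_le n R M \<psi>" for \<psi> M
      unfolding seminorm_le_def contr_def
    proof (intro ballI allI impI)
      fix x :: "complex ^ 3" and us vs :: "(complex ^ 3) list" assume "x \<in> cball 0 R" "length us \<le> n"
      hence "cmod (iter_deriv us (\<lambda>y. \<psi> y (V # vs)) x) \<le> M * pn us * pn (V # vs)"
        using M(2) unfolding seminorm_le_def by blast
      hence "cmod (iter_deriv us (\<lambda>y. \<psi> y (V # vs)) x) \<le> M * pn us * (norm V * pn vs)" by simp
      also have "\<dots> \<le> M * pn us * (1 * pn vs)" using M assms by (intro mult_left_mono mult_right_mono) auto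
      finally show "cmod (iter_deriv us (\<lambda>y. \<psi> y (V # vs)) x) \<le> 1 * M * pn us * pn vs" by simp
    qed
    show "\<exists>n' R' C. R' \<ge> 0 \<and> C \<ge> 0 \<and>
       (\<forall>\<psi>\<in>hatforms W k. \<forall>M\<ge>0. seminorm_le n' R' M \<psi> \<longrightarrow> seminorm_le n R (C * M) (contr V \<psi>))"
      by (rule exI[of _ n], rule exI[of _ R], rule exI[of _ 1]) (use \<open>R \<ge> 0\<close> st in simp)
  qed
  thus ?thesis unfolding good_op_def using contr_hatforms
    by (simp add: real_form_def contr_def fun_eq_iff)
qed

lemma pn_update: "norm a \<le> norm (vs ! i) \<Longrightarrow> i < length vs \<Longrightarrow> pn (vs[i := a]) \<le> pn vs"
proof (induction vs arbitrary: i)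
  case (Cons v vs) thus ?case by (cases i) (auto intro: mult_left_mono mult_right_mono)
qed simp

lemma good_op_lie:
  assumes "\<And>u. norm (brk V u) \<le> norm u" shows "good_op W k W k (lie_op V)"
proof -
  have "bounded_op W k (lie_op V)"
    unfolding bounded_op_def
  proof (intro allI impI)
    fix n and R :: real assume "R \<ge> 0"
    have st: "seminorm_le n R (real k * M) (lie_op V \<psi>)" if \<psi>: "\<psi> \<in> hatforms W k" and M: "M \<ge> 0" "seminorm_le n R M \<psi>" for \<psi> M
      unfolding seminorm_le_def
    proof (intro ballI allI impI)
      fix x :: "complex ^ 3" and us vs :: "(complex ^ 3) list" assume x: "x \<in> cball 0 R" "length us \<le> n"
      show "cmod (iter_deriv us (\<lambda>y. lie_op V \<psi> y vs) x) \<le> real k * M * pn us * pn vs"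
      proof (cases "length vs = k")
        case True
        have "cmod (iter_deriv us (\<lambda>y. lie_op V \<psi> y vs) x) = cmod (\<Sum>i<length vs. iter_deriv us (\<lambda>y. \<psi> y (vs[i := brk V (vs ! i)])) x)"
          unfolding lie_op_def slot_sum_def by (simp add: iter_deriv_sum hatforms_smooth[OF \<psi>])
        also have "\<dots> \<le> (\<Sum>i<length vs. M * pn us * pn vs)"
        proof (rule order_trans[OF norm_sum sum_mono])
          fix i assume i: "i \<in> {..<length vs}"
          have "cmod (iter_deriv us (\<lambda>y. \<psi> y (vs[i := brk V (vs ! i)])) x) \<le> M * pn us * pn (vs[i := brk V (vs ! i)])"
            using M x unfolding seminorm_le_def by blast
          also have "\<dots> \<le> M * pn us * pn vs" using M assms i by (intro mult_left_mono pn_update) auto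
          finally show "cmod (iter_deriv us (\<lambda>y. \<psi> y (vs[i := brk V (vs ! i)])) x) \<le> M * pn us * pn vs" .
        qed
        finally show ?thesis using True by (simp add: mult.assoc)
      next
        case False
        have "(\<lambda>y. lie_op V \<psi> y vs) = (\<lambda>y. 0)"
          by (intro ext alternating_length[OF hatforms_alternating[OF lie_op_hatforms[OF \<psi>]] False])
        thus ?thesis using M by simp
      qed
    qed
    show "\<exists>n' R' C. R' \<ge> 0 \<and> C \<ge> 0 \<and>
       (\<forall>\<psi>\<in>hatforms W k. \<forall>M\<ge>0. seminorm_le n' R' M \<psi> \<longrightarrow> seminorm_le n R (C * M) (lie_op V \<psi>))"
      by (rule exI[of _ n], rule exI[of _ R], rule exI[of _ "real k"]) (use \<open>R \<ge> 0\<close> st in simp)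
  qed
  thus ?thesis unfolding good_op_def using lie_op_hatforms
    by (simp add: real_form_def lie_op_def slot_sum_def sum_in_Reals fun_eq_iff sum.distrib sum_distrib_left)
qed

section \<open>Chain homotopies\<close>

text \<open>Zero is listed separately for degree 0, where nothing precedes. Keeping the primitive
  real makes the homotopy usable for real cohomology.\<close>

definition exact_part :: "(complex ^ 3) set \<Rightarrow> nat \<Rightarrow> (complex ^ 3) form \<Rightarrow> (complex ^ 3) form \<Rightarrow> bool" where
  "exact_part W k \<psi> e \<longleftrightarrow> e = 0 \<or> (\<exists>j \<eta>. k = Suc j \<and> \<eta> \<in> hatforms W j \<and> e = dh \<eta> \<and> (real_form \<psi> \<longrightarrow> real_form \<eta>))"

text \<open>A chain map homotopic to the identity. The half of the homotopy that acts on
  \<open>dh \<psi>\<close> is kept as an operator, since currents are composed with it; of the other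
  half only the exactness of its value is recorded.\<close>

definition chain_step :: "(complex ^ 3) set \<Rightarrow> (complex ^ 3) set \<Rightarrow> ((complex ^ 3) form \<Rightarrow> (complex ^ 3) form) \<Rightarrow> bool" where
  "chain_step W W' F \<longleftrightarrow> W \<subseteq> W' \<and> (\<forall>k. good_op W k W' k F \<and> (\<forall>\<psi>\<in>hatforms W k. F (dh \<psi>) = dh (F \<psi>)) \<and>
     (\<exists>H. good_op W (Suc k) W k H \<and>
        (\<forall>\<psi>\<in>hatforms W k. \<exists>e. exact_part W k \<psi> e \<and> \<psi> - F \<psi> = e + H (dh \<psi>))))"

lemma dh_eq_hat: "smooth_family k \<psi> \<Longrightarrow> dh \<psi> = hat (ext_d (unhat \<psi>))"
  by (simp add: hat_ext_d_unhat)

lemma dh_add: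
  assumes "smooth_family k \<phi>" "smooth_family k \<psi>" shows "dh (\<phi> + \<psi>) = dh \<phi> + dh \<psi>"
proof -
  have s: "smooth_family k (\<phi> + \<psi>)" using smooth_family_add[OF assms] by (simp add: plus_fun_def)
  have u: "unhat (\<phi> + \<psi>) = unhat \<phi> + unhat \<psi>" by (simp add: unhat_def fun_eq_iff)
  show ?thesis unfolding dh_eq_hat[OF s] dh_eq_hat[OF assms(1)] dh_eq_hat[OF assms(2)] u
      ext_d_add[OF smooth_family_unhat[OF assms(1)] smooth_family_unhat[OF assms(2)]]
    by (simp add: hat_def fun_eq_iff)
qed

lemma dh_zero [simp]: "dh 0 = 0"
  by (simp add: dh_def antisymmetrize_def slot_sum_def fun_eq_iff frechet_derivative_const zero_fun_def)

lemma dh_diff: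
  assumes "smooth_family k \<phi>" "smooth_family k \<psi>" shows "dh (\<phi> - \<psi>) = dh \<phi> - dh \<psi>"
proof -
  have "\<phi> - \<psi> = (\<lambda>x vs. \<phi> x vs - \<psi> x vs)" by (simp add: fun_eq_iff)
  hence "smooth_family k (\<phi> - \<psi>)" using smooth_family_diff[OF assms] by simp
  from dh_add[OF this assms(2)] have "dh \<phi> = dh (\<phi> - \<psi>) + dh \<psi>" by (simp only: diff_add_cancel)
  thus ?thesis by (simp only: add_diff_cancel_right')
qed

lemma dh_sum: "(\<And>i. i < (m::nat) \<Longrightarrow> \<psi> i \<in> hatforms W k) \<Longrightarrow> dh (\<Sum>i<m. \<psi> i) = (\<Sum>i<m. dh (\<psi> i))"
proof (induction m)
  case (Suc m)
  have "(\<Sum>i<m. \<psi> i) \<in> hatforms W k" "\<psi> m \<in> hatforms W k" using Suc.prems by (auto intro: hatforms_sum)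
  from dh_add[OF this[THEN hatforms_smooth_family]] Suc
  show ?case by (simp only: sum.lessThan_Suc)
qed simp

lemma exact_part_add:
  assumes "exact_part W k \<psi> e" "exact_part W k \<psi> e'" shows "exact_part W k \<psi> (e + e')"
proof (cases "e = 0 \<or> e' = 0")
  case True thus ?thesis using assms by auto
next
  case False
  obtain j \<eta> where 1: "k = Suc j" "\<eta> \<in> hatforms W j" "e = dh \<eta>" "real_form \<psi> \<longrightarrow> real_form \<eta>"
    using assms(1) False unfolding exact_part_def by blast
  obtain \<eta>' where 2: "\<eta>' \<in> hatforms W j" "e' = dh \<eta>'" "real_form \<psi> \<longrightarrow> real_form \<eta>'"
    using assms(2) False 1(1) unfolding exact_part_def by blast
  have "e + e' = dh (\<eta> + \<eta>')"
    unfolding 1(3) 2(2) by (rule dh_add[OF 1(2)[THEN hatforms_smooth_family] 2(1)[THEN hatforms_smooth_family], symmetric])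
  moreover have "\<eta> + \<eta>' \<in> hatforms W j" by (rule hatforms_add[OF 1(2) 2(1)])
  moreover have "real_form \<psi> \<longrightarrow> real_form (\<eta> + \<eta>')" using 1(4) 2(3) by (simp add: real_form_def)
  ultimately show ?thesis unfolding exact_part_def using 1(1) by blast
qed

text \<open>Homotopies add up: the second one acts after F, and since F commutes with
  \<open>dh\<close> it too is applied to a form built from \<open>dh \<psi>\<close>.\<close>

lemma chain_step_compose:
  assumes F: "chain_step W W' F" and G: "chain_step W' W'' G"
  shows "chain_step W W'' (\<lambda>\<psi>. G (F \<psi>))"
  unfolding chain_step_def
proof (intro conjI allI)
  show "W \<subseteq> W''" using F G unfolding chain_step_def by blast
  fix k
  have f: "good_op W k W' k F" "\<And>\<psi>. \<psi>\<in>hatforms W k \<Longrightarrow> F (dh \<psi>) = dh (F \<psi>)" "good_op W (Suc k) W' (Suc k) F"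
    using F unfolding chain_step_def by auto
  have g: "good_op W' k W'' k G" "\<And>\<psi>. \<psi>\<in>hatforms W' k \<Longrightarrow> G (dh \<psi>) = dh (G \<psi>)"
    using G unfolding chain_step_def by auto
  have FW: "F \<psi> \<in> hatforms W' k" if "\<psi> \<in> hatforms W k" for \<psi> using f(1) that by (simp add: good_op_def)
  show "good_op W k W'' k (\<lambda>\<psi>. G (F \<psi>))" by (rule good_op_compose[OF f(1) g(1)])
  show "\<forall>\<psi>\<in>hatforms W k. G (F (dh \<psi>)) = dh (G (F \<psi>))" using f(2) g(2) FW by simp
  obtain H where H: "good_op W (Suc k) W k H" "\<And>\<psi>. \<psi>\<in>hatforms W k \<Longrightarrow> \<exists>e. exact_part W k \<psi> e \<and> \<psi> - F \<psi> = e + H (dh \<psi>)"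
    using F unfolding chain_step_def by blast
  obtain H' where H': "good_op W' (Suc k) W' k H'" "\<And>\<psi>. \<psi>\<in>hatforms W' k \<Longrightarrow> \<exists>e. exact_part W' k \<psi> e \<and> \<psi> - G \<psi> = e + H' (dh \<psi>)"
    using G unfolding chain_step_def by blast
  have sub: "W \<subseteq> W'" using F unfolding chain_step_def by blast
  have H'2: "good_op W' (Suc k) W k H'" by (rule good_op_weaken[OF H'(1) subset_refl sub])
  show "\<exists>H. good_op W (Suc k) W k H \<and>
        (\<forall>\<psi>\<in>hatforms W k. \<exists>e. exact_part W k \<psi> e \<and> \<psi> - G (F \<psi>) = e + H (dh \<psi>))"
  proof (intro exI[of _ "\<lambda>\<psi>. H \<psi> + H' (F \<psi>)"] conjI ballI)
    show "good_op W (Suc k) W k (\<lambda>\<psi>. H \<psi> + H' (F \<psi>))"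
      by (rule good_op_add[OF H(1) good_op_compose[OF f(3) H'2]])
  next
    fix \<psi> assume \<psi>: "\<psi> \<in> hatforms W k"
    obtain e where e: "exact_part W k \<psi> e" "\<psi> - F \<psi> = e + H (dh \<psi>)" using H(2)[OF \<psi>] by blast
    obtain e' where e': "exact_part W' k (F \<psi>) e'" "F \<psi> - G (F \<psi>) = e' + H' (dh (F \<psi>))" using H'(2)[OF FW[OF \<psi>]] by blast
    have "real_form \<psi> \<Longrightarrow> real_form (F \<psi>)" using f(1) \<psi> by (simp add: good_op_def)
    hence "exact_part W k \<psi> e'" using e'(1) hatforms_mono[OF sub] unfolding exact_part_def by blast
    hence "exact_part W k \<psi> (e + e')" by (rule exact_part_add[OF e(1)])
    moreover have "\<psi> - G (F \<psi>) = (\<psi> - F \<psi>) + (F \<psi> - G (F \<psi>))" by simp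
    hence "\<psi> - G (F \<psi>) = (e + e') + (H (dh \<psi>) + H' (F (dh \<psi>)))"
      unfolding e(2) e'(2) f(2)[OF \<psi>] by (simp add: add_ac)
    ultimately show "\<exists>e. exact_part W k \<psi> e \<and> \<psi> - G (F \<psi>) = e + (H (dh \<psi>) + H' (F (dh \<psi>)))" by blast
  qed
qed

text \<open>P, the sum of average and error term, is homotopic to the identity by
  \<open>homotopy_formula\<close>, hence so are its powers. As the average is idempotent and
  annihilates the nilpotent part from both sides, the power k + 1 of P equals \<open>avg V\<close>
  on k-forms.\<close>

lemma chain_step_avg:
  assumes V: "admissible W V" shows "chain_step W (insert V W) (avg V)"
  unfolding chain_step_def
proof (intro conjI allI)
  fix k
  have W: "ideal W" using V unfolding admissible_def by blast
  have nV: "norm V \<le> 1" using V unfolding admissible_def by blast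
  have nb: "\<And>u. norm (brk V u) \<le> norm u" using V unfolding admissible_def by blast
  have g_avg: "good_op W l W l (avg V)" for l
    unfolding avg_def by (rule good_op_form_int[OF V]) auto
  have g_saw: "good_op W l W l (form_int saw V)" for l
    by (rule good_op_form_int[OF V continuous_on_saw]) (auto simp: abs_le_iff)
  have g_nil: "good_op W l W l (nilop V)" for l
    using good_op_compose[OF good_op_lie[OF nb] g_saw] by (simp add: nilop_def[abs_def])
  have g_hom: "good_op W l W (l - 1) (homot V)" for l
    using good_op_compose[OF good_op_contr[OF nV] g_saw] by (simp add: homot_def[abs_def])
  define P where "P = (\<lambda>\<psi>. avg V \<psi> + nilop V \<psi>)"
  have g_P: "good_op W l W l P" for l unfolding P_def by (rule good_op_add[OF g_avg g_nil])
  have P_in: "(P ^^ m) \<psi> \<in> hatforms W l" if "\<psi> \<in> hatforms W l" for m l \<psi>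
    using good_op_funpow[OF g_P[of l], of m] that by (simp add: good_op_def)
  have hom: "\<psi> - P \<psi> = dh (homot V \<psi>) + homot V (dh \<psi>)" if "\<psi> \<in> hatforms W l" for l \<psi>
    unfolding P_def by (rule homotopy_formula[OF V that])
  have hom_in: "homot V \<psi> \<in> hatforms W (l - 1)" if "\<psi> \<in> hatforms W l" for l \<psi>
    using g_hom[of l] that by (simp add: good_op_def)
  have sf: "smooth_family l \<psi>" if "\<psi> \<in> hatforms W l" for l \<psi> by (rule hatforms_smooth_family[OF that])
  have P_dh: "P (dh \<psi>) = dh (P \<psi>)" if \<psi>: "\<psi> \<in> hatforms W l" for l \<psi>
  proof -
    have d: "dh \<psi> \<in> hatforms W (Suc l)" by (rule dh_hatforms[OF W \<psi>])
    have h1: "homot V \<psi> \<in> hatforms W (l - 1)" "homot V (dh \<psi>) \<in> hatforms W l" using hom_in[OF \<psi>] hom_in[OF d] by auto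
    have "dh \<psi> - P (dh \<psi>) = dh (homot V (dh \<psi>))"
      using hom[OF d] dh_dh[OF sf[OF \<psi>]] good_op_zero_arg[OF g_hom] by simp
    also have "\<dots> = dh (dh (homot V \<psi>) + homot V (dh \<psi>))"
    \<comment> \<open>In degree 0 the additional term vanishes by itself; in positive degree it is
      exact and killed by the differential.\<close>
    proof (cases l)
      case 0
      hence "contr V \<psi> = 0" unfolding contr_def using alternating_length[OF hatforms_alternating[OF \<psi>]] by (auto simp: fun_eq_iff)
      hence "homot V \<psi> = 0" by (simp add: homot_def form_int_def fun_eq_iff)
      thus ?thesis by (metis dh_zero add_0_left)
    next
      case (Suc j)
      hence "dh (homot V \<psi>) \<in> hatforms W l" using dh_hatforms[OF W h1(1)] by simp
      thus ?thesis using dh_add[OF sf sf, OF _ h1(2)] dh_dh[OF sf[OF h1(1)]] by simp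
    qed
    also have "\<dots> = dh (\<psi> - P \<psi>)" by (simp add: hom[OF \<psi>])
    also have "\<dots> = dh \<psi> - dh (P \<psi>)"
      using g_P[of l] \<psi> by (intro dh_diff[of l] sf) (auto simp: good_op_def)
    finally show ?thesis by simp
  qed
  have Pm_dh: "(P ^^ m) (dh \<psi>) = dh ((P ^^ m) \<psi>)" if "\<psi> \<in> hatforms W l" for l m \<psi>
    by (induction m) (simp_all add: P_dh[OF P_in[OF that]])
  \<comment> \<open>Adds up the homotopies between consecutive powers of P.\<close>
  have telescope: "\<psi> - (P ^^ m) \<psi> = dh (\<Sum>i<m. homot V ((P ^^ i) \<psi>)) + (\<Sum>i<m. homot V ((P ^^ i) (dh \<psi>)))"
    if \<psi>: "\<psi> \<in> hatforms W l" for l m \<psi>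
  proof (induction m)
    case (Suc m)
    have "\<psi> - (P ^^ Suc m) \<psi> = (\<psi> - (P ^^ m) \<psi>) + ((P ^^ m) \<psi> - P ((P ^^ m) \<psi>))" by simp
    also have "\<dots> = (dh (\<Sum>i<m. homot V ((P ^^ i) \<psi>)) + dh (homot V ((P ^^ m) \<psi>))) + (\<Sum>i<Suc m. homot V ((P ^^ i) (dh \<psi>)))"
      unfolding Suc.IH hom[OF P_in[OF \<psi>]] Pm_dh[OF \<psi>] by (simp add: add_ac)
    also have "dh (\<Sum>i<m. homot V ((P ^^ i) \<psi>)) + dh (homot V ((P ^^ m) \<psi>)) = dh (\<Sum>i<Suc m. homot V ((P ^^ i) \<psi>))"
      using dh_sum[of "Suc m" "\<lambda>i. homot V ((P ^^ i) \<psi>)" W "l - 1"] dh_sum[of m "\<lambda>i. homot V ((P ^^ i) \<psi>)" W "l - 1"]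
        hom_in[OF P_in[OF \<psi>]] by simp
    finally show ?case .
  qed (simp only: funpow.simps id_apply lessThan_0 sum.empty dh_zero diff_self add_0_left)
  have P_pow: "(P ^^ Suc m) \<psi> = avg V \<psi> + (nilop V ^^ Suc m) \<psi>" if \<psi>: "\<psi> \<in> hatforms W l" for l m \<psi>
  proof (induction m)
    case (Suc m)
    let ?N = "(nilop V ^^ Suc m) \<psi>"
    have a: "avg V \<psi> \<in> hatforms W l" using g_avg[of l] \<psi> by (simp add: good_op_def)
    have n: "?N \<in> hatforms W l" by (rule nilop_funpow_hatforms[OF V \<psi>])
    have "avg V ?N = 0" using avg_nilop[OF V nilop_funpow_hatforms[OF V \<psi>, of m]] by simp
    hence "avg V (avg V \<psi> + ?N) = avg V \<psi>" using g_avg[of l] a n avg_avg[OF V \<psi>] by (simp add: good_op_def)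
    moreover have "nilop V (avg V \<psi> + ?N) = nilop V ?N" using g_nil[of l] a n nilop_avg[OF V \<psi>] by (simp add: good_op_def)
    ultimately have "P (avg V \<psi> + ?N) = avg V \<psi> + nilop V ?N" by (simp add: P_def)
    moreover have "(P ^^ Suc (Suc m)) \<psi> = P ((P ^^ Suc m) \<psi>)" by simp
    ultimately show ?case unfolding Suc.IH by simp
  qed (simp add: P_def)
  have P_avg: "(P ^^ Suc l) \<psi> = avg V \<psi>" if \<psi>: "\<psi> \<in> hatforms W l" for l \<psi>
    unfolding P_pow[OF \<psi>] nilop_nilpotent[OF V \<psi>] by simp
  have "avg V \<psi> \<in> hatforms (insert V W) k" if "\<psi> \<in> hatforms W k" for \<psi> by (rule avg_hatforms[OF V that])
  thus "good_op W k (insert V W) k (avg V)" using g_avg[of k] by (simp add: good_op_def)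
  show "\<forall>\<psi>\<in>hatforms W k. avg V (dh \<psi>) = dh (avg V \<psi>)"
    unfolding avg_def using dh_form_int[OF V, of _ k "\<lambda>s. 1"] by simp
  show "\<exists>H. good_op W (Suc k) W k H \<and> (\<forall>\<psi>\<in>hatforms W k. \<exists>e. exact_part W k \<psi> e \<and> \<psi> - avg V \<psi> = e + H (dh \<psi>))"
  proof (intro exI[of _ "\<lambda>\<psi>. \<Sum>i<Suc k. homot V ((P ^^ i) \<psi>)"] conjI ballI)
    show "good_op W (Suc k) W k (\<lambda>\<psi>. \<Sum>i<Suc k. homot V ((P ^^ i) \<psi>))"
      using good_op_compose[OF good_op_funpow[OF g_P] g_hom, of "Suc k"] by (intro good_op_sum) simp
  next
    fix \<psi> assume \<psi>: "\<psi> \<in> hatforms W k"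
    let ?\<eta> = "\<Sum>i<Suc k. homot V ((P ^^ i) \<psi>)"
    have g\<eta>: "good_op W k W (k - 1) (\<lambda>\<psi>. \<Sum>i<Suc k. homot V ((P ^^ i) \<psi>))"
      using good_op_compose[OF good_op_funpow[OF g_P] g_hom, of k] by (intro good_op_sum) simp
    have "exact_part W k \<psi> (dh ?\<eta>)"
    proof (cases k)
      case 0
      have "contr V \<psi>' = 0" if "\<psi>' \<in> hatforms W k" for \<psi>'
        unfolding contr_def using alternating_length[OF hatforms_alternating[OF that]] 0 by (auto simp: fun_eq_iff)
      hence "homot V \<psi>' = 0" if "\<psi>' \<in> hatforms W k" for \<psi>' using that by (simp add: homot_def form_int_def fun_eq_iff)
      hence "?\<eta> = 0" using P_in[OF \<psi>] by simp
      thus ?thesis by (simp add: exact_part_def)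
    next
      case (Suc j)
      have "?\<eta> \<in> hatforms W (k - 1)" "real_form \<psi> \<Longrightarrow> real_form ?\<eta>"
        using g\<eta> \<psi> unfolding good_op_def by auto
      thus ?thesis unfolding exact_part_def using Suc by auto
    qed
    moreover have "\<psi> - avg V \<psi> = dh ?\<eta> + (\<Sum>i<Suc k. homot V ((P ^^ i) (dh \<psi>)))"
      using telescope[OF \<psi>, of "Suc k"] unfolding P_avg[OF \<psi>] .
    ultimately show "\<exists>e. exact_part W k \<psi> e \<and> \<psi> - avg V \<psi> = e + (\<Sum>i<Suc k. homot V ((P ^^ i) (dh \<psi>)))" by blast
  qed
qed auto

section \<open>Left-invariant forms compute the cohomology\<close>

lemma norm_axis: "norm (axis i a :: complex ^ 3) = cmod a"
  using exhaust_3[of i] by (auto simp: norm_vec_def L2_set_def sum_3 axis_def)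

lemma admissible_central:
  assumes "\<And>w. w \<in> W \<Longrightarrow> central w" "a \<in> gauss_ints" "cmod a \<le> 1"
  shows "admissible W (axis 3 a)"
proof -
  have z: "bet u (axis 3 a) = 0" "bet (axis 3 a) u = 0" for u by (simp_all add: vec_eq_iff forall_3 axis_def)
  have "bet u w = 0" "bet w u = 0" if "w \<in> W" for u w using assms(1)[OF that] by (simp_all add: vec_eq_iff forall_3)
  hence "ideal W" by (simp add: ideal_def span_zero)
  moreover have "axis 3 a \<in> lattice" using assms(2) by (simp add: lattice_def axis_def gauss_ints_def)
  ultimately show ?thesis using assms(3) by (simp add: admissible_def z span_zero brk_def norm_axis)
qed

text \<open>All values of \<open>bet\<close> lie in the centre, which is the real span of the two
  vectors assumed in W. So after averaging over the centre every remaining direction is central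
  modulo W.\<close>

lemma admissible_noncentral:
  assumes W: "axis 3 1 \<in> W" "axis 3 \<i> \<in> W" and i: "i = 1 \<or> i = 2" and a: "a \<in> gauss_ints" "cmod a \<le> 1"
  shows "admissible W (axis i a)"
proof -
  have s: "bet u v \<in> span W" for u v
  proof -
    have "bet u v = Re (u $ 1 * v $ 2) *\<^sub>R axis 3 1 + Im (u $ 1 * v $ 2) *\<^sub>R axis 3 \<i>"
      by (simp add: vec_eq_iff forall_3 axis_def complex_eq_iff)
    thus ?thesis using W by (metis span_add span_base span_scale)
  qed
  have "norm (brk (axis i a) u) \<le> norm u" for u
  proof -
    have "norm (brk (axis i a) u) = cmod (axis i a $ 1 * u $ 2 - u $ 1 * axis i a $ 2)"
      by (simp add: norm_vec_def L2_set_def sum_3 brk_def)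
    also have "\<dots> \<le> norm u"
      using i mult_mono[OF a(2) Finite_Cartesian_Product.norm_nth_le[of u 2]] mult_mono[OF a(2) Finite_Cartesian_Product.norm_nth_le[of u 1]]
      by (auto simp: axis_def norm_mult mult.commute)
    finally show ?thesis .
  qed
  moreover have "axis i a \<in> lattice" using a(1) by (simp add: lattice_def axis_def gauss_ints_def)
  ultimately show ?thesis using a(2) s by (simp add: admissible_def ideal_def norm_axis)
qed

definition average :: "(complex ^ 3) form \<Rightarrow> (complex ^ 3) form" where
  "average \<psi> = avg (axis 2 \<i>) (avg (axis 2 1) (avg (axis 1 \<i>) (avg (axis 1 1) (avg (axis 3 \<i>) (avg (axis 3 1) \<psi>)))))"

definition frame :: "(complex ^ 3) set" where
  "frame = {axis 2 \<i>, axis 2 1, axis 1 \<i>, axis 1 1, axis 3 \<i>, axis 3 1}"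

lemma chain_step_average: "chain_step {} frame average"
proof -
  have g: "1 \<in> gauss_ints" "\<i> \<in> gauss_ints" by (simp_all add: gauss_ints_def)
  have c: "chain_step {} {axis 3 1} (avg (axis 3 1))"
    by (rule chain_step_avg[OF admissible_central]) (simp_all add: g)
  have c: "chain_step {} {axis 3 \<i>, axis 3 1} (\<lambda>\<psi>. avg (axis 3 \<i>) (avg (axis 3 1) \<psi>))"
    by (rule chain_step_compose[OF c chain_step_avg[OF admissible_central]]) (simp_all add: g axis_def)
  note n = chain_step_compose[OF _ chain_step_avg[OF admissible_noncentral]]
  note c = n[OF c, of 1 1, simplified g, simplified] 
  note c = n[OF c, of 1 \<i>, simplified g, simplified]
  note c = n[OF c, of 2 1, simplified g, simplified]
  note c = n[OF c, of 2 \<i>, simplified g, simplified]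
  show ?thesis unfolding average_def[abs_def] frame_def by (rule c)
qed

lemma span_frame: "span frame = UNIV"
proof -
  have "v \<in> span frame" for v
  proof -
    have "v = Re (v $ 2) *\<^sub>R axis 2 1 + Im (v $ 2) *\<^sub>R axis 2 \<i> + Re (v $ 1) *\<^sub>R axis 1 1 + Im (v $ 1) *\<^sub>R axis 1 \<i>
       + Re (v $ 3) *\<^sub>R axis 3 1 + Im (v $ 3) *\<^sub>R axis 3 \<i>"
      by (simp add: vec_eq_iff forall_3 axis_def complex_eq_iff)
    moreover have "\<dots> \<in> span frame"
      by (intro span_add span_scale span_base) (simp_all add: frame_def)
    ultimately show ?thesis by simp
  qed
  thus ?thesis by blast
qed

lemma hatforms_frame_const: "\<psi> \<in> hatforms frame k \<Longrightarrow> \<psi> x = \<psi> 0"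
  using hatforms_span[of \<psi> frame k x 0] by (simp add: span_frame)

section \<open>Forms on the quotient and their frame coefficients\<close>

lemma frechet_heis_mult: "frechet_derivative (heis_mult \<gamma>) (at x) = (\<lambda>v. v + bet \<gamma> v)"
proof -
  have "linear (\<lambda>v. v + bet \<gamma> v)" by (intro linear_compose_add linear_ident[unfolded id_def] bet_linear_right)
  hence "((\<lambda>v. \<gamma> + (v + bet \<gamma> v)) has_derivative (\<lambda>v. v + bet \<gamma> v)) (at x)"
    by (auto intro!: derivative_eq_intros bounded_linear_imp_has_derivative simp: linear_conv_bounded_linear[symmetric] bet_linear_right)
  hence "(heis_mult \<gamma> has_derivative (\<lambda>v. v + bet \<gamma> v)) (at x)"
    by (simp add: heis_mult_bet[abs_def] add.assoc)
  thus ?thesis by (simp add: frechet_derivative_at[symmetric])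
qed

text \<open>The frame vector at the product is the frame vector at x carried along by the
  translation, so deck invariance of a form becomes invariance of its coefficients.\<close>

lemma hat_heis_mult: "hat \<phi> (heis_mult \<gamma> x) vs = \<phi> (heis_mult \<gamma> x) (map (\<lambda>v. v + bet \<gamma> v) (map (\<lambda>v. v + bet x v) vs))"
  by (simp add: hat_def o_def heis_mult_bet bet_add_left bet_add_right add_ac)

lemma hat_forms: "\<phi> \<in> forms iwasawa_deck k \<Longrightarrow> hat \<phi> \<in> hatforms {} k"
proof -
  assume \<phi>: "\<phi> \<in> forms iwasawa_deck k"
  have "hat \<phi> (heis_mult \<gamma> x) = hat \<phi> x" if "\<gamma> \<in> lattice" for \<gamma> x
  proof
    fix vs
    have "pullback (heis_mult \<gamma>) \<phi> = \<phi>" using \<phi> that by (auto simp: forms_def iwasawa_deck_lattice)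
    hence "\<phi> (heis_mult \<gamma> x) (map (\<lambda>v. v + bet \<gamma> v) ws) = \<phi> x ws" for ws
      by (simp add: pullback_def frechet_heis_mult fun_eq_iff)
    thus "hat \<phi> (heis_mult \<gamma> x) vs = hat \<phi> x vs" unfolding hat_heis_mult by (simp only: hat_def)
  qed
  thus ?thesis using \<phi> by (simp add: hatforms_def forms_iff smooth_family_hat)
qed

lemma unhat_forms: "\<psi> \<in> hatforms W k \<Longrightarrow> unhat \<psi> \<in> forms iwasawa_deck k"
proof -
  assume \<psi>: "\<psi> \<in> hatforms W k"
  have "pullback (heis_mult \<gamma>) (unhat \<psi>) = unhat \<psi>" if "\<gamma> \<in> lattice" for \<gamma>
  proof (intro ext)
    fix x ws
    let ?E = "\<lambda>v. v + bet x v"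
    have ws: "ws = map ?E (map (\<lambda>v. v + - bet x v) ws)" by (simp add: o_def bet_diff_right)
    have "pullback (heis_mult \<gamma>) (unhat \<psi>) x ws = hat (unhat \<psi>) (heis_mult \<gamma> x) (map (\<lambda>v. v + - bet x v) ws)"
      unfolding hat_heis_mult pullback_def frechet_heis_mult ws[symmetric] ..
    also have "\<dots> = \<psi> x (map (\<lambda>v. v + - bet x v) ws)" by (simp only: hat_unhat hatforms_lattice[OF \<psi> that])
    also have "\<dots> = unhat \<psi> x ws" by (simp only: unhat_def)
    finally show "pullback (heis_mult \<gamma>) (unhat \<psi>) x ws = unhat \<psi> x ws" .
  qed
  thus ?thesis using hatforms_smooth_family[OF \<psi>] by (auto simp: forms_iff smooth_family_unhat iwasawa_deck_lattice)
qed

lemma hat_ext_d: "smooth_family k \<phi> \<Longrightarrow> hat (ext_d \<phi>) = dh (hat \<phi>)"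
  using hat_ext_d_unhat[OF smooth_family_hat, of k \<phi>] by simp

lemma ext_d_forms: "\<phi> \<in> forms iwasawa_deck k \<Longrightarrow> ext_d \<phi> \<in> forms iwasawa_deck (Suc k)"
proof -
  assume \<phi>: "\<phi> \<in> forms iwasawa_deck k"
  have "dh (hat \<phi>) \<in> hatforms {} (Suc k)" by (rule dh_hatforms[OF _ hat_forms[OF \<phi>]]) (simp add: ideal_def)
  from unhat_forms[OF this] show ?thesis using \<phi> hat_ext_d[of k \<phi>] by (metis forms_iff unhat_hat)
qed

lemma real_form_hat [simp]: "real_form \<phi> \<Longrightarrow> real_form (hat \<phi>)" and real_form_unhat [simp]: "real_form \<phi> \<Longrightarrow> real_form (unhat \<phi>)"
  by (simp_all add: real_form_def hat_def unhat_def)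

lemma real_forms_iff: "\<phi> \<in> real_forms G k \<longleftrightarrow> \<phi> \<in> forms G k \<and> real_form \<phi>"
  by (simp add: real_forms_def real_form_def)

lemma hat_add: "hat (\<phi> + \<psi>) = hat \<phi> + hat \<psi>" and unhat_add: "unhat (\<phi> + \<psi>) = unhat \<phi> + unhat \<psi>"
  and unhat_diff: "unhat (\<phi> - \<psi>) = unhat \<phi> - unhat \<psi>"
  and hat_zero [simp]: "hat 0 = 0" and unhat_zero [simp]: "unhat 0 = 0"
  by (simp_all add: hat_def unhat_def fun_eq_iff)

section \<open>Left-invariant forms and the projection onto them\<close>

definition inv_form :: "((complex ^ 3) list \<Rightarrow> complex) \<Rightarrow> (complex ^ 3) form" where
  "inv_form f = unhat (\<lambda>x. f)"

text \<open>The averaged coefficients are constant, so their value at the origin carries all the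
  information.\<close>

definition inv_part :: "(complex ^ 3) form \<Rightarrow> (complex ^ 3) list \<Rightarrow> complex" where
  "inv_part \<phi> = average (hat \<phi>) 0"

text \<open>The Chevalley--Eilenberg differential.\<close>

definition ce_d :: "((complex ^ 3) list \<Rightarrow> complex) \<Rightarrow> (complex ^ 3) list \<Rightarrow> complex" where
  "ce_d f = (\<lambda>vs. - antisymmetrize (\<lambda>v ws. slot_sum (bet v) f ws) vs)"

lemma hat_inv_form [simp]: "hat (inv_form f) = (\<lambda>x. f)"
  by (simp add: inv_form_def)

lemma const_hatforms: "alternating k f \<Longrightarrow> (\<lambda>x. f) \<in> hatforms W k"
  by (simp add: hatforms_def smooth_family_const)

lemma inv_form_forms: "alternating k f \<Longrightarrow> inv_form f \<in> forms iwasawa_deck k"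
  unfolding inv_form_def by (rule unhat_forms[OF const_hatforms])

lemma dh_const: "dh (\<lambda>x. f) = (\<lambda>x. ce_d f)"
  by (simp add: dh_def ce_d_def antisymmetrize_def frechet_derivative_const fun_eq_iff sum_negf)

lemma ext_d_inv_form: "alternating k f \<Longrightarrow> ext_d (inv_form f) = inv_form (ce_d f)"
proof -
  assume f: "alternating k f"
  have "smooth_family k (inv_form f)" using inv_form_forms[OF f] by (simp add: forms_iff)
  from hat_ext_d[OF this] have "hat (ext_d (inv_form f)) = (\<lambda>x. ce_d f)" by (simp add: dh_const)
  thus ?thesis by (metis inv_form_def unhat_hat)
qed

lemma average_good: "good_op {} k frame k average"
  and average_dh: "\<psi> \<in> hatforms {} k \<Longrightarrow> average (dh \<psi>) = dh (average \<psi>)"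
proof -
  note c = chain_step_average[unfolded chain_step_def, THEN conjunct2, THEN spec, of k]
  show "good_op {} k frame k average" by (rule conjunct1[OF c])
  assume "\<psi> \<in> hatforms {} k"
  thus "average (dh \<psi>) = dh (average \<psi>)" by (rule bspec[OF conjunct1[OF conjunct2[OF c]]])
qed

lemma average_const: "average (\<lambda>x. f) = (\<lambda>x. f)"
proof -
  have "avg V (\<lambda>x. f) = (\<lambda>x. f)" for V
    by (simp add: avg_def form_int_def tint_const)
  thus ?thesis by (simp add: average_def)
qed

lemma average_hat: "\<phi> \<in> forms iwasawa_deck k \<Longrightarrow> average (hat \<phi>) = (\<lambda>x. inv_part \<phi>)"
proof
  fix x assume "\<phi> \<in> forms iwasawa_deck k"
  hence "average (hat \<phi>) \<in> hatforms frame k" using average_good hat_forms by (auto simp: good_op_def)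
  from hatforms_frame_const[OF this] show "average (hat \<phi>) x = inv_part \<phi>" by (simp add: inv_part_def)
qed

lemma alternating_inv_part: "\<phi> \<in> forms iwasawa_deck k \<Longrightarrow> alternating k (inv_part \<phi>)"
proof -
  assume "\<phi> \<in> forms iwasawa_deck k"
  hence "average (hat \<phi>) \<in> hatforms frame k" using average_good hat_forms by (auto simp: good_op_def)
  thus ?thesis unfolding inv_part_def by (rule hatforms_alternating)
qed

lemma inv_part_inv_form [simp]: "inv_part (inv_form f) = f"
  by (simp add: inv_part_def average_const)

lemma inv_part_add:
  assumes "\<phi> \<in> forms iwasawa_deck k" "\<psi> \<in> forms iwasawa_deck k"
  shows "inv_part (\<phi> + \<psi>) = (\<lambda>vs. inv_part \<phi> vs + inv_part \<psi> vs)"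
  using average_good[of k] hat_forms[OF assms(1)] hat_forms[OF assms(2)]
  by (simp add: inv_part_def hat_add good_op_def fun_eq_iff)

lemma inv_part_cmult:
  assumes "\<phi> \<in> forms iwasawa_deck k"
  shows "inv_part (\<lambda>x vs. c * \<phi> x vs) = (\<lambda>vs. c * inv_part \<phi> vs)"
proof -
  have "hat (\<lambda>x vs. c * \<phi> x vs) = (\<lambda>x vs. c * hat \<phi> x vs)" by (simp add: hat_def)
  thus ?thesis using average_good[of k] hat_forms[OF assms] by (simp add: inv_part_def good_op_def)
qed

lemma inv_part_real:
  assumes "\<phi> \<in> real_forms iwasawa_deck k" shows "inv_part \<phi> vs \<in> \<real>"
proof -
  have "real_form (average (hat \<phi>))"
    using average_good[of k] assms hat_forms by (simp add: real_forms_iff good_op_def)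
  thus ?thesis by (simp add: real_form_def inv_part_def)
qed

lemma inv_part_ext_d:
  assumes "\<phi> \<in> forms iwasawa_deck k" shows "inv_part (ext_d \<phi>) = ce_d (inv_part \<phi>)"
proof -
  have "smooth_family k \<phi>" using assms by (simp add: forms_iff)
  hence "average (hat (ext_d \<phi>)) = dh (average (hat \<phi>))" using average_dh[OF hat_forms[OF assms]] by (simp add: hat_ext_d)
  thus ?thesis by (simp add: inv_part_def[of "ext_d \<phi>"] average_hat[OF assms] dh_const)
qed

lemma alternating_ce_d: "alternating k f \<Longrightarrow> alternating (Suc k) (ce_d f)"
  using dh_hatforms[OF _ const_hatforms, of "{}" k f] hatforms_alternating[of "dh (\<lambda>x. f)" "{}" "Suc k" 0]
  by (simp add: ideal_def dh_const)

text \<open>Averaging moves only the base point, so an equation that concerns the arguments passes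
  through the integral. This is how averaging preserves types.\<close>

lemma avg_eigen:
  assumes "\<And>x vs. \<psi> x (map L vs) = c * \<psi> x vs" shows "avg V \<psi> x (map L vs) = c * avg V \<psi> x vs"
  unfolding avg_def form_int_def using assms by (simp add: tint_cmult)

lemma inv_part_eigen:
  assumes "\<And>x vs. hat \<phi> x (map L vs) = c * hat \<phi> x vs" shows "inv_part \<phi> (map L vs) = c * inv_part \<phi> vs"
  unfolding inv_part_def average_def by (intro avg_eigen assms)

lemma real_form_inv_form: "(\<And>vs. f vs \<in> \<real>) \<Longrightarrow> real_form (inv_form f)"
  by (simp add: inv_form_def real_form_def unhat_def)

text \<open>The homotopy between the identity and averaging, brought back from the frame to forms on
  the quotient.\<close>

lemma homotopy_inv_part:
  "\<exists>H. good_op {} (Suc k) {} k H \<and> (\<forall>\<phi>\<in>forms iwasawa_deck k. \<exists>e. exact_part {} k (hat \<phi>) e \<and>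
     \<phi> - inv_form (inv_part \<phi>) = unhat e + unhat (H (hat (ext_d \<phi>))))"
proof -
  note c = chain_step_average[unfolded chain_step_def, THEN conjunct2, THEN spec, of k]
  obtain H where H1: "good_op {} (Suc k) {} k H" and
    H2: "\<forall>\<psi>\<in>hatforms {} k. \<exists>e. exact_part {} k \<psi> e \<and> \<psi> - average \<psi> = e + H (dh \<psi>)"
    using conjunct2[OF conjunct2[OF c]] by (elim exE conjE)
  note H = H1 H2[rule_format]
  have "\<exists>e. exact_part {} k (hat \<phi>) e \<and> \<phi> - inv_form (inv_part \<phi>) = unhat e + unhat (H (hat (ext_d \<phi>)))"
    if \<phi>: "\<phi> \<in> forms iwasawa_deck k" for \<phi>
  proof -
    obtain e where e: "exact_part {} k (hat \<phi>) e" "hat \<phi> - average (hat \<phi>) = e + H (dh (hat \<phi>))"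
      using H(2)[OF hat_forms[OF \<phi>]] by blast
    have sf: "smooth_family k \<phi>" using \<phi> by (simp add: forms_iff)
    have "\<phi> - inv_form (inv_part \<phi>) = unhat (hat \<phi> - average (hat \<phi>))"
      by (simp only: unhat_diff unhat_hat average_hat[OF \<phi>] inv_form_def)
    also have "\<dots> = unhat e + unhat (H (hat (ext_d \<phi>)))" by (simp only: e(2) unhat_add hat_ext_d[OF sf])
    finally show ?thesis using e(1) by blast
  qed
  with H(1) show ?thesis by blast
qed

lemma unhat_exact_part:
  assumes "exact_part {} k \<psi> e"
  shows "unhat e = 0 \<or> (\<exists>j \<eta>. k = Suc j \<and> \<eta> \<in> forms iwasawa_deck j \<and> unhat e = ext_d \<eta> \<and> (real_form \<psi> \<longrightarrow> real_form \<eta>))"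
proof (cases "e = 0")
  case False
  then obtain j \<eta> where *: "k = Suc j" "\<eta> \<in> hatforms {} j" "e = dh \<eta>" "real_form \<psi> \<longrightarrow> real_form \<eta>"
    using assms unfolding exact_part_def by blast
  have "unhat e = ext_d (unhat \<eta>)"
    using dh_eq_hat[OF hatforms_smooth_family[OF *(2)]] *(3) by simp
  thus ?thesis using * unhat_forms[OF *(2)] real_form_unhat by blast
qed simp

text \<open>For a closed form the operator part of the homotopy is applied to 0, so only the exact
  part, with its real primitive, remains.\<close>

theorem cohomologous_inv_part:
  assumes \<phi>: "\<phi> \<in> closed_forms iwasawa_deck k"
  shows "\<phi> - inv_form (inv_part \<phi>) \<in> exact_forms iwasawa_deck k"
proof -
  have f: "\<phi> \<in> forms iwasawa_deck k" "real_form \<phi>" "ext_d \<phi> = 0" using \<phi> by (simp_all add: closed_forms_def real_forms_iff)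
  from homotopy_inv_part[of k] obtain H where H1: "good_op {} (Suc k) {} k H" and
    H2: "\<forall>\<phi>\<in>forms iwasawa_deck k. \<exists>e. exact_part {} k (hat \<phi>) e \<and>
      \<phi> - inv_form (inv_part \<phi>) = unhat e + unhat (H (hat (ext_d \<phi>)))"
    by (elim exE conjE)
  note H = H1 H2[rule_format]
  obtain e where e: "exact_part {} k (hat \<phi>) e" "\<phi> - inv_form (inv_part \<phi>) = unhat e + unhat (H (hat (ext_d \<phi>)))"
    using H(2)[OF f(1)] by blast
  have "\<phi> - inv_form (inv_part \<phi>) = unhat e"
    unfolding e(2) f(3) hat_zero good_op_zero_arg[OF H(1)] unhat_zero by simp
  thus ?thesis using unhat_exact_part[OF e(1)] f(2) unfolding exact_forms_def real_forms_iff
    by (metis (mono_tags, lifting) insertCI mem_Collect_eq real_form_hat)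
qed

section \<open>The dual homotopy for currents\<close>

lemma seminorm_le_hat:
  fixes M R :: real
  assumes "smooth_family k \<phi>" "M \<ge> 0" "R \<ge> 0" "seminorm_le n R M \<phi>"
  shows "seminorm_le n R ((1 + real DIM(complex ^ 3) * 1 * (R + n)) ^ k * M) (hat \<phi>)"
  unfolding hat_def
  by (rule twist_seminorm_le[where B = bet and K = 1]) (use assms in \<open>simp_all add: norm_bet bet_linear_left\<close>)

lemma seminorm_le_unhat:
  fixes M R :: real
  assumes "smooth_family k \<phi>" "M \<ge> 0" "R \<ge> 0" "seminorm_le n R M \<phi>"
  shows "seminorm_le n R ((1 + real DIM(complex ^ 3) * 1 * (R + n)) ^ k * M) (unhat \<phi>)"
  unfolding unhat_def
  by (rule twist_seminorm_le[where B = "\<lambda>x v. - bet x v" and K = 1]) (use assms in \<open>simp_all add: norm_bet linear_neg_bet\<close>)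

text \<open>Chains the estimates for the passage to the frame, for F, for the way back and for T;
  each may enlarge the constant, and F also the order and the radius.\<close>

lemma bounded_functional_good_op:
  assumes T: "bounded_functional iwasawa_deck l T" and F: "good_op {} k W l F"
    and S: "\<And>\<phi>. \<phi> \<in> forms iwasawa_deck k \<Longrightarrow> S \<phi> = T (unhat (F (hat \<phi>)))"
  shows "bounded_functional iwasawa_deck k S"
proof -
  obtain n R C where T: "R \<ge> 0" "C \<ge> 0"
     "\<And>\<phi> M. \<phi>\<in>forms iwasawa_deck l \<Longrightarrow> M\<ge>0 \<Longrightarrow> seminorm_le n R M \<phi> \<Longrightarrow> cmod (T \<phi>) \<le> C * M"
    using T unfolding bounded_functional_def by blast
  have b: "bounded_op {} k F" using F by (simp add: good_op_def)
  from bounded_opD[where n = n, OF b T(1)] obtain n' R' C' where F': "R' \<ge> 0" "C' \<ge> 0"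
      "\<forall>\<psi>\<in>hatforms {} k. \<forall>M\<ge>0. seminorm_le n' R' M \<psi> \<longrightarrow> seminorm_le n R (C' * M) (F \<psi>)"
    by (elim exE conjE)
  define c1 where "c1 = (1 + real DIM(complex ^ 3) * 1 * (R' + n')) ^ k"
  define c2 where "c2 = (1 + real DIM(complex ^ 3) * 1 * (R + n)) ^ l"
  have c: "c1 \<ge> 0" "c2 \<ge> 0" unfolding c1_def c2_def using T(1) F'(1) by simp_all
  have "cmod (S \<phi>) \<le> C * c2 * C' * c1 * M" if \<phi>: "\<phi> \<in> forms iwasawa_deck k" and M: "M \<ge> 0" "seminorm_le n' R' M \<phi>" for \<phi> M
  proof -
    have sf: "smooth_family k \<phi>" using \<phi> by (simp add: forms_iff)
    have "seminorm_le n' R' (c1 * M) (hat \<phi>)" unfolding c1_def by (rule seminorm_le_hat[OF sf M(1) F'(1) M(2)])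
    hence 1: "seminorm_le n R (C' * (c1 * M)) (F (hat \<phi>))" using F'(3) hat_forms[OF \<phi>] c M(1) by simp
    have Fh: "F (hat \<phi>) \<in> hatforms W l" using F hat_forms[OF \<phi>] by (simp add: good_op_def)
    have nn: "0 \<le> C' * (c1 * M)" using F'(2) c M(1) by simp
    have "seminorm_le n R (c2 * (C' * (c1 * M))) (unhat (F (hat \<phi>)))" unfolding c2_def
      by (rule seminorm_le_unhat[OF hatforms_smooth_family[OF Fh] nn T(1) 1])
    hence "cmod (T (unhat (F (hat \<phi>)))) \<le> C * (c2 * (C' * (c1 * M)))"
      using nn c by (intro T(3) unhat_forms[OF Fh]) auto
    thus ?thesis by (simp add: S[OF \<phi>] mult.assoc)
  qed
  moreover have "C * c2 * C' * c1 \<ge> 0" using T(2) F'(2) c by simp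
  ultimately show ?thesis unfolding bounded_functional_def
    by - (rule exI[of _ n'], rule exI[of _ R'], rule exI[of _ "C * c2 * C' * c1"], use F'(1) in simp)
qed

lemma currentsD:
  assumes "T \<in> currents G k"
  shows "\<phi> \<notin> forms G k \<Longrightarrow> T \<phi> = 0"
    and "\<phi> \<in> forms G k \<Longrightarrow> \<psi> \<in> forms G k \<Longrightarrow> T (\<phi> + \<psi>) = T \<phi> + T \<psi>"
    and "\<phi> \<in> forms G k \<Longrightarrow> T (\<lambda>x vs. c * \<phi> x vs) = c * T \<phi>"
  using assms by (simp_all add: currents_def)

lemma currents_good_op:
  assumes T: "T \<in> currents iwasawa_deck l" and F: "good_op {} k {} l F"
  shows "(\<lambda>\<phi>. if \<phi> \<in> forms iwasawa_deck k then T (unhat (F (hat \<phi>))) else 0) \<in> currents iwasawa_deck k" (is "?S \<in> _")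
proof (rule currentsI)
  have Ff: "unhat (F (hat \<phi>)) \<in> forms iwasawa_deck l" if "\<phi> \<in> forms iwasawa_deck k" for \<phi>
    using F hat_forms[OF that] unhat_forms by (auto simp: good_op_def)
  show "bounded_functional iwasawa_deck k ?S"
    by (rule bounded_functional_good_op[OF currents_bounded[OF T] F]) simp
  fix \<phi> assume \<phi>: "\<phi> \<in> forms iwasawa_deck k"
  { fix \<psi> assume \<psi>: "\<psi> \<in> forms iwasawa_deck k"
    have "unhat (F (hat (\<phi> + \<psi>))) = unhat (F (hat \<phi>)) + unhat (F (hat \<psi>))"
      using F hat_forms[OF \<phi>] hat_forms[OF \<psi>] by (simp only: hat_add good_op_def unhat_add)
    thus "?S (\<phi> + \<psi>) = ?S \<phi> + ?S \<psi>"
      using \<phi> \<psi> forms_add[OF \<phi> \<psi>] currentsD(2)[OF T Ff Ff] by simp }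
  { fix c
    have "hat (\<lambda>x vs. c * \<phi> x vs) = (\<lambda>x vs. c * hat \<phi> x vs)" by (simp add: hat_def)
    hence "F (hat (\<lambda>x vs. c * \<phi> x vs)) = (\<lambda>x vs. c * F (hat \<phi>) x vs)"
      using F hat_forms[OF \<phi>] by (simp add: good_op_def)
    hence "unhat (F (hat (\<lambda>x vs. c * \<phi> x vs))) = (\<lambda>x vs. c * unhat (F (hat \<phi>)) x vs)" by (simp add: unhat_def)
    thus "?S (\<lambda>x vs. c * \<phi> x vs) = c * ?S \<phi>"
      using \<phi> forms_cmult[OF \<phi>] currentsD(3)[OF T Ff] by simp }
qed simp

text \<open>The transpose of the homotopy: composing T with the operator H gives a current whose
  boundary is the stated difference, because the closed current T kills the exact part of the
  homotopy.\<close>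

theorem homologous_inv_part:
  assumes T: "T \<in> closed_currents iwasawa_deck k"
  shows "(\<lambda>\<phi>. if \<phi> \<in> forms iwasawa_deck k then T \<phi> - T (inv_form (inv_part \<phi>)) else 0) \<in> exact_currents iwasawa_deck k"
proof -
  have Tc: "T \<in> currents iwasawa_deck k" and Tr: "\<And>\<phi>. \<phi> \<in> real_forms iwasawa_deck k \<Longrightarrow> T \<phi> \<in> \<real>"
    and Td: "current_d iwasawa_deck k T = 0"
    using T by (auto simp: closed_currents_def real_currents_def)
  from homotopy_inv_part[of k] obtain H where H1: "good_op {} (Suc k) {} k H" and
    H2: "\<forall>\<phi>\<in>forms iwasawa_deck k. \<exists>e. exact_part {} k (hat \<phi>) e \<and>
      \<phi> - inv_form (inv_part \<phi>) = unhat e + unhat (H (hat (ext_d \<phi>)))"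
    by (elim exE conjE)
  note H = H1 H2[rule_format]
  define S where "S = (\<lambda>\<phi>. if \<phi> \<in> forms iwasawa_deck (Suc k) then T (unhat (H (hat \<phi>))) else 0)"
  have Sc: "S \<in> currents iwasawa_deck (Suc k)" unfolding S_def by (rule currents_good_op[OF Tc H(1)])
  have "S \<phi> \<in> \<real>" if "\<phi> \<in> real_forms iwasawa_deck (Suc k)" for \<phi>
  proof -
    have *: "\<phi> \<in> forms iwasawa_deck (Suc k)" "real_form \<phi>" using that by (simp_all add: real_forms_iff)
    have "H (hat \<phi>) \<in> hatforms {} k" "real_form (H (hat \<phi>))"
      using H(1) hat_forms[OF *(1)] *(2) by (simp_all add: good_op_def)
    thus ?thesis using * Tr unhat_forms by (simp add: S_def real_forms_iff)
  qed
  hence Sr: "S \<in> real_currents iwasawa_deck (Suc k)" using Sc by (simp add: real_currents_def)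
  have "current_d iwasawa_deck (Suc k) S \<phi> = (if \<phi> \<in> forms iwasawa_deck k then T \<phi> - T (inv_form (inv_part \<phi>)) else 0)" for \<phi>
  proof (cases "\<phi> \<in> forms iwasawa_deck k")
    case True
    have i: "inv_form (inv_part \<phi>) \<in> forms iwasawa_deck k" by (rule inv_form_forms[OF alternating_inv_part[OF True]])
    obtain e where e: "exact_part {} k (hat \<phi>) e" "\<phi> - inv_form (inv_part \<phi>) = unhat e + unhat (H (hat (ext_d \<phi>)))"
      using H(2)[OF True] by blast
    have "T (unhat e) = 0 \<and> unhat e \<in> forms iwasawa_deck k"
      using unhat_exact_part[OF e(1)]
    proof
      assume "unhat e = 0"
      thus ?thesis using currentsD(3)[OF Tc forms_zero, of 0] forms_zero[of iwasawa_deck k] by (simp add: zero_fun_def)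
    next
      assume "\<exists>j \<eta>. k = Suc j \<and> \<eta> \<in> forms iwasawa_deck j \<and> unhat e = ext_d \<eta> \<and> (real_form (hat \<phi>) \<longrightarrow> real_form \<eta>)"
      then obtain j \<eta> where "k = Suc j" "\<eta> \<in> forms iwasawa_deck j" "unhat e = ext_d \<eta>" by blast
      thus ?thesis using fun_cong[OF Td, of \<eta>] ext_d_forms[of \<eta> j] by (auto simp: current_d_def)
    qed
    moreover have "unhat (H (hat (ext_d \<phi>))) \<in> forms iwasawa_deck k"
      using H(1) hat_forms[OF ext_d_forms[OF True]] unhat_forms by (auto simp: good_op_def)
    ultimately have "T (\<phi> - inv_form (inv_part \<phi>)) = T (unhat (H (hat (ext_d \<phi>))))"
      unfolding e(2) by (simp add: currentsD(2)[OF Tc])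
    moreover have "T \<phi> = T (\<phi> - inv_form (inv_part \<phi>)) + T (inv_form (inv_part \<phi>))"
      using currentsD(2)[OF Tc forms_diff[OF True i] i] by (simp only: diff_add_cancel)
    ultimately show ?thesis using True ext_d_forms[OF True] by (simp add: current_d_def S_def)
  qed (simp add: current_d_def)
  hence "(\<lambda>\<phi>. if \<phi> \<in> forms iwasawa_deck k then T \<phi> - T (inv_form (inv_part \<phi>)) else 0) = current_d iwasawa_deck (Suc k) S"
    by (intro ext) simp
  thus ?thesis unfolding exact_currents_def using Sr by (rule image_eqI)
qed

section \<open>Left-invariant currents\<close>

text \<open>Lets a functional on left-invariant forms act on the invariant part. As the invariant
  part is compatible with the differential, boundaries of such currents are computed by
  \<open>ce_d\<close>.\<close>

definition inv_current :: "nat \<Rightarrow> (((complex ^ 3) list \<Rightarrow> complex) \<Rightarrow> complex) \<Rightarrow> (complex ^ 3) current" where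
  "inv_current k l = (\<lambda>\<phi>. if \<phi> \<in> forms iwasawa_deck k then l (inv_part \<phi>) else 0)"

text \<open>The norm bound provides the continuity of the associated current.\<close>

definition alt_functional :: "nat \<Rightarrow> (((complex ^ 3) list \<Rightarrow> complex) \<Rightarrow> complex) \<Rightarrow> bool" where
  "alt_functional k l \<longleftrightarrow>
     (\<forall>f g. alternating k f \<longrightarrow> alternating k g \<longrightarrow> l (\<lambda>vs. f vs + g vs) = l f + l g) \<and>
     (\<forall>c f. alternating k f \<longrightarrow> l (\<lambda>vs. c * f vs) = c * l f) \<and>
     (\<exists>C\<ge>0. \<forall>f M. alternating k f \<longrightarrow> M \<ge> 0 \<longrightarrow> (\<forall>vs. cmod (f vs) \<le> M * pn vs) \<longrightarrow> cmod (l f) \<le> C * M)"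

lemma inv_current_currents:
  assumes l: "alt_functional k l" shows "inv_current k l \<in> currents iwasawa_deck k"
proof (rule currentsI)
  have add: "\<And>f g. alternating k f \<Longrightarrow> alternating k g \<Longrightarrow> l (\<lambda>vs. f vs + g vs) = l f + l g"
    and hom: "\<And>c f. alternating k f \<Longrightarrow> l (\<lambda>vs. c * f vs) = c * l f"
    using l by (simp_all add: alt_functional_def)
  obtain C where C: "C \<ge> 0" "\<forall>f M. alternating k f \<longrightarrow> M \<ge> 0 \<longrightarrow> (\<forall>vs. cmod (f vs) \<le> M * pn vs) \<longrightarrow> cmod (l f) \<le> C * M"
    using l[unfolded alt_functional_def, THEN conjunct2, THEN conjunct2] by (elim exE conjE)
  note C = C(1) C(2)[rule_format]
  show "bounded_functional iwasawa_deck k (inv_current k l)"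
  proof (rule bounded_functional_good_op[OF _ good_op_weaken[OF average_good, of "{}" "{}"], where T = "\<lambda>\<phi>. l (hat \<phi> 0)"])
    show "bounded_functional iwasawa_deck k (\<lambda>\<phi>. l (hat \<phi> 0))"
      unfolding bounded_functional_def
    proof (rule exI[of _ 0], rule exI[of _ 0], rule exI[of _ C], intro conjI ballI allI impI C(1))
      fix \<phi> M assume \<phi>: "\<phi> \<in> forms iwasawa_deck k" "(0::real) \<le> M" "seminorm_le 0 0 M \<phi>"
      have "hat \<phi> 0 = \<phi> 0" by (simp add: hat_def)
      moreover have "alternating k (\<phi> 0)" using \<phi>(1) by (simp add: forms_def)
      moreover have "cmod (\<phi> 0 vs) \<le> M * pn vs" for vs using \<phi>(3) unfolding seminorm_le_def by (auto dest!: spec[of _ "[]"])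
      ultimately show "cmod (l (hat \<phi> 0)) \<le> C * M" using C(2) \<phi>(2) by simp
    qed simp
  qed (simp_all add: inv_current_def inv_part_def)
  fix \<phi> assume \<phi>: "\<phi> \<in> forms iwasawa_deck k"
  show "inv_current k l (\<phi> + \<psi>) = inv_current k l \<phi> + inv_current k l \<psi>" if \<psi>: "\<psi> \<in> forms iwasawa_deck k" for \<psi>
    using \<phi> \<psi> forms_add[OF \<phi> \<psi>] by (simp add: inv_current_def inv_part_add[OF \<phi> \<psi>] add alternating_inv_part)
  show "inv_current k l (\<lambda>x vs. c * \<phi> x vs) = c * inv_current k l \<phi>" for c
    using \<phi> forms_cmult[OF \<phi>] by (simp add: inv_current_def inv_part_cmult[OF \<phi>] hom alternating_inv_part)
qed (simp add: inv_current_def)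

lemma inv_current_inv_form: "alternating k f \<Longrightarrow> inv_current k l (inv_form f) = l f"
  by (simp add: inv_current_def inv_form_forms)

section \<open>Monomial expansion of alternating functions\<close>

lemma permute_list_transpose:
  assumes "a < length vs" "b < length vs"
  shows "permute_list (Transposition.transpose a b) vs = vs[a := vs ! b, b := vs ! a]"
  using assms by (intro nth_equalityI)
    (auto simp: permute_list_nth permutes_swap_id nth_list_update Transposition.transpose_def)

lemma alternating_transpose:
  assumes f: "alternating k f" and l: "length vs = k" "a < k" "b < k" "a \<noteq> b"
  shows "f (vs[a := vs ! b, b := vs ! a]) = - f vs"
proof -
  let ?g = "\<lambda>x y. f (vs[a := x, b := y])"
  have z: "?g x x = 0" for x
  proof -
    have rep: "\<And>ws i j. length ws = k \<Longrightarrow> i < j \<Longrightarrow> j < k \<Longrightarrow> ws ! i = ws ! j \<Longrightarrow> f ws = 0"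
      using f[unfolded alternating_def, THEN conjunct2, THEN conjunct2] by blast
    have "vs[a := x, b := x] ! a = x" "vs[a := x, b := x] ! b = x" using l by (simp_all add: nth_list_update)
    thus ?thesis using rep[of "vs[a := x, b := x]" a b] rep[of "vs[a := x, b := x]" b a] l
      by (cases a b rule: linorder_cases) auto
  qed
  have lin: "\<And>ws i. length ws = k \<Longrightarrow> i < k \<Longrightarrow> linear (\<lambda>v. f (ws[i := v]))"
    using f[unfolded alternating_def, THEN conjunct2, THEN conjunct1] by simp
  have lb: "?g x (y + y') = ?g x y + ?g x y'" for x y y'
    using linear_add[OF lin[of "vs[a := x]" b]] l by simp
  have la: "?g (x + x') y = ?g x y + ?g x' y" for x x' y
    using linear_add[OF lin[of "vs[b := y]" a]] l by (simp add: list_update_swap)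
  have "?g (vs ! a + vs ! b) (vs ! a + vs ! b) = ?g (vs ! a) (vs ! a) + ?g (vs ! b) (vs ! b) + (?g (vs ! a) (vs ! b) + ?g (vs ! b) (vs ! a))"
    by (simp only: la lb add_ac)
  hence "?g (vs ! a) (vs ! b) + ?g (vs ! b) (vs ! a) = 0" by (simp only: z add_0_left add_0_right)
  thus ?thesis by (simp add: add_eq_0_iff2)
qed

lemma alternating_permute:
  assumes f: "alternating k f" and \<sigma>: "\<sigma> permutes {..<k}"
  shows "length vs = k \<Longrightarrow> f (permute_list \<sigma> vs) = of_int (sign \<sigma>) * f vs"
  using \<sigma> finite_lessThan[of k]
proof (induction arbitrary: vs rule: permutes_induct)
  case id thus ?case by (simp add: permute_list_id sign_id)
next
  case (swap a b p)
  have pp: "permutation p" "permutation (Transposition.transpose a b)"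
    using permutes_imp_permutation[OF finite_lessThan swap.hyps(4)] permutation_swap_id[of a b] by simp_all
  have "permute_list (Transposition.transpose a b \<circ> p) vs = permute_list p (permute_list (Transposition.transpose a b) vs)"
    using swap by (intro permute_list_compose) auto
  also have "permute_list (Transposition.transpose a b) vs = vs[a := vs ! b, b := vs ! a]"
    using swap by (intro permute_list_transpose) auto
  also have "f (permute_list p (vs[a := vs ! b, b := vs ! a])) = of_int (sign p) * f (vs[a := vs ! b, b := vs ! a])"
    using swap by simp
  also have "f (vs[a := vs ! b, b := vs ! a]) = - f vs"
    by (rule alternating_transpose[OF f]) (use swap in auto)
  finally show ?case using swap.hyps(3) unfolding sign_compose[OF pp(2,1)] by (simp add: sign_swap_id)
qed

lemma wedge_permute:
  assumes \<pi>: "\<pi> permutes {..<length as}"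
  shows "wedge (permute_list \<pi> as) vs = of_int (sign \<pi>) * wedge as vs"
proof (cases "length vs = length as")
  case True
  let ?S = "{..<length as}"
  have p\<pi>: "permutation \<pi>" by (rule permutes_imp_permutation[OF finite_lessThan \<pi>])
  have "wedge (permute_list \<pi> as) vs = (\<Sum>\<sigma> | \<sigma> permutes ?S. of_int (sign \<sigma>) * (\<Prod>i<length as. (as ! \<pi> i) (vs ! \<sigma> i)))"
    using True by (simp add: wedge_def permute_list_nth[OF \<pi>])
  also have "\<dots> = (\<Sum>\<sigma> | \<sigma> permutes ?S. of_int (sign (\<sigma> \<circ> \<pi>)) * (\<Prod>i<length as. (as ! \<pi> i) (vs ! (\<sigma> \<circ> \<pi>) i)))"
    by (rule sum_permutations_compose_right[OF \<pi>])
  also have "\<dots> = (\<Sum>\<sigma> | \<sigma> permutes ?S. of_int (sign \<pi>) * (of_int (sign \<sigma>) * (\<Prod>i<length as. (as ! i) (vs ! \<sigma> i))))"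
  proof (intro sum.cong refl)
    fix \<sigma> assume "\<sigma> \<in> {\<sigma>. \<sigma> permutes ?S}"
    hence "permutation \<sigma>" using permutes_imp_permutation[OF finite_lessThan] by simp
    moreover have "(\<Prod>i<length as. (as ! i) (vs ! \<sigma> i)) = (\<Prod>i<length as. (as ! \<pi> i) (vs ! \<sigma> (\<pi> i)))"
      using prod.permute[OF \<pi>, of "\<lambda>i. (as ! i) (vs ! \<sigma> i)"] by (simp add: o_def)
    ultimately show "of_int (sign (\<sigma> \<circ> \<pi>)) * (\<Prod>i<length as. (as ! \<pi> i) (vs ! (\<sigma> \<circ> \<pi>) i)) =
      of_int (sign \<pi>) * (of_int (sign \<sigma>) * (\<Prod>i<length as. (as ! i) (vs ! \<sigma> i)))"
      by (simp add: sign_compose p\<pi>)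
  qed
  also have "\<dots> = of_int (sign \<pi>) * wedge as vs" using True by (simp add: wedge_def sum_distrib_left)
  finally show ?thesis .
qed (simp add: wedge_def)

text \<open>Exchanging two equal covectors changes nothing and yet reverses the sign.\<close>

lemma wedge_not_distinct:
  assumes "\<not> distinct as" shows "wedge as vs = 0"
proof -
  obtain i j where ij: "i < length as" "j < length as" "i \<noteq> j" "as ! i = as ! j"
    using assms by (auto simp: distinct_conv_nth)
  have "permute_list (Transposition.transpose i j) as = as"
    unfolding permute_list_transpose[OF ij(1,2)] by (simp add: ij(4)[symmetric]) (simp add: ij(4))
  hence "wedge as vs = - wedge as vs"
    using wedge_permute[of "Transposition.transpose i j" as vs] ij by (simp add: permutes_swap_id sign_swap_id)
  thus ?thesis by simp
qed

lemma wedge_mset: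
  assumes "mset as = mset bs" obtains c where "wedge as = (\<lambda>vs. c * wedge bs vs)"
proof -
  obtain \<pi> where "\<pi> permutes {..<length bs}" "permute_list \<pi> bs = as" using mset_eq_permutation[OF assms] .
  hence "wedge as = (\<lambda>vs. of_int (sign \<pi>) * wedge bs vs)" using wedge_permute[of \<pi> bs] by (intro ext) simp
  thus thesis by (rule that)
qed

lemma wedge_scale:
  assumes "\<And>i v. i < length as \<Longrightarrow> (as ! i) (U v) = h i * (bs ! i) v" "length bs = length as"
  shows "wedge as (map U vs) = (\<Prod>i<length as. h i) * wedge bs vs"
proof (cases "length vs = length as")
  case True
  have "(\<Prod>i<length as. (as ! i) (map U vs ! \<sigma> i)) = (\<Prod>i<length as. h i) * (\<Prod>i<length as. (bs ! i) (vs ! \<sigma> i))"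
    if "\<sigma> permutes {..<length as}" for \<sigma>
  proof -
    have "\<sigma> i < length vs" if "i < length as" for i using permutes_in_image[OF \<open>\<sigma> permutes _\<close>, of i] that True by auto
    thus ?thesis unfolding prod.distrib[symmetric] by (intro prod.cong) (auto simp: assms(1))
  qed
  thus ?thesis using True assms(2)
    by (auto simp: wedge_def sum_distrib_left intro!: sum.cong)
qed (simp add: wedge_def assms(2))

text \<open>\<open>dual\<close> expresses that the \<open>cov c\<close> span the complex covectors:
  the coefficient of \<open>cov c\<close> in g is the value of the complex-linear extension of g at
  (e + s h)/2. In the application s is \<i> or -\<i>. The expansion then proceeds slot by
  slot.\<close>

lemma multilinear_expansion:
  fixes cov :: "'c::finite \<Rightarrow> 'e::euclidean_space \<Rightarrow> complex"
  assumes dual: "\<And>g v. linear g \<Longrightarrow> g v = (\<Sum>c\<in>UNIV. (g (e c) + s c * g (h c)) / 2 * cov c v)"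
  shows "(\<And>us vs. length us + length vs + 1 = k \<Longrightarrow> linear (\<lambda>v. f (us @ v # vs))) \<Longrightarrow>
     \<exists>coef. \<forall>vs. length vs = k \<longrightarrow> f vs = (\<Sum>cs | length cs = k. coef cs * (\<Prod>i<k. cov (cs ! i) (vs ! i)))"
proof (induction k arbitrary: f)
  case 0
  show ?case by (rule exI[of _ "\<lambda>_. f []"]) simp
next
  case (Suc k)
  define G where "G c ws = (f (e c # ws) + s c * f (h c # ws)) / 2" for c ws
  have "linear (\<lambda>v. G c (us @ v # vs))" if "length us + length vs + 1 = k" for c us vs
  proof -
    have 1: "linear (\<lambda>v. f (u # us @ v # vs))" for u using Suc.prems[of "u # us" vs] that by simp
    show ?thesis unfolding G_def using 1[of "e c"] 1[of "h c"]
      by (simp add: linear_iff algebra_simps add_divide_distrib scaleR_conv_of_real)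
  qed
  hence "\<forall>c. \<exists>coef. \<forall>vs. length vs = k \<longrightarrow> G c vs = (\<Sum>cs | length cs = k. coef cs * (\<Prod>i<k. cov (cs ! i) (vs ! i)))"
    by (intro allI Suc.IH)
  from choice[OF this] obtain coef where
    "\<forall>c vs. length vs = k \<longrightarrow> G c vs = (\<Sum>cs | length cs = k. coef c cs * (\<Prod>i<k. cov (cs ! i) (vs ! i)))"
    by (elim exE)
  note coef = this[rule_format]
  have lists: "{cs :: 'c list. length cs = Suc k} = (\<lambda>(c, cs). c # cs) ` (UNIV \<times> {cs. length cs = k})"
    by (auto simp: length_Suc_conv image_iff)
  have "f vs = (\<Sum>cs | length cs = Suc k. coef (hd cs) (tl cs) * (\<Prod>i<Suc k. cov (cs ! i) (vs ! i)))" if "length vs = Suc k" for vs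
  proof -
    obtain v ws where vs: "vs = v # ws" "length ws = k" using \<open>length vs = Suc k\<close> by (cases vs) auto
    have lin: "linear (\<lambda>v. f (v # ws))" using Suc.prems[of "[]" ws] vs by simp
    have "f vs = (\<Sum>c\<in>UNIV. G c ws * cov c v)"
      unfolding vs(1) G_def by (rule dual[OF lin])
    also have "\<dots> = (\<Sum>c\<in>UNIV. \<Sum>cs | length cs = k. coef c cs * (\<Prod>i<Suc k. cov ((c # cs) ! i) (vs ! i)))"
      unfolding coef[OF vs(2)] vs(1) sum_distrib_right
      by (intro sum.cong refl) (simp add: prod.lessThan_Suc_shift mult.assoc mult.commute[of "cov _ _"] del: prod.lessThan_Suc)
    also have "\<dots> = (\<Sum>(c, cs)\<in>UNIV \<times> {cs. length cs = k}. coef c cs * (\<Prod>i<Suc k. cov ((c # cs) ! i) (vs ! i)))"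
      by (rule sum.cartesian_product)
    also have "\<dots> = (\<Sum>cs | length cs = Suc k. coef (hd cs) (tl cs) * (\<Prod>i<Suc k. cov (cs ! i) (vs ! i)))"
      unfolding lists by (subst sum.reindex) (auto simp: inj_on_def split_beta intro!: sum.cong)
    finally show ?thesis .
  qed
  hence "\<forall>vs. length vs = Suc k \<longrightarrow> f vs = (\<Sum>cs | length cs = Suc k. coef (hd cs) (tl cs) * (\<Prod>i<Suc k. cov (cs ! i) (vs ! i)))"
    by (intro allI impI)
  thus ?case by (rule exI[of _ "\<lambda>cs. coef (hd cs) (tl cs)"])
qed

text \<open>Antisymmetrising the multilinear expansion turns products into wedges, at the cost of
  the factor k!. The sum runs over all index lists, including permuted and repeated ones.\<close>

lemma alternating_expansion:
  fixes cov :: "'c::finite \<Rightarrow> 'e::euclidean_space \<Rightarrow> complex"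
  assumes dual: "\<And>g v. linear g \<Longrightarrow> g v = (\<Sum>c\<in>UNIV. (g (e c) + s c * g (h c)) / 2 * cov c v)"
    and f: "alternating k f"
  shows "\<exists>coef. f = (\<lambda>vs. \<Sum>cs | length cs = k. coef cs * wedge (map cov cs) vs)"
proof -
  obtain coef where coef: "\<And>vs. length vs = k \<Longrightarrow> f vs = (\<Sum>cs | length cs = k. coef cs * (\<Prod>i<k. cov (cs ! i) (vs ! i)))"
    using multilinear_expansion[OF dual alternating_linear[OF f]] by blast
  have "f vs = (\<Sum>cs | length cs = k. coef cs / fact k * wedge (map cov cs) vs)" for vs
  proof (cases "length vs = k")
    case True
    let ?P = "{\<sigma>. \<sigma> permutes {..<k}}"
    have "(\<Sum>\<sigma>\<in>?P. of_int (sign \<sigma>) * f (permute_list \<sigma> vs)) = (\<Sum>\<sigma>\<in>?P. f vs)"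
      using alternating_permute[OF f _ True]
      by (intro sum.cong refl) (simp add: mult.assoc[symmetric] flip: of_int_mult)
    also have "\<dots> = fact k * f vs" by (simp add: card_permutations)
    finally have "fact k * f vs = (\<Sum>\<sigma>\<in>?P. of_int (sign \<sigma>) * f (permute_list \<sigma> vs))" ..
    also have "\<dots> = (\<Sum>\<sigma>\<in>?P. \<Sum>cs | length cs = k. coef cs * (of_int (sign \<sigma>) * (\<Prod>i<k. cov (cs ! i) (vs ! \<sigma> i))))"
      using True by (intro sum.cong refl) (simp add: coef sum_distrib_left permute_list_nth mult.left_commute)
    also have "\<dots> = (\<Sum>cs | length cs = k. coef cs * (\<Sum>\<sigma>\<in>?P. of_int (sign \<sigma>) * (\<Prod>i<k. cov (cs ! i) (vs ! \<sigma> i))))"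
      unfolding sum_distrib_left by (rule sum.swap)
    also have "\<dots> = (\<Sum>cs | length cs = k. coef cs * wedge (map cov cs) vs)"
      using True by (intro sum.cong refl) (simp add: wedge_def)
    finally have "f vs = (\<Sum>cs | length cs = k. coef cs * wedge (map cov cs) vs) / fact k"
      by (simp add: field_simps)
    thus ?thesis by (simp add: sum_divide_distrib)
  next
    case False
    thus ?thesis by (simp add: alternating_length[OF f] wedge_def)
  qed
  hence "f = (\<lambda>vs. \<Sum>cs | length cs = k. coef cs / fact k * wedge (map cov cs) vs)" by (rule ext)
  thus ?thesis by (rule exI[of _ "\<lambda>cs. coef cs / fact k"])
qed

section \<open>Types with respect to a constant complex structure\<close>

text \<open>Orthogonality of the characters of the cyclic group of order N, by the geometric
  series.\<close>

lemma sum_cis_roots: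
  assumes "N > 0"
  shows "(\<Sum>l<N. cis (2 * pi * real l / real N * real_of_int n)) = (if int N dvd n then of_nat N else 0)"
proof -
  define z where "z = cis (2 * pi * real_of_int n / real N)"
  have "cis (2 * pi * real l / real N * real_of_int n) = z ^ l" for l
  proof -
    have "2 * pi * real l / real N * real_of_int n = real l * (2 * pi * real_of_int n / real N)" by simp
    thus ?thesis unfolding z_def by (simp only: Complex.DeMoivre)
  qed
  hence s: "(\<Sum>l<N. cis (2 * pi * real l / real N * real_of_int n)) = (\<Sum>l<N. z ^ l)" by simp
  show ?thesis
  proof (cases "int N dvd n")
    case True
    then obtain m where "n = int N * m" by blast
    hence "2 * pi * real_of_int n / real N = 2 * pi * real_of_int m" using assms by simp
    hence "z = cis (2 * pi * real_of_int m)" unfolding z_def by (rule arg_cong)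
    also have "\<dots> = 1" by (rule cis_multiple_2pi) simp
    finally have "z = 1" .
    thus ?thesis using s True by simp
  next
    case False
    have "z \<noteq> 1"
    proof
      assume "z = 1"
      moreover have "Re z = cos (2 * pi * real_of_int n / real N)" by (simp only: z_def cis.simps)
      ultimately have "cos (2 * pi * real_of_int n / real N) = 1" by simp
      then obtain m where "2 * pi * real_of_int n / real N = of_int m * 2 * pi" using cos_one_2pi_int by auto
      hence "real_of_int n = of_int m * real N" using assms by (simp add: field_simps)
      hence "real_of_int n = real_of_int (m * int N)" by simp
      hence "n = m * int N" by (simp only: of_int_eq_iff)
      thus False using False by simp
    qed
    moreover have "z ^ N = 1"
    proof -
      have "real N * (2 * pi * real_of_int n / real N) = 2 * pi * real_of_int n" using assms by simp
      hence "z ^ N = cis (2 * pi * real_of_int n)" unfolding z_def Complex.DeMoivre by (rule arg_cong)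
      also have "\<dots> = 1" by (rule cis_multiple_2pi) simp
      finally show ?thesis .
    qed
    ultimately show ?thesis using s False by (simp add: geometric_sum)
  qed
qed

text \<open>The scalar multiplication is the one in \<open>covectors_pq\<close>, whose span thereby
  obtains the usual rules.\<close>

interpretation cspan: vector_space "\<lambda>(c::complex) (f::'a list \<Rightarrow> complex) vs. c * f vs"
  by unfold_locales (auto simp: fun_eq_iff algebra_simps)

text \<open>The components of \<Psi> serve as a basis of (1,0)-covectors for the complex structure
  \<open>jj\<close> that \<Psi> transports from the standard one.\<close>

locale frame_iso =
  fixes \<Psi> :: "complex ^ 3 \<Rightarrow> complex ^ 3"
  assumes linear_\<Psi>: "linear \<Psi>" and bij_\<Psi>: "bij \<Psi>"
begin

lemma \<Psi>_inv [simp]: "\<Psi> (inv \<Psi> y) = y" and inv_\<Psi> [simp]: "inv \<Psi> (\<Psi> v) = v"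
  using bij_\<Psi> by (simp_all add: bij_is_surj surj_f_inv_f bij_is_inj)

lemma \<Psi>_inject: "\<Psi> u = \<Psi> v \<longleftrightarrow> u = v"
  using bij_\<Psi> by (simp add: bij_is_inj inj_eq)

lemma linear_inv_\<Psi>: "linear (inv \<Psi>)"
proof (rule linearI)
  fix x y show "inv \<Psi> (x + y) = inv \<Psi> x + inv \<Psi> y"
    by (rule \<Psi>_inject[THEN iffD1]) (simp only: linear_add[OF linear_\<Psi>] \<Psi>_inv)
next
  fix r x show "inv \<Psi> (r *\<^sub>R x) = r *\<^sub>R inv \<Psi> x"
    by (rule \<Psi>_inject[THEN iffD1]) (simp only: linear_scale[OF linear_\<Psi>] \<Psi>_inv)
qed

definition jj :: "complex ^ 3 \<Rightarrow> complex ^ 3" where "jj v = inv \<Psi> (\<i> *s \<Psi> v)"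

text \<open>The circle acting diagonally in the coordinates \<Psi> with integer weights \<kappa>.
  All weights 1 give the rotation by the complex structure, which detects types.\<close>

definition rot :: "(3 \<Rightarrow> int) \<Rightarrow> real \<Rightarrow> complex ^ 3 \<Rightarrow> complex ^ 3" where
  "rot \<kappa> \<theta> v = inv \<Psi> (vec_lambda (\<lambda>i. cis (\<theta> * of_int (\<kappa> i)) * \<Psi> v $ i))"

lemma linear_rot: "linear (rot \<kappa> \<theta>)"
proof (rule linearI)
  fix x y show "rot \<kappa> \<theta> (x + y) = rot \<kappa> \<theta> x + rot \<kappa> \<theta> y"
    unfolding rot_def linear_add[OF linear_inv_\<Psi>, symmetric] linear_add[OF linear_\<Psi>]
    by (rule arg_cong[of _ _ "inv \<Psi>"]) (simp add: vec_eq_iff distrib_left)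
next
  fix r x show "rot \<kappa> \<theta> (r *\<^sub>R x) = r *\<^sub>R rot \<kappa> \<theta> x"
    unfolding rot_def linear_scale[OF linear_inv_\<Psi>, symmetric] linear_scale[OF linear_\<Psi>]
    by (rule arg_cong[of _ _ "inv \<Psi>"]) (simp add: vec_eq_iff)
qed

definition cov :: "bool \<times> 3 \<Rightarrow> complex ^ 3 \<Rightarrow> complex" where
  "cov c v = (if fst c then \<Psi> v $ snd c else cnj (\<Psi> v $ snd c))"

definition wt :: "(3 \<Rightarrow> int) \<Rightarrow> (bool \<times> 3) list \<Rightarrow> int" where
  "wt \<kappa> cs = (\<Sum>c\<leftarrow>cs. if fst c then \<kappa> (snd c) else - \<kappa> (snd c))"

lemma cov_rot: "cov c (rot \<kappa> \<theta> v) = cis (\<theta> * of_int (if fst c then \<kappa> (snd c) else - \<kappa> (snd c))) * cov c v"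
  by (simp add: cov_def rot_def cis_cnj)

lemma prod_cis_sum_list: "(\<Prod>i<length xs. cis (\<theta> * of_int (xs ! i))) = cis (\<theta> * of_int (sum_list xs))"
  by (induction xs) (simp_all add: prod.lessThan_Suc_shift cis_mult distrib_left del: prod.lessThan_Suc)

lemma wedge_cov_rot: "wedge (map cov cs) (map (rot \<kappa> \<theta>) vs) = cis (\<theta> * of_int (wt \<kappa> cs)) * wedge (map cov cs) vs"
proof -
  let ?w = "\<lambda>c. if fst c then \<kappa> (snd c) else - \<kappa> (snd c)"
  have "wedge (map cov cs) (map (rot \<kappa> \<theta>) vs) = (\<Prod>i<length (map cov cs). cis (\<theta> * of_int (map ?w cs ! i))) * wedge (map cov cs) vs"
    by (rule wedge_scale) (simp_all add: cov_rot)
  also have "(\<Prod>i<length (map cov cs). cis (\<theta> * of_int (map ?w cs ! i))) = cis (\<theta> * of_int (wt \<kappa> cs))"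
    using prod_cis_sum_list[of \<theta> "map ?w cs"] by (simp add: wt_def)
  finally show ?thesis .
qed

text \<open>Splits a real-linear function into its complex-linear and antilinear parts in each
  coordinate of \<Psi>.\<close>

lemma cov_dual:
  assumes g: "linear (g :: complex ^ 3 \<Rightarrow> complex)"
  shows "g v = (\<Sum>c\<in>UNIV. (g (inv \<Psi> (axis (snd c) 1)) + (if fst c then - \<i> else \<i>) * g (inv \<Psi> (axis (snd c) \<i>))) / 2 * cov c v)"
proof -
  let ?e = "\<lambda>i. inv \<Psi> (axis i 1)" and ?h = "\<lambda>i. inv \<Psi> (axis i \<i>)"
  have "\<Psi> v = (\<Sum>i\<in>UNIV. Re (\<Psi> v $ i) *\<^sub>R axis i 1 + Im (\<Psi> v $ i) *\<^sub>R axis i \<i>)"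
    by (simp add: vec_eq_iff forall_3 sum_3 axis_def complex_eq_iff)
  hence "inv \<Psi> (\<Psi> v) = inv \<Psi> (\<Sum>i\<in>UNIV. Re (\<Psi> v $ i) *\<^sub>R axis i 1 + Im (\<Psi> v $ i) *\<^sub>R axis i \<i>)"
    by (rule arg_cong)
  hence "g v = g (\<Sum>i\<in>UNIV. Re (\<Psi> v $ i) *\<^sub>R ?e i + Im (\<Psi> v $ i) *\<^sub>R ?h i)"
    by (simp only: inv_\<Psi> linear_sum[OF linear_inv_\<Psi>] linear_add[OF linear_inv_\<Psi>] linear_scale[OF linear_inv_\<Psi>])
  also have "\<dots> = (\<Sum>i\<in>UNIV. Re (\<Psi> v $ i) *\<^sub>R g (?e i) + Im (\<Psi> v $ i) *\<^sub>R g (?h i))"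
    by (simp only: linear_sum[OF g] linear_add[OF g] linear_scale[OF g])
  also have "\<dots> = (\<Sum>i\<in>UNIV. (g (?e i) - \<i> * g (?h i)) / 2 * \<Psi> v $ i + (g (?e i) + \<i> * g (?h i)) / 2 * cnj (\<Psi> v $ i))"
    by (intro sum.cong refl) (simp add: complex_eq_iff field_simps)
  also have "\<dots> = (\<Sum>b\<in>UNIV. \<Sum>i\<in>UNIV. (g (?e i) + (if b then - \<i> else \<i>) * g (?h i)) / 2 * cov (b, i) v)"
    by (simp add: UNIV_bool cov_def sum.distrib)
  also have "\<dots> = (\<Sum>c\<in>UNIV. (g (?e (snd c)) + (if fst c then - \<i> else \<i>) * g (?h (snd c))) / 2 * cov c v)"
    unfolding sum.cartesian_product by (simp add: UNIV_Times_UNIV[symmetric] split_beta del: UNIV_Times_UNIV)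
  finally show ?thesis .
qed

lemma cov_expansion: "alternating k f \<Longrightarrow> \<exists>coef. f = (\<lambda>vs. \<Sum>cs | length cs = k. coef cs * wedge (map cov cs) vs)"
  by (rule alternating_expansion[OF cov_dual])

text \<open>Projection onto weight m under the circle action, as a discrete Fourier sum. N sample
  points see weights only modulo N, so N has to exceed the differences of weights that
  occur.\<close>

definition four :: "(3 \<Rightarrow> int) \<Rightarrow> nat \<Rightarrow> int \<Rightarrow> ((complex ^ 3) list \<Rightarrow> complex) \<Rightarrow> (complex ^ 3) list \<Rightarrow> complex" where
  "four \<kappa> N m f vs = (\<Sum>l<N. cis (2 * pi * real l / real N * of_int (- m)) / of_nat N * f (map (rot \<kappa> (2 * pi * real l / real N)) vs))"

lemma four_eigen:
  assumes "\<And>\<theta> vs. f (map (rot \<kappa> \<theta>) vs) = cis (\<theta> * of_int n) * f vs" "N > 0"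
  shows "four \<kappa> N m f = (if int N dvd n - m then f else (\<lambda>vs. 0))"
proof
  fix vs
  have "four \<kappa> N m f vs = (\<Sum>l<N. cis (2 * pi * real l / real N * of_int (n - m)) * (f vs / of_nat N))"
  proof -
    have c: "cis (t * of_int (n - m)) = cis (t * of_int (- m)) * cis (t * of_int n)" for t
      unfolding cis_mult by (rule arg_cong[of _ _ cis]) (simp add: algebra_simps)
    show ?thesis unfolding four_def assms(1) c by (intro sum.cong refl) simp
  qed
  also have "\<dots> = (\<Sum>l<N. cis (2 * pi * real l / real N * of_int (n - m))) * (f vs / of_nat N)"
    by (rule sum_distrib_right[symmetric])
  finally show "four \<kappa> N m f vs = (if int N dvd n - m then f else (\<lambda>vs. 0)) vs"
    using assms(2) by (simp only: sum_cis_roots[OF assms(2)]) simp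
qed

lemma four_sum: "four \<kappa> N m (\<lambda>vs. \<Sum>i\<in>A. c i * f i vs) = (\<lambda>vs. \<Sum>i\<in>A. c i * four \<kappa> N m (f i) vs)"
proof
  fix vs
  have "four \<kappa> N m (\<lambda>vs. \<Sum>i\<in>A. c i * f i vs) vs = (\<Sum>l<N. \<Sum>i\<in>A. c i * (cis (2 * pi * real l / real N * of_int (- m)) / of_nat N * f i (map (rot \<kappa> (2 * pi * real l / real N)) vs)))"
    unfolding four_def sum_distrib_left by (intro sum.cong refl mult.left_commute)
  also have "\<dots> = (\<Sum>i\<in>A. c i * four \<kappa> N m (f i) vs)"
    unfolding four_def sum_distrib_left by (rule sum.swap)
  finally show "four \<kappa> N m (\<lambda>vs. \<Sum>i\<in>A. c i * f i vs) vs = (\<Sum>i\<in>A. c i * four \<kappa> N m (f i) vs)" .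
qed

lemma four_add: "four \<kappa> N m (\<lambda>vs. f vs + g vs) = (\<lambda>vs. four \<kappa> N m f vs + four \<kappa> N m g vs)"
  by (simp add: four_def fun_eq_iff distrib_left sum.distrib)

lemma four_cmult: "four \<kappa> N m (\<lambda>vs. c * f vs) = (\<lambda>vs. c * four \<kappa> N m f vs)"
  by (simp add: four_def fun_eq_iff sum_distrib_left ac_simps)

lemma alternating_four: "alternating k f \<Longrightarrow> alternating k (four \<kappa> N m f)"
  unfolding four_def by (intro alternating_sum alternating_cmult alternating_map linear_rot)

lemma four_wedge:
  assumes "N > 0"
  shows "four \<kappa> N m (wedge (map cov cs)) = (if int N dvd wt \<kappa> cs - m then wedge (map cov cs) else (\<lambda>vs. 0))"
  by (rule four_eigen[OF wedge_cov_rot assms])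

lemma cnj_four:
  assumes "\<And>vs. f vs \<in> \<real>" shows "cnj (four \<kappa> N m f vs) = four \<kappa> N (- m) f vs"
  using assms by (simp add: four_def Reals_cnj_iff cis_cnj)

text \<open>Each of the finitely many rotations is a bounded linear map, and a k-form picks up its
  bound k times.\<close>

lemma four_bound:
  "\<exists>C\<ge>0. \<forall>f M. alternating k f \<longrightarrow> M \<ge> 0 \<longrightarrow> (\<forall>vs. cmod (f vs) \<le> M * pn vs) \<longrightarrow> (\<forall>vs. cmod (four \<kappa> N m f vs) \<le> C * M * pn vs)"
proof -
  have "\<exists>B>0. \<forall>v. norm (rot \<kappa> (2 * pi * real l / real N) v) \<le> norm v * B" for l
    by (rule bounded_linear.pos_bounded[OF linear_conv_bounded_linear[THEN iffD1, OF linear_rot]])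
  hence "\<forall>l. \<exists>B. B > 0 \<and> (\<forall>v. norm (rot \<kappa> (2 * pi * real l / real N) v) \<le> norm v * B)" by (rule allI)
  from choice[OF this] obtain B where
    B0: "\<forall>l. B l > 0 \<and> (\<forall>v. norm (rot \<kappa> (2 * pi * real l / real N) v) \<le> norm v * B l)" by (elim exE)
  have B: "B l > 0" "norm (rot \<kappa> (2 * pi * real l / real N) v) \<le> B l * norm v" for l v
    using B0[THEN spec, of l] by (simp_all add: mult.commute)
  have pnB: "pn (map (rot \<kappa> (2 * pi * real l / real N)) vs) \<le> B l ^ length vs * pn vs" for l vs
  proof (induction vs)
    case (Cons v vs)
    have "pn (map (rot \<kappa> (2 * pi * real l / real N)) (v # vs)) \<le> (B l * norm v) * (B l ^ length vs * pn vs)"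
      unfolding list.map prod_list.Cons using B(1)[of l] by (intro mult_mono B(2) Cons.IH pn_nonneg) simp
    thus ?case by (simp add: ac_simps)
  qed simp
  define C where "C = (\<Sum>l<N. cmod (cis (2 * pi * real l / real N * of_int (- m)) / of_nat N) * B l ^ k)"
  have "C \<ge> 0" unfolding C_def using B(1) by (intro sum_nonneg mult_nonneg_nonneg) (auto simp: less_imp_le)
  moreover have "cmod (four \<kappa> N m f vs) \<le> C * M * pn vs"
    if f: "alternating k f" "M \<ge> 0" "\<forall>vs. cmod (f vs) \<le> M * pn vs" for f M vs
  proof (cases "length vs = k")
    case True
    have "cmod (four \<kappa> N m f vs) \<le> (\<Sum>l<N. cmod (cis (2 * pi * real l / real N * of_int (- m)) / of_nat N) * (M * (B l ^ k * pn vs)))"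
      unfolding four_def
    proof (rule order_trans[OF norm_sum sum_mono])
      fix l
      have "cmod (f (map (rot \<kappa> (2 * pi * real l / real N)) vs)) \<le> M * pn (map (rot \<kappa> (2 * pi * real l / real N)) vs)" using f(3) by blast
      also have "\<dots> \<le> M * (B l ^ k * pn vs)" using pnB[of l vs] True f(2) by (intro mult_left_mono) simp_all
      finally show "cmod (cis (2 * pi * real l / real N * of_int (- m)) / of_nat N * f (map (rot \<kappa> (2 * pi * real l / real N)) vs)) \<le>
        cmod (cis (2 * pi * real l / real N * of_int (- m)) / of_nat N) * (M * (B l ^ k * pn vs))"
        unfolding norm_mult by (rule mult_left_mono) simp
    qed
    also have "\<dots> = C * M * pn vs" unfolding C_def sum_distrib_right by (intro sum.cong refl) (simp only: mult_ac)
    finally show ?thesis .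
  next
    case False
    thus ?thesis using \<open>C \<ge> 0\<close> f(2) by (simp add: alternating_length[OF alternating_four[OF f(1)]])
  qed
  ultimately show ?thesis by (intro exI[of _ C] conjI allI impI)
qed

lemma four_nat_scale: "N > 0 \<Longrightarrow> int N dvd n \<Longrightarrow> \<bar>n\<bar> < int N \<Longrightarrow> n = 0"
  using dvd_imp_le_int[of n "int N"] by (rule_tac ccontr) simp

lemma rot_one: "rot (\<lambda>_. 1) \<theta> v = cos \<theta> *\<^sub>R v + sin \<theta> *\<^sub>R jj v"
proof -
  have "\<Psi> (cos \<theta> *\<^sub>R v + sin \<theta> *\<^sub>R jj v) = cos \<theta> *\<^sub>R \<Psi> v + sin \<theta> *\<^sub>R (\<i> *s \<Psi> v)"
    using linear_add[OF linear_\<Psi>] linear_scale[OF linear_\<Psi>] by (simp add: jj_def)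
  also have "\<dots> = vec_lambda (\<lambda>i. cis (\<theta> * of_int 1) * \<Psi> v $ i)"
    by (simp add: vec_eq_iff complex_eq_iff algebra_simps)
  finally have "inv \<Psi> (\<Psi> (cos \<theta> *\<^sub>R v + sin \<theta> *\<^sub>R jj v)) = rot (\<lambda>_. 1) \<theta> v" unfolding rot_def by (rule arg_cong)
  thus ?thesis by (simp only: inv_\<Psi>)
qed

text \<open>A (1,0)-covector is multiplied by the phase and a (0,1)-covector by its inverse, so a
  monomial of type (p,q) has weight p - q.\<close>

lemma covectors_pq_eigen:
  assumes "f \<in> covectors_pq jj p q"
  shows "f (map (rot (\<lambda>_. 1) \<theta>) vs) = cis (\<theta> * of_int (int p - int q)) * f vs"
  using assms unfolding covectors_pq_def
proof (induction rule: cspan.span_induct_alt)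
  case base show ?case by simp
next
  case (step c f g)
  then obtain as bs where f: "f = wedge (as @ bs)" "length as = p" "length bs = q"
    "set as \<subseteq> covectors10 jj" "set bs \<subseteq> covectors01 jj" by blast
  let ?h = "\<lambda>i. if i < p then cis \<theta> else cis (- \<theta>)"
  have "wedge (as @ bs) (map (rot (\<lambda>_. 1) \<theta>) vs) = (\<Prod>i<length (as @ bs). ?h i) * wedge (as @ bs) vs"
  proof (rule wedge_scale)
    fix i v assume i: "i < length (as @ bs)"
    let ?L = "(as @ bs) ! i"
    have rs: "r *\<^sub>R z = complex_of_real r * z" for r z by (simp add: scaleR_conv_of_real)
    have rot: "?L (rot (\<lambda>_. 1) \<theta> v) = of_real (cos \<theta>) * ?L v + of_real (sin \<theta>) * ?L (jj v)" if "linear ?L"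
      by (simp only: rot_one linear_add[OF that] linear_scale[OF that] rs)
    have c: "cis \<theta> = of_real (cos \<theta>) + of_real (sin \<theta>) * \<i>" "cis (- \<theta>) = of_real (cos \<theta>) + of_real (sin \<theta>) * (- \<i>)"
      by (simp_all add: complex_eq_iff)
    show "?L (rot (\<lambda>_. 1) \<theta> v) = ?h i * ?L v"
    proof (cases "i < p")
      case True
      hence "?L \<in> covectors10 jj" using f by (auto simp: nth_append)
      hence "linear ?L" "?L (jj v) = \<i> * ?L v" by (auto simp: covectors10_def)
      thus ?thesis using True by (simp only: rot c distrib_right mult.assoc if_True)
    next
      case False
      hence "?L \<in> covectors01 jj" using f i by (auto simp: nth_append)
      hence "linear ?L" "?L (jj v) = - \<i> * ?L v" by (auto simp: covectors01_def)
      thus ?thesis using False by (simp only: rot c distrib_right mult.assoc if_False)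
    qed
  qed simp
  also have "(\<Prod>i<length (as @ bs). ?h i) = cis (\<theta> * of_int (int p - int q))"
  proof -
    have "(\<Prod>i<p + n. ?h i) = cis (\<theta> * of_int (int p - int n))" for n
    proof (induction n)
      case 0
      have "(\<Prod>i<p. ?h i) = cis \<theta> ^ p" by simp
      thus ?case by (simp add: Complex.DeMoivre mult.commute)
    next
      case (Suc n) thus ?case by (simp add: cis_mult algebra_simps)
    qed
    from this[of q] show ?thesis using f by simp
  qed
  finally show ?case using step f by (simp add: distrib_left ac_simps)
qed

lemma linear_cov: "linear (cov c)"
proof -
  have "linear (\<lambda>v. \<Psi> v $ i)" for i using linear_add[OF linear_\<Psi>] linear_scale[OF linear_\<Psi>] by (intro linearI) auto
  moreover from this have "linear (\<lambda>v. cnj (\<Psi> v $ i))" for i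
    by (simp add: linear_iff)
  ultimately show ?thesis by (cases "fst c") (simp_all add: cov_def[abs_def])
qed

lemma cov_jj: "cov c (jj v) = (if fst c then \<i> else - \<i>) * cov c v"
  by (simp add: cov_def jj_def)

text \<open>The converse: expand in monomials and keep those of weight p - q. In the fixed degree p
  + q the weight determines the type.\<close>

lemma eigen_covectors_pq:
  assumes f: "alternating (p + q) f"
    and eig: "\<And>\<theta> vs. f (map (rot (\<lambda>_. 1) \<theta>) vs) = cis (\<theta> * of_int (int p - int q)) * f vs"
  shows "f \<in> covectors_pq jj p q"
proof -
  \<comment> \<open>Weights in degree p + q lie between -(p + q) and p + q, so their differences
    stay below N.\<close>
  define N where "N = 2 * (p + q) + 1"
  have N: "N > 0" by (simp add: N_def)
  let ?S = "{wedge (as @ bs) | as bs. length as = p \<and> length bs = q \<and>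
        set as \<subseteq> covectors10 jj \<and> set bs \<subseteq> covectors01 jj}"
  obtain coef where coef: "f = (\<lambda>vs. \<Sum>cs | length cs = p + q. coef cs * wedge (map cov cs) vs)"
    using cov_expansion[OF f] by blast
  have mem: "four (\<lambda>_. 1) N (int p - int q) (wedge (map cov cs)) \<in> cspan.span ?S" if len: "length cs = p + q" for cs
  proof (cases "int N dvd wt (\<lambda>_. 1) cs - (int p - int q)")
    case True
    define P where "P = length (filter fst cs)" 
    define Q where "Q = length (filter (\<lambda>c. \<not> fst c) cs)"
    have PQ: "P + Q = p + q" unfolding P_def Q_def using sum_length_filter_compl[of fst cs] len by simp
    have w: "wt (\<lambda>_. 1) cs = int P - int Q" unfolding P_def Q_def wt_def by (induction cs) auto
    have PQ': "int P + int Q = int p + int q" using PQ by (simp flip: of_nat_add)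
    have "\<bar>wt (\<lambda>_. 1) cs - (int p - int q)\<bar> < int N" unfolding w N_def using PQ' by (auto simp: abs_less_iff)
    from four_nat_scale[OF N True this] have "int P - int Q = int p - int q" unfolding w by simp
    hence "P = p" "Q = q" using PQ' by linarith+
    let ?as = "map cov (filter fst cs)" and ?bs = "map cov (filter (\<lambda>c. \<not> fst c) cs)"
    \<comment> \<open>Reordering puts the (1,0)-covectors first, as the definition of
      \<open>covectors_pq\<close> demands, and changes the wedge only by a scalar.\<close>
    have "mset (map cov cs) = mset (?as @ ?bs)"
      by (simp flip: image_mset_union add: multiset_partition[symmetric])
    then obtain c where c: "wedge (map cov cs) = (\<lambda>vs. c * wedge (?as @ ?bs) vs)" by (rule wedge_mset)
    have "wedge (?as @ ?bs) \<in> ?S"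
      using \<open>P = p\<close> \<open>Q = q\<close> unfolding P_def Q_def
      by (intro CollectI exI[of _ ?as] exI[of _ ?bs]) (auto simp: covectors10_def covectors01_def linear_cov cov_jj)
    hence "wedge (map cov cs) \<in> cspan.span ?S" unfolding c by (intro cspan.span_scale cspan.span_base)
    thus ?thesis using True by (simp add: four_wedge[OF N])
  next
    case False
    thus ?thesis using cspan.span_zero[of ?S] by (simp add: four_wedge[OF N] zero_fun_def)
  qed
  have "f = four (\<lambda>_. 1) N (int p - int q) f" using four_eigen[OF eig N, of "int p - int q"] by simp
  also have "\<dots> = (\<lambda>vs. \<Sum>cs | length cs = p + q. coef cs * four (\<lambda>_. 1) N (int p - int q) (wedge (map cov cs)) vs)"
    by (subst coef) (rule four_sum)
  also have "\<dots> = (\<Sum>cs | length cs = p + q. (\<lambda>vs. coef cs * four (\<lambda>_. 1) N (int p - int q) (wedge (map cov cs)) vs))"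
  proof -
    have "(\<Sum>i\<in>A. h i) vs = (\<Sum>i\<in>A. h i vs)" for A :: "(bool \<times> 3) list set" and h :: "_ \<Rightarrow> (complex ^ 3) list \<Rightarrow> complex" and vs
      by (induction A rule: infinite_finite_induct) auto
    thus ?thesis by (simp add: fun_eq_iff)
  qed
  also have "\<dots> \<in> cspan.span ?S"
    by (intro cspan.span_sum cspan.span_scale mem) simp
  finally show ?thesis unfolding covectors_pq_def .
qed

end

section \<open>Splitting the left-invariant complex\<close>

lemma ce_d_sum:
  "ce_d (\<lambda>vs. \<Sum>i\<in>A. c i * f i vs) = (\<lambda>vs. \<Sum>i\<in>A. c i * ce_d (f i) vs)"
proof
  fix vs
  have "ce_d (\<lambda>vs. \<Sum>i\<in>A. c i * f i vs) vs =
    - (\<Sum>n<length vs. \<Sum>i\<in>A. c i * ((- 1) ^ n * slot_sum (bet (vs ! n)) (f i) (del n vs)))"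
  proof -
    have "slot_sum C (\<lambda>vs. \<Sum>i\<in>A. c i * f i vs) ws = (\<Sum>i\<in>A. c i * slot_sum C (f i) ws)" for C ws
      unfolding slot_sum_def sum_distrib_left by (rule sum.swap)
    thus ?thesis unfolding ce_d_def antisymmetrize_def by (simp only: sum_distrib_left mult.left_commute)
  qed
  also have "\<dots> = (\<Sum>i\<in>A. c i * ce_d (f i) vs)"
    unfolding sum.swap[of _ A] by (simp add: ce_d_def antisymmetrize_def sum_distrib_left sum_negf)
  finally show "ce_d (\<lambda>vs. \<Sum>i\<in>A. c i * f i vs) vs = (\<Sum>i\<in>A. c i * ce_d (f i) vs)" .
qed

lemma ce_d_diff: "ce_d (\<lambda>vs. f vs - g vs) = (\<lambda>vs. ce_d f vs - ce_d g vs)"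
  by (simp add: ce_d_def antisymmetrize_def slot_sum_def fun_eq_iff sum_subtractf right_diff_distrib)

lemma ce_d_zero [simp]: "ce_d (\<lambda>vs. 0) = (\<lambda>vs. 0)"
  by (simp add: ce_d_def antisymmetrize_def slot_sum_def)

text \<open>\<open>ce_d\<close> is built from \<open>bet\<close> alone, so it commutes with
  substitutions that preserve \<open>bet\<close>.\<close>

lemma ce_d_map:
  assumes "\<And>u v. bet (U u) (U v) = U (bet u v)"
  shows "ce_d (\<lambda>vs. f (map U vs)) vs = ce_d f (map U vs)"
proof -
  have "slot_sum (bet (U v)) f (map U ws) = slot_sum (bet v) (\<lambda>vs. f (map U vs)) ws" for v ws
    unfolding slot_sum_def by (intro sum.cong) (simp_all add: map_update assms)
  thus ?thesis unfolding ce_d_def antisymmetrize_def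
    by (simp add: take_map drop_map flip: map_append)
qed

text \<open>In complex dimension 3 the difference \<bar>p - q\<bar> is 0 or 2 in even degree and 1
  or 3 in odd degree. This is the larger value; the smaller one is \<open>k mod 2\<close>.\<close>

definition thr :: "nat \<Rightarrow> nat" where "thr k = (if even k then 2 else 3)"

lemma unordered_pairs_finite [simp]: "finite (unordered_pairs k)"
  by (rule finite_subset[of _ "{..k} \<times> {..k}"]) (auto simp: unordered_pairs_def)

context frame_iso
begin

section \<open>Two gradings of the monomials: by type and by automorphism weight\<close>

abbreviation \<kappa>t :: "3 \<Rightarrow> int" where "\<kappa>t \<equiv> \<lambda>_. 1"
abbreviation \<kappa>g :: "3 \<Rightarrow> int" where "\<kappa>g \<equiv> \<lambda>i. if i = 3 then 2 else 1"

text \<open>For d = 0 the two weights coincide and are counted once. The modulus 2 k + 9 exceeds all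
  differences of weights compared below: monomial weights are at most 3 or 4 in absolute value, and
  \<bar>p - q\<bar> is at most k.\<close>

definition comp :: "nat \<Rightarrow> nat \<Rightarrow> ((complex ^ 3) list \<Rightarrow> complex) \<Rightarrow> (complex ^ 3) list \<Rightarrow> complex" where
  "comp k d f = (if d = 0 then four \<kappa>t (2 * k + 9) 0 f
     else (\<lambda>vs. four \<kappa>t (2 * k + 9) (int d) f vs + four \<kappa>t (2 * k + 9) (- int d) f vs))"

text \<open>The bound 4 = 1 + 1 + 2 is the largest weight of a monomial under \<kappa>g.\<close>

definition weights :: "nat \<Rightarrow> int set" where "weights k = {m \<in> {-4..4}. \<bar>m\<bar> \<ge> int (thr k)}"

text \<open>Built from the weights of \<kappa>g alone, hence compatible with the differential
  whenever these rotations preserve \<open>bet\<close>.\<close>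

definition Qop :: "nat \<Rightarrow> ((complex ^ 3) list \<Rightarrow> complex) \<Rightarrow> (complex ^ 3) list \<Rightarrow> complex" where
  "Qop k f = (\<lambda>vs. \<Sum>m\<in>weights k. four \<kappa>g (2 * k + 9) m f vs)"

lemma finite_weights [simp]: "finite (weights k)"
  by (rule finite_subset[of _ "{-4..4}"]) (auto simp: weights_def)

text \<open>Only six covectors exist, so a monomial without repetitions is a subset of six elements.
  Weight and degree become sums over membership, which a case distinction can decide.\<close>

lemma wt_distinct:
  assumes "distinct cs"
  shows "wt \<kappa> cs = (\<Sum>i\<in>UNIV. (if (True, i) \<in> set cs then \<kappa> i else 0) - (if (False, i) \<in> set cs then \<kappa> i else 0))"
    and "int (length cs) = (\<Sum>i\<in>UNIV. (if (True, i) \<in> set cs then 1 else 0) + (if (False, i) \<in> set cs then 1 else 0))"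
proof -
  have g: "(\<Sum>c\<in>set cs. g c) = (\<Sum>i\<in>UNIV. (if (True, i) \<in> set cs then g (True, i) else 0) + (if (False, i) \<in> set cs then g (False, i) else 0))"
    for g :: "bool \<times> 3 \<Rightarrow> int"
  proof -
    have "(\<Sum>c\<in>set cs. g c) = (\<Sum>c\<in>UNIV. if c \<in> set cs then g c else 0)"
      by (simp add: sum.If_cases)
    also have "\<dots> = (\<Sum>b\<in>UNIV. \<Sum>i\<in>UNIV. if (b, i) \<in> set cs then g (b, i) else 0)"
      unfolding sum.cartesian_product UNIV_Times_UNIV by (rule sum.cong) auto
    finally show ?thesis by (simp add: UNIV_bool sum.distrib add.commute)
  qed
  have "wt \<kappa> cs = (\<Sum>c\<in>set cs. if fst c then \<kappa> (snd c) else - \<kappa> (snd c))"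
    unfolding wt_def using assms by (rule sum_list_distinct_conv_sum_set)
  thus "wt \<kappa> cs = (\<Sum>i\<in>UNIV. (if (True, i) \<in> set cs then \<kappa> i else 0) - (if (False, i) \<in> set cs then \<kappa> i else 0))"
    unfolding g by (simp add: if_distrib[of uminus] diff_conv_add_uminus cong: if_cong)
  have "int (length cs) = (\<Sum>c\<in>set cs. 1)" using assms by (simp add: distinct_card)
  thus "int (length cs) = (\<Sum>i\<in>UNIV. (if (True, i) \<in> set cs then 1 else 0) + (if (False, i) \<in> set cs then 1 else 0))"
    unfolding g by simp
qed

text \<open>In every degree, the weight of a monomial under the circle of automorphisms given by
  \<open>\<kappa>g\<close> decides whether its types p, q are as close to each other as possible.\<close>

lemma weight_type:
  assumes "distinct cs" "length cs = k"
  shows "\<bar>wt \<kappa>g cs\<bar> \<le> 4" "\<bar>wt \<kappa>t cs\<bar> \<le> 3"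
    "\<bar>wt \<kappa>g cs\<bar> \<ge> int (thr k) \<longleftrightarrow> \<bar>wt \<kappa>t cs\<bar> = int (thr k)"
    "\<bar>wt \<kappa>g cs\<bar> < int (thr k) \<longleftrightarrow> \<bar>wt \<kappa>t cs\<bar> = int (k mod 2)"
proof -
  let ?P = "\<lambda>b i. (b, i) \<in> set cs"
  have k: "k = nat (int (length cs))" using assms(2) by simp
  \<comment> \<open>All 64 subsets of the six covectors are checked.\<close>
  have *: "\<bar>wt \<kappa>g cs\<bar> \<le> 4 \<and> \<bar>wt \<kappa>t cs\<bar> \<le> 3 \<and>
    (\<bar>wt \<kappa>g cs\<bar> \<ge> int (thr k) \<longleftrightarrow> \<bar>wt \<kappa>t cs\<bar> = int (thr k)) \<and>
    (\<bar>wt \<kappa>g cs\<bar> < int (thr k) \<longleftrightarrow> \<bar>wt \<kappa>t cs\<bar> = int (k mod 2))"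
    unfolding k wt_distinct[OF assms(1)] sum_3 thr_def
    by (cases "?P True 1"; cases "?P True 2"; cases "?P True 3";
        cases "?P False 1"; cases "?P False 2"; cases "?P False 3"; simp)
  thus "\<bar>wt \<kappa>g cs\<bar> \<le> 4" "\<bar>wt \<kappa>t cs\<bar> \<le> 3"
    "\<bar>wt \<kappa>g cs\<bar> \<ge> int (thr k) \<longleftrightarrow> \<bar>wt \<kappa>t cs\<bar> = int (thr k)"
    "\<bar>wt \<kappa>g cs\<bar> < int (thr k) \<longleftrightarrow> \<bar>wt \<kappa>t cs\<bar> = int (k mod 2)" by blast+
qed

lemma dvd_small: "int (2 * k + 9) dvd n \<Longrightarrow> \<bar>n\<bar> < int (2 * k + 9) \<Longrightarrow> n = 0"
  by (rule four_nat_scale[of "2 * k + 9" n]) simp_all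

lemma four_zero_fun [simp]: "four \<kappa> N m (\<lambda>vs. 0) = (\<lambda>vs. 0)"
  by (simp add: four_def fun_eq_iff)

lemma Qop_zero_fun [simp]: "Qop k (\<lambda>vs. 0) = (\<lambda>vs. 0)"
  by (simp add: Qop_def)

lemma comp_mono:
  assumes "length cs = k" "d \<le> k + 3"
  shows "comp k d (wedge (map cov cs)) = (if \<bar>wt \<kappa>t cs\<bar> = int d then wedge (map cov cs) else (\<lambda>vs. 0))"
proof (cases "distinct cs")
  case True
  note w = weight_type(2)[OF True assms(1)]
  have "int (2 * k + 9) dvd wt \<kappa>t cs - m \<longleftrightarrow> wt \<kappa>t cs = m" if "\<bar>m\<bar> \<le> int k + 3" for m
    using dvd_small[of k "wt \<kappa>t cs - m"] w that by fastforce
  hence "four \<kappa>t (2 * k + 9) m (wedge (map cov cs)) = (if wt \<kappa>t cs = m then wedge (map cov cs) else (\<lambda>vs. 0))"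
    if "\<bar>m\<bar> \<le> int k + 3" for m using that by (simp add: four_wedge)
  thus ?thesis using assms(2) by (auto simp: comp_def)
next
  case False
  hence "wedge (map cov cs) = (\<lambda>vs. 0)" by (intro ext wedge_not_distinct) (simp add: distinct_map)
  thus ?thesis by (simp add: comp_def)
qed

text \<open>Here \<open>weight_type\<close> turns a condition on graded weights into one on
  types.\<close>

lemma Qop_mono:
  assumes "length cs = k"
  shows "Qop k (wedge (map cov cs)) = (if \<bar>wt \<kappa>t cs\<bar> = int (thr k) then wedge (map cov cs) else (\<lambda>vs. 0))"
proof (cases "distinct cs")
  case True
  note w = weight_type[OF True assms]
  have "int (2 * k + 9) dvd wt \<kappa>g cs - m \<longleftrightarrow> wt \<kappa>g cs = m" if "m \<in> weights k" for m
    using dvd_small[of k "wt \<kappa>g cs - m"] w(1) that by (fastforce simp: weights_def)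
  hence "four \<kappa>g (2 * k + 9) m (wedge (map cov cs)) = (\<lambda>vs. if wt \<kappa>g cs = m then wedge (map cov cs) vs else 0)"
    if "m \<in> weights k" for m using that by (simp add: four_wedge)
  hence "Qop k (wedge (map cov cs)) = (\<lambda>vs. \<Sum>m\<in>weights k. if wt \<kappa>g cs = m then wedge (map cov cs) vs else 0)"
    unfolding Qop_def by (intro ext sum.cong refl) simp
  also have "\<dots> = (if wt \<kappa>g cs \<in> weights k then wedge (map cov cs) else (\<lambda>vs. 0))"
    by (simp add: fun_eq_iff)
  finally show ?thesis using w by (simp add: weights_def abs_le_iff)
next
  case False
  hence "wedge (map cov cs) = (\<lambda>vs. 0)" by (intro ext wedge_not_distinct) (simp add: distinct_map)
  thus ?thesis by (simp add: Qop_def)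
qed

lemma comp_sum: "comp k d (\<lambda>vs. \<Sum>i\<in>A. c i * f i vs) = (\<lambda>vs. \<Sum>i\<in>A. c i * comp k d (f i) vs)"
  by (simp add: comp_def four_sum sum.distrib distrib_left)

lemma Qop_sum: "Qop k (\<lambda>vs. \<Sum>i\<in>A. c i * f i vs) = (\<lambda>vs. \<Sum>i\<in>A. c i * Qop k (f i) vs)"
proof
  fix vs
  show "Qop k (\<lambda>vs. \<Sum>i\<in>A. c i * f i vs) vs = (\<Sum>i\<in>A. c i * Qop k (f i) vs)"
    unfolding Qop_def four_sum sum_distrib_left by (rule sum.swap)
qed

text \<open>Monomials span, so operators compatible with linear combinations need only be compared
  on them.\<close>

lemma operator_eqI:
  assumes f: "alternating k f"
    and S: "\<And>(A :: (bool \<times> 3) list set) c f. S (\<lambda>vs. \<Sum>i\<in>A. c i * f i vs) = (\<lambda>vs. \<Sum>i\<in>A. c i * S (f i) vs)"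
    and T: "\<And>(A :: (bool \<times> 3) list set) c f. T (\<lambda>vs. \<Sum>i\<in>A. c i * f i vs) = (\<lambda>vs. \<Sum>i\<in>A. c i * T (f i) vs)"
    and eq: "\<And>cs. length cs = k \<Longrightarrow> S (wedge (map cov cs)) = T (wedge (map cov cs))"
  shows "S f = T f"
proof -
  obtain coef where e: "f = (\<lambda>vs. \<Sum>cs | length cs = k. coef cs * wedge (map cov cs) vs)"
    using cov_expansion[OF f] by blast
  have "S f = (\<lambda>vs. \<Sum>cs | length cs = k. coef cs * S (wedge (map cov cs)) vs)"
    unfolding e by (rule S)
  also have "\<dots> = (\<lambda>vs. \<Sum>cs | length cs = k. coef cs * T (wedge (map cov cs)) vs)"
    by (intro ext sum.cong refl) (simp add: eq)
  also have "\<dots> = T f" unfolding e by (rule T[symmetric])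
  finally show ?thesis .
qed

text \<open>For \<open>d = p - q\<close>, the projector of k-forms onto the types (p,q) and (q,p), extended
  to all degrees as an operator commuting with the differential.\<close>

definition Pr :: "nat \<Rightarrow> nat \<Rightarrow> ((complex ^ 3) list \<Rightarrow> complex) \<Rightarrow> (complex ^ 3) list \<Rightarrow> complex" where
  "Pr k d f = (\<lambda>vs. if d = thr k then Qop k f vs else if d = k mod 2 then f vs - Qop k f vs else 0)"

lemma Pr_alt: "Pr k d f = (if d = thr k then Qop k f else if d = k mod 2 then (\<lambda>vs. f vs - Qop k f vs) else (\<lambda>vs. 0))"
  by (simp add: Pr_def fun_eq_iff)

lemma Pr_sum: "Pr k d (\<lambda>vs. \<Sum>i\<in>A. c i * f i vs) = (\<lambda>vs. \<Sum>i\<in>A. c i * Pr k d (f i) vs)"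
  by (simp add: Pr_def Qop_sum fun_eq_iff sum_subtractf right_diff_distrib)

lemma Pr_comp:
  assumes "alternating k f" "d \<le> k" shows "Pr k d f = comp k d f"
proof (rule operator_eqI[OF assms(1), where S = "Pr k d" and T = "comp k d"])
  fix cs :: "(bool \<times> 3) list" assume l: "length cs = k"
  show "Pr k d (wedge (map cov cs)) = comp k d (wedge (map cov cs))"
  proof (cases "distinct cs")
    case True
    note w = weight_type[OF True l]
    have "\<bar>wt \<kappa>t cs\<bar> = int (thr k) \<or> \<bar>wt \<kappa>t cs\<bar> = int (k mod 2)" using w by linarith
    moreover have "thr k \<noteq> k mod 2" by (auto simp: thr_def)
    ultimately show ?thesis using comp_mono[OF l, of d] assms(2) Qop_mono[OF l]
      by (auto simp: Pr_def fun_eq_iff)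
  next
    case False
    hence "wedge (map cov cs) = (\<lambda>vs. 0)" by (intro ext wedge_not_distinct) (simp add: distinct_map)
    thus ?thesis by (simp add: comp_def Pr_alt)
  qed
qed (rule Pr_sum comp_sum)+

lemma sum_Pr:
  assumes f: "alternating k f"
  shows "(\<Sum>(p, q)\<in>unordered_pairs k. Pr k (p - q) f vs) = f vs"
proof -
  let ?S = "\<lambda>f vs. \<Sum>i\<in>unordered_pairs k. Pr k (fst i - snd i) f vs"
  have "?S f = f"
  proof (rule operator_eqI[OF f, where S = ?S and T = "\<lambda>f. f"])
    fix A :: "(bool \<times> 3) list set" and c f
    show "?S (\<lambda>vs. \<Sum>i\<in>A. c i * f i vs) = (\<lambda>vs. \<Sum>i\<in>A. c i * ?S (f i) vs)"
      unfolding Pr_sum sum_distrib_left by (rule ext) (rule sum.swap)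
  next
    fix cs :: "(bool \<times> 3) list" assume l: "length cs = k"
    define P where "P = length (filter fst cs)"
    define Q where "Q = length (filter (\<lambda>c. \<not> fst c) cs)"
    have PQ: "P + Q = k" unfolding P_def Q_def using sum_length_filter_compl[of fst cs] l by simp
    have w: "wt \<kappa>t cs = int P - int Q" unfolding P_def Q_def wt_def by (induction cs) auto
    have c: "comp k (fst i - snd i) (wedge (map cov cs)) = (if i = (max P Q, min P Q) then wedge (map cov cs) else (\<lambda>vs. 0))"
      if "i \<in> unordered_pairs k" for i
    proof -
      have i: "fst i + snd i = k" "snd i \<le> fst i" using that by (auto simp: unordered_pairs_def)
      \<comment> \<open>A monomial of type (P,Q) belongs to exactly one unordered pair.\<close>
      have "\<bar>wt \<kappa>t cs\<bar> = int (fst i - snd i) \<longleftrightarrow> i = (max P Q, min P Q)"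
        unfolding w using i PQ by (auto simp: prod_eq_iff max_def min_def)
      thus ?thesis using comp_mono[OF l, of "fst i - snd i"] i by simp
    qed
    have m: "(max P Q, min P Q) \<in> unordered_pairs k" using PQ by (auto simp: unordered_pairs_def)
    have pc: "Pr k (fst i - snd i) (wedge (map cov cs)) = comp k (fst i - snd i) (wedge (map cov cs))"
      if "i \<in> unordered_pairs k" for i
    proof -
      have d: "fst i - snd i \<le> k" using that by (auto simp: unordered_pairs_def)
      show ?thesis
      proof (cases "distinct cs")
        case True
        note w = weight_type[OF True l]
        have "\<bar>wt \<kappa>t cs\<bar> = int (thr k) \<or> \<bar>wt \<kappa>t cs\<bar> = int (k mod 2)" using w by linarith
        moreover have "thr k \<noteq> k mod 2" by (auto simp: thr_def)
        ultimately show ?thesis using comp_mono[OF l, of "fst i - snd i"] d Qop_mono[OF l]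
          by (auto simp: Pr_def fun_eq_iff)
      next
        case False
        hence "wedge (map cov cs) = (\<lambda>vs. 0)" by (intro ext wedge_not_distinct) (simp add: distinct_map)
        thus ?thesis by (simp add: comp_def Pr_alt)
      qed
    qed
    have "?S (wedge (map cov cs)) = (\<lambda>vs. \<Sum>i\<in>unordered_pairs k. if i = (max P Q, min P Q) then wedge (map cov cs) vs else 0)"
      by (intro ext sum.cong refl) (simp add: pc c)
    thus "?S (wedge (map cov cs)) = wedge (map cov cs)" using m by (simp add: fun_eq_iff)
  qed simp
  thus ?thesis by (simp add: split_beta fun_eq_iff)
qed

lemma alternating_Pr: "alternating l f \<Longrightarrow> alternating l (Pr k d f)"
  unfolding Pr_alt Qop_def by (simp add: alternating_sum alternating_four alternating_diff alternating_zero)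

lemma Pr_add: "Pr k d (\<lambda>vs. f vs + g vs) = (\<lambda>vs. Pr k d f vs + Pr k d g vs)"
  by (simp add: Pr_def Qop_def four_add sum.distrib fun_eq_iff)

lemma Pr_cmult: "Pr k d (\<lambda>vs. c * f vs) = (\<lambda>vs. c * Pr k d f vs)"
  by (simp add: Pr_def Qop_def four_cmult sum_distrib_left fun_eq_iff right_diff_distrib)

text \<open>Conjugation exchanges the weights m and -m, and \<open>weights k\<close> is
  symmetric.\<close>

lemma Pr_real:
  assumes "\<And>vs. f vs \<in> \<real>" shows "Pr k d f vs \<in> \<real>"
proof -
  have "cnj (Qop k f vs) = (\<Sum>m\<in>weights k. four \<kappa>g (2 * k + 9) (- m) f vs)"
    by (simp add: Qop_def cnj_four[OF assms])
  also have "\<dots> = Qop k f vs" unfolding Qop_def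
    by (rule sum.reindex_bij_witness[of _ uminus uminus]) (auto simp: weights_def)
  finally have "Qop k f vs \<in> \<real>" by (simp add: Reals_cnj_iff)
  thus ?thesis using assms by (simp add: Pr_def)
qed

lemma Pr_bound:
  "\<exists>C\<ge>0. \<forall>f M. alternating l f \<longrightarrow> M \<ge> 0 \<longrightarrow> (\<forall>vs. cmod (f vs) \<le> M * pn vs) \<longrightarrow> (\<forall>vs. cmod (Pr k d f vs) \<le> C * M * pn vs)"
proof -
  have "\<forall>m. \<exists>C. C \<ge> 0 \<and> (\<forall>f M. alternating l f \<longrightarrow> M \<ge> 0 \<longrightarrow> (\<forall>vs. cmod (f vs) \<le> M * pn vs) \<longrightarrow> (\<forall>vs. cmod (four \<kappa>g (2 * k + 9) m f vs) \<le> C * M * pn vs))"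
    using four_bound by (intro allI)
  from choice[OF this] obtain C where "\<forall>m. C m \<ge> 0 \<and> (\<forall>f M. alternating l f \<longrightarrow> M \<ge> 0 \<longrightarrow> (\<forall>vs. cmod (f vs) \<le> M * pn vs) \<longrightarrow> (\<forall>vs. cmod (four \<kappa>g (2 * k + 9) m f vs) \<le> C m * M * pn vs))"
    by (elim exE)
  hence C: "C m \<ge> 0" "alternating l f \<Longrightarrow> M \<ge> 0 \<Longrightarrow> (\<And>vs. cmod (f vs) \<le> M * pn vs) \<Longrightarrow> cmod (four \<kappa>g (2 * k + 9) m f vs) \<le> C m * M * pn vs" for m f M vs
    by simp_all
  define D where "D = 1 + (\<Sum>m\<in>weights k. C m)"
  have s0: "(\<Sum>m\<in>weights k. C m) \<ge> 0" by (intro sum_nonneg C)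
  have "cmod (Pr k d f vs) \<le> D * M * pn vs" if f: "alternating l f" "M \<ge> 0" "\<forall>vs. cmod (f vs) \<le> M * pn vs" for f M vs
  proof -
    have q: "cmod (Qop k f vs) \<le> (\<Sum>m\<in>weights k. C m) * M * pn vs"
    proof -
      have "cmod (Qop k f vs) \<le> (\<Sum>m\<in>weights k. C m * M * pn vs)"
        unfolding Qop_def by (rule order_trans[OF norm_sum sum_mono[OF C(2)]]) (use f in auto)
      thus ?thesis by (simp add: sum_distrib_right)
    qed
    have f': "cmod (f vs) \<le> M * pn vs" "0 \<le> M * pn vs" "0 \<le> (\<Sum>m\<in>weights k. C m) * M * pn vs"
      using f s0 by simp_all
    have e: "D * M * pn vs = M * pn vs + (\<Sum>m\<in>weights k. C m) * M * pn vs" by (simp add: D_def algebra_simps)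
    have "cmod (Pr k d f vs) \<le> cmod (f vs) + cmod (Qop k f vs)"
      using norm_triangle_ineq4[of "f vs" "Qop k f vs"] by (simp add: Pr_def)
    thus ?thesis using q f' unfolding e by linarith
  qed
  moreover have "D \<ge> 0" using s0 by (simp add: D_def)
  ultimately show ?thesis by (intro exI[of _ D] conjI allI impI)
qed

text \<open>On monomials the modulus is large enough for the projection to keep precisely the weight
  m and not only its residue class.\<close>

lemma four_type:
  assumes "alternating k f" "\<bar>m\<bar> \<le> int k"
  shows "four \<kappa>t (2 * k + 9) m f (map (rot \<kappa>t \<theta>) vs) = cis (\<theta> * of_int m) * four \<kappa>t (2 * k + 9) m f vs"
proof -
  let ?F = "four \<kappa>t (2 * k + 9) m"
  have "(\<lambda>vs. ?F f (map (rot \<kappa>t \<theta>) vs)) = (\<lambda>vs. cis (\<theta> * of_int m) * ?F f vs)"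
  proof (rule operator_eqI[OF assms(1), where S = "\<lambda>f vs. ?F f (map (rot \<kappa>t \<theta>) vs)" and T = "\<lambda>f vs. cis (\<theta> * of_int m) * ?F f vs"])
    fix cs :: "(bool \<times> 3) list" assume l: "length cs = k"
    show "(\<lambda>vs. ?F (wedge (map cov cs)) (map (rot \<kappa>t \<theta>) vs)) = (\<lambda>vs. cis (\<theta> * of_int m) * ?F (wedge (map cov cs)) vs)"
    proof (cases "distinct cs")
      case True
      have "int (2 * k + 9) dvd wt \<kappa>t cs - m \<Longrightarrow> wt \<kappa>t cs = m"
        using dvd_small[of k "wt \<kappa>t cs - m"] weight_type(2)[OF True l] assms(2) by fastforce
      thus ?thesis by (auto simp: four_wedge wedge_cov_rot)
    next
      case False
      hence "wedge (map cov cs) = (\<lambda>vs. 0)" by (intro ext wedge_not_distinct) (simp add: distinct_map)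
      thus ?thesis by simp
    qed
  qed (simp_all add: four_sum sum_distrib_left mult.left_commute)
  thus ?thesis by (rule fun_cong)
qed

lemma four_covectors_pq:
  assumes "alternating (p + q) f"
  shows "four \<kappa>t (2 * (p + q) + 9) (int p - int q) f \<in> covectors_pq jj p q"
  by (rule eigen_covectors_pq[OF alternating_four[OF assms]], rule four_type[OF assms]) simp

end

text \<open>Compatibility with \<open>bet\<close>, not just with its antisymmetrisation, makes the
  rotations automorphisms of the group; it is what \<open>ce_d_map\<close> uses.\<close>

locale lie_frame = frame_iso +
  assumes rot_bet: "bet (rot \<kappa>g \<theta> u) (rot \<kappa>g \<theta> v) = rot \<kappa>g \<theta> (bet u v)"
begin

lemma ce_d_four: "ce_d (four \<kappa>g N m f) = four \<kappa>g N m (ce_d f)"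
  unfolding four_def[abs_def] ce_d_sum by (intro ext sum.cong refl arg_cong2[where f = "(*)"] ce_d_map[OF rot_bet])

lemma ce_d_Qop: "ce_d (Qop k f) = Qop k (ce_d f)"
  using ce_d_sum[where A = "weights k" and c = "\<lambda>_. 1" and f = "\<lambda>m. four \<kappa>g (2 * k + 9) m f"]
  by (simp add: Qop_def[abs_def] ce_d_four)

text \<open>The index k is the same on both sides although the degree rises by one:
  \<open>Pr k d\<close> is built from fixed graded weights and so makes sense in every degree, while
  \<open>Pr_comp\<close> reads it as a projection onto types in degree k.\<close>

lemma ce_d_Pr: "ce_d (Pr k d f) = Pr k d (ce_d f)"
  unfolding Pr_alt by (simp add: ce_d_Qop ce_d_diff)

end

section \<open>Cosets and types\<close>

definition subgrp :: "'a::ab_group_add set \<Rightarrow> bool" where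
  "subgrp B \<longleftrightarrow> 0 \<in> B \<and> (\<forall>a\<in>B. \<forall>b\<in>B. a - b \<in> B)"

lemma subgrpD:
  assumes "subgrp B"
  shows "0 \<in> B" "a \<in> B \<Longrightarrow> b \<in> B \<Longrightarrow> a - b \<in> B" "a \<in> B \<Longrightarrow> - a \<in> B" "a \<in> B \<Longrightarrow> b \<in> B \<Longrightarrow> a + b \<in> B"
proof -
  show 0: "0 \<in> B" and d: "a \<in> B \<Longrightarrow> b \<in> B \<Longrightarrow> a - b \<in> B" for a b using assms by (auto simp: subgrp_def)
  show m: "a \<in> B \<Longrightarrow> - a \<in> B" for a using d[OF 0, of a] by simp
  show "a \<in> B \<Longrightarrow> b \<in> B \<Longrightarrow> a + b \<in> B" using d[OF _ m, of a b] by simp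
qed

lemma subgrp_sum: "subgrp B \<Longrightarrow> (\<And>i. i \<in> I \<Longrightarrow> c i \<in> B) \<Longrightarrow> (\<Sum>i\<in>I. c i) \<in> B"
  by (induction I rule: infinite_finite_induct) (auto intro: subgrpD)

lemma coset_eq_iff:
  assumes "subgrp B" shows "a +o B = b +o B \<longleftrightarrow> a - b \<in> B"
proof
  assume "a +o B = b +o B"
  moreover have "a + 0 \<in> a +o B" using subgrpD(1)[OF assms] by (rule set_plus_intro2)
  ultimately obtain c where "c \<in> B" "a + 0 = b + c" by (auto simp: elt_set_plus_def)
  thus "a - b \<in> B" by simp
next
  assume ab: "a - b \<in> B"
  have *: "x +o B \<subseteq> y +o B" if "x - y \<in> B" for x y
  proof
    fix z assume "z \<in> x +o B"
    then obtain c where c: "c \<in> B" "z = x + c" by (auto simp: elt_set_plus_def)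
    have "z = y + ((x - y) + c)" using c(2) by simp
    thus "z \<in> y +o B" using subgrpD(4)[OF assms that c(1)] unfolding elt_set_plus_def by blast
  qed
  have "b - a \<in> B" using subgrpD(3)[OF assms ab] by simp
  thus "a +o B = b +o B" using *[OF ab] *[of b a] by blast
qed

lemma coset_plus:
  assumes "subgrp B" shows "(a +o B) + (b +o B) = (a + b) +o B"
proof -
  have "\<exists>c\<in>B. \<exists>d\<in>B. e = c + d" if "e \<in> B" for e
    using that subgrpD(1)[OF assms] by (intro bexI[of _ e] bexI[of _ 0]) auto
  hence "B + B = B" using subgrpD(4)[OF assms] by (fastforce simp: set_plus_def)
  thus ?thesis by (simp add: set_plus_rearrange)
qed

lemma coset_sum:
  assumes "subgrp B" "finite I" "I \<noteq> {}"
  shows "(\<Sum>i\<in>I. c i +o B) = (\<Sum>i\<in>I. c i) +o B"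
  using assms(2,3)
proof (induction I rule: finite_ne_induct)
  case (insert x F)
  have "(\<Sum>i\<in>insert x F. c i +o B) = (c x +o B) + ((\<Sum>i\<in>F. c i) +o B)" using insert by simp
  also have "\<dots> = (\<Sum>i\<in>insert x F. c i) +o B" using insert by (simp add: coset_plus[OF assms(1)])
  finally show ?case .
qed simp

lemma subspace_sum_cosets:
  assumes B: "subgrp B" and I: "finite I" "I \<noteq> {}" and V: "\<And>i. i \<in> I \<Longrightarrow> V i = cosets (Zi i) B"
  shows "subspace_sum I V = {(\<Sum>i\<in>I. c i) +o B | c. \<forall>i\<in>I. c i \<in> Zi i}"
proof (intro equalityI subsetI)
  fix S assume "S \<in> subspace_sum I V"
  then obtain a where a: "S = (\<Sum>i\<in>I. a i)" "\<forall>i\<in>I. a i \<in> V i" by (auto simp: subspace_sum_def)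
  have "\<forall>i\<in>I. \<exists>c. c \<in> Zi i \<and> a i = c +o B" using a(2) V by (auto simp: cosets_def)
  from bchoice[OF this] obtain c where c: "\<forall>i\<in>I. c i \<in> Zi i \<and> a i = c i +o B" by (elim exE)
  have "S = (\<Sum>i\<in>I. c i +o B)" unfolding a(1) by (rule sum.cong) (use c in auto)
  thus "S \<in> {(\<Sum>i\<in>I. c i) +o B | c. \<forall>i\<in>I. c i \<in> Zi i}" unfolding coset_sum[OF B I] using c by blast
next
  fix S assume "S \<in> {(\<Sum>i\<in>I. c i) +o B | c. \<forall>i\<in>I. c i \<in> Zi i}"
  then obtain c where c: "S = (\<Sum>i\<in>I. c i) +o B" "\<forall>i\<in>I. c i \<in> Zi i" by (elim CollectE exE conjE)
  have "S = (\<Sum>i\<in>I. c i +o B)" unfolding coset_sum[OF B I] by (rule c(1))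
  moreover have "\<forall>i\<in>I. c i +o B \<in> V i" using c(2) V by (auto simp: cosets_def)
  ultimately show "S \<in> subspace_sum I V" unfolding subspace_sum_def by blast
qed

text \<open>Eliminates cosets in favour of representatives. The sum always lies in
  \<open>cosets Z B\<close> because each \<open>Zi i\<close> lies in the group Z, so only the other
  inclusion carries content.\<close>

lemma subspace_sum_eq_iff:
  assumes B: "subgrp B" and I: "finite I" "I \<noteq> {}" and V: "\<And>i. i \<in> I \<Longrightarrow> V i = cosets (Zi i) B"
    and Z: "subgrp Z" "\<And>i. i \<in> I \<Longrightarrow> Zi i \<subseteq> Z"
  shows "subspace_sum I V = cosets Z B \<longleftrightarrow> (\<forall>z\<in>Z. \<exists>c. (\<forall>i\<in>I. c i \<in> Zi i) \<and> z - (\<Sum>i\<in>I. c i) \<in> B)"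
proof -
  have "(\<Sum>i\<in>I. c i) +o B \<in> cosets Z B" if "\<forall>i\<in>I. c i \<in> Zi i" for c
    unfolding cosets_def by (rule imageI, rule subgrp_sum[OF Z(1)]) (use that Z(2) in auto)
  hence "{(\<Sum>i\<in>I. c i) +o B | c. \<forall>i\<in>I. c i \<in> Zi i} \<subseteq> cosets Z B" by blast
  moreover have e: "subspace_sum I V = {(\<Sum>i\<in>I. c i) +o B | c. \<forall>i\<in>I. c i \<in> Zi i}"
    by (rule subspace_sum_cosets[OF B I V])
  moreover have "X = Y \<longleftrightarrow> Y \<subseteq> X" if "X \<subseteq> Y" for X Y :: "'a set set" using that by auto
  ultimately have "subspace_sum I V = cosets Z B \<longleftrightarrow> cosets Z B \<subseteq> {(\<Sum>i\<in>I. c i) +o B | c. \<forall>i\<in>I. c i \<in> Zi i}"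
    unfolding e by (intro \<open>\<And>X Y. X \<subseteq> Y \<Longrightarrow> X = Y \<longleftrightarrow> Y \<subseteq> X\<close>)
  hence "subspace_sum I V = cosets Z B \<longleftrightarrow> (\<forall>z\<in>Z. z +o B \<in> {(\<Sum>i\<in>I. c i) +o B | c. \<forall>i\<in>I. c i \<in> Zi i})"
    unfolding cosets_def image_subset_iff .
  also have "\<dots> \<longleftrightarrow> (\<forall>z\<in>Z. \<exists>c. (\<forall>i\<in>I. c i \<in> Zi i) \<and> z - (\<Sum>i\<in>I. c i) \<in> B)"
    unfolding coset_eq_iff[OF B, symmetric] by blast
  finally show ?thesis .
qed

lemma sum_is_direct_iff:
  assumes B: "subgrp B" and I: "finite I" "I \<noteq> {}" and V: "\<And>i. i \<in> I \<Longrightarrow> V i = cosets (Zi i) B"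
  shows "sum_is_direct I V B \<longleftrightarrow> (\<forall>c. (\<forall>i\<in>I. c i \<in> Zi i) \<and> (\<Sum>i\<in>I. c i) \<in> B \<longrightarrow> (\<forall>i\<in>I. c i \<in> B))"
proof -
  have z: "x +o B = B \<longleftrightarrow> x \<in> B" for x using coset_eq_iff[OF B, of x 0] by simp
  show ?thesis
  proof
    assume d: "sum_is_direct I V B"
    show "\<forall>c. (\<forall>i\<in>I. c i \<in> Zi i) \<and> (\<Sum>i\<in>I. c i) \<in> B \<longrightarrow> (\<forall>i\<in>I. c i \<in> B)"
    proof (intro allI impI)
      fix c assume c: "(\<forall>i\<in>I. c i \<in> Zi i) \<and> (\<Sum>i\<in>I. c i) \<in> B"
      have "\<forall>i\<in>I. c i +o B \<in> V i" using c V by (auto simp: cosets_def)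
      moreover have "(\<Sum>i\<in>I. c i +o B) = B" using c by (simp add: coset_sum[OF B I] z)
      ultimately have "\<forall>i\<in>I. c i +o B = B" using d[unfolded sum_is_direct_def, rule_format, of "\<lambda>i. c i +o B"] by blast
      thus "\<forall>i\<in>I. c i \<in> B" by (simp add: z)
    qed
  next
    assume d: "\<forall>c. (\<forall>i\<in>I. c i \<in> Zi i) \<and> (\<Sum>i\<in>I. c i) \<in> B \<longrightarrow> (\<forall>i\<in>I. c i \<in> B)"
    show "sum_is_direct I V B" unfolding sum_is_direct_def
    proof (intro allI impI)
      fix a assume a: "(\<forall>i\<in>I. a i \<in> V i) \<and> (\<Sum>i\<in>I. a i) = B"
      have "\<forall>i\<in>I. \<exists>c. c \<in> Zi i \<and> a i = c +o B" using a V by (auto simp: cosets_def)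
      from bchoice[OF this] obtain c where c: "\<forall>i\<in>I. c i \<in> Zi i \<and> a i = c i +o B" by (elim exE)
      have "(\<Sum>i\<in>I. a i) = (\<Sum>i\<in>I. c i +o B)" by (rule sum.cong) (use c in auto)
      hence "B = (\<Sum>i\<in>I. c i +o B)" using a by simp
      hence "(\<Sum>i\<in>I. c i) +o B = B" unfolding coset_sum[OF B I] by (rule sym)
      hence "\<forall>i\<in>I. c i \<in> B" using d[rule_format, of c] c by (auto simp: z)
      thus "\<forall>i\<in>I. a i = B" using c by (simp add: z)
    qed
  qed
qed

section \<open>Closed and exact forms and currents as groups\<close>

lemma real_forms_diff: "\<phi> \<in> real_forms G k \<Longrightarrow> \<psi> \<in> real_forms G k \<Longrightarrow> \<phi> - \<psi> \<in> real_forms G k"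
  by (simp add: real_forms_def forms_diff)

lemma real_forms_zero: "0 \<in> real_forms G k"
  using forms_zero[of G k] by (simp add: real_forms_def)

lemma ext_d_diff:
  assumes "\<phi> \<in> forms G k" "\<psi> \<in> forms G k" shows "ext_d (\<phi> - \<psi>) = ext_d \<phi> - ext_d \<psi>"
proof -
  have "ext_d ((\<phi> - \<psi>) + \<psi>) = ext_d (\<phi> - \<psi>) + ext_d \<psi>"
    by (rule ext_d_add) (use assms forms_diff[OF assms] in \<open>auto simp: forms_iff\<close>)
  thus ?thesis by (simp only: diff_add_cancel eq_diff_eq)
qed

lemma ext_d_zero [simp]: "ext_d 0 = 0"
  using ext_d_diff[OF forms_zero forms_zero] by (simp only: diff_self)

lemma subgrp_closed_forms: "subgrp (closed_forms G k)"
  unfolding subgrp_def closed_forms_def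
proof (intro conjI ballI CollectI)
  fix a b assume *: "a \<in> {\<phi> \<in> real_forms G k. ext_d \<phi> = 0}" "b \<in> {\<phi> \<in> real_forms G k. ext_d \<phi> = 0}"
  thus "a - b \<in> real_forms G k" using real_forms_diff by blast
  have "a \<in> forms G k" "b \<in> forms G k" using * by (auto simp: real_forms_def)
  thus "ext_d (a - b) = 0" using * by (simp only: ext_d_diff mem_Collect_eq diff_self)
qed (rule real_forms_zero ext_d_zero)+

text \<open>The inserted 0 matters in degree 0; in positive degree it is the differential of
  0.\<close>

lemma exact_forms_cases:
  "exact_forms G k = (case k of 0 \<Rightarrow> {0} | Suc j \<Rightarrow> ext_d ` real_forms G j)"
proof (cases k)
  case (Suc j)
  have "0 \<in> ext_d ` real_forms G j" by (rule image_eqI[OF _ real_forms_zero]) simp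
  thus ?thesis using Suc by (auto simp: exact_forms_def)
qed (simp add: exact_forms_def)

lemma subgrp_exact_forms: "subgrp (exact_forms G k)"
proof (cases k)
  case (Suc j)
  show ?thesis unfolding subgrp_def exact_forms_cases Suc nat.case
  proof (intro conjI ballI)
    show "0 \<in> ext_d ` real_forms G j" by (rule image_eqI[OF _ real_forms_zero]) simp
    fix a b assume "a \<in> ext_d ` real_forms G j" "b \<in> ext_d ` real_forms G j"
    then obtain \<phi> \<psi> where *: "a = ext_d \<phi>" "b = ext_d \<psi>" "\<phi> \<in> real_forms G j" "\<psi> \<in> real_forms G j" by (elim imageE)
    have "a - b = ext_d (\<phi> - \<psi>)" unfolding *(1,2)
      by (rule ext_d_diff[symmetric]) (use *(3,4) in \<open>auto simp: real_forms_def\<close>)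
    moreover have "\<phi> - \<psi> \<in> real_forms G j" by (rule real_forms_diff[OF *(3,4)])
    ultimately show "a - b \<in> ext_d ` real_forms G j" by (simp only: imageI)
  qed
qed (simp add: subgrp_def exact_forms_cases)

lemma currents_diff: "T \<in> currents G k \<Longrightarrow> S \<in> currents G k \<Longrightarrow> T - S \<in> currents G k"
  by (simp add: currents_def fun_diff_def continuous_map_diff right_diff_distrib)

lemma currents_zero: "0 \<in> currents G k"
  by (simp add: currents_def zero_fun_def)

lemma real_currents_diff: "T \<in> real_currents G k \<Longrightarrow> S \<in> real_currents G k \<Longrightarrow> T - S \<in> real_currents G k"
  by (simp add: real_currents_def currents_diff)

lemma real_currents_zero: "0 \<in> real_currents G k"
  using currents_zero[of G k] by (simp add: real_currents_def)

lemma current_d_diff: "current_d G k (T - S) = current_d G k T - current_d G k S"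
  by (intro ext) (auto simp: current_d_def split: if_split)

lemma current_d_zero [simp]: "current_d G k 0 = 0"
  by (simp add: current_d_def fun_eq_iff)

lemma subgrp_closed_currents: "subgrp (closed_currents G k)"
  unfolding subgrp_def closed_currents_def
  by (simp add: current_d_diff real_currents_diff real_currents_zero)

lemma subgrp_exact_currents: "subgrp (exact_currents G k)"
  unfolding subgrp_def exact_currents_def
proof (intro conjI ballI)
  show "0 \<in> current_d G (Suc k) ` real_currents G (Suc k)"
    by (rule image_eqI[OF _ real_currents_zero]) simp
  fix a b assume "a \<in> current_d G (Suc k) ` real_currents G (Suc k)" "b \<in> current_d G (Suc k) ` real_currents G (Suc k)"
  thus "a - b \<in> current_d G (Suc k) ` real_currents G (Suc k)"
    by (auto simp: current_d_diff[symmetric] intro!: imageI real_currents_diff)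
qed

lemma unordered_pairs_nonempty [simp]: "unordered_pairs k \<noteq> {}"
proof -
  have "(k, 0) \<in> unordered_pairs k" by (simp add: unordered_pairs_def)
  thus ?thesis by blast
qed

section \<open>The four notions in terms of representatives\<close>

abbreviation closed_forms_type where
  "closed_forms_type G J k i \<equiv> closed_forms G k \<inter> (forms_pq G J (fst i) (snd i) + forms_pq G J (snd i) (fst i))"

abbreviation closed_currents_type where
  "closed_currents_type G J k i \<equiv> closed_currents G k \<inter> (currents_pq G J (fst i) (snd i) + currents_pq G J (snd i) (fst i))"

lemma Cinf_full_at_iff:
  "Cinf_full_at G J k \<longleftrightarrow> (\<forall>z\<in>closed_forms G k. \<exists>c. (\<forall>i\<in>unordered_pairs k. c i \<in> closed_forms_type G J k i) \<and>
     z - (\<Sum>i\<in>unordered_pairs k. c i) \<in> exact_forms G k)"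
  unfolding Cinf_full_at_def deRham_cohomology_def
  by (rule subspace_sum_eq_iff[OF subgrp_exact_forms unordered_pairs_finite unordered_pairs_nonempty _ subgrp_closed_forms])
     (auto simp: cohomology_pq_def unordered_pairs_def)

lemma Cinf_pure_at_iff:
  "Cinf_pure_at G J k \<longleftrightarrow> (\<forall>c. (\<forall>i\<in>unordered_pairs k. c i \<in> closed_forms_type G J k i) \<and>
     (\<Sum>i\<in>unordered_pairs k. c i) \<in> exact_forms G k \<longrightarrow> (\<forall>i\<in>unordered_pairs k. c i \<in> exact_forms G k))"
  unfolding Cinf_pure_at_def
  by (rule sum_is_direct_iff[OF subgrp_exact_forms unordered_pairs_finite unordered_pairs_nonempty])
     (auto simp: cohomology_pq_def unordered_pairs_def)

lemma full_at_iff: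
  "full_at G J k \<longleftrightarrow> (\<forall>z\<in>closed_currents G k. \<exists>c. (\<forall>i\<in>unordered_pairs k. c i \<in> closed_currents_type G J k i) \<and>
     z - (\<Sum>i\<in>unordered_pairs k. c i) \<in> exact_currents G k)"
  unfolding full_at_def deRham_homology_def
  by (rule subspace_sum_eq_iff[OF subgrp_exact_currents unordered_pairs_finite unordered_pairs_nonempty _ subgrp_closed_currents])
     (auto simp: homology_pq_def unordered_pairs_def)

lemma pure_at_iff:
  "pure_at G J k \<longleftrightarrow> (\<forall>c. (\<forall>i\<in>unordered_pairs k. c i \<in> closed_currents_type G J k i) \<and>
     (\<Sum>i\<in>unordered_pairs k. c i) \<in> exact_currents G k \<longrightarrow> (\<forall>i\<in>unordered_pairs k. c i \<in> exact_currents G k))"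
  unfolding pure_at_def
  by (rule sum_is_direct_iff[OF subgrp_exact_currents unordered_pairs_finite unordered_pairs_nonempty])
     (auto simp: homology_pq_def unordered_pairs_def)

lemma wedge_map: "wedge as (map L vs) = wedge (map (\<lambda>a v. a (L v)) as) vs"
proof (cases "length vs = length as")
  case True
  have "(\<Prod>i<length as. (as ! i) (map L vs ! \<sigma> i)) = (\<Prod>i<length as. (map (\<lambda>a v. a (L v)) as ! i) (vs ! \<sigma> i))"
    if "\<sigma> permutes {..<length as}" for \<sigma>
  proof (rule prod.cong[OF refl])
    fix i assume i: "i \<in> {..<length as}"
    hence "\<sigma> i < length vs" using permutes_in_image[OF that, of i] True by simp
    thus "(as ! i) (map L vs ! \<sigma> i) = (map (\<lambda>a v. a (L v)) as ! i) (vs ! \<sigma> i)" using i by simp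
  qed
  thus ?thesis using True by (simp add: wedge_def)
qed (simp add: wedge_def)

text \<open>Pulling back along a map that intertwines the complex structures sends (1,0)-covectors
  to (1,0)-covectors and (0,1)-covectors to (0,1)-covectors, hence wedges to wedges of the same
  type.\<close>

lemma covectors_pq_map:
  fixes L :: "'a::euclidean_space \<Rightarrow> 'b::euclidean_space"
  assumes f: "f \<in> covectors_pq j p q" and L: "linear L" "\<And>v. L (j' v) = j (L v)"
  shows "(\<lambda>vs. f (map L vs)) \<in> covectors_pq j' p q"
  using f unfolding covectors_pq_def
proof (induction rule: cspan.span_induct_alt)
  case base show ?case unfolding zero_fun_def by (rule cspan.span_zero[unfolded zero_fun_def])
next
  case (step c f g)
  then obtain as bs where f: "f = wedge (as @ bs)" "length as = p" "length bs = q"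
    "set as \<subseteq> covectors10 j" "set bs \<subseteq> covectors01 j" by blast
  let ?as = "map (\<lambda>a v. a (L v)) as" and ?bs = "map (\<lambda>a v. a (L v)) bs"
  have "(\<lambda>v. a (L v)) \<in> covectors10 j'" if "a \<in> covectors10 j" for a
    using that L(2) linear_compose[OF L(1), of a] by (simp add: covectors10_def o_def)
  moreover have "(\<lambda>v. a (L v)) \<in> covectors01 j'" if "a \<in> covectors01 j" for a
    using that L(2) linear_compose[OF L(1), of a] by (simp add: covectors01_def o_def)
  ultimately have "set ?as \<subseteq> covectors10 j'" "set ?bs \<subseteq> covectors01 j'"
    using f(4,5) by auto
  hence "wedge (?as @ ?bs) \<in> {wedge (as @ bs) | as bs. length as = p \<and> length bs = q \<and>
        set as \<subseteq> covectors10 j' \<and> set bs \<subseteq> covectors01 j'}" using f(2,3)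
    by (intro CollectI exI[of _ ?as] exI[of _ ?bs]) simp
  from cspan.span_add[OF cspan.span_scale[OF cspan.span_base[OF this], of c] step(2)]
  show ?case by (simp add: f(1) wedge_map plus_fun_def)
qed

text \<open>\<open>currents_pq\<close> tests against forms of every bidegree, including those of
  another total degree; this disposes of them.\<close>

lemma forms_two_degrees:
  fixes \<phi> :: "'e::euclidean_space form"
  assumes "\<phi> \<in> forms G k" "\<phi> \<in> forms G l" "k \<noteq> l" shows "\<phi> = 0"
proof (intro ext)
  fix x and vs :: "'e list"
  have a: "alternating k (\<phi> x)" "alternating l (\<phi> x)" using assms by (simp_all add: forms_def)
  have "\<phi> x vs = 0"
  proof (cases "length vs = k")
    case True
    hence "length vs \<noteq> l" using assms(3) by simp
    thus ?thesis by (rule alternating_length[OF a(2)])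
  qed (rule alternating_length[OF a(1)])
  thus "\<phi> x vs = 0 x vs" by simp
qed

text \<open>Constant coefficients have vanishing derivatives, so every seminorm of a left-invariant
  form is controlled by its norm at the origin.\<close>

lemma alt_functional_current:
  assumes T: "T \<in> currents iwasawa_deck k" shows "alt_functional k (\<lambda>f. T (inv_form f))"
  unfolding alt_functional_def
proof (intro conjI allI impI)
  fix f g :: "(complex ^ 3) list \<Rightarrow> complex" assume f: "alternating k f" and g: "alternating k g"
  have "inv_form (\<lambda>vs. f vs + g vs) = inv_form f + inv_form g" by (simp add: inv_form_def unhat_def fun_eq_iff)
  thus "T (inv_form (\<lambda>vs. f vs + g vs)) = T (inv_form f) + T (inv_form g)"
    using currentsD(2)[OF T inv_form_forms[OF f] inv_form_forms[OF g]] by simp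
next
  fix c and f :: "(complex ^ 3) list \<Rightarrow> complex" assume f: "alternating k f"
  have "inv_form (\<lambda>vs. c * f vs) = (\<lambda>x vs. c * inv_form f x vs)" by (simp add: inv_form_def unhat_def)
  thus "T (inv_form (\<lambda>vs. c * f vs)) = c * T (inv_form f)"
    using currentsD(3)[OF T inv_form_forms[OF f]] by simp
next
  obtain n R C where T: "R \<ge> 0" "C \<ge> 0"
     "\<And>\<phi> M. \<phi>\<in>forms iwasawa_deck k \<Longrightarrow> M\<ge>0 \<Longrightarrow> seminorm_le n R M \<phi> \<Longrightarrow> cmod (T \<phi>) \<le> C * M"
    using currents_bounded[OF T] unfolding bounded_functional_def by blast
  define c where "c = (1 + real DIM(complex ^ 3) * 1 * (R + n)) ^ k"
  have c: "c \<ge> 0" unfolding c_def using T(1) by simp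
  show "\<exists>C\<ge>0. \<forall>f M. alternating k f \<longrightarrow> M \<ge> 0 \<longrightarrow> (\<forall>vs. cmod (f vs) \<le> M * pn vs) \<longrightarrow> cmod (T (inv_form f)) \<le> C * M"
  proof (rule exI[of _ "C * c"], intro conjI allI impI)
    show "0 \<le> C * c" using T(2) c by simp
    fix f :: "(complex ^ 3) list \<Rightarrow> complex" and M :: real assume f: "alternating k f" "M \<ge> 0" "\<forall>vs. cmod (f vs) \<le> M * pn vs"
    have "seminorm_le n R M (\<lambda>x::complex^3. f)" unfolding seminorm_le_def
    proof (intro ballI allI impI)
      fix x and us vs :: "(complex ^ 3) list"
      have "iter_deriv us (\<lambda>y::complex^3. f vs) = (\<lambda>x. if us = [] then f vs else 0)"
        by (induction us) (simp_all add: frechet_derivative_const)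
      thus "cmod (iter_deriv us (\<lambda>y. f vs) x) \<le> M * pn us * pn vs" using f by simp
    qed
    from seminorm_le_unhat[OF smooth_family_const[OF f(1)] f(2) T(1) this]
    have "seminorm_le n R (c * M) (inv_form f)" by (simp add: c_def inv_form_def)
    from T(3)[OF inv_form_forms[OF f(1)] _ this] show "cmod (T (inv_form f)) \<le> C * c * M"
      using c f(2) by (simp add: mult.assoc)
  qed
qed

lemma alt_functional_compose:
  fixes P :: "((complex ^ 3) list \<Rightarrow> complex) \<Rightarrow> (complex ^ 3) list \<Rightarrow> complex"
  assumes l: "alt_functional m l"
    and alt: "\<And>f. alternating k f \<Longrightarrow> alternating m (P f)"
    and add: "\<And>f g. P (\<lambda>vs. f vs + g vs) = (\<lambda>vs. P f vs + P g vs)"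
    and cm: "\<And>c f. P (\<lambda>vs. c * f vs) = (\<lambda>vs. c * P f vs)"
    and b: "\<exists>C\<ge>0. \<forall>f M. alternating k f \<longrightarrow> M \<ge> 0 \<longrightarrow> (\<forall>vs. cmod (f vs) \<le> M * pn vs) \<longrightarrow> (\<forall>vs. cmod (P f vs) \<le> C * M * pn vs)"
  shows "alt_functional k (\<lambda>f. l (P f))"
proof -
  have ladd: "\<And>f g. alternating m f \<Longrightarrow> alternating m g \<Longrightarrow> l (\<lambda>vs. f vs + g vs) = l f + l g"
    and lhom: "\<And>c f. alternating m f \<Longrightarrow> l (\<lambda>vs. c * f vs) = c * l f"
    using l by (simp_all add: alt_functional_def)
  obtain C where C: "C \<ge> 0" "\<forall>f M. alternating m f \<longrightarrow> M \<ge> 0 \<longrightarrow> (\<forall>vs. cmod (f vs) \<le> M * pn vs) \<longrightarrow> cmod (l f) \<le> C * M"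
    using l[unfolded alt_functional_def, THEN conjunct2, THEN conjunct2] by (elim exE conjE)
  obtain D where D: "D \<ge> 0" "\<forall>f M. alternating k f \<longrightarrow> M \<ge> 0 \<longrightarrow> (\<forall>vs. cmod (f vs) \<le> M * pn vs) \<longrightarrow> (\<forall>vs. cmod (P f vs) \<le> D * M * pn vs)"
    using b by (elim exE conjE)
  show ?thesis unfolding alt_functional_def
  proof (intro conjI allI impI)
    show "\<exists>C\<ge>0. \<forall>f M. alternating k f \<longrightarrow> M \<ge> 0 \<longrightarrow> (\<forall>vs. cmod (f vs) \<le> M * pn vs) \<longrightarrow> cmod (l (P f)) \<le> C * M"
    proof (rule exI[of _ "C * D"], intro conjI allI impI)
      fix f :: "(complex ^ 3) list \<Rightarrow> complex" and M :: real assume f: "alternating k f" "M \<ge> 0" "\<forall>vs. cmod (f vs) \<le> M * pn vs"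
      have "cmod (l (P f)) \<le> C * (D * M)"
        using C(2)[rule_format, OF alt[OF f(1)], of "D * M"] D(2)[rule_format, OF f(1,2)] f D(1) by simp
      thus "cmod (l (P f)) \<le> C * D * M" by (simp add: mult.assoc)
    qed (use C D in simp)
  qed (simp_all add: add cm ladd lhom alt)
qed

lemma alt_functional_eval: "alt_functional k (\<lambda>f. f vs)"
  unfolding alt_functional_def
  by (intro conjI allI impI exI[of _ "pn vs"]) (simp_all add: mult.commute)

section \<open>Purity and fullness\<close>

lemma sum_fun_apply: "(\<Sum>i\<in>I. c i) x = (\<Sum>i\<in>I. c i x)"
  by (induction I rule: infinite_finite_induct) simp_all

lemma inv_form_zero: "inv_form (\<lambda>vs. 0) = 0"
  by (simp add: inv_form_def unhat_def zero_fun_def)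

lemma inv_form_add: "inv_form (\<lambda>vs. f vs + g vs) = inv_form f + inv_form g"
  by (simp add: inv_form_def unhat_def fun_eq_iff)

lemma inv_form_sum: "inv_form (\<lambda>vs. \<Sum>i\<in>I. f i vs) = (\<Sum>i\<in>I. inv_form (f i))"
  by (intro ext) (simp add: inv_form_def unhat_def sum_fun_apply)

lemma inv_part_zero: "inv_part 0 = (\<lambda>vs. 0)"
  unfolding inv_form_zero[symmetric] by simp

lemma inv_part_sum:
  assumes "\<And>i. i \<in> I \<Longrightarrow> c i \<in> forms iwasawa_deck k"
  shows "inv_part (\<Sum>i\<in>I. c i) = (\<lambda>vs. \<Sum>i\<in>I. inv_part (c i) vs) \<and> (\<Sum>i\<in>I. c i) \<in> forms iwasawa_deck k"
  using assms
proof (induction I rule: infinite_finite_induct)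
  case (insert x F)
  hence F: "inv_part (\<Sum>i\<in>F. c i) = (\<lambda>vs. \<Sum>i\<in>F. inv_part (c i) vs)" "(\<Sum>i\<in>F. c i) \<in> forms iwasawa_deck k"
    and x: "c x \<in> forms iwasawa_deck k" by simp_all
  show ?case using insert(1,2) inv_part_add[OF x F(2)] forms_add[OF x F(2)] by (simp only: F(1) sum.insert simp_thms)
qed (simp_all only: sum.infinite sum.empty inv_part_zero forms_zero not_False_eq_True)

lemma current_zero: "T \<in> currents G k \<Longrightarrow> T 0 = 0"
  using currentsD(3)[of T G k 0 0] forms_zero[of G k] by (simp add: zero_fun_def)

lemma current_sum:
  assumes "T \<in> currents G k" "\<And>i. i \<in> I \<Longrightarrow> \<phi> i \<in> forms G k"
  shows "T (\<Sum>i\<in>I. \<phi> i) = (\<Sum>i\<in>I. T (\<phi> i)) \<and> (\<Sum>i\<in>I. \<phi> i) \<in> forms G k"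
  using assms(2)
proof (induction I rule: infinite_finite_induct)
  case (insert x F)
  hence F: "T (\<Sum>i\<in>F. \<phi> i) = (\<Sum>i\<in>F. T (\<phi> i))" "(\<Sum>i\<in>F. \<phi> i) \<in> forms G k"
    and x: "\<phi> x \<in> forms G k" by simp_all
  show ?case using insert(1,2) currentsD(2)[OF assms(1) x F(2)] forms_add[OF x F(2)] by (simp only: F(1) sum.insert simp_thms)
qed (simp_all only: sum.infinite sum.empty current_zero[OF assms(1)] forms_zero not_False_eq_True)

lemma closed_formsD:
  assumes "\<phi> \<in> closed_forms G k"
  shows "\<phi> \<in> real_forms G k" "\<phi> \<in> forms G k" "ext_d \<phi> = 0"
  using assms by (simp_all add: closed_forms_def real_forms_def)

lemma inv_form_real_forms:
  "alternating k f \<Longrightarrow> (\<And>vs. f vs \<in> \<real>) \<Longrightarrow> inv_form f \<in> real_forms iwasawa_deck k"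
  by (simp add: real_forms_iff inv_form_forms real_form_inv_form)

lemma inv_form_closed_forms:
  assumes "alternating k f" "\<And>vs. f vs \<in> \<real>" "ce_d f = (\<lambda>vs. 0)" shows "inv_form f \<in> closed_forms iwasawa_deck k"
  by (simp only: closed_forms_def mem_Collect_eq inv_form_real_forms[OF assms(1,2)] ext_d_inv_form[OF assms(1)] assms(3) inv_form_zero)

lemma current_d_inv_current:
  "current_d iwasawa_deck (Suc k) (inv_current (Suc k) l) = inv_current k (\<lambda>f. l (ce_d f))"
proof
  fix \<phi>
  show "current_d iwasawa_deck (Suc k) (inv_current (Suc k) l) \<phi> = inv_current k (\<lambda>f. l (ce_d f)) \<phi>"
    using inv_part_ext_d[of \<phi> k] ext_d_forms[of \<phi> k] by (simp add: current_d_def inv_current_def)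
qed

lemma inv_current_real:
  assumes "alt_functional k l" "\<And>f. alternating k f \<Longrightarrow> (\<And>vs. f vs \<in> \<real>) \<Longrightarrow> l f \<in> \<real>"
  shows "inv_current k l \<in> real_currents iwasawa_deck k"
proof -
  have "inv_current k l \<phi> \<in> \<real>" if "\<phi> \<in> real_forms iwasawa_deck k" for \<phi>
  proof -
    have \<phi>: "\<phi> \<in> forms iwasawa_deck k" using that by (simp add: real_forms_def)
    show ?thesis using \<phi> assms(2)[OF alternating_inv_part[OF \<phi>] inv_part_real[OF that]] by (simp add: inv_current_def)
  qed
  thus ?thesis using inv_current_currents[OF assms(1)] by (simp add: real_currents_def)
qed

lemma inv_current_closed:
  assumes "alt_functional k l" "\<And>f. alternating k f \<Longrightarrow> (\<And>vs. f vs \<in> \<real>) \<Longrightarrow> l f \<in> \<real>"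
    and "\<And>j f. k = Suc j \<Longrightarrow> alternating j f \<Longrightarrow> l (ce_d f) = 0"
  shows "inv_current k l \<in> closed_currents iwasawa_deck k"
proof -
  have "current_d iwasawa_deck k (inv_current k l) = 0"
  proof (cases k)
    case (Suc j)
    have "inv_current j (\<lambda>f. l (ce_d f)) \<phi> = 0" for \<phi>
      using assms(3)[OF Suc alternating_inv_part[of \<phi> j]] by (simp add: inv_current_def)
    thus ?thesis unfolding Suc current_d_inv_current by (simp add: fun_eq_iff)
  qed (simp add: current_d_def fun_eq_iff)
  thus ?thesis using inv_current_real[OF assms(1,2)] by (simp add: closed_currents_def)
qed

lemma closed_currentsD:
  assumes "T \<in> closed_currents G k"
  shows "T \<in> currents G k" "\<phi> \<in> real_forms G k \<Longrightarrow> T \<phi> \<in> \<real>" "k = Suc j \<Longrightarrow> \<phi> \<in> forms G j \<Longrightarrow> T (ext_d \<phi>) = 0"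
proof -
  show "T \<in> currents G k" "\<phi> \<in> real_forms G k \<Longrightarrow> T \<phi> \<in> \<real>"
    using assms by (simp_all add: closed_currents_def real_currents_def)
  have "current_d G k T \<phi> = 0" using assms by (simp add: closed_currents_def)
  thus "k = Suc j \<Longrightarrow> \<phi> \<in> forms G j \<Longrightarrow> T (ext_d \<phi>) = 0" by (auto simp: current_d_def split: if_splits)
qed

lemma homologous_inv_current:
  assumes T: "T \<in> closed_currents iwasawa_deck k"
  shows "T - inv_current k (\<lambda>f. T (inv_form f)) \<in> exact_currents iwasawa_deck k"
proof -
  have "T - inv_current k (\<lambda>f. T (inv_form f)) =
    (\<lambda>\<phi>. if \<phi> \<in> forms iwasawa_deck k then T \<phi> - T (inv_form (inv_part \<phi>)) else 0)"
    using currentsD(1)[OF closed_currentsD(1)[OF T]] by (intro ext) (simp add: inv_current_def)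
  thus ?thesis using homologous_inv_part[OF T] by simp
qed

abbreviation forms_type where
  "forms_type G J i \<equiv> forms_pq G J (fst i) (snd i) + forms_pq G J (snd i) (fst i)"

abbreviation currents_type where
  "currents_type G J i \<equiv> currents_pq G J (fst i) (snd i) + currents_pq G J (snd i) (fst i)"

text \<open>Currents of bidimension (p,q) vanish on forms of all other types, and distinct unordered
  pairs share no ordered type.\<close>

lemma type_pairing:
  assumes i: "i \<in> unordered_pairs k" and j: "j \<in> unordered_pairs k" and ij: "i \<noteq> j"
    and T: "T \<in> currents_type G J i" and \<phi>: "\<phi> \<in> forms_type G J j"
  shows "T \<phi> = 0"
proof -
  obtain p q where pq: "i = (p, q)" by fastforce
  obtain r s where rs: "j = (r, s)" by fastforce
  have ne: "(r, s) \<noteq> (p, q)" "(s, r) \<noteq> (p, q)" "(r, s) \<noteq> (q, p)" "(s, r) \<noteq> (q, p)" and k: "r + s = k" "p + q = k"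
    using i j ij by (auto simp: pq rs unordered_pairs_def)
  obtain U V where UV: "T = U + V" "U \<in> currents_pq G J p q" "V \<in> currents_pq G J q p"
    using T unfolding pq by (elim set_plus_elim) simp
  obtain \<alpha> \<beta> where ab: "\<phi> = \<alpha> + \<beta>" "\<alpha> \<in> forms_pq G J r s" "\<beta> \<in> forms_pq G J s r"
    using \<phi> unfolding rs by (elim set_plus_elim) simp
  have f: "\<alpha> \<in> forms G k" "\<beta> \<in> forms G k" using ab k by (auto simp: forms_pq_def add.commute)
  have c: "U \<in> currents G k" "V \<in> currents G k" using UV k by (auto simp: currents_pq_def add.commute)
  have "U \<alpha> = 0" "U \<beta> = 0" "V \<alpha> = 0" "V \<beta> = 0"
    using UV(2,3) ab(2,3) ne by (simp_all add: currents_pq_def)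
  thus ?thesis using currentsD(2)[OF c(1) f] currentsD(2)[OF c(2) f] by (simp only: UV(1) ab(1) plus_fun_apply add_0_left)
qed

text \<open>J is left-invariant: it carries the frame vector of v to that of \<open>jj v\<close>, so
  in the frame it is the constant \<open>jj\<close>.\<close>

locale twisted = frame_iso +
  fixes J :: "complex ^ 3 \<Rightarrow> complex ^ 3 \<Rightarrow> complex ^ 3"
  assumes J_bet: "J x (v + bet x v) = jj v + bet x (jj v)"
begin

lemma hat_covectors: "\<phi> x \<in> covectors_pq (J x) p q \<longleftrightarrow> hat \<phi> x \<in> covectors_pq jj p q"
proof
  assume "\<phi> x \<in> covectors_pq (J x) p q"
  thus "hat \<phi> x \<in> covectors_pq jj p q" unfolding hat_def
    by (rule covectors_pq_map) (simp_all add: linear_compose_add linear_id[unfolded id_def] bet_linear_right J_bet)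
next
  assume h: "hat \<phi> x \<in> covectors_pq jj p q"
  let ?L = "\<lambda>v. v - bet x v"
  have "(\<lambda>vs. hat \<phi> x (map ?L vs)) \<in> covectors_pq (J x) p q"
  proof (rule covectors_pq_map[OF h])
    show "linear ?L" by (simp add: linear_compose_sub linear_id[unfolded id_def] bet_linear_right)
    fix v
    have "J x v = jj (?L v) + bet x (jj (?L v))" using J_bet[of x "?L v"] by (simp add: bet_diff_right)
    thus "?L (J x v) = jj (?L v)" by (simp add: bet_add_right)
  qed
  moreover have "hat \<phi> x (map ?L vs) = \<phi> x vs" for vs
    by (simp add: hat_def o_def bet_diff_right)
  ultimately show "\<phi> x \<in> covectors_pq (J x) p q" by simp
qed

text \<open>Membership in a span is not visibly stable under integration, but the eigenvalue
  equation that characterises the type is.\<close>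

lemma inv_part_type:
  assumes "\<phi> \<in> forms_pq iwasawa_deck J p q" shows "inv_part \<phi> \<in> covectors_pq jj p q"
proof (rule eigen_covectors_pq)
  have \<phi>: "\<phi> \<in> forms iwasawa_deck (p + q)" "hat \<phi> x \<in> covectors_pq jj p q" for x
    using assms by (simp_all add: forms_pq_def hat_covectors)
  show "alternating (p + q) (inv_part \<phi>)" by (rule alternating_inv_part[OF \<phi>(1)])
  show "inv_part \<phi> (map (rot \<kappa>t \<theta>) vs) = cis (\<theta> * of_int (int p - int q)) * inv_part \<phi> vs" for \<theta> vs
    by (rule inv_part_eigen, rule covectors_pq_eigen, rule \<phi>(2))
qed

lemma inv_form_type:
  assumes "alternating (p + q) f" "f \<in> covectors_pq jj p q" shows "inv_form f \<in> forms_pq iwasawa_deck J p q"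
  using assms by (simp add: forms_pq_def hat_covectors inv_form_forms)

lemma four_type_eq:
  assumes "f \<in> covectors_pq jj p q" "\<bar>m\<bar> \<le> int (p + q)"
  shows "four \<kappa>t (2 * (p + q) + 9) m f = (if int p - int q = m then f else (\<lambda>vs. 0))"
proof -
  have "four \<kappa>t (2 * (p + q) + 9) m f = (if int (2 * (p + q) + 9) dvd (int p - int q) - m then f else (\<lambda>vs. 0))"
    by (rule four_eigen[OF covectors_pq_eigen[OF assms(1)]]) simp
  moreover have "int (2 * (p + q) + 9) dvd (int p - int q) - m \<longleftrightarrow> int p - int q = m"
    using dvd_small[of "p + q" "(int p - int q) - m"] assms(2) by fastforce
  ultimately show ?thesis by simp
qed

lemma comp_type:
  assumes "f \<in> covectors_pq jj p q" "d \<le> p + q"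
  shows "comp (p + q) d f = (if \<bar>int p - int q\<bar> = int d then f else (\<lambda>vs. 0))"
  using assms(2) four_type_eq[OF assms(1), of "int d"] four_type_eq[OF assms(1), of "- int d"]
  by (auto simp: comp_def)

lemma Pr_type:
  assumes i: "i \<in> unordered_pairs k" and j: "j \<in> unordered_pairs k"
    and \<phi>: "\<phi> \<in> forms_type iwasawa_deck J j"
  shows "Pr k (fst i - snd i) (inv_part \<phi>) = (if i = j then inv_part \<phi> else (\<lambda>vs. 0))"
proof -
  let ?d = "fst i - snd i"
  obtain p q where pq: "j = (p, q)" "p + q = k" "q \<le> p" using j by (auto simp: unordered_pairs_def)
  have d: "?d \<le> k" and ij: "int p - int q = int ?d \<longleftrightarrow> i = j"
    using i pq by (auto simp: unordered_pairs_def)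
  obtain \<alpha> \<beta> where ab: "\<phi> = \<alpha> + \<beta>" "\<alpha> \<in> forms_pq iwasawa_deck J p q" "\<beta> \<in> forms_pq iwasawa_deck J q p"
    using \<phi> pq(1) by (auto elim: set_plus_elim)
  have f: "\<alpha> \<in> forms iwasawa_deck k" "\<beta> \<in> forms iwasawa_deck k" using ab pq by (auto simp: forms_pq_def add.commute)
  have a: "Pr k ?d (inv_part \<alpha>) = (if i = j then inv_part \<alpha> else (\<lambda>vs. 0))"
    using Pr_comp[OF alternating_inv_part[OF f(1)] d] comp_type[OF inv_part_type[OF ab(2)], of ?d] d pq ij by simp
  have "\<bar>int q - int p\<bar> = int ?d \<longleftrightarrow> i = j" using ij pq(3) by linarith
  hence b: "Pr k ?d (inv_part \<beta>) = (if i = j then inv_part \<beta> else (\<lambda>vs. 0))"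
    using Pr_comp[OF alternating_inv_part[OF f(2)] d] comp_type[OF inv_part_type[OF ab(3)], of ?d] d pq by (simp add: add.commute)
  show ?thesis unfolding ab(1) inv_part_add[OF f] Pr_add a b by simp
qed

lemma Pr_decomp:
  assumes i: "(p, q) \<in> unordered_pairs k" and f: "alternating k f"
  obtains f1 f2 where "Pr k (p - q) f = (\<lambda>vs. f1 vs + f2 vs)" "alternating (p + q) f1" "f1 \<in> covectors_pq jj p q"
    "alternating (q + p) f2" "f2 \<in> covectors_pq jj q p"
proof -
  have pq: "p + q = k" "q \<le> p" using i by (auto simp: unordered_pairs_def)
  have P: "Pr k (p - q) f = comp k (p - q) f" by (rule Pr_comp[OF f]) (use pq in simp)
  define f1 where "f1 = four \<kappa>t (2 * (p + q) + 9) (int p - int q) f"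
  \<comment> \<open>For p = q the whole component is already in f1.\<close>
  define f2 where "f2 = (if p = q then (\<lambda>vs. 0) else four \<kappa>t (2 * (q + p) + 9) (int q - int p) f)"
  have "f1 \<in> covectors_pq jj p q" unfolding f1_def by (rule four_covectors_pq) (use f pq in simp)
  moreover have "f2 \<in> covectors_pq jj q p"
  proof (cases "p = q")
    case True thus ?thesis using cspan.span_zero by (simp add: f2_def covectors_pq_def zero_fun_def)
  next
    case False
    have "alternating (q + p) f" using f pq by (simp add: add.commute)
    thus ?thesis using False four_covectors_pq by (simp add: f2_def)
  qed
  moreover have "alternating (p + q) f1" "alternating (q + p) f2"
    unfolding f1_def f2_def using f pq by (auto simp: add.commute intro: alternating_four)
  moreover have "Pr k (p - q) f = (\<lambda>vs. f1 vs + f2 vs)"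
    using pq unfolding P comp_def f1_def f2_def by (auto simp: add.commute of_nat_diff)
  ultimately show thesis by (intro that)
qed

text \<open>Precomposing with the projection onto type (p,q) leaves a current that only sees forms
  of this type.\<close>

lemma four_current_type:
  assumes T: "T \<in> currents iwasawa_deck k" and k: "p + q = k"
  shows "inv_current k (\<lambda>f. T (inv_form (four \<kappa>t (2 * k + 9) (int p - int q) f))) \<in> currents_pq iwasawa_deck J p q"
  unfolding currents_pq_def
proof (intro CollectI conjI allI impI ballI)
  let ?F = "four \<kappa>t (2 * k + 9) (int p - int q)"
  have "alt_functional k (\<lambda>f. T (inv_form (?F f)))"
    by (rule alt_functional_compose[OF alt_functional_current[OF T] alternating_four four_add four_cmult four_bound])
  thus "inv_current k (\<lambda>f. T (inv_form (?F f))) \<in> currents iwasawa_deck (p + q)"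
    unfolding k by (rule inv_current_currents)
  fix r s \<phi> assume rs: "(r, s) \<noteq> (p, q)" and \<phi>: "\<phi> \<in> forms_pq iwasawa_deck J r s"
  show "inv_current k (\<lambda>f. T (inv_form (?F f))) \<phi> = 0"
  proof (cases "\<phi> \<in> forms iwasawa_deck k")
    case True
    have "?F (inv_part \<phi>) = (\<lambda>vs. 0)"
    proof (cases "r + s = k")
      case True
      thus ?thesis using four_type_eq[OF inv_part_type[OF \<phi>], of "int p - int q"] rs k by auto
    next
      case False
      have "\<phi> \<in> forms iwasawa_deck (r + s)" using \<phi> by (simp add: forms_pq_def)
      from forms_two_degrees[OF this True False] show ?thesis by (simp only: inv_part_zero four_zero_fun)
    qed
    thus ?thesis by (simp add: inv_current_def inv_form_zero current_zero[OF T])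
  qed (simp add: inv_current_def)
qed

lemma Pr_form_type:
  assumes i: "i \<in> unordered_pairs k" and f: "alternating k f"
  shows "inv_form (Pr k (fst i - snd i) f) \<in> forms_type iwasawa_deck J i"
proof -
  obtain p q where pq: "i = (p, q)" by fastforce
  obtain f1 f2 where *: "Pr k (p - q) f = (\<lambda>vs. f1 vs + f2 vs)" "alternating (p + q) f1" "f1 \<in> covectors_pq jj p q"
    "alternating (q + p) f2" "f2 \<in> covectors_pq jj q p"
    using Pr_decomp[OF i[unfolded pq] f] .
  show ?thesis unfolding pq fst_conv snd_conv *(1) inv_form_add
    by (intro set_plus_intro inv_form_type *)
qed

lemma Pr_current_type:
  assumes T: "T \<in> currents iwasawa_deck k" and i: "i \<in> unordered_pairs k"
  shows "inv_current k (\<lambda>f. T (inv_form (Pr k (fst i - snd i) f))) \<in> currents_type iwasawa_deck J i" (is "?c \<in> _")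
proof -
  obtain p q where pq: "i = (p, q)" by fastforce
  have k: "p + q = k" "q \<le> p" using i pq by (auto simp: unordered_pairs_def)
  let ?F = "\<lambda>m. inv_current k (\<lambda>f. T (inv_form (four \<kappa>t (2 * k + 9) m f)))"
  have F: "?F (int p - int q) \<in> currents_pq iwasawa_deck J p q" "?F (int q - int p) \<in> currents_pq iwasawa_deck J q p"
    using four_current_type[OF T, of p q] four_current_type[OF T, of q p] k by (simp_all add: add.commute)
  have zero: "0 \<in> currents_pq iwasawa_deck J q p" by (simp add: currents_pq_def currents_zero)
  have Pc: "Pr k (p - q) (inv_part \<phi>) = comp k (p - q) (inv_part \<phi>)" if "\<phi> \<in> forms iwasawa_deck k" for \<phi>
    by (rule Pr_comp[OF alternating_inv_part[OF that]]) (use k in simp)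
  show ?thesis
  proof (cases "p = q")
    case True
    have "?c = ?F (int p - int q) + 0"
      using True Pc by (intro ext) (simp add: pq inv_current_def comp_def)
    thus ?thesis using set_plus_intro[OF F(1) zero] by (simp only: pq fst_conv snd_conv)
  next
    case False
    have "?c = ?F (int p - int q) + ?F (int q - int p)"
    proof
      fix \<phi>
      show "?c \<phi> = (?F (int p - int q) + ?F (int q - int p)) \<phi>"
      proof (cases "\<phi> \<in> forms iwasawa_deck k")
        case True
        have a: "alternating k (four \<kappa>t (2 * k + 9) m (inv_part \<phi>))" for m
          by (rule alternating_four[OF alternating_inv_part[OF True]])
        show ?thesis using True False k
          by (simp add: pq inv_current_def Pc[OF True] comp_def inv_form_add of_nat_diff
              currentsD(2)[OF T inv_form_forms[OF a] inv_form_forms[OF a]])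
      qed (simp add: inv_current_def)
    qed
    thus ?thesis using set_plus_intro[OF F] by (simp only: pq fst_conv snd_conv)
  qed
qed

lemma alt_functional_Pr: "alt_functional l L \<Longrightarrow> alt_functional l (\<lambda>f. L (Pr k d f))"
  by (rule alt_functional_compose[OF _ alternating_Pr Pr_add Pr_cmult Pr_bound])

end

section \<open>Graded frames: the type splitting descends to cohomology and homology\<close>

locale twisted_lie = twisted + lie_frame
begin

text \<open>The projections of the invariant part onto types are closed because they commute with
  \<open>ce_d\<close>, and they add up to a representative of the class.\<close>

lemma Cinf_full: "Cinf_full_at iwasawa_deck J k"
  unfolding Cinf_full_at_iff
proof
  fix z assume z: "z \<in> closed_forms iwasawa_deck k"
  let ?f = "inv_part z"
  let ?c = "\<lambda>i. inv_form (Pr k (fst i - snd i) ?f)"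
  note z' = closed_formsD[OF z]
  have f: "alternating k ?f" by (rule alternating_inv_part[OF z'(2)])
  have cf: "ce_d ?f = (\<lambda>vs. 0)" using inv_part_ext_d[OF z'(2)] by (simp only: z'(3) inv_part_zero)
  have "?c i \<in> closed_forms_type iwasawa_deck J k i" if i: "i \<in> unordered_pairs k" for i
  proof (rule IntI)
    have "Pr k (fst i - snd i) (\<lambda>vs. 0) = (\<lambda>vs. 0)" by (simp add: Pr_alt)
    thus "?c i \<in> closed_forms iwasawa_deck k"
      by (intro inv_form_closed_forms alternating_Pr[OF f] Pr_real inv_part_real[OF z'(1)]) (simp only: ce_d_Pr cf)
    show "?c i \<in> forms_type iwasawa_deck J i" by (rule Pr_form_type[OF i f])
  qed
  moreover have "(\<Sum>i\<in>unordered_pairs k. ?c i) = inv_form ?f"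
    using sum_Pr[OF f] by (simp add: inv_form_sum[symmetric] split_beta)
  ultimately show "\<exists>c. (\<forall>i\<in>unordered_pairs k. c i \<in> closed_forms_type iwasawa_deck J k i) \<and>
     z - (\<Sum>i\<in>unordered_pairs k. c i) \<in> exact_forms iwasawa_deck k"
    using cohomologous_inv_part[OF z] by (intro exI[of _ ?c]) simp
qed

text \<open>If the c i add up to the differential of \<eta>, then projecting the invariant parts
  leaves that of c i on one side and the differential of the projection of \<eta> on the
  other.\<close>

lemma Cinf_pure: "Cinf_pure_at iwasawa_deck J k"
  unfolding Cinf_pure_at_iff
proof (intro allI impI ballI, elim conjE)
  fix c i
  assume c: "\<forall>i\<in>unordered_pairs k. c i \<in> closed_forms_type iwasawa_deck J k i"
    and s: "(\<Sum>i\<in>unordered_pairs k. c i) \<in> exact_forms iwasawa_deck k" and i: "i \<in> unordered_pairs k"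
  let ?P = "Pr k (fst i - snd i)"
  have cl: "c j \<in> closed_forms iwasawa_deck k" if "j \<in> unordered_pairs k" for j using c that by blast
  have cf: "c j \<in> forms iwasawa_deck k" if "j \<in> unordered_pairs k" for j by (rule closed_formsD(2)[OF cl[OF that]])
  have "?P (inv_part (\<Sum>j\<in>unordered_pairs k. c j)) = (\<lambda>vs. \<Sum>j\<in>unordered_pairs k. ?P (inv_part (c j)) vs)"
    using conjunct1[OF inv_part_sum[of "unordered_pairs k" c k, OF cf]] Pr_sum[where k = k and d = "fst i - snd i" and A = "unordered_pairs k" and c = "\<lambda>_. 1" and f = "\<lambda>j. inv_part (c j)"]
    by simp
  also have "\<dots> = (\<lambda>vs. \<Sum>j\<in>unordered_pairs k. if i = j then inv_part (c j) vs else 0)"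
    by (intro ext sum.cong refl) (use c in \<open>simp add: Pr_type[OF i]\<close>)
  also have "\<dots> = inv_part (c i)" using i by simp
  finally have Pi: "?P (inv_part (\<Sum>j\<in>unordered_pairs k. c j)) = inv_part (c i)" .
  have "inv_form (inv_part (c i)) \<in> exact_forms iwasawa_deck k"
  proof (cases k)
    case 0
    hence "(\<Sum>i\<in>unordered_pairs k. c i) = 0" using s by (simp add: exact_forms_cases)
    hence "inv_part (c i) = (\<lambda>vs. 0)" unfolding Pi[symmetric] by (simp add: inv_part_zero Pr_alt)
    thus ?thesis using subgrpD(1)[OF subgrp_exact_forms] by (simp only: inv_form_zero)
  next
    case (Suc j)
    then obtain \<eta> where \<eta>: "(\<Sum>i\<in>unordered_pairs k. c i) = ext_d \<eta>" "\<eta> \<in> real_forms iwasawa_deck j"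
      using s by (auto simp: exact_forms_cases)
    have \<eta>': "\<eta> \<in> forms iwasawa_deck j" using \<eta>(2) by (simp add: real_forms_def)
    have a: "alternating j (?P (inv_part \<eta>))" by (rule alternating_Pr[OF alternating_inv_part[OF \<eta>']])
    have "inv_part (c i) = ce_d (?P (inv_part \<eta>))"
      unfolding Pi[symmetric] \<eta>(1) inv_part_ext_d[OF \<eta>'] ce_d_Pr ..
    hence "inv_form (inv_part (c i)) = ext_d (inv_form (?P (inv_part \<eta>)))" by (simp only: ext_d_inv_form[OF a])
    moreover have "inv_form (?P (inv_part \<eta>)) \<in> real_forms iwasawa_deck j"
      by (intro inv_form_real_forms a Pr_real inv_part_real[OF \<eta>(2)])
    ultimately show ?thesis unfolding exact_forms_cases Suc nat.case by (rule image_eqI)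
  qed
  from subgrpD(4)[OF subgrp_exact_forms cohomologous_inv_part[OF cl[OF i]] this]
  show "c i \<in> exact_forms iwasawa_deck k" by (simp only: diff_add_cancel)
qed

text \<open>As for forms, with the projections transposed: T is evaluated on the type components of
  the invariant part.\<close>

lemma full: "full_at iwasawa_deck J k"
  unfolding full_at_iff
proof
  fix T assume T: "T \<in> closed_currents iwasawa_deck k"
  note T' = closed_currentsD[OF T]
  let ?l = "\<lambda>i f. T (inv_form (Pr k (fst i - snd i) f))"
  let ?c = "\<lambda>i. inv_current k (?l i)"
  have "?c i \<in> closed_currents_type iwasawa_deck J k i" if i: "i \<in> unordered_pairs k" for i
  proof (rule IntI)
    have Ti: "T (inv_form (ce_d f)) = 0" if "k = Suc j" "alternating j f" for j f
      using T'(3)[OF that(1) inv_form_forms[OF that(2)]] ext_d_inv_form[OF that(2)] by simp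
    show "?c i \<in> closed_currents iwasawa_deck k"
    proof (rule inv_current_closed)
      show "alt_functional k (?l i)" by (rule alt_functional_Pr[OF alt_functional_current[OF T'(1)]])
      show "?l i f \<in> \<real>" if "alternating k f" "\<And>vs. f vs \<in> \<real>" for f
        by (intro T'(2) inv_form_real_forms alternating_Pr Pr_real that)
      show "?l i (ce_d f) = 0" if "k = Suc j" "alternating j f" for j f
        using Ti[OF that(1) alternating_Pr[OF that(2)]] by (simp only: ce_d_Pr)
    qed
    show "?c i \<in> currents_type iwasawa_deck J i" by (rule Pr_current_type[OF T'(1) i])
  qed
  moreover have "(\<Sum>i\<in>unordered_pairs k. ?c i) = inv_current k (\<lambda>f. T (inv_form f))"
  proof
    fix \<phi>
    show "(\<Sum>i\<in>unordered_pairs k. ?c i) \<phi> = inv_current k (\<lambda>f. T (inv_form f)) \<phi>"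
    proof (cases "\<phi> \<in> forms iwasawa_deck k")
      case True
      note a = alternating_inv_part[OF True]
      have "(\<Sum>i\<in>unordered_pairs k. ?l i (inv_part \<phi>)) = T (\<Sum>i\<in>unordered_pairs k. inv_form (Pr k (fst i - snd i) (inv_part \<phi>)))"
        by (rule conjunct1[OF current_sum[OF T'(1)], symmetric]) (rule inv_form_forms[OF alternating_Pr[OF a]])
      also have "\<dots> = T (inv_form (inv_part \<phi>))"
        using sum_Pr[OF a] by (simp add: inv_form_sum[symmetric] split_beta)
      finally show ?thesis using True by (simp add: sum_fun_apply inv_current_def)
    qed (simp add: sum_fun_apply inv_current_def)
  qed
  ultimately show "\<exists>c. (\<forall>i\<in>unordered_pairs k. c i \<in> closed_currents_type iwasawa_deck J k i) \<and>
     T - (\<Sum>i\<in>unordered_pairs k. c i) \<in> exact_currents iwasawa_deck k"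
    using homologous_inv_current[OF T] by (intro exI[of _ ?c]) simp
qed

text \<open>If the c j add up to the boundary of S, then c i takes the same value on a
  left-invariant f as on its component of type i, where the other c j vanish. So c i is homologous
  to the boundary of S composed with the projection.\<close>

lemma pure: "pure_at iwasawa_deck J k"
  unfolding pure_at_iff
proof (intro allI impI ballI, elim conjE)
  fix c i
  assume c: "\<forall>i\<in>unordered_pairs k. c i \<in> closed_currents_type iwasawa_deck J k i"
    and s: "(\<Sum>i\<in>unordered_pairs k. c i) \<in> exact_currents iwasawa_deck k" and i: "i \<in> unordered_pairs k"
  let ?P = "Pr k (fst i - snd i)"
  obtain S where S: "S \<in> real_currents iwasawa_deck (Suc k)" "(\<Sum>i\<in>unordered_pairs k. c i) = current_d iwasawa_deck (Suc k) S"
    using s by (auto simp: exact_currents_def)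
  have cl: "c j \<in> closed_currents iwasawa_deck k" if "j \<in> unordered_pairs k" for j using c that by blast
  note cc = closed_currentsD(1)[OF cl]
  have off: "c j (inv_form (Pr k (fst l - snd l) f)) = 0"
    if j: "j \<in> unordered_pairs k" and l: "l \<in> unordered_pairs k" and jl: "j \<noteq> l" and f: "alternating k f" for j l f
    by (rule type_pairing[OF j l jl _ Pr_form_type[OF l f]]) (use c j in blast)
  have Sc: "S \<in> currents iwasawa_deck (Suc k)" using S(1) by (simp add: real_currents_def)
  have "inv_current k (\<lambda>f. c i (inv_form f)) = current_d iwasawa_deck (Suc k) (inv_current (Suc k) (\<lambda>f. S (inv_form (?P f))))"
    unfolding current_d_inv_current
  proof
    fix \<phi>
    show "inv_current k (\<lambda>f. c i (inv_form f)) \<phi> = inv_current k (\<lambda>f. S (inv_form (?P (ce_d f)))) \<phi>"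
    proof (cases "\<phi> \<in> forms iwasawa_deck k")
      case True
      let ?f = "inv_part \<phi>"
      note a = alternating_inv_part[OF True]
      have aP: "alternating k (?P ?f)" by (rule alternating_Pr[OF a])
      have "S (inv_form (?P (ce_d ?f))) = current_d iwasawa_deck (Suc k) S (inv_form (?P ?f))"
        using inv_form_forms[OF aP] by (simp add: current_d_def ext_d_inv_form[OF aP] ce_d_Pr)
      also have "\<dots> = (\<Sum>j\<in>unordered_pairs k. c j (inv_form (?P ?f)))"
        unfolding S(2)[symmetric] by (simp add: sum_fun_apply)
      also have "\<dots> = (\<Sum>j\<in>unordered_pairs k. if j = i then c i (inv_form (?P ?f)) else 0)"
        by (rule sum.cong) (use off[OF _ i _ a] in auto)
      also have "\<dots> = (\<Sum>j\<in>unordered_pairs k. if j = i then c i (inv_form (Pr k (fst j - snd j) ?f)) else 0)"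
        by (rule sum.cong) auto
      also have "\<dots> = (\<Sum>j\<in>unordered_pairs k. c i (inv_form (Pr k (fst j - snd j) ?f)))"
        by (rule sum.cong) (use off[OF i _ _ a] in auto)
      also have "\<dots> = c i (\<Sum>j\<in>unordered_pairs k. inv_form (Pr k (fst j - snd j) ?f))"
        by (rule conjunct1[OF current_sum[OF cc[OF i]], symmetric]) (rule inv_form_forms[OF alternating_Pr[OF a]])
      also have "\<dots> = c i (inv_form ?f)"
        using sum_Pr[OF a] by (simp add: inv_form_sum[symmetric] split_beta)
      finally show ?thesis using True by (simp add: inv_current_def)
    qed (simp add: inv_current_def)
  qed
  moreover have "inv_current (Suc k) (\<lambda>f. S (inv_form (?P f))) \<in> real_currents iwasawa_deck (Suc k)"
  proof (rule inv_current_real)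
    show "alt_functional (Suc k) (\<lambda>f. S (inv_form (?P f)))" by (rule alt_functional_Pr[OF alt_functional_current[OF Sc]])
    show "S (inv_form (?P f)) \<in> \<real>" if f: "alternating (Suc k) f" "\<And>vs. f vs \<in> \<real>" for f
      using S(1) inv_form_real_forms[OF alternating_Pr[OF f(1)] Pr_real[OF f(2)]] by (simp add: real_currents_def)
  qed
  ultimately have "inv_current k (\<lambda>f. c i (inv_form f)) \<in> exact_currents iwasawa_deck k"
    unfolding exact_currents_def by (rule image_eqI)
  from subgrpD(4)[OF subgrp_exact_currents homologous_inv_current[OF cl[OF i]] this]
  show "c i \<in> exact_currents iwasawa_deck k" by (simp only: diff_add_cancel)
qed

end

section \<open>Obstructions in degree two\<close>

definition form1 :: "('a \<Rightarrow> complex) \<Rightarrow> 'a list \<Rightarrow> complex" where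
  "form1 a vs = (case vs of [u] \<Rightarrow> a u | _ \<Rightarrow> 0)"

definition form2 :: "('a \<Rightarrow> 'a \<Rightarrow> complex) \<Rightarrow> 'a list \<Rightarrow> complex" where
  "form2 B vs = (case vs of [u, v] \<Rightarrow> B u v | _ \<Rightarrow> 0)"

lemma form1_simps [simp]: "form1 a [u] = a u" and form2_simps [simp]: "form2 B [u, v] = B u v"
  by (simp_all add: form1_def form2_def)

lemma list_length_3: "length vs = 3 \<longleftrightarrow> (\<exists>u v w. vs = [u, v, w])"
  by (auto simp: numeral_3_eq_3 length_Suc_conv)

lemma form1_real: "(\<And>u. a u \<in> \<real>) \<Longrightarrow> form1 a vs \<in> \<real>"
  by (simp add: form1_def split: list.split)

lemma form2_real: "(\<And>u v. B u v \<in> \<real>) \<Longrightarrow> form2 B vs \<in> \<real>"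
  by (simp add: form2_def split: list.split)

lemma alternating_form1:
  assumes "linear a" shows "alternating 1 (form1 a)"
proof (rule alternatingI)
  fix vs :: "'a list" assume "length vs \<noteq> 1"
  thus "form1 a vs = 0" by (auto simp: form1_def split: list.split)
qed (use assms in simp_all)

lemma alternating_form2:
  assumes "\<And>u. linear (B u)" "\<And>v. linear (\<lambda>u. B u v)" "\<And>v. B v v = 0" shows "alternating 2 (form2 B)"
proof (rule alternatingI)
  fix vs :: "'a list" assume "length vs \<noteq> 2"
  thus "form2 B vs = 0" by (auto simp: form2_def split: list.split)
next
  fix us vs :: "'a list" assume "length us + length vs + 1 = 2"
  hence "(\<exists>x. us = [x] \<and> vs = []) \<or> (\<exists>x. us = [] \<and> vs = [x])"
    by (cases us; cases vs) auto
  thus "linear (\<lambda>v. form2 B (us @ v # vs))" using assms(1,2) by auto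
next
  fix us vs ws :: "'a list" and v assume "length us + length vs + length ws + 2 = 2"
  thus "form2 B (us @ v # vs @ v # ws) = 0" using assms(3) by simp
qed

text \<open>The central coordinate of the Lie bracket.\<close>

definition sg :: "complex ^ 3 \<Rightarrow> complex ^ 3 \<Rightarrow> complex" where
  "sg u v = u $ 1 * v $ 2 - v $ 1 * u $ 2"

lemma axis_zero [simp]: "axis i 0 = (0 :: complex ^ 3)"
  by (simp add: axis_def zero_vec_def)

lemma sg_central [simp]: "sg (axis 3 c) v = 0" "sg v (axis 3 c) = 0"
  by (simp_all add: sg_def axis_def)

lemma bet_sg: "bet u v - bet v u = axis 3 (sg u v)"
  by (simp add: vec_eq_iff forall_3 axis_def sg_def mult.commute)

lemma ce_d_1:
  assumes "alternating 1 f" shows "ce_d f [u, v] = - f [axis 3 (sg u v)]"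
proof -
  have lin: "linear (\<lambda>v. f [v])" using alternating_linear[OF assms, of "[]" "[]"] by simp
  have "ce_d f [u, v] = - (f [bet u v] - f [bet v u])"
    by (simp add: ce_d_def antisymmetrize_def slot_sum_def numeral_2_eq_2)
  thus ?thesis using linear_diff[OF lin, of "bet u v" "bet v u"] by (simp only: bet_sg)
qed

lemma alternating_2_swap: "alternating 2 f \<Longrightarrow> f [v, u] = - f [u, v]"
  using alternating_transpose[of 2 f "[u, v]" 0 1] by simp

lemma ce_d_2:
  assumes "alternating 2 f"
  shows "ce_d f [u, v, w] = - (f [axis 3 (sg u v), w] - f [axis 3 (sg u w), v] + f [axis 3 (sg v w), u])"
proof -
  have lin: "linear (\<lambda>v. f [v, x])" for x using alternating_linear[OF assms, of "[]" "[x]"] by simp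
  have d: "f [axis 3 (sg u v), x] = f [bet u v, x] - f [bet v u, x]" for u v x
    using linear_diff[OF lin[of x], of "bet u v" "bet v u"] by (simp only: bet_sg)
  note s = alternating_2_swap[OF assms]
  have "ce_d f [u, v, w] = - ((f [bet u v, w] + f [v, bet u w]) - (f [bet v u, w] + f [u, bet v w]) + (f [bet w u, v] + f [u, bet w v]))"
    by (simp add: ce_d_def antisymmetrize_def slot_sum_def numeral_3_eq_3 numeral_2_eq_2)
  also have "\<dots> = - ((f [bet u v, w] - f [bet u w, v]) - (f [bet v u, w] - f [bet v w, u]) + (f [bet w u, v] - f [bet w v, u]))"
    using s[of v "bet u w"] s[of u "bet v w"] s[of u "bet w v"] by simp
  finally show ?thesis by (simp add: d)
qed

lemma ce_d_eq_0I:
  assumes f: "alternating 2 f" and z: "\<And>u v w. ce_d f [u, v, w] = 0" shows "ce_d f = (\<lambda>vs. 0)"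
proof
  fix vs
  have "alternating 3 (ce_d f)" using alternating_ce_d[OF f] by (simp add: numeral_3_eq_3 numeral_2_eq_2)
  thus "ce_d f vs = 0" using alternating_length[of 3 "ce_d f" vs] z by (cases "length vs = 3") (auto simp: list_length_3)
qed

lemma ce_d_real: "(\<And>vs. f vs \<in> \<real>) \<Longrightarrow> ce_d f vs \<in> \<real>"
  unfolding ce_d_def antisymmetrize_def slot_sum_def by (intro Reals_minus sum_in_Reals Reals_mult Reals_power) auto

lemma alt_functional_diff:
  assumes "alt_functional k l" "alt_functional k l'" shows "alt_functional k (\<lambda>f. l f - l' f)"
proof -
  obtain C where C: "C \<ge> 0" "\<forall>f M. alternating k f \<longrightarrow> M \<ge> 0 \<longrightarrow> (\<forall>vs. cmod (f vs) \<le> M * pn vs) \<longrightarrow> cmod (l f) \<le> C * M"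
    using assms(1)[unfolded alt_functional_def, THEN conjunct2, THEN conjunct2] by (elim exE conjE)
  obtain D where D: "D \<ge> 0" "\<forall>f M. alternating k f \<longrightarrow> M \<ge> 0 \<longrightarrow> (\<forall>vs. cmod (f vs) \<le> M * pn vs) \<longrightarrow> cmod (l' f) \<le> D * M"
    using assms(2)[unfolded alt_functional_def, THEN conjunct2, THEN conjunct2] by (elim exE conjE)
  have b: "cmod (l f - l' f) \<le> (C + D) * M" if "alternating k f" "M \<ge> 0" "\<forall>vs. cmod (f vs) \<le> M * pn vs" for f M
  proof -
    have "cmod (l f - l' f) \<le> cmod (l f) + cmod (l' f)" by (rule norm_triangle_ineq4)
    also have "\<dots> \<le> C * M + D * M" by (rule add_mono[OF C(2)[rule_format, OF that(1,2)] D(2)[rule_format, OF that(1,2)]]) (use that in auto)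
    finally show ?thesis by (simp add: distrib_right)
  qed
  show ?thesis unfolding alt_functional_def
  proof (intro conjI allI impI)
    show "\<exists>C\<ge>0. \<forall>f M. alternating k f \<longrightarrow> M \<ge> 0 \<longrightarrow> (\<forall>vs. cmod (f vs) \<le> M * pn vs) \<longrightarrow> cmod (l f - l' f) \<le> C * M"
      by (rule exI[of _ "C + D"], intro conjI allI impI b) (use C(1) D(1) in auto)
  qed (use assms in \<open>simp_all add: alt_functional_def right_diff_distrib\<close>)
qed

lemma inv_current_cong:
  assumes "\<And>f. alternating k f \<Longrightarrow> l f = l' f" shows "inv_current k l = inv_current k l'"
proof
  fix \<phi>
  show "inv_current k l \<phi> = inv_current k l' \<phi>"
    using assms[OF alternating_inv_part[of \<phi> k]] by (simp add: inv_current_def)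
qed

lemma exact_forms_2: "exact_forms G 2 = ext_d ` real_forms G 1"
  by (simp add: exact_forms_cases numeral_2_eq_2)

text \<open>After averaging, the primitive is a left-invariant 1-form, and its differential at two
  vectors depends only on their bracket.\<close>

lemma exact_forms_2_eval:
  assumes "alternating 2 g" "inv_form g \<in> exact_forms iwasawa_deck 2" "sg u v = 0" shows "g [u, v] = 0"
proof -
  obtain \<xi> where \<xi>: "inv_form g = ext_d \<xi>" "\<xi> \<in> real_forms iwasawa_deck 1"
    using assms(2) unfolding exact_forms_2 by blast
  have f: "\<xi> \<in> forms iwasawa_deck 1" using \<xi>(2) by (simp add: real_forms_def)
  have "g = ce_d (inv_part \<xi>)" using inv_part_inv_form[of g] inv_part_ext_d[OF f] by (simp only: \<xi>(1))
  moreover have "inv_part \<xi> [0] = 0"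
    using linear_0[OF alternating_linear[OF alternating_inv_part[OF f], of "[]" "[]"]] by simp
  ultimately show ?thesis using ce_d_1[OF alternating_inv_part[OF f], of u v] assms(3) by simp
qed

lemma current_d_closed:
  assumes "S \<in> real_currents iwasawa_deck (Suc 2)" "\<phi> \<in> closed_forms iwasawa_deck 2"
  shows "current_d iwasawa_deck (Suc 2) S \<phi> = 0"
proof -
  have "S 0 = 0" using assms(1) by (intro current_zero[of S iwasawa_deck "Suc 2"]) (simp add: real_currents_def)
  thus ?thesis by (simp only: current_d_def closed_formsD(3)[OF assms(2)] if_cancel)
qed

lemma unordered_pairs_2: "unordered_pairs 2 = {(2, 0), (1, 1)}"
  by (auto simp: unordered_pairs_def)

context twisted
begin

lemma Psi_jj [simp]: "\<Psi> (jj v) = \<i> *s \<Psi> v"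
  by (simp add: jj_def)

lemma map_jj_eigen:
  assumes "f \<in> covectors_pq jj p q" shows "f (map jj vs) = cis (pi / 2 * of_int (int p - int q)) * f vs"
proof -
  have "rot \<kappa>t (pi / 2) = jj" by (simp add: rot_one fun_eq_iff)
  thus ?thesis using covectors_pq_eigen[OF assms, of "pi / 2" vs] by simp
qed

text \<open>\<open>jj\<close> acts on 2-forms as -1 on the types (2,0) and (0,2) and as 1 on the
  type (1,1), so the projections are half the difference and half the sum.\<close>

lemma Pr_2:
  assumes f: "alternating 2 f"
  shows "Pr 2 2 f vs = (f vs - f (map jj vs)) / 2" "Pr 2 0 f vs = (f vs + f (map jj vs)) / 2"
proof -
  have s: "f ws = Pr 2 2 f ws + Pr 2 0 f ws" for ws using sum_Pr[OF f, of ws] by (simp add: unordered_pairs_2)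
  have m: "(2, 0) \<in> unordered_pairs 2" "(1, 1) \<in> unordered_pairs 2" by (simp_all add: unordered_pairs_2)
  have a: "Pr 2 2 f (map jj vs) = - Pr 2 2 f vs"
  proof -
    obtain f1 f2 where *: "Pr 2 (2 - 0) f = (\<lambda>vs. f1 vs + f2 vs)" "f1 \<in> covectors_pq jj 2 0" "f2 \<in> covectors_pq jj 0 2"
      by (rule Pr_decomp[OF m(1) f])
    have "cis (- pi) = -1" by (simp add: complex_eq_iff)
    thus ?thesis using *(1) map_jj_eigen[OF *(2), of vs] map_jj_eigen[OF *(3), of vs] by simp
  qed
  have b: "Pr 2 0 f (map jj vs) = Pr 2 0 f vs"
  proof -
    obtain f1 f2 where *: "Pr 2 (1 - 1) f = (\<lambda>vs. f1 vs + f2 vs)" "f1 \<in> covectors_pq jj 1 1" "f2 \<in> covectors_pq jj 1 1"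
      by (rule Pr_decomp[OF m(2) f])
    thus ?thesis using *(1) map_jj_eigen[OF *(2), of vs] map_jj_eigen[OF *(3), of vs] by simp
  qed
  show "Pr 2 2 f vs = (f vs - f (map jj vs)) / 2" "Pr 2 0 f vs = (f vs + f (map jj vs)) / 2"
    unfolding s[of vs] s[of "map jj vs"] a b by simp_all
qed

end

text \<open>The bracket is complex bilinear, so v0 and \<i> v0 commute; the second assumption says
  that their images under \<open>jj\<close> do not.\<close>

locale obstructed = twisted +
  fixes v0 :: "complex ^ 3"
  assumes jj_central: "\<exists>c'. jj (axis 3 c) = axis 3 c'"
    and v0: "sg (jj v0) (jj (\<i> *s v0)) \<noteq> 0"
begin

abbreviation iv0 where "iv0 \<equiv> \<i> *s v0"

lemma sg_v0 [simp]: "sg v0 iv0 = 0"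
  by (simp add: sg_def)

text \<open>The differential of a left-invariant 1-form vanishes on central arguments, and so do its
  type components because \<open>jj\<close> preserves the centre. The differential of a 2-form only
  sees values with a central argument.\<close>

lemma ce_d_Pr_ce_d:
  assumes f: "alternating 1 f" and d: "d = 0 \<or> d = 2" shows "ce_d (Pr 2 d (ce_d f)) = (\<lambda>vs. 0)"
proof -
  have a: "alternating 2 (ce_d f)" using alternating_ce_d[OF f] by (simp add: numeral_2_eq_2)
  have "f [0] = 0" using linear_0[OF alternating_linear[OF f, of "[]" "[]"]] by simp
  hence z: "ce_d f [axis 3 c, v] = 0" for c v by (simp add: ce_d_1[OF f])
  have "Pr 2 d (ce_d f) [axis 3 c, v] = 0" for c v
  proof -
    obtain c' where "jj (axis 3 c) = axis 3 c'" using jj_central by blast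
    thus ?thesis using d by (auto simp: Pr_2[OF a] z)
  qed
  thus ?thesis by (intro ce_d_eq_0I alternating_Pr[OF a]) (simp add: ce_d_2[OF alternating_Pr[OF a]])
qed

text \<open>A real functional of the central coordinate. The conjugate factor makes its value on the
  bracket of the \<open>jj\<close>-images the square of a modulus.\<close>

definition \<eta> :: "(complex ^ 3) list \<Rightarrow> complex" where
  "\<eta> = form1 (\<lambda>v. of_real (Re (cnj (sg (jj v0) (jj iv0)) * v $ 3)))"

lemma alternating_\<eta>: "alternating 1 \<eta>"
  unfolding \<eta>_def by (rule alternating_form1, rule linearI) (simp_all add: scaleR_conv_of_real[where 'a = complex] algebra_simps)

lemma \<eta>_real: "\<eta> vs \<in> \<real>"
  unfolding \<eta>_def by (rule form1_real) simp

lemma alternating_d\<eta>: "alternating 2 (ce_d \<eta>)"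
  using alternating_ce_d[OF alternating_\<eta>] by (simp add: numeral_2_eq_2)

abbreviation \<alpha> :: "nat \<times> nat \<Rightarrow> (complex ^ 3) form" where
  "\<alpha> i \<equiv> inv_form (Pr 2 (fst i - snd i) (ce_d \<eta>))"

lemma \<alpha>_closed: "i \<in> unordered_pairs 2 \<Longrightarrow> \<alpha> i \<in> closed_forms_type iwasawa_deck J 2 i"
proof (rule IntI)
  assume i: "i \<in> unordered_pairs 2"
  thus "\<alpha> i \<in> forms_type iwasawa_deck J i" by (rule Pr_form_type[OF _ alternating_d\<eta>])
  have "fst i - snd i = 0 \<or> fst i - snd i = 2" using i by (auto simp: unordered_pairs_2)
  thus "\<alpha> i \<in> closed_forms iwasawa_deck 2"
    by (intro inv_form_closed_forms alternating_Pr[OF alternating_d\<eta>] Pr_real ce_d_real \<eta>_real ce_d_Pr_ce_d alternating_\<eta>)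
qed

lemma sum_\<alpha>: "(\<Sum>i\<in>unordered_pairs 2. \<alpha> i) = ext_d (inv_form \<eta>)"
  using sum_Pr[OF alternating_d\<eta>] by (simp add: inv_form_sum[symmetric] split_beta ext_d_inv_form[OF alternating_\<eta>])

text \<open>The differential of \<eta> is 0 at (v0, \<i> v0), and at the \<open>jj\<close>-images it
  is minus the squared modulus of their bracket; half the difference is positive.\<close>

lemma \<alpha>_eval: "Pr 2 2 (ce_d \<eta>) [v0, iv0] \<noteq> 0"
proof -
  let ?s = "sg (jj v0) (jj iv0)"
  have "ce_d \<eta> [u, v] = - of_real (Re (cnj ?s * sg u v))" for u v
    unfolding ce_d_1[OF alternating_\<eta>] by (simp add: \<eta>_def axis_def)
  hence "Pr 2 2 (ce_d \<eta>) [v0, iv0] = of_real (Re (cnj ?s * ?s)) / 2"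
    by (simp add: Pr_2[OF alternating_d\<eta>])
  moreover have "Re (cnj ?s * ?s) \<noteq> 0" using v0 by (simp add: complex_eq_iff sum_power2_eq_zero_iff[unfolded power2_eq_square])
  ultimately show ?thesis by (simp only: divide_eq_0_iff of_real_eq_0_iff) simp
qed

lemma pairs_2: "(2, 0) \<in> unordered_pairs 2" "(1, 1) \<in> unordered_pairs 2"
  by (simp_all add: unordered_pairs_2)

text \<open>The \<alpha> are closed with exact sum, but \<open>\<alpha> (2, 0)\<close> does not
  vanish on the commuting pair v0, \<i> v0 and hence is not exact.\<close>

theorem not_Cinf_pure: "\<not> Cinf_pure_at iwasawa_deck J 2"
proof
  assume p: "Cinf_pure_at iwasawa_deck J 2"
  have "(\<Sum>i\<in>unordered_pairs 2. \<alpha> i) \<in> exact_forms iwasawa_deck 2"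
    unfolding sum_\<alpha> exact_forms_2 by (rule imageI[OF inv_form_real_forms[OF alternating_\<eta> \<eta>_real]])
  hence "\<alpha> (2, 0) \<in> exact_forms iwasawa_deck 2"
    by (intro mp[OF spec[OF p[unfolded Cinf_pure_at_iff], of \<alpha>], THEN bspec, OF _ pairs_2(1)] conjI ballI \<alpha>_closed)
  hence "Pr 2 2 (ce_d \<eta>) [v0, iv0] = 0"
    by (intro exact_forms_2_eval[OF alternating_Pr[OF alternating_d\<eta>] _ sg_v0]) simp
  thus False using \<alpha>_eval by blast
qed

text \<open>In a decomposition of the evaluation current everything would kill
  \<open>\<alpha> (2, 0)\<close>: the (1,1)-part by type; the other part because it kills
  \<open>\<alpha> (1, 1)\<close> by type and the exact sum of both by closedness; and a boundary
  because \<open>\<alpha> (2, 0)\<close> is closed.\<close>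

theorem not_full: "\<not> full_at iwasawa_deck J 2"
proof
  assume f: "full_at iwasawa_deck J 2"
  let ?T = "inv_current 2 (\<lambda>f. f [v0, iv0])"
  have T: "?T \<in> closed_currents iwasawa_deck 2"
  proof (rule inv_current_closed)
    fix j and f :: "(complex ^ 3) list \<Rightarrow> complex" assume "2 = Suc j" "alternating j f"
    hence f: "alternating 1 f" by simp
    have "f [0] = 0" using linear_0[OF alternating_linear[OF f, of "[]" "[]"]] by simp
    thus "ce_d f [v0, iv0] = 0" by (simp add: ce_d_1[OF f])
  qed (rule alt_functional_eval)
  from bspec[OF f[unfolded full_at_iff] T] obtain c
    where "\<forall>i\<in>unordered_pairs 2. c i \<in> closed_currents_type iwasawa_deck J 2 i"
    and e: "?T - (\<Sum>i\<in>unordered_pairs 2. c i) \<in> exact_currents iwasawa_deck 2"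
    by (elim exE conjE)
  note c = bspec[OF this(1)]
  have \<alpha>: "\<alpha> i \<in> forms iwasawa_deck 2" for i by (rule inv_form_forms[OF alternating_Pr[OF alternating_d\<eta>]])
  have z: "c i (\<alpha> (2, 0)) = 0" if i: "i \<in> unordered_pairs 2" for i
  proof (cases "i = (2, 0)")
    case True
    have ci: "c i \<in> closed_currents iwasawa_deck 2" by (rule IntD1[OF c[OF i]])
    have "(\<Sum>j\<in>unordered_pairs 2. c i (\<alpha> j)) = c i (\<Sum>j\<in>unordered_pairs 2. \<alpha> j)"
      by (rule conjunct1[OF current_sum[OF closed_currentsD(1)[OF ci]], symmetric]) (rule \<alpha>)
    also have "\<dots> = 0" unfolding sum_\<alpha>
      by (rule closed_currentsD(3)[OF ci _ inv_form_forms[OF alternating_\<eta>]]) simp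
    finally have "c i (\<alpha> (2, 0)) + c i (\<alpha> (1, 1)) = 0" by (simp add: unordered_pairs_2)
    moreover have "c i (\<alpha> (1, 1)) = 0"
      by (rule type_pairing[OF i pairs_2(2) _ IntD2[OF c[OF i]] IntD2[OF \<alpha>_closed[OF pairs_2(2)]]]) (simp add: True)
    ultimately show ?thesis by simp
  next
    case False
    show ?thesis
      by (rule type_pairing[OF i pairs_2(1) False IntD2[OF c[OF i]] IntD2[OF \<alpha>_closed[OF pairs_2(1)]]])
  qed
  obtain S where S: "S \<in> real_currents iwasawa_deck (Suc 2)" "?T - (\<Sum>i\<in>unordered_pairs 2. c i) = current_d iwasawa_deck (Suc 2) S"
    using e by (auto simp: exact_currents_def)
  have "\<alpha> (2, 0) \<in> closed_forms iwasawa_deck 2" by (rule IntD1[OF \<alpha>_closed[OF pairs_2(1)]])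
  hence "current_d iwasawa_deck (Suc 2) S (\<alpha> (2, 0)) = 0" by (rule current_d_closed[OF S(1)])
  hence "?T (\<alpha> (2, 0)) - (\<Sum>i\<in>unordered_pairs 2. c i (\<alpha> (2, 0))) = 0"
    unfolding S(2)[symmetric] by (simp only: fun_diff_def sum_fun_apply)
  hence "?T (\<alpha> (2, 0)) = 0" using z by simp
  thus False using \<alpha>_eval by (simp add: inv_current_inv_form[OF alternating_Pr[OF alternating_d\<eta>]])
qed

text \<open>The differential evaluated at (v0, \<i> v0, w), written without w: the brackets of v0
  and \<i> v0 with w will be 1 and \<i>, and their own bracket is 0.\<close>

definition d_eval :: "((complex ^ 3) list \<Rightarrow> complex) \<Rightarrow> complex" where
  "d_eval f = f [axis 3 1, iv0] - f [axis 3 \<i>, v0]"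

lemma alt_functional_d_eval: "alt_functional 2 d_eval"
  unfolding d_eval_def[abs_def] by (intro alt_functional_diff alt_functional_eval)

text \<open>v0 is not central, for otherwise \<open>jj v0\<close> would be central too and have no
  nonzero bracket. So one of its first two coordinates can be inverted.\<close>

lemma ex_w: "\<exists>w. sg v0 w = 1"
proof -
  have "v0 $ 1 \<noteq> 0 \<or> v0 $ 2 \<noteq> 0"
  proof (rule ccontr)
    assume "\<not> (v0 $ 1 \<noteq> 0 \<or> v0 $ 2 \<noteq> 0)"
    hence "v0 = axis 3 (v0 $ 3)" by (simp add: vec_eq_iff forall_3 axis_def)
    moreover obtain c' where "jj (axis 3 (v0 $ 3)) = axis 3 c'" using jj_central[of "v0 $ 3"] by (elim exE)
    ultimately have "jj v0 = axis 3 c'" by simp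
    thus False using v0 by simp
  qed
  thus ?thesis
  proof
    assume "v0 $ 1 \<noteq> 0"
    thus ?thesis by (intro exI[of _ "axis 2 (1 / v0 $ 1)"]) (simp add: sg_def axis_def)
  next
    assume "v0 $ 2 \<noteq> 0"
    thus ?thesis by (intro exI[of _ "axis 1 (- 1 / v0 $ 2)"]) (simp add: sg_def axis_def)
  qed
qed

definition w :: "complex ^ 3" where "w = (SOME w. sg v0 w = 1)"

lemma d_eval_ce_d:
  assumes f: "alternating 2 f" shows "d_eval f = ce_d f [v0, iv0, w]"
proof -
  have w: "sg v0 w = 1" unfolding w_def by (rule someI_ex[OF ex_w])
  hence "sg iv0 w = \<i>" by (simp add: sg_def algebra_simps)
  moreover have "f [0, w] = 0" using linear_0[OF alternating_linear[OF f, of "[]" "[w]"]] by simp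
  ultimately show ?thesis unfolding ce_d_2[OF f] by (simp add: d_eval_def w)
qed

text \<open>The type components of the boundary of the evaluation at (v0, \<i> v0, w).\<close>

definition split_current :: "nat \<times> nat \<Rightarrow> (complex ^ 3) current" where
  "split_current i = inv_current 2 (\<lambda>f. d_eval (Pr 2 (fst i - snd i) f))"

lemma split_current_closed: "i \<in> unordered_pairs 2 \<Longrightarrow> split_current i \<in> closed_currents_type iwasawa_deck J 2 i"
proof (rule IntI)
  assume i: "i \<in> unordered_pairs 2"
  have "split_current i = inv_current 2 (\<lambda>f. inv_current 2 d_eval (inv_form (Pr 2 (fst i - snd i) f)))"
    unfolding split_current_def by (rule inv_current_cong) (rule inv_current_inv_form[OF alternating_Pr, symmetric])
  thus "split_current i \<in> currents_type iwasawa_deck J i"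
    using Pr_current_type[OF inv_current_currents[OF alt_functional_d_eval] i] by simp
  have d: "fst i - snd i = 0 \<or> fst i - snd i = 2" using i by (auto simp: unordered_pairs_2)
  show "split_current i \<in> closed_currents iwasawa_deck 2" unfolding split_current_def
  proof (rule inv_current_closed)
    show "alt_functional 2 (\<lambda>f. d_eval (Pr 2 (fst i - snd i) f))" by (rule alt_functional_Pr[OF alt_functional_d_eval])
    show "d_eval (Pr 2 (fst i - snd i) f) \<in> \<real>" if "\<And>vs. f vs \<in> \<real>" for f
      unfolding d_eval_def by (intro Reals_diff Pr_real that)
    show "d_eval (Pr 2 (fst i - snd i) (ce_d f)) = 0" if "2 = Suc j" "alternating j f" for j f
    proof -
      have f: "alternating 1 f" using that by simp
      have "alternating 2 (ce_d f)" using alternating_ce_d[OF f] by (simp add: numeral_2_eq_2)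
      from d_eval_ce_d[OF alternating_Pr[OF this]] show ?thesis by (simp add: ce_d_Pr_ce_d[OF f d])
    qed
  qed
qed

lemma sum_split_current: "(\<Sum>i\<in>unordered_pairs 2. split_current i) = current_d iwasawa_deck (Suc 2) (inv_current (Suc 2) (\<lambda>f. f [v0, iv0, w]))"
  unfolding current_d_inv_current
proof
  fix \<phi>
  show "(\<Sum>i\<in>unordered_pairs 2. split_current i) \<phi> = inv_current 2 (\<lambda>f. ce_d f [v0, iv0, w]) \<phi>"
  proof (cases "\<phi> \<in> forms iwasawa_deck 2")
    case True
    note a = alternating_inv_part[OF True]
    have "d_eval (inv_part \<phi>) = d_eval (Pr 2 2 (inv_part \<phi>)) + d_eval (Pr 2 0 (inv_part \<phi>))"
      using sum_Pr[OF a, of "[axis 3 1, iv0]"] sum_Pr[OF a, of "[axis 3 \<i>, v0]"]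
      unfolding d_eval_def by (simp add: unordered_pairs_2 algebra_simps)
    thus ?thesis using True d_eval_ce_d[OF a] by (simp add: sum_fun_apply split_current_def inv_current_def unordered_pairs_2)
  qed (simp add: sum_fun_apply split_current_def inv_current_def)
qed

text \<open>The witness is the real part of a multiple of the wedge of the a-th and the third
  left-invariant coframe element, with a one of 1 and 2. Index and multiple are adapted to the
  vectors that enter \<open>d_eval\<close> after applying \<open>jj\<close>.\<close>

lemma ex_\<omega>:
  "\<exists>\<omega>. alternating 2 \<omega> \<and> (\<forall>vs. \<omega> vs \<in> \<real>) \<and> ce_d \<omega> = (\<lambda>vs. 0) \<and> d_eval (Pr 2 2 \<omega>) \<noteq> 0"
proof -
  define p where "p = jj v0"
  define p' where "p' = jj iv0"
  obtain s where s: "jj (axis 3 1) = axis 3 s" using jj_central by blast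
  obtain s' where s': "jj (axis 3 \<i>) = axis 3 s'" using jj_central by blast
  \<comment> \<open>\<open>d_eval (Pr 2 2 \<omega>)\<close> will depend only on the a-th coordinate
    of this vector, because the contributions of v0 and \<i> v0 themselves cancel.\<close>
  let ?X = "\<lambda>a. s * p' $ a - s' * p $ a"
  have "s \<noteq> 0"
  proof
    assume "s = 0"
    hence "jj (axis 3 1) = 0" using s by simp
    hence "\<i> *s \<Psi> (axis 3 1) = \<Psi> 0" using Psi_jj[of "axis 3 1"] by simp
    hence "\<Psi> (axis 3 1) = \<Psi> 0" by (simp add: linear_0[OF linear_\<Psi>] vec_eq_iff)
    hence "axis 3 (1 :: complex) = (0 :: complex ^ 3)" by (simp only: \<Psi>_inject)
    thus False by (simp add: axis_eq_0_iff)
  qed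
  moreover have "sg p p' \<noteq> 0" unfolding p_def p'_def by (rule v0)
  ultimately have "s * sg p p' \<noteq> 0" by simp
  \<comment> \<open>The terms with s' cancel, so a nonzero bracket forces \<open>?X 1\<close> or
    \<open>?X 2\<close> to be nonzero.\<close>
  moreover have e: "s * sg p p' = p $ 1 * ?X 2 - p $ 2 * ?X 1" by (simp add: sg_def algebra_simps)
  ultimately have n: "\<not> (?X 1 = 0 \<and> ?X 2 = 0)" unfolding e by auto
  obtain a :: 3 where a: "?X a \<noteq> 0" "a = 1 \<or> a = 2"
  proof (cases "?X 1 = 0")
    case True thus thesis using n by (intro that[of 2]) auto
  next
    case False thus thesis by (intro that[of 1]) auto
  qed
  \<comment> \<open>Makes \<open>R (?X a)\<close> the squared modulus of
    \<open>?X a\<close>.\<close>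
  define c where "c = cnj (?X a)"
  define R where "R z = complex_of_real (Re (c * z))" for z
  have R: "linear R" unfolding R_def[abs_def]
    by (rule linearI) (simp_all add: distrib_left scaleR_conv_of_real[where 'a = complex] right_diff_distrib)
  define \<omega> where "\<omega> = form2 (\<lambda>u v :: complex ^ 3. R (u $ a * v $ 3 - v $ a * u $ 3))"
  have "linear (\<lambda>v :: complex ^ 3. u $ a * v $ 3 - v $ a * u $ 3)" "linear (\<lambda>u :: complex ^ 3. u $ a * v $ 3 - v $ a * u $ 3)" for u v
    by (rule linearI; simp add: distrib_left distrib_right scaleR_right_diff_distrib)+
  from this[THEN linear_compose[OF _ R], unfolded o_def]
  have alt: "alternating 2 \<omega>" unfolding \<omega>_def by (rule alternating_form2) (simp add: linear_0[OF R])
  have z: "\<omega> [axis 3 x, v] = - R (x * v $ a)" for x v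
  proof -
    have "(axis 3 x :: complex ^ 3) $ a * v $ 3 - v $ a * (axis 3 x :: complex ^ 3) $ 3 = - (x * v $ a)" using a(2) by (auto simp: axis_def)
    thus ?thesis by (simp only: \<omega>_def form2_simps linear_neg[OF R])
  qed
  have "ce_d \<omega> [u, v, w] = R (sg u v * w $ a - sg u w * v $ a + sg v w * u $ a)" for u v w
    unfolding ce_d_2[OF alt] z linear_add[OF R] linear_diff[OF R] by simp
  \<comment> \<open>A 3 by 3 determinant with two equal rows, since a is 1 or 2.\<close>
  moreover have "sg u v * w $ a - sg u w * v $ a + sg v w * u $ a = 0" for u v w
    using a(2) by (auto simp: sg_def algebra_simps)
  ultimately have dz: "ce_d \<omega> = (\<lambda>vs. 0)" by (intro ce_d_eq_0I alt) (simp only: linear_0[OF R])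
  have "d_eval (Pr 2 2 \<omega>) = (\<omega> [axis 3 1, iv0] - \<omega> [axis 3 s, p'] - (\<omega> [axis 3 \<i>, v0] - \<omega> [axis 3 s', p])) / 2"
    by (simp add: d_eval_def Pr_2[OF alt] s s' p_def p'_def diff_divide_distrib)
  also have "\<dots> = R (?X a) / 2"
    unfolding z linear_diff[OF R] by simp
  also have "R (?X a) = of_real ((cmod (?X a))\<^sup>2)"
    unfolding R_def c_def
    by (simp only: complex_norm_square[symmetric] mult.commute[of "cnj _"] of_real_power[symmetric] Re_complex_of_real)
  finally have "d_eval (Pr 2 2 \<omega>) \<noteq> 0" using a(1) by auto
  moreover have "\<omega> vs \<in> \<real>" for vs unfolding \<omega>_def R_def by (rule form2_real) simp
  ultimately show ?thesis using alt dz by (intro exI[of _ \<omega>] conjI allI)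
qed

lemma bounding_current: "inv_current (Suc 2) (\<lambda>f. f [v0, iv0, w]) \<in> real_currents iwasawa_deck (Suc 2)"
  by (rule inv_current_real[OF alt_functional_eval])

text \<open>The split currents are closed and add up to a boundary, but the first one does not
  vanish on the closed form \<omega>, as a boundary would.\<close>

theorem not_pure: "\<not> pure_at iwasawa_deck J 2"
proof
  assume p: "pure_at iwasawa_deck J 2"
  have "(\<Sum>i\<in>unordered_pairs 2. split_current i) \<in> exact_currents iwasawa_deck 2"
    unfolding sum_split_current exact_currents_def by (rule imageI[OF bounding_current])
  hence "split_current (2, 0) \<in> exact_currents iwasawa_deck 2"
    by (intro mp[OF spec[OF p[unfolded pure_at_iff], of split_current], THEN bspec, OF _ pairs_2(1)] conjI ballI split_current_closed)
  then obtain S where S: "S \<in> real_currents iwasawa_deck (Suc 2)" "split_current (2, 0) = current_d iwasawa_deck (Suc 2) S"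
    by (auto simp: exact_currents_def)
  from ex_\<omega> obtain \<omega> where \<omega>: "alternating 2 \<omega>" "\<forall>vs. \<omega> vs \<in> \<real>" "ce_d \<omega> = (\<lambda>vs. 0)" "d_eval (Pr 2 2 \<omega>) \<noteq> 0"
    by (elim exE conjE)
  have "inv_form \<omega> \<in> closed_forms iwasawa_deck 2" by (rule inv_form_closed_forms[OF \<omega>(1) spec[OF \<omega>(2)] \<omega>(3)])
  hence "split_current (2, 0) (inv_form \<omega>) = 0" unfolding S(2) by (rule current_d_closed[OF S(1)])
  thus False using \<omega>(4) by (simp add: split_current_def inv_current_inv_form[OF \<omega>(1)])
qed

text \<open>Mirror image of \<open>not_full\<close>: \<open>split_current (2, 0)\<close> kills exact
  forms and the closed forms of type (1,1). It also kills those of type (2,0)+(0,2), on which the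
  other split current vanishes and the sum of both is a boundary. But it does not kill
  \<omega>.\<close>

theorem not_Cinf_full: "\<not> Cinf_full_at iwasawa_deck J 2"
proof
  assume full: "Cinf_full_at iwasawa_deck J 2"
  from ex_\<omega> obtain \<omega> where \<omega>: "alternating 2 \<omega>" "\<forall>vs. \<omega> vs \<in> \<real>" "ce_d \<omega> = (\<lambda>vs. 0)" "d_eval (Pr 2 2 \<omega>) \<noteq> 0"
    by (elim exE conjE)
  have cl: "inv_form \<omega> \<in> closed_forms iwasawa_deck 2" by (rule inv_form_closed_forms[OF \<omega>(1) spec[OF \<omega>(2)] \<omega>(3)])
  from bspec[OF full[unfolded Cinf_full_at_iff] cl] obtain c
    where "\<forall>i\<in>unordered_pairs 2. c i \<in> closed_forms_type iwasawa_deck J 2 i"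
    and e: "inv_form \<omega> - (\<Sum>i\<in>unordered_pairs 2. c i) \<in> exact_forms iwasawa_deck 2"
    by (elim exE conjE)
  note c = bspec[OF this(1)]
  have T: "split_current (2, 0) \<in> closed_currents iwasawa_deck 2" by (rule IntD1[OF split_current_closed[OF pairs_2(1)]])
  note T' = closed_currentsD[OF T]
  obtain \<xi> where \<xi>: "inv_form \<omega> - (\<Sum>i\<in>unordered_pairs 2. c i) = ext_d \<xi>" "\<xi> \<in> forms iwasawa_deck 1"
    using e unfolding exact_forms_2 real_forms_def by blast
  have cc: "c i \<in> closed_forms iwasawa_deck 2" if "i \<in> unordered_pairs 2" for i by (rule IntD1[OF c[OF that]])
  have Tc: "split_current (2, 0) (c i) = 0" if i: "i \<in> unordered_pairs 2" for i
  proof (cases "i = (2, 0)")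
    case True
    have "(\<Sum>j\<in>unordered_pairs 2. split_current j) (c i) = 0" unfolding sum_split_current by (rule current_d_closed[OF bounding_current cc[OF i]])
    hence "split_current (2, 0) (c i) + split_current (1, 1) (c i) = 0" by (simp add: sum_fun_apply unordered_pairs_2)
    moreover have "split_current (1, 1) (c i) = 0"
      by (rule type_pairing[OF pairs_2(2) i _ IntD2[OF split_current_closed[OF pairs_2(2)]] IntD2[OF c[OF i]]]) (simp add: True)
    ultimately show ?thesis by simp
  next
    case False
    show ?thesis
      by (rule type_pairing[OF pairs_2(1) i False[symmetric] IntD2[OF split_current_closed[OF pairs_2(1)]] IntD2[OF c[OF i]]])
  qed
  note s = current_sum[OF T'(1), of "unordered_pairs 2" c, OF closed_formsD(2)[OF cc]]
  have "split_current (2, 0) (inv_form \<omega>) = split_current (2, 0) (ext_d \<xi> + (\<Sum>i\<in>unordered_pairs 2. c i))"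
    unfolding \<xi>(1)[symmetric] by (simp only: diff_add_cancel)
  also have "\<dots> = split_current (2, 0) (ext_d \<xi>) + split_current (2, 0) (\<Sum>i\<in>unordered_pairs 2. c i)"
    by (rule currentsD(2)[OF T'(1) _ conjunct2[OF s]]) (use ext_d_forms[OF \<xi>(2)] in \<open>simp add: numeral_2_eq_2\<close>)
  also have "\<dots> = 0" using T'(3)[OF _ \<xi>(2)] conjunct1[OF s] Tc by (simp add: numeral_2_eq_2)
  finally show False using \<omega>(4) by (simp add: split_current_def inv_current_inv_form[OF \<omega>(1)])
qed

end

section \<open>The small deformations\<close>

text \<open>The differential of \<open>def_coords t\<close> at the origin.\<close>

definition def_frame :: "complex ^ 2 ^ 3 \<Rightarrow> complex ^ 3 \<Rightarrow> complex ^ 3" where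
  "def_frame t v = vector
     [v $ 1 + t $ 1 $ 1 * cnj (v $ 1) + t $ 1 $ 2 * cnj (v $ 2),
      v $ 2 + t $ 2 $ 1 * cnj (v $ 1) + t $ 2 $ 2 * cnj (v $ 2),
      v $ 3 + t $ 3 $ 1 * cnj (v $ 1) + t $ 3 $ 2 * cnj (v $ 2) - def_D t * cnj (v $ 3)]"

lemma linear_def_frame: "linear (def_frame t)"
  by (rule linearI) (simp_all add: def_frame_def vec_eq_iff forall_3 algebra_simps scaleR_right_diff_distrib)

lemma has_derivative_vec_nth [derivative_intros]:
  fixes f :: "'a::real_normed_vector \<Rightarrow> complex ^ 3"
  shows "(f has_derivative f') F \<Longrightarrow> ((\<lambda>x. f x $ i) has_derivative (\<lambda>v. f' v $ i)) F"
  by (rule bounded_linear.has_derivative[OF bounded_linear_vec_nth])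

lemma has_derivative_vector_3:
  fixes f g h :: "complex ^ 3 \<Rightarrow> complex"
  assumes "(f has_derivative f') F" "(g has_derivative g') F" "(h has_derivative h') F"
  shows "((\<lambda>x. vector [f x, g x, h x] :: complex ^ 3) has_derivative (\<lambda>v. vector [f' v, g' v, h' v])) F"
proof -
  have "linear (axis i :: complex \<Rightarrow> complex ^ 3)" for i
    by (rule linearI) (auto simp: vec_eq_iff axis_def)
  hence b: "bounded_linear (axis i :: complex \<Rightarrow> complex ^ 3)" for i by (simp add: linear_conv_bounded_linear)
  have v: "vector [x, y, z] = axis 1 x + axis 2 y + (axis 3 z :: complex ^ 3)" for x y z
    by (simp add: vec_eq_iff forall_3 axis_def)
  show ?thesis unfolding v by (intro has_derivative_add bounded_linear.has_derivative[OF b] assms)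
qed

text \<open>At each point, the frame is obtained from the differentials of the coordinates by a
  complex linear change of basis, which does not affect the almost-complex structure.\<close>

lemma def_coords_derivative:
  "frechet_derivative (def_coords t) (at x) (v + bet x v) =
     (let w = def_frame t v in vector [w $ 1, w $ 2, w $ 3 + x $ 1 * w $ 2 + (t $ 2 $ 1 * cnj (x $ 1) + t $ 2 $ 2 * cnj (x $ 2)) * w $ 1])"
proof -
  let ?a = "t $ 1 $ 1" and ?b = "t $ 1 $ 2" and ?c = "t $ 2 $ 1" and ?d = "t $ 2 $ 2"
  have "(def_coords t has_derivative (\<lambda>u. vector
     [u $ 1 + ?a * cnj (u $ 1) + ?b * cnj (u $ 2),
      u $ 2 + ?c * cnj (u $ 1) + ?d * cnj (u $ 2),
      u $ 3 + ((t $ 3 $ 1 + ?c * x $ 1) * cnj (u $ 1) + ?c * u $ 1 * cnj (x $ 1))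
        + ((t $ 3 $ 2 + ?d * x $ 1) * cnj (u $ 2) + ?d * u $ 1 * cnj (x $ 2))
        + (?a * ?c * cnj (x $ 1) * cnj (u $ 1) + ?a * ?d * (cnj (x $ 1) * cnj (u $ 2) + cnj (u $ 1) * cnj (x $ 2))
           + ?b * ?d * cnj (x $ 2) * cnj (u $ 2)) - def_D t * cnj (u $ 3)])) (at x)"
    unfolding def_coords_def[abs_def] def_A_def
    by (rule has_derivative_vector_3)
       (auto intro!: derivative_eq_intros bounded_linear.has_derivative[OF bounded_linear_cnj] simp: fun_eq_iff field_simps)
  from frechet_derivative_at[OF this, symmetric]
  show ?thesis by (simp add: def_frame_def def_D_def vec_eq_iff forall_3 algebra_simps)
qed

lemma small_entries:
  fixes t :: "complex ^ 2 ^ 3"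
  assumes "t \<in> ball 0 (1 / 10)" shows "cmod (t $ i $ j) \<le> 1 / 10"
proof -
  have "cmod (t $ i $ j) \<le> norm (t $ i)" by (rule Finite_Cartesian_Product.norm_nth_le)
  also have "\<dots> \<le> norm t" by (rule Finite_Cartesian_Product.norm_nth_le)
  finally show ?thesis using assms by simp
qed

lemma norm_mult_small: "cmod x \<le> 1 / 10 \<Longrightarrow> cmod y \<le> 1 / 10 \<Longrightarrow> cmod (x * y) \<le> 1 / 100"
  using mult_mono[of "cmod x" "1 / 10" "cmod y" "1 / 10"] by (simp add: norm_mult)

lemma def_D_small:
  assumes "t \<in> ball 0 (1 / 10)" shows "cmod (def_D t) \<le> 1 / 50"
  using norm_triangle_ineq4[of "t $ 1 $ 1 * t $ 2 $ 2" "t $ 1 $ 2 * t $ 2 $ 1"]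
    norm_mult_small[OF small_entries[OF assms] small_entries[OF assms], of 1 1 2 2]
    norm_mult_small[OF small_entries[OF assms] small_entries[OF assms], of 1 2 2 1] by (simp add: def_D_def)

locale deformation =
  fixes t :: "complex ^ 2 ^ 3"
  assumes t: "t \<in> ball 0 (1 / 10)"
begin

text \<open>The antiholomorphic coefficients are at most 1/10, so the first two equations force v $
  1 = v $ 2 = 0; the third is then settled by the smallness of \<open>def_D t\<close>.\<close>

lemma bij_def_frame: "bij (def_frame t)"
proof -
  have "v = 0" if v: "def_frame t v = 0" for v
  proof -
    have m: "cmod (t $ i $ j * cnj z) \<le> cmod z / 10" for i j z
      using mult_right_mono[OF small_entries[OF t, of i j], of "cmod z"] by (simp add: norm_mult)
    have e: "v $ 1 = - (t $ 1 $ 1 * cnj (v $ 1) + t $ 1 $ 2 * cnj (v $ 2))" "v $ 2 = - (t $ 2 $ 1 * cnj (v $ 1) + t $ 2 $ 2 * cnj (v $ 2))"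
      "v $ 3 = def_D t * cnj (v $ 3) - (t $ 3 $ 1 * cnj (v $ 1) + t $ 3 $ 2 * cnj (v $ 2))"
      using v by (simp_all add: def_frame_def vec_eq_iff forall_3 eq_neg_iff_add_eq_0 algebra_simps)
    have b: "cmod (v $ 1) \<le> cmod (v $ 1) / 10 + cmod (v $ 2) / 10" "cmod (v $ 2) \<le> cmod (v $ 1) / 10 + cmod (v $ 2) / 10"
      using arg_cong[OF e(1), of cmod] arg_cong[OF e(2), of cmod] m[of 1 1 "v $ 1"] m[of 1 2 "v $ 2"] m[of 2 1 "v $ 1"] m[of 2 2 "v $ 2"]
        norm_triangle_ineq[of "t $ 1 $ 1 * cnj (v $ 1)" "t $ 1 $ 2 * cnj (v $ 2)"]
        norm_triangle_ineq[of "t $ 2 $ 1 * cnj (v $ 1)" "t $ 2 $ 2 * cnj (v $ 2)"]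
      unfolding norm_minus_cancel by linarith+
    hence "cmod (v $ 1) = 0 \<and> cmod (v $ 2) = 0" using norm_ge_zero[of "v $ 1"] norm_ge_zero[of "v $ 2"] by linarith
    hence v12: "v $ 1 = 0" "v $ 2 = 0" by simp_all
    hence "cmod (v $ 3) = cmod (def_D t) * cmod (v $ 3)" using arg_cong[OF e(3), of cmod] by (simp add: norm_mult)
    also have "\<dots> \<le> 1 / 50 * cmod (v $ 3)" by (rule mult_right_mono[OF def_D_small[OF t]]) simp
    finally have "v $ 3 = 0" by simp
    thus "v = 0" using v12 by (simp add: vec_eq_iff forall_3)
  qed
  hence "inj (def_frame t)" by (intro linear_injective_0[OF linear_def_frame, THEN iffD2]) blast
  thus ?thesis using linear_injective_imp_surjective[OF linear_def_frame] by (simp add: bij_def)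
qed

sublocale frame_iso "def_frame t"
  by (rule frame_iso.intro) (rule linear_def_frame bij_def_frame)+

lemma def_frame_jj [simp]: "def_frame t (jj v) = \<i> *s def_frame t v"
  by (simp add: jj_def)

sublocale twisted "def_frame t" "deformed_J t"
proof
  fix x v
  let ?D = "frechet_derivative (def_coords t) (at x)"
  have "inj ?D"
  proof (rule injI)
    fix u u' assume uu: "?D u = ?D u'"
    define w where "w u = u - bet x u" for u
    have s: "w u + bet x (w u) = u" for u by (simp add: w_def bet_diff_right)
    \<comment> \<open>Triangular with ones on the diagonal, hence injective.\<close>
    define M :: "complex ^ 3 \<Rightarrow> complex ^ 3" where
      "M z = vector [z $ 1, z $ 2, z $ 3 + x $ 1 * z $ 2 + (t $ 2 $ 1 * cnj (x $ 1) + t $ 2 $ 2 * cnj (x $ 2)) * z $ 1]" for z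
    have M: "z = z'" if e: "M z = M z'" for z z'
    proof -
      have 12: "z $ 1 = z' $ 1" "z $ 2 = z' $ 2"
        using arg_cong[OF e, of "\<lambda>v. v $ 1"] arg_cong[OF e, of "\<lambda>v. v $ 2"] by (simp_all add: M_def)
      have "z $ 3 = z' $ 3" using arg_cong[OF e, of "\<lambda>v. v $ 3"] by (simp add: M_def 12)
      thus ?thesis by (simp add: vec_eq_iff forall_3 12)
    qed
    have "?D u = M (def_frame t (w u))" for u
      using def_coords_derivative[of t x "w u"] by (simp only: s Let_def M_def)
    hence "def_frame t (w u) = def_frame t (w u')" using uu by - (rule M, simp)
    hence "w u = w u'" by (simp only: \<Psi>_inject)
    hence "w u + bet x (w u) = w u' + bet x (w u')" by simp
    thus "u = u'" by (simp only: s)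
  qed
  moreover have "\<i> *s ?D (v + bet x v) = ?D (jj v + bet x (jj v))"
    unfolding def_coords_derivative Let_def def_frame_jj by (simp add: vec_eq_iff forall_3 algebra_simps)
  ultimately show "deformed_J t x (v + bet x v) = jj v + bet x (jj v)"
    by (simp add: deformed_J_def coord_structure_def inv_f_f)
qed

text \<open>In class (i) the first two frame components are the coordinates themselves and
  \<open>def_D t\<close> is 0, so \<Psi> fixes the values of \<open>bet\<close>. The product of two
  entries of weight 1 has weight 2, the weight of the third component.\<close>

lemma lie_frame:
  assumes "class_i t" shows "lie_frame (def_frame t)"
proof
  fix \<theta> u v
  have D: "t $ 1 $ 1 = 0" "t $ 1 $ 2 = 0" "t $ 2 $ 1 = 0" "t $ 2 $ 2 = 0" "def_D t = 0"
    using assms by (simp_all add: class_i_def def_D_def)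
  have Psi: "def_frame t (rot \<kappa>g \<theta> v) = (\<chi> i. cis (\<theta> * of_int (\<kappa>g i)) * def_frame t v $ i)" for v
    by (simp add: rot_def)
  have 12: "def_frame t v $ 1 = v $ 1" "def_frame t v $ 2 = v $ 2" for v by (simp_all add: def_frame_def D)
  have "cis \<theta> * cis \<theta> = cis (\<theta> * 2)" by (simp add: cis_mult mult_2_right)
  hence cc: "cis \<theta> * x * (cis \<theta> * y) = cis (\<theta> * 2) * (x * y)" for x y by (metis mult.assoc mult.left_commute)
  have c: "def_frame t (bet u v) = bet u v" for u v by (simp add: def_frame_def D vec_eq_iff forall_3)
  have r: "rot \<kappa>g \<theta> v $ 1 = cis \<theta> * v $ 1" "rot \<kappa>g \<theta> v $ 2 = cis \<theta> * v $ 2" for v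
    using 12[of "rot \<kappa>g \<theta> v"] 12[of v] by (simp_all add: Psi)
  have "def_frame t (bet (rot \<kappa>g \<theta> u) (rot \<kappa>g \<theta> v)) = def_frame t (rot \<kappa>g \<theta> (bet u v))"
    unfolding Psi c by (simp add: vec_eq_iff forall_3 r cc)
  thus "bet (rot \<kappa>g \<theta> u) (rot \<kappa>g \<theta> v) = rot \<kappa>g \<theta> (bet u v)" by (simp only: \<Psi>_inject)
qed

theorem pure_and_full_class_i:
  assumes "class_i t"
  shows "Cinf_pure_and_full_at iwasawa_deck (deformed_J t) k \<and> pure_and_full_at iwasawa_deck (deformed_J t) k"
proof -
  interpret l: lie_frame "def_frame t" by (rule lie_frame[OF assms])
  interpret twisted_lie "def_frame t" "deformed_J t" by unfold_locales
  show ?thesis unfolding Cinf_pure_and_full_at_def pure_and_full_at_def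
    using Cinf_full Cinf_pure full pure by blast
qed

text \<open>On the centre the condition is c' - D cnj c' = y. Combined with its conjugate it is
  solved by dividing by 1 - \<bar>D\<bar>^2, which is not 0.\<close>

lemma jj_central: "\<exists>c'. jj (axis 3 c) = axis 3 c'"
proof -
  let ?k = "1 - cmod (def_D t) ^ 2"
  have "cmod (def_D t) ^ 2 \<le> (1 / 50) ^ 2" by (rule power_mono[OF def_D_small[OF t]]) simp
  hence k: "complex_of_real ?k \<noteq> 0" by (simp add: power2_eq_square del: of_real_diff)
  have kk: "complex_of_real ?k = 1 - def_D t * cnj (def_D t)" by (simp only: of_real_diff complex_norm_square of_real_1)
  define y where "y = \<i> * (c - def_D t * cnj c)"
  define c' where "c' = (y + def_D t * cnj y) / of_real ?k"
  have "c' - def_D t * cnj c' = (y - def_D t * cnj (def_D t) * y) / of_real ?k"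
    unfolding c'_def by (simp add: diff_divide_distrib algebra_simps add_divide_distrib)
  also have "\<dots> = of_real ?k * y / of_real ?k" unfolding kk by (simp add: algebra_simps)
  also have "\<dots> = y" by (rule nonzero_mult_div_cancel_left[OF k])
  finally have "def_frame t (axis 3 c') = def_frame t (jj (axis 3 c))"
    unfolding def_frame_jj by (simp add: def_frame_def vec_eq_iff forall_3 axis_def y_def)
  hence "jj (axis 3 c) = axis 3 c'" by (simp only: \<Psi>_inject)
  thus ?thesis ..
qed

section \<open>Existence of the obstructing vector in the classes (ii) and (iii)\<close>

abbreviation "a \<equiv> t $ 1 $ 1"
abbreviation "b \<equiv> t $ 1 $ 2"
abbreviation "c \<equiv> t $ 2 $ 1"
abbreviation "d \<equiv> t $ 2 $ 2"
text \<open>These are the entries of T cnj T for the 2 by 2 matrix T with rows (a, b) and (c,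
  d).\<close>

abbreviation "p11 \<equiv> a * cnj a + b * cnj c"
abbreviation "p12 \<equiv> a * cnj b + b * cnj d"
abbreviation "p21 \<equiv> c * cnj a + d * cnj c"
abbreviation "p22 \<equiv> c * cnj b + d * cnj d"

text \<open>For the first two coordinates u of \<open>jj v\<close> the equation u + T cnj u = \<i>
  (v + T cnj v) and its conjugate allow cnj u to be eliminated: (1 - T cnj T) u = \<i> ((1 + T cnj
  T) v + 2 T cnj v).\<close>

lemma jj_eq:
  fixes v :: "complex ^ 3"
  defines "x1 \<equiv> (1 + p11) * v $ 1 + p12 * v $ 2" and "x2 \<equiv> p21 * v $ 1 + (1 + p22) * v $ 2"
    and "y1 \<equiv> a * cnj (v $ 1) + b * cnj (v $ 2)" and "y2 \<equiv> c * cnj (v $ 1) + d * cnj (v $ 2)"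
  shows "(1 - p11) * jj v $ 1 - p12 * jj v $ 2 = \<i> * (x1 + 2 * y1)"
    and "- p21 * jj v $ 1 + (1 - p22) * jj v $ 2 = \<i> * (x2 + 2 * y2)"
proof -
  let ?u = "jj v"
  have "def_frame t ?u = \<i> *s def_frame t v" by simp
  hence e: "?u $ 1 + a * cnj (?u $ 1) + b * cnj (?u $ 2) = \<i> * (v $ 1 + y1)"
    "?u $ 2 + c * cnj (?u $ 1) + d * cnj (?u $ 2) = \<i> * (v $ 2 + y2)"
    by (simp_all add: def_frame_def vec_eq_iff forall_3 y1_def y2_def add.assoc)
  have e': "cnj (?u $ 1) = - \<i> * (cnj (v $ 1) + cnj y1) - cnj a * ?u $ 1 - cnj b * ?u $ 2"
    "cnj (?u $ 2) = - \<i> * (cnj (v $ 2) + cnj y2) - cnj c * ?u $ 1 - cnj d * ?u $ 2"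
    using arg_cong[OF e(1), of cnj] arg_cong[OF e(2), of cnj] by (simp_all add: algebra_simps)
  have cy: "cnj y1 = cnj a * v $ 1 + cnj b * v $ 2" "cnj y2 = cnj c * v $ 1 + cnj d * v $ 2"
    by (simp_all add: y1_def y2_def)
  show "(1 - p11) * ?u $ 1 - p12 * ?u $ 2 = \<i> * (x1 + 2 * y1)"
    using e(1) unfolding e' cy x1_def y1_def by (simp add: algebra_simps)
  show "- p21 * ?u $ 1 + (1 - p22) * ?u $ 2 = \<i> * (x2 + 2 * y2)"
    using e(2) unfolding e' cy x2_def y2_def by (simp add: algebra_simps)
qed

text \<open>Passing from v to \<i> v replaces \<i> (x + 2 y) by 2 y - x. The bracket is a
  determinant: multiplied by det (1 - T cnj T) it becomes the determinant of these two vectors,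
  which is 4 \<i> times that of x and y.\<close>

lemma sg_jj_nonzero:
  fixes v :: "complex ^ 3"
  defines "x1 \<equiv> (1 + p11) * v $ 1 + p12 * v $ 2" and "x2 \<equiv> p21 * v $ 1 + (1 + p22) * v $ 2"
    and "y1 \<equiv> a * cnj (v $ 1) + b * cnj (v $ 2)" and "y2 \<equiv> c * cnj (v $ 1) + d * cnj (v $ 2)"
  assumes nz: "x1 * y2 - y1 * x2 \<noteq> 0"
  shows "sg (jj v) (jj (\<i> *s v)) \<noteq> 0"
proof
  let ?u = "jj v" and ?w = "jj (\<i> *s v)"
  assume s: "sg ?u ?w = 0"
  have u: "(1 - p11) * ?u $ 1 - p12 * ?u $ 2 = \<i> * (x1 + 2 * y1)"
    "- p21 * ?u $ 1 + (1 - p22) * ?u $ 2 = \<i> * (x2 + 2 * y2)"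
    using jj_eq[of v] by (simp_all only: x1_def x2_def y1_def y2_def)
  have w: "(1 - p11) * ?w $ 1 - p12 * ?w $ 2 = 2 * y1 - x1"
    "- p21 * ?w $ 1 + (1 - p22) * ?w $ 2 = 2 * y2 - x2"
    using jj_eq[of "\<i> *s v"] by (simp_all add: x1_def x2_def y1_def y2_def algebra_simps)
  have "((1 - p11) * (1 - p22) - p12 * p21) * sg ?u ?w =
     ((1 - p11) * ?u $ 1 - p12 * ?u $ 2) * (- p21 * ?w $ 1 + (1 - p22) * ?w $ 2)
     - ((1 - p11) * ?w $ 1 - p12 * ?w $ 2) * (- p21 * ?u $ 1 + (1 - p22) * ?u $ 2)"
    unfolding sg_def by algebra
  also have "\<dots> = 4 * \<i> * (x1 * y2 - y1 * x2)" unfolding u w by algebra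
  finally show False using nz s by simp
qed

text \<open>Otherwise a sesquilinear expression in the first two coordinates of v vanishes
  identically, hence so do its coefficients. These are the determinants of the columns of 1 + T cnj
  T with the columns of T, so T = 0 as soon as 1 + T cnj T is invertible.\<close>

lemma ex_v0:
  assumes "a \<noteq> 0 \<or> b \<noteq> 0 \<or> c \<noteq> 0 \<or> d \<noteq> 0"
  shows "\<exists>v0. sg (jj v0) (jj (\<i> *s v0)) \<noteq> 0"
proof (rule ccontr)
  assume n: "\<not> ?thesis"
  define K11 where "K11 = (1 + p11) * c - a * p21"
  define K12 where "K12 = (1 + p11) * d - b * p21"
  define K21 where "K21 = p12 * c - a * (1 + p22)"
  define K22 where "K22 = p12 * d - b * (1 + p22)"
  have q: "v1 * cnj v1 * K11 + v1 * cnj v2 * K12 + v2 * cnj v1 * K21 + v2 * cnj v2 * K22 = 0" for v1 v2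
  proof -
    let ?v = "vector [v1, v2, 0] :: complex ^ 3"
    have "((1 + p11) * ?v $ 1 + p12 * ?v $ 2) * (c * cnj (?v $ 1) + d * cnj (?v $ 2))
        - (a * cnj (?v $ 1) + b * cnj (?v $ 2)) * (p21 * ?v $ 1 + (1 + p22) * ?v $ 2) = 0"
      using n sg_jj_nonzero[of ?v] by blast
    thus ?thesis unfolding K11_def K12_def K21_def K22_def by (simp add: algebra_simps)
  qed
  \<comment> \<open>Polarisation with the vectors (1, 0), (0, 1), (1, 1) and (1, \<i>).\<close>
  have K: "K11 = 0" "K22 = 0" using q[of 1 0] q[of 0 1] by simp_all
  have "K12 + K21 = 0" "K21 = K12" using q[of 1 1] q[of 1 \<i>] by (simp_all add: K)
  hence "K12 = 0" "K21 = 0" by simp_all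
  note K = K this
  let ?det = "(1 + p11) * (1 + p22) - p12 * p21"
  have "a * ?det = 0" "b * ?det = 0" "c * ?det = 0" "d * ?det = 0"
    using K unfolding K11_def K12_def K21_def K22_def by algebra+
  \<comment> \<open>The entries of T cnj T are at most 1/50, so the determinant is within 4/50 of
    1.\<close>
  moreover have "?det \<noteq> 0"
  proof -
    have pr: "cmod (t $ i $ j * cnj (t $ k $ l)) \<le> 1 / 100" for i j k l
      by (rule norm_mult_small) (simp_all only: complex_mod_cnj small_entries[OF t])
    have pp: "cmod (t $ i $ j * cnj (t $ k $ l) + t $ i' $ j' * cnj (t $ k' $ l')) \<le> 1 / 50" for i j k l i' j' k' l'
      using norm_triangle_ineq[of "t $ i $ j * cnj (t $ k $ l)" "t $ i' $ j' * cnj (t $ k' $ l')"] pr[of i j k l] pr[of i' j' k' l'] by linarith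
    have m: "cmod (z * z') \<le> 1 / 50" if "cmod z \<le> 1 / 50" "cmod z' \<le> 1 / 50" for z z'
      using mult_mono[of "cmod z" "1 / 50" "cmod z'" "1 / 50"] that by (simp add: norm_mult)
    have "cmod (?det - 1) = cmod (p11 + p22 + p11 * p22 - p12 * p21)" by (simp add: algebra_simps)
    also have "\<dots> \<le> cmod p11 + cmod p22 + cmod (p11 * p22) + cmod (p12 * p21)"
      using norm_triangle_ineq4[of "p11 + p22 + p11 * p22" "p12 * p21"] norm_triangle_ineq[of "p11 + p22" "p11 * p22"] norm_triangle_ineq[of p11 p22]
      by linarith
    also have "\<dots> \<le> 1 / 50 + 1 / 50 + 1 / 50 + 1 / 50" by (intro add_mono m pp)
    finally show ?thesis by auto
  qed
  ultimately show False using assms by simp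
qed

theorem obstructed_class_ii_iii:
  assumes "class_ii t \<or> class_iii t"
  shows "\<not> Cinf_pure iwasawa_deck (deformed_J t) \<and> \<not> Cinf_full iwasawa_deck (deformed_J t) \<and>
    \<not> pure iwasawa_deck (deformed_J t) \<and> \<not> full iwasawa_deck (deformed_J t)"
proof -
  have "a \<noteq> 0 \<or> b \<noteq> 0 \<or> c \<noteq> 0 \<or> d \<noteq> 0" using assms by (auto simp: class_ii_def class_iii_def def_D_def)
  from ex_v0[OF this] obtain v0 where v0: "sg (jj v0) (jj (\<i> *s v0)) \<noteq> 0" by (elim exE)
  interpret o: obstructed "def_frame t" "deformed_J t" v0 by unfold_locales (rule jj_central v0)+
  show ?thesis unfolding Cinf_pure_def Cinf_full_def pure_def full_def
    using o.not_Cinf_pure o.not_Cinf_full o.not_pure o.not_full by blast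
qed

end

section \<open>Assembly of the classes on the ball of radius 1/10\<close>

theorem theorem3p1:
  shows "(\<forall>k. Cinf_pure_and_full_at iwasawa_deck iwasawa_J k \<and>
              pure_and_full_at iwasawa_deck iwasawa_J k) \<and>
    (\<exists>\<epsilon>>0. \<forall>t::complex^2^3. t \<in> ball 0 \<epsilon> \<longrightarrow>
       (class_i t \<longrightarrow>
          (\<forall>k. Cinf_pure_and_full_at iwasawa_deck (deformed_J t) k \<and>
               pure_and_full_at iwasawa_deck (deformed_J t) k)) \<and>
       (class_ii t \<or> class_iii t \<longrightarrow>
          \<not> Cinf_pure iwasawa_deck (deformed_J t) \<and>
          \<not> Cinf_full iwasawa_deck (deformed_J t) \<and>
          \<not> pure iwasawa_deck (deformed_J t) \<and>
          \<not> full iwasawa_deck (deformed_J t)))"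
proof
  have "def_coords 0 = (\<lambda>z. z)"
    by (simp add: fun_eq_iff def_coords_def def_A_def def_D_def vec_eq_iff forall_3)
  \<comment> \<open>X is itself the deformation with t = 0, which belongs to class (i).\<close>
  hence J: "iwasawa_J = deformed_J 0" by (simp add: iwasawa_J_def deformed_J_def)
  have "deformation 0" by unfold_locales simp
  moreover have "class_i 0" by (simp add: class_i_def)
  ultimately show "\<forall>k. Cinf_pure_and_full_at iwasawa_deck iwasawa_J k \<and> pure_and_full_at iwasawa_deck iwasawa_J k"
    unfolding J using deformation.pure_and_full_class_i by blast
  show "\<exists>\<epsilon>>0. \<forall>t::complex^2^3. t \<in> ball 0 \<epsilon> \<longrightarrow>
       (class_i t \<longrightarrow>
          (\<forall>k. Cinf_pure_and_full_at iwasawa_deck (deformed_J t) k \<and>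
               pure_and_full_at iwasawa_deck (deformed_J t) k)) \<and>
       (class_ii t \<or> class_iii t \<longrightarrow>
          \<not> Cinf_pure iwasawa_deck (deformed_J t) \<and>
          \<not> Cinf_full iwasawa_deck (deformed_J t) \<and>
          \<not> pure iwasawa_deck (deformed_J t) \<and>
          \<not> full iwasawa_deck (deformed_J t))"
  proof (intro exI[of _ "1 / 10"] conjI allI impI)
    fix t :: "complex ^ 2 ^ 3" assume "t \<in> ball 0 (1 / 10)"
    then interpret deformation t by unfold_locales
    show "Cinf_pure_and_full_at iwasawa_deck (deformed_J t) k" "pure_and_full_at iwasawa_deck (deformed_J t) k" if "class_i t" for k
      using pure_and_full_class_i[OF that] by blast+
    show "\<not> Cinf_pure iwasawa_deck (deformed_J t)" "\<not> Cinf_full iwasawa_deck (deformed_J t)"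
      "\<not> pure iwasawa_deck (deformed_J t)" "\<not> full iwasawa_deck (deformed_J t)" if "class_ii t \<or> class_iii t"
      using obstructed_class_ii_iii[OF that] by blast+
  qed simp
qed

end
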